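(* Let $(X,\mu)$ be a measure space and $F$ a complete $PL$-space. Then there exists an $L$-isometric isomorphism $\mathcal{I}:L_1(X)\widehat\otimes_{pl}F\to L_1(X,F)$, well defined by taking an elementary tensor $z\otimes x$, $z\in L_1(X)$, $x\in F$, to the $F$-valued function $t\mapsto z(t)x$, $t\in X$.
   Context: All linear spaces are complex. $H$ is a fixed separable infinite-dimensional Hilbert space, $\mathcal{B}$ is the algebra of bounded operators on $H$ with the operator norm. For a linear space $E$, $HE:=H\otimes E$ (algebraic tensor product), with elementary tensors written $\xi x$; it is a left $\mathcal{B}$-module via $a\cdot(\xi x):=a(\xi)x$. A (normed) $PL$-space is a linear space $E$ together with a norm on $HE$ (the $PL$-norm) such that $\|a\cdot u\|\le\|a\|\|u\|$ for all $a\in\mathcal{B}$, $u\in HE$. Its underlying normed space is $E$ with $\|x\|:=\|\xi x\|$ for any $\xi\in H$, $\|\xi\|=1$ (independent of $\xi$). A $PL$-space is complete if its underlying normed space is complete. $\mathbb{C}$ has the unique $PL$-norm with underlying norm $|\cdot|$, given by $H\mathbb{C}=H$. A linear operator $\varphi:E\to F$ has amplification $\varphi_\infty:HE\to HF,\ \xi x\mapsto\xi\varphi(x)$; between $PL$-spaces, $\varphi$ is an $L$-isometric isomorphism if $\varphi_\infty$ is an isometric isomorphism. The completion of a $PL$-space $E$ is the complete $PL$-space $\overline{E}$ (the usual completion of the underlying normed space), where the norm on $H\overline{E}$ is induced by the natural embedding of $H\overline{E}$ into the completion $\overline{HE}$ of the normed space $HE$, $\xi x\mapsto\lim\xi x_n$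 for $x_n\in E$, $x_n\to x$. For a measure space $(X,\mu)$, $1\le p<\infty$ and a normed $PL$-space $F$, the usual (Bochner) space $L_p(X,F)$ of $F$-valued functions is made a $PL$-space by setting, for $u=\sum_k\xi_kx_k\in H(L_p(X,F))$, $\|u\|:=\big(\int_X\|\sum_k\xi_k(x_k(t))\|_{HF}^p\,d\mu(t)\big)^{1/p}$, i.e. the norm of the $HF$-valued function $t\mapsto\sum_k\xi_k(x_k(t))$ in $L_p(X,HF)$. $L_p(X):=L_p(X,\mathbb{C})$. Fix a unitary isomorphism $\iota$ from the Hilbert tensor product $H\widehat\otimes_{hil}H$ onto $H$, and put $\xi\diamondsuit\eta:=\iota(\xi\otimes\eta)$. For $u\in HE$, $v\in HF$ the element $u\diamondsuit v\in H(E\otimes F)$ is well defined bilinearly by $\xi x\diamondsuit\eta y:=(\xi\diamondsuit\eta)(x\otimes y)$. For $PL$-spaces $E,F$, $E\otimes_{pl}F$ is the $PL$-space $E\otimes F$ with the norm on $H(E\otimes F)$ $$\|U\|_{pl}:=\inf\Big\{\sum_{k=1}^n\|a_k\|\|u_k\|\|v_k\|\Big\},$$ the infimum being over all representations $U=\sum_{k=1}^n a_k\cdot(u_k\diamondsuit v_k)$ with $a_k\in\mathcal{B}$, $u_k\in HE$, $v_k\in HF$. $E\widehat\otimes_{pl}F$ is the completion of the $PL$-space $E\otimes_{pl}F$. *)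

theory Defs
  imports
    "HOL-Analysis.Analysis"
    "HOL-Algebra.Module"
    "HOL-Algebra.Algebraic_Closure_Type"
    "HOL-Library.Poly_Mapping"
begin

section \<open>Hilbert spaces, linear spaces, normed spaces\<close>

text \<open>The inner product is linear in the first argument.  Completeness is part of \<open>banach\<close>.\<close>

class complex_hilbert_space = banach +
  fixes scaleC :: "complex \<Rightarrow> 'a \<Rightarrow> 'a" (infixr \<open>*\<^sub>C\<close> 75)
    and cinner :: "'a \<Rightarrow> 'a \<Rightarrow> complex"
  assumes scaleC_add_right: "c *\<^sub>C (x + y) = c *\<^sub>C x + c *\<^sub>C y"
    and scaleC_add_left: "(c + d) *\<^sub>C x = c *\<^sub>C x + d *\<^sub>C x"
    and scaleC_scaleC: "c *\<^sub>C (d *\<^sub>C x) = (c * d) *\<^sub>C x"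
    and scaleC_of_real: "complex_of_real r *\<^sub>C x = r *\<^sub>R x"
    and cinner_add_left: "cinner (x + y) z = cinner x z + cinner y z"
    and cinner_scaleC_left: "cinner (c *\<^sub>C x) y = c * cinner x y"
    and cinner_commute: "cinner x y = cnj (cinner y x)"
    and cinner_self: "cinner x x = complex_of_real ((norm x)\<^sup>2)"

text \<open>
  The spaces \<open>L\<^sub>1(X,F)\<close>, tensor products and completions depend on terms, so linear spaces are modules
  with explicit carriers over the ring of complex numbers.  The fields \<open>mult\<close> and \<open>one\<close>, which
  module records inherit from ring records, play no role.
\<close>

abbreviation complex_ring :: "complex ring" where
  "complex_ring \<equiv> ring_of_type_algebra"

abbreviation linear_space :: "(complex, 'a, 'm) module_scheme \<Rightarrow> bool" where
  "linear_space V \<equiv> Module.module complex_ring V"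

definition linear_op ::
    "(complex, 'a, 'm) module_scheme \<Rightarrow> (complex, 'b, 'n) module_scheme \<Rightarrow> ('a \<Rightarrow> 'b) \<Rightarrow> bool" where
  "linear_op V W \<phi> \<longleftrightarrow>
     \<phi> \<in> carrier V \<rightarrow> carrier W \<and>
     (\<forall>x\<in>carrier V. \<forall>y\<in>carrier V. \<phi> (x \<oplus>\<^bsub>V\<^esub> y) = \<phi> x \<oplus>\<^bsub>W\<^esub> \<phi> y) \<and>
     (\<forall>c. \<forall>x\<in>carrier V. \<phi> (c \<odot>\<^bsub>V\<^esub> x) = c \<odot>\<^bsub>W\<^esub> \<phi> x)"

record 'a normed_lspace = "(complex, 'a) module" +
  nrm :: "'a \<Rightarrow> real"

definition with_norm :: "(complex, 'a, 'm) module_scheme \<Rightarrow> ('a \<Rightarrow> real) \<Rightarrow> 'a normed_lspace" where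
  "with_norm V N = \<lparr>carrier = carrier V, mult = undefined, one = undefined, zero = zero V,
     add = add V, smult = smult V, nrm = N\<rparr>"

definition normed_space :: "'a normed_lspace \<Rightarrow> bool" where
  "normed_space V \<longleftrightarrow>
     linear_space V \<and>
     (\<forall>x\<in>carrier V. 0 \<le> nrm V x) \<and>
     (\<forall>x\<in>carrier V. nrm V x = 0 \<longleftrightarrow> x = \<zero>\<^bsub>V\<^esub>) \<and>
     (\<forall>c. \<forall>x\<in>carrier V. nrm V (c \<odot>\<^bsub>V\<^esub> x) = cmod c * nrm V x) \<and>
     (\<forall>x\<in>carrier V. \<forall>y\<in>carrier V. nrm V (x \<oplus>\<^bsub>V\<^esub> y) \<le> nrm V x + nrm V y)"

definition isometric_isomorphism :: "'a normed_lspace \<Rightarrow> 'b normed_lspace \<Rightarrow> ('a \<Rightarrow> 'b) \<Rightarrow> bool" where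
  "isometric_isomorphism V W \<phi> \<longleftrightarrow>
     linear_op V W \<phi> \<and> bij_betw \<phi> (carrier V) (carrier W) \<and>
     (\<forall>x\<in>carrier V. nrm W (\<phi> x) = nrm V x)"

definition cauchy_seqs :: "'a normed_lspace \<Rightarrow> (nat \<Rightarrow> 'a) set" where
  "cauchy_seqs V = {x. (\<forall>n. x n \<in> carrier V) \<and>
     (\<forall>e>0. \<exists>N. \<forall>m\<ge>N. \<forall>n\<ge>N. nrm V (x m \<ominus>\<^bsub>V\<^esub> x n) < e)}"

definition complete_normed :: "'a normed_lspace \<Rightarrow> bool" where
  "complete_normed V \<longleftrightarrow>
     (\<forall>x\<in>cauchy_seqs V. \<exists>l\<in>carrier V. (\<lambda>n. nrm V (x n \<ominus>\<^bsub>V\<^esub> l)) \<longlonglongrightarrow> 0)"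

text \<open>The completion consists of the Cauchy sequences modulo null sequences.\<close>

definition completion_class :: "'a normed_lspace \<Rightarrow> (nat \<Rightarrow> 'a) \<Rightarrow> (nat \<Rightarrow> 'a) set" where
  "completion_class V x = {y \<in> cauchy_seqs V. (\<lambda>n. nrm V (y n \<ominus>\<^bsub>V\<^esub> x n)) \<longlonglongrightarrow> 0}"

definition completion :: "'a normed_lspace \<Rightarrow> (nat \<Rightarrow> 'a) set normed_lspace" where
  "completion V = \<lparr>carrier = completion_class V ` cauchy_seqs V,
     mult = undefined, one = undefined,
     zero = completion_class V (\<lambda>_. \<zero>\<^bsub>V\<^esub>),
     add = (\<lambda>A B. \<Union>x\<in>A. \<Union>y\<in>B. completion_class V (\<lambda>n. x n \<oplus>\<^bsub>V\<^esub> y n)),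
     smult = (\<lambda>c A. \<Union>x\<in>A. completion_class V (\<lambda>n. c \<odot>\<^bsub>V\<^esub> x n)),
     nrm = (\<lambda>A. the_elem ((\<lambda>x. lim (\<lambda>n. nrm V (x n))) ` A))\<rparr>"

definition completion_embed :: "'a normed_lspace \<Rightarrow> 'a \<Rightarrow> (nat \<Rightarrow> 'a) set" where
  "completion_embed V x = completion_class V (\<lambda>_. x)"


section \<open>Algebraic tensor products\<close>

text \<open>
  \<open>V \<otimes> W\<close> is the free linear space on pairs (finitely supported functions) modulo the span of the
  usual relations; its elements are cosets.
\<close>

type_synonym ('a, 'b) tensor = "('a \<times> 'b \<Rightarrow>\<^sub>0 complex) set"

definition tensor_relations ::
    "(complex, 'a, 'm) module_scheme \<Rightarrow> (complex, 'b, 'n) module_scheme \<Rightarrow> ('a \<times> 'b \<Rightarrow>\<^sub>0 complex) set" where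
  "tensor_relations V W =
     {Poly_Mapping.single (x \<oplus>\<^bsub>V\<^esub> x', y) 1 - Poly_Mapping.single (x, y) 1 - Poly_Mapping.single (x', y) 1
        | x x' y. x \<in> carrier V \<and> x' \<in> carrier V \<and> y \<in> carrier W} \<union>
     {Poly_Mapping.single (x, y \<oplus>\<^bsub>W\<^esub> y') 1 - Poly_Mapping.single (x, y) 1 - Poly_Mapping.single (x, y') 1
        | x y y'. x \<in> carrier V \<and> y \<in> carrier W \<and> y' \<in> carrier W} \<union>
     {Poly_Mapping.single (c \<odot>\<^bsub>V\<^esub> x, y) 1 - Poly_Mapping.single (x, y) c
        | c x y. x \<in> carrier V \<and> y \<in> carrier W} \<union>
     {Poly_Mapping.single (x, c \<odot>\<^bsub>W\<^esub> y) 1 - Poly_Mapping.single (x, y) c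
        | c x y. x \<in> carrier V \<and> y \<in> carrier W}"

definition tensor_class ::
    "(complex, 'a, 'm) module_scheme \<Rightarrow> (complex, 'b, 'n) module_scheme \<Rightarrow>
     ('a \<times> 'b \<Rightarrow>\<^sub>0 complex) \<Rightarrow> ('a, 'b) tensor" where
  "tensor_class V W f =
     {g. g - f \<in> Modules.module.span (\<lambda>c. Poly_Mapping.map ((*) c)) (tensor_relations V W)}"

definition tensor_product ::
    "(complex, 'a, 'm) module_scheme \<Rightarrow> (complex, 'b, 'n) module_scheme \<Rightarrow>
     (complex, ('a, 'b) tensor) module" where
  "tensor_product V W = \<lparr>
     carrier = tensor_class V W ` {f. Poly_Mapping.keys f \<subseteq> carrier V \<times> carrier W},
     mult = undefined, one = undefined,
     zero = tensor_class V W 0,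
     add = (\<lambda>A B. \<Union>f\<in>A. \<Union>g\<in>B. tensor_class V W (f + g)),
     smult = (\<lambda>c A. \<Union>f\<in>A. tensor_class V W (Poly_Mapping.map ((*) c) f))\<rparr>"

definition elem_tensor ::
    "(complex, 'a, 'm) module_scheme \<Rightarrow> (complex, 'b, 'n) module_scheme \<Rightarrow> 'a \<Rightarrow> 'b \<Rightarrow> ('a, 'b) tensor" where
  "elem_tensor V W x y = tensor_class V W (Poly_Mapping.single (x, y) 1)"

text \<open>
  For a bilinear \<open>\<beta>\<close> into \<open>G\<close>, the following is the linear operator on the tensor product that takes
  \<open>x \<otimes> y\<close> to \<open>\<beta> x y\<close>; all representatives of the argument give the same value.
\<close>

definition tensor_lift ::
    "(complex, 'c, 'm) module_scheme \<Rightarrow> ('a \<Rightarrow> 'b \<Rightarrow> 'c) \<Rightarrow> ('a, 'b) tensor \<Rightarrow> 'c" where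
  "tensor_lift G \<beta> U =
     the_elem ((\<lambda>f. \<Oplus>\<^bsub>G\<^esub>p\<in>Poly_Mapping.keys f. Poly_Mapping.lookup f p \<odot>\<^bsub>G\<^esub> \<beta> (fst p) (snd p)) ` U)"


section \<open>PL-spaces\<close>

definition hilbert_lspace :: "'h::complex_hilbert_space normed_lspace" where
  "hilbert_lspace = \<lparr>carrier = UNIV, mult = undefined, one = undefined, zero = 0, add = (+),
     smult = scaleC, nrm = norm\<rparr>"

definition complex_lspace :: "(complex, complex) module" where
  "complex_lspace = \<lparr>carrier = UNIV, mult = (*), one = 1, zero = 0, add = (+), smult = (*)\<rparr>"

definition bounded_operators :: "('h::complex_hilbert_space \<Rightarrow> 'h) set" where
  "bounded_operators = {a. bounded_linear a \<and> (\<forall>c \<xi>. a (c *\<^sub>C \<xi>) = c *\<^sub>C a \<xi>)}"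

record ('h, 'a) pl_space = "(complex, 'a) module" +
  pl_norm :: "('h, 'a) tensor \<Rightarrow> real"

definition with_pl_norm ::
    "(complex, 'a, 'm) module_scheme \<Rightarrow> (('h, 'a) tensor \<Rightarrow> real) \<Rightarrow> ('h, 'a) pl_space" where
  "with_pl_norm V N = \<lparr>carrier = carrier V, mult = undefined, one = undefined, zero = zero V,
     add = add V, smult = smult V, pl_norm = N\<rparr>"

abbreviation H_elem ::
    "(complex, 'a, 'm) module_scheme \<Rightarrow> 'h::complex_hilbert_space \<Rightarrow> 'a \<Rightarrow> ('h, 'a) tensor" where
  "H_elem E \<equiv> elem_tensor hilbert_lspace E"

definition H_space :: "('h::complex_hilbert_space, 'a) pl_space \<Rightarrow> ('h, 'a) tensor normed_lspace" where
  "H_space E = with_norm (tensor_product (hilbert_lspace :: 'h normed_lspace) E) (pl_norm E)"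

definition op_action ::
    "('h::complex_hilbert_space, 'a) pl_space \<Rightarrow> ('h \<Rightarrow> 'h) \<Rightarrow> ('h, 'a) tensor \<Rightarrow> ('h, 'a) tensor" where
  "op_action E a = tensor_lift (H_space E) (\<lambda>\<xi> x. H_elem E (a \<xi>) x)"

definition amplification ::
    "('h::complex_hilbert_space, 'b) pl_space \<Rightarrow> ('a \<Rightarrow> 'b) \<Rightarrow> ('h, 'a) tensor \<Rightarrow> ('h, 'b) tensor" where
  "amplification F \<phi> = tensor_lift (H_space F) (\<lambda>\<xi> x. H_elem F \<xi> (\<phi> x))"

definition is_pl_space :: "('h::complex_hilbert_space, 'a) pl_space \<Rightarrow> bool" where
  "is_pl_space E \<longleftrightarrow>
     linear_space E \<and> normed_space (H_space E) \<and>
     (\<forall>a\<in>bounded_operators. \<forall>u\<in>carrier (H_space E).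
        pl_norm E (op_action E a u) \<le> onorm a * pl_norm E u)"

text \<open>In a PL-space the norm of \<open>\<xi>x\<close> does not depend on the choice of the unit vector \<open>\<xi>\<close>.\<close>

definition underlying :: "('h::complex_hilbert_space, 'a) pl_space \<Rightarrow> 'a normed_lspace" where
  "underlying E = with_norm E (\<lambda>x. pl_norm E (H_elem E (SOME \<xi>::'h. norm \<xi> = 1) x))"

definition complete_pl_space :: "('h::complex_hilbert_space, 'a) pl_space \<Rightarrow> bool" where
  "complete_pl_space E \<longleftrightarrow> is_pl_space E \<and> complete_normed (underlying E)"

definition L_isometric_isomorphism ::
    "('h::complex_hilbert_space, 'a) pl_space \<Rightarrow> ('h, 'b) pl_space \<Rightarrow> ('a \<Rightarrow> 'b) \<Rightarrow> bool" where
  "L_isometric_isomorphism E F \<phi> \<longleftrightarrow>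
     linear_op E F \<phi> \<and> isometric_isomorphism (H_space E) (H_space F) (amplification F \<phi>)"

definition complex_pl :: "('h::complex_hilbert_space, complex) pl_space" where
  "complex_pl = with_pl_norm complex_lspace
     (\<lambda>u. norm (tensor_lift hilbert_lspace (\<lambda>\<xi> c. c *\<^sub>C \<xi>) u))"

text \<open>
  The bilinear operator lifted below takes \<open>(\<xi>, lim x\<^sub>n)\<close> to \<open>lim \<xi>x\<^sub>n\<close>, an element of the completion
  of \<open>HE\<close>.
\<close>

definition pl_completion ::
    "('h::complex_hilbert_space, 'a) pl_space \<Rightarrow> ('h, (nat \<Rightarrow> 'a) set) pl_space" where
  "pl_completion E = with_pl_norm (completion (underlying E))
     (\<lambda>u. nrm (completion (H_space E))
        (tensor_lift (completion (H_space E))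
           (\<lambda>\<xi> A. \<Union>x\<in>A. completion_class (H_space E) (\<lambda>n. H_elem E \<xi> (x n))) u))"


section \<open>Bochner spaces\<close>

text \<open>
  Values in an arbitrary, possibly non-separable and incomplete, normed space are needed, so
  the Bochner-integrable functions of the library, which assume second countability, do not suffice.
  On a function that is strongly measurable only up to a null set, \<open>nn_integral\<close> still takes the
  expected value, as it respects equality almost everywhere.
\<close>

definition strongly_measurable :: "'x measure \<Rightarrow> 'a normed_lspace \<Rightarrow> ('x \<Rightarrow> 'a) \<Rightarrow> bool" where
  "strongly_measurable M V f \<longleftrightarrow>
     (\<exists>s. (\<forall>n. simple_function M (s n) \<and> s n \<in> space M \<rightarrow> carrier V) \<and>
          (AE t in M. (\<lambda>n. nrm V (s n t \<ominus>\<^bsub>V\<^esub> f t)) \<longlonglongrightarrow> 0))"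

definition L1_functions :: "'x measure \<Rightarrow> 'a normed_lspace \<Rightarrow> ('x \<Rightarrow> 'a) set" where
  "L1_functions M V = {f. f \<in> space M \<rightarrow> carrier V \<and> strongly_measurable M V f \<and>
     (\<integral>\<^sup>+ t. ennreal (nrm V (f t)) \<partial>M) < \<infinity>}"

definition L1_class :: "'x measure \<Rightarrow> 'a normed_lspace \<Rightarrow> ('x \<Rightarrow> 'a) \<Rightarrow> ('x \<Rightarrow> 'a) set" where
  "L1_class M V f = {g \<in> L1_functions M V. AE t in M. g t = f t}"

definition L1_normed :: "'x measure \<Rightarrow> 'a normed_lspace \<Rightarrow> ('x \<Rightarrow> 'a) set normed_lspace" where
  "L1_normed M V = \<lparr>carrier = L1_class M V ` L1_functions M V,
     mult = undefined, one = undefined,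
     zero = L1_class M V (\<lambda>_. \<zero>\<^bsub>V\<^esub>),
     add = (\<lambda>A B. \<Union>f\<in>A. \<Union>g\<in>B. L1_class M V (\<lambda>t. f t \<oplus>\<^bsub>V\<^esub> g t)),
     smult = (\<lambda>c A. \<Union>f\<in>A. L1_class M V (\<lambda>t. c \<odot>\<^bsub>V\<^esub> f t)),
     nrm = (\<lambda>A. the_elem ((\<lambda>f. enn2real (\<integral>\<^sup>+ t. ennreal (nrm V (f t)) \<partial>M)) ` A))\<rparr>"

definition L1_space ::
    "'x measure \<Rightarrow> ('h::complex_hilbert_space, 'a) pl_space \<Rightarrow> ('h, ('x \<Rightarrow> 'a) set) pl_space" where
  "L1_space M F = with_pl_norm (L1_normed M (underlying F))
     (\<lambda>u. nrm (L1_normed M (H_space F))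
        (tensor_lift (L1_normed M (H_space F))
           (\<lambda>\<xi> A. \<Union>f\<in>A. L1_class M (H_space F) (\<lambda>t. H_elem F \<xi> (f t))) u))"


section \<open>The projective PL-tensor product\<close>

definition hilbert_tensor_inner ::
    "('h::complex_hilbert_space, 'h) tensor \<Rightarrow> ('h, 'h) tensor \<Rightarrow> complex" where
  "hilbert_tensor_inner U V =
     tensor_lift complex_lspace
       (\<lambda>\<xi> \<eta>. cnj (tensor_lift complex_lspace (\<lambda>\<xi>' \<eta>'. cinner \<xi>' \<xi> * cinner \<eta>' \<eta>) V)) U"

definition hilbert_pre_tensor :: "('h::complex_hilbert_space, 'h) tensor normed_lspace" where
  "hilbert_pre_tensor =
     with_norm (tensor_product (hilbert_lspace :: 'h normed_lspace) (hilbert_lspace :: 'h normed_lspace))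
       (\<lambda>U. sqrt (Re (hilbert_tensor_inner U U)))"

type_synonym 'h hilbert_tensor = "(nat \<Rightarrow> ('h, 'h) tensor) set"

definition hilbert_tensor_product :: "'h::complex_hilbert_space hilbert_tensor normed_lspace" where
  "hilbert_tensor_product = completion hilbert_pre_tensor"

text \<open>
  A unitary isomorphism onto \<open>H\<close> is an isometric isomorphism \<open>\<iota>\<close> of \<open>hilbert_tensor_product\<close> onto
  \<open>hilbert_lspace\<close>.
\<close>

definition diamond_vec ::
    "('h::complex_hilbert_space hilbert_tensor \<Rightarrow> 'h) \<Rightarrow> 'h \<Rightarrow> 'h \<Rightarrow> 'h" where
  "diamond_vec \<iota> \<xi> \<eta> =
     \<iota> (completion_embed hilbert_pre_tensor (elem_tensor hilbert_lspace hilbert_lspace \<xi> \<eta>))"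

definition diamond ::
    "('h::complex_hilbert_space hilbert_tensor \<Rightarrow> 'h) \<Rightarrow> ('h, 'a) pl_space \<Rightarrow> ('h, 'b) pl_space \<Rightarrow>
     ('h, 'a) tensor \<Rightarrow> ('h, 'b) tensor \<Rightarrow> ('h, ('a, 'b) tensor) tensor" where
  "diamond \<iota> E F u v =
     (let EF = tensor_product E F; G = tensor_product (hilbert_lspace :: 'h normed_lspace) EF in
      tensor_lift G (\<lambda>\<xi> x.
        tensor_lift G (\<lambda>\<eta> y. H_elem EF (diamond_vec \<iota> \<xi> \<eta>) (elem_tensor E F x y)) v) u)"

text \<open>
  The action of \<open>\<B>\<close> on \<open>H(E \<otimes> F)\<close> does not involve the norm that is being defined, so the
  norm passed to \<open>op_action\<close> is a dummy.
\<close>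

definition pl_tensor_norm ::
    "('h::complex_hilbert_space hilbert_tensor \<Rightarrow> 'h) \<Rightarrow> ('h, 'a) pl_space \<Rightarrow> ('h, 'b) pl_space \<Rightarrow>
     ('h, ('a, 'b) tensor) tensor \<Rightarrow> real" where
  "pl_tensor_norm \<iota> E F U =
     (let EF = tensor_product E F in
      Inf {(\<Sum>k<n. onorm (a k) * pl_norm E (u k) * pl_norm F (v k)) | (n::nat) a u v.
        (\<forall>k<n. a k \<in> bounded_operators \<and> u k \<in> carrier (H_space E) \<and> v k \<in> carrier (H_space F)) \<and>
        U = (\<Oplus>\<^bsub>tensor_product (hilbert_lspace :: 'h normed_lspace) EF\<^esub>k\<in>{..<n}.
               op_action (with_pl_norm EF undefined) (a k) (diamond \<iota> E F (u k) (v k)))})"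

definition pl_tensor ::
    "('h::complex_hilbert_space hilbert_tensor \<Rightarrow> 'h) \<Rightarrow> ('h, 'a) pl_space \<Rightarrow> ('h, 'b) pl_space \<Rightarrow>
     ('h, ('a, 'b) tensor) pl_space" where
  "pl_tensor \<iota> E F = with_pl_norm (tensor_product E F) (pl_tensor_norm \<iota> E F)"

definition pl_tensor_completed ::
    "('h::complex_hilbert_space hilbert_tensor \<Rightarrow> 'h) \<Rightarrow> ('h, 'a) pl_space \<Rightarrow> ('h, 'b) pl_space \<Rightarrow>
     ('h, (nat \<Rightarrow> ('a, 'b) tensor) set) pl_space" where
  "pl_tensor_completed \<iota> E F = pl_completion (pl_tensor \<iota> E F)"

definition completed_elem_tensor ::
    "('h::complex_hilbert_space hilbert_tensor \<Rightarrow> 'h) \<Rightarrow> ('h, 'a) pl_space \<Rightarrow> ('h, 'b) pl_space \<Rightarrow>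
     'a \<Rightarrow> 'b \<Rightarrow> (nat \<Rightarrow> ('a, 'b) tensor) set" where
  "completed_elem_tensor \<iota> E F x y =
     completion_embed (underlying (pl_tensor \<iota> E F)) (elem_tensor E F x y)"

end

theory Submission
  imports Defs
begin

text \<open>
  Write \<open>E = L\<^sub>1(X)\<close>.  An element \<open>U\<close> of \<open>H(E \<otimes> F)\<close> is identified with an \<open>HF\<close>-valued function, and
  the point is that its norm \<open>\<parallel>U\<parallel>\<^sub>p\<^sub>l\<close> equals the \<open>L\<^sub>1\<close>-norm of this function.  For \<open>u \<in> HE\<close>, which is an
  \<open>H\<close>-valued function, the function of \<open>a \<sqdot> (u \<diamondsuit> v)\<close> has the value \<open>a \<sqdot> (u(t) \<diamondsuit> v)\<close> at \<open>t\<close>, whose norm is at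
  most \<open>\<parallel>a\<parallel> \<parallel>u(t)\<parallel> \<parallel>v\<parallel>\<close>; integration gives one inequality.  Conversely, let \<open>e\<close> be a unit vector and
  \<open>a\<close> a contraction with \<open>a(e \<diamondsuit> \<eta>) = \<eta>\<close>.  A step function \<open>\<Sum> \<chi>\<^sub>A w\<^sub>A\<close> with disjoint sets \<open>A\<close> comes from
  \<open>\<Sum> a \<sqdot> (e\<chi>\<^sub>A \<diamondsuit> w\<^sub>A)\<close>, whose norm is at most \<open>\<Sum> \<mu>(A) \<parallel>w\<^sub>A\<parallel>\<close>, the \<open>L\<^sub>1\<close>-norm; step functions approximate
  every \<open>U\<close> in both norms.  So \<open>E \<otimes> F \<rightarrow> L\<^sub>1(X, F)\<close> is an \<open>L\<close>-isometry with dense image into a complete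
  space, and it extends to the completion.
\<close>


section \<open>Linear spaces with explicit carriers\<close>

text \<open>The pointwise bound on \<open>a \<sqdot> (u(t) \<diamondsuit> v)\<close> rests on HC =
  H: the value u(t) is a vector \<xi>, and \<xi> \<diamondsuit> v is the action on v of the operator
  \<eta> \<mapsto> \<xi> \<diamondsuit> \<eta>, whose norm is at most that of \<xi>; the module
  inequality of F, used twice, gives the estimate. The contraction a is the slice map <., e>
  \<otimes> id of the Hilbert tensor product, carried to H by the inverse of \<iota>. The sets of a
  step function have to be disjoint because the L1 norm is additive on disjoint supports only; with
  overlaps the sum of the costs can exceed the norm of the function. One representing sum controls
  the remainder of an approximation in both norms: it bounds the projective norm by definition and
  the L1 norm by the first inequality. The algebraic tensor products are treated as seminormed
  spaces, and completing them produces norms. The space H of a completion is not itself a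
  completion, so continuity alone does not give bijectivity of the amplified operator: this is
  obtained algebraically, by amplifying the inverse.\<close>

lemma complex_ring_simps [simp]:
  "carrier complex_ring = UNIV" "x \<oplus>\<^bsub>complex_ring\<^esub> y = x + y" "x \<otimes>\<^bsub>complex_ring\<^esub> y = x * y"
  "\<zero>\<^bsub>complex_ring\<^esub> = 0" "\<one>\<^bsub>complex_ring\<^esub> = 1"
  by (simp_all add: ring_of_type_algebra_def)

lemma ls_abelian: "linear_space V \<Longrightarrow> abelian_group V"
  by (simp add: Module.module_def)

lemma ls_monoid: "linear_space V \<Longrightarrow> abelian_monoid V"
  using abelian_group.axioms(1) ls_abelian by blast

context
  fixes V :: "(complex, 'a, 'm) module_scheme" (structure)
  assumes V: "linear_space V"
begin

interpretation Module.module complex_ring V by (rule V)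

lemma ls_closed [simp, intro]:
  "\<zero> \<in> carrier V"
  "x \<in> carrier V \<Longrightarrow> c \<odot> x \<in> carrier V"
  "x \<in> carrier V \<Longrightarrow> y \<in> carrier V \<Longrightarrow> x \<oplus> y \<in> carrier V"
  "x \<in> carrier V \<Longrightarrow> y \<in> carrier V \<Longrightarrow> x \<ominus> y \<in> carrier V"
  by auto

lemma ls_assoc:
  "x \<in> carrier V \<Longrightarrow> y \<in> carrier V \<Longrightarrow> z \<in> carrier V \<Longrightarrow> (x \<oplus> y) \<oplus> z = x \<oplus> (y \<oplus> z)"
  and ls_comm: "x \<in> carrier V \<Longrightarrow> y \<in> carrier V \<Longrightarrow> x \<oplus> y = y \<oplus> x"
  and ls_lcomm:
  "x \<in> carrier V \<Longrightarrow> y \<in> carrier V \<Longrightarrow> z \<in> carrier V \<Longrightarrow> x \<oplus> (y \<oplus> z) = y \<oplus> (x \<oplus> z)"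
  by (simp_all add: M.a_ac)

lemma ls_zero [simp]: "x \<in> carrier V \<Longrightarrow> \<zero> \<oplus> x = x" "x \<in> carrier V \<Longrightarrow> x \<oplus> \<zero> = x"
  by simp_all

lemma ls_smult [simp]:
  "x \<in> carrier V \<Longrightarrow> 1 \<odot> x = x" "x \<in> carrier V \<Longrightarrow> 0 \<odot> x = \<zero>" "c \<odot> \<zero> = \<zero>"
  using smult_one[of x] smult_l_null[of x] smult_r_null[of c] by simp_all

lemma ls_smult_assoc: "x \<in> carrier V \<Longrightarrow> c \<odot> (d \<odot> x) = (c * d) \<odot> x"
  using smult_assoc1[of c d x] by simp

lemma ls_distrib_left: "x \<in> carrier V \<Longrightarrow> (c + d) \<odot> x = c \<odot> x \<oplus> d \<odot> x"
  using smult_l_distr[of c d x] by simp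

lemma ls_distrib_right:
  "x \<in> carrier V \<Longrightarrow> y \<in> carrier V \<Longrightarrow> c \<odot> (x \<oplus> y) = c \<odot> x \<oplus> c \<odot> y"
  using smult_r_distr[of c x y] by simp

text \<open>Reduces differences to addition and scaling, the two operations for which linear
  operators and spaces of classes have rules.\<close>

lemma ls_minus:
  assumes "y \<in> carrier V" shows "x \<ominus> y = x \<oplus> (-1) \<odot> y"
proof -
  have "y \<oplus> (-1) \<odot> y = \<zero>"
    using ls_distrib_left[OF assms, of 1 "-1"] assms by simp
  then have "\<ominus> y = (-1) \<odot> y"
    using assms by (metis ls_closed(2) ls_comm minus_equality)
  then show ?thesis by (simp add: M.minus_eq)
qed

lemma ls_minus_self [simp]: "x \<in> carrier V \<Longrightarrow> x \<ominus> x = \<zero>"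
  by (simp add: M.minus_eq M.r_neg)

lemma ls_add_minus: "x \<in> carrier V \<Longrightarrow> y \<in> carrier V \<Longrightarrow> y \<oplus> (x \<ominus> y) = x"
  using M.add.m_comm M.add.inv_solve_right' by (simp add: M.minus_eq M.a_lcomm M.r_neg)

lemma ls_add_minus_cancel:
  assumes "x \<in> carrier V" "y \<in> carrier V" shows "(x \<oplus> y) \<ominus> x = y"
proof -
  have "(x \<oplus> y) \<ominus> x = \<ominus> x \<oplus> (x \<oplus> y)"
    using assms by (simp add: M.minus_eq M.a_comm[of "x \<oplus> y" "\<ominus> x"])
  then show ?thesis using assms by (simp only: M.r_neg1)
qed

lemma ls_minus_zero_iff: "x \<in> carrier V \<Longrightarrow> y \<in> carrier V \<Longrightarrow> x \<ominus> y = \<zero> \<longleftrightarrow> x = y"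
  using ls_add_minus[of x y] by auto

end

lemmas ls_ac = ls_assoc ls_comm ls_lcomm

text \<open>Additive inverses need not be supplied: \<open>(-1) \<odot> x\<close> is one, because
  the scalars -1 and 1 add up to 0 and \<open>0 \<odot> x\<close> is the zero vector.\<close>

lemma linear_spaceI:
  fixes V :: "(complex, 'a, 'm) module_scheme" (structure)
  assumes "\<zero> \<in> carrier V"
    and "\<And>x y. x \<in> carrier V \<Longrightarrow> y \<in> carrier V \<Longrightarrow> x \<oplus> y \<in> carrier V"
    and "\<And>c x. x \<in> carrier V \<Longrightarrow> c \<odot> x \<in> carrier V"
    and "\<And>x y z. x \<in> carrier V \<Longrightarrow> y \<in> carrier V \<Longrightarrow> z \<in> carrier V \<Longrightarrow> (x \<oplus> y) \<oplus> z = x \<oplus> (y \<oplus> z)"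
    and "\<And>x y. x \<in> carrier V \<Longrightarrow> y \<in> carrier V \<Longrightarrow> x \<oplus> y = y \<oplus> x"
    and "\<And>x. x \<in> carrier V \<Longrightarrow> \<zero> \<oplus> x = x"
    and left: "\<And>c d x. x \<in> carrier V \<Longrightarrow> (c + d) \<odot> x = c \<odot> x \<oplus> d \<odot> x"
    and "\<And>c x y. x \<in> carrier V \<Longrightarrow> y \<in> carrier V \<Longrightarrow> c \<odot> (x \<oplus> y) = c \<odot> x \<oplus> c \<odot> y"
    and "\<And>c d x. x \<in> carrier V \<Longrightarrow> (c * d) \<odot> x = c \<odot> (d \<odot> x)"
    and one: "\<And>x. x \<in> carrier V \<Longrightarrow> 1 \<odot> x = x"
    and null: "\<And>x. x \<in> carrier V \<Longrightarrow> 0 \<odot> x = \<zero>"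
  shows "linear_space V"
proof (rule moduleI)
  show "cring complex_ring" by (rule cring_from_type_algebra)
  show "abelian_group V"
  proof (rule abelian_groupI)
    show "\<exists>y\<in>carrier V. y \<oplus> x = \<zero>" if "x \<in> carrier V" for x
      using left[OF that, of "-1" 1] that assms(3) one null by (intro bexI[of _ "(-1) \<odot> x"]) auto
  qed (use assms in auto)
qed (use assms in auto)

lemma with_norm_simps [simp]:
  "carrier (with_norm V N) = carrier V" "zero (with_norm V N) = zero V"
  "add (with_norm V N) = add V" "smult (with_norm V N) = smult V" "nrm (with_norm V N) = N"
  by (simp_all add: with_norm_def)

lemma with_pl_norm_simps [simp]:
  "carrier (with_pl_norm V N') = carrier V" "zero (with_pl_norm V N') = zero V"
  "add (with_pl_norm V N') = add V" "smult (with_pl_norm V N') = smult V"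
  "pl_norm (with_pl_norm V N') = N'"
  by (simp_all add: with_pl_norm_def)

text \<open>One and the same linear space occurs in several records, which differ in the norm
  attached to it or in the fields \<open>mult\<close> and \<open>one\<close>. Comparing the four
  relevant fields moves structural facts between them.\<close>

lemma linear_space_transfer:
  assumes "linear_space V" "carrier W = carrier V" "zero W = zero V" "add W = add V"
    "smult W = smult V"
  shows "linear_space W"
  by (rule linear_spaceI)
    (simp_all add: assms ls_ac[OF assms(1)] ls_smult_assoc[OF assms(1)]
      ls_distrib_left[OF assms(1)] ls_distrib_right[OF assms(1)])

lemma linear_space_with_norm [simp]: "linear_space (with_norm V N) \<longleftrightarrow> linear_space V"
  by (auto elim: linear_space_transfer[of "with_norm V N"] linear_space_transfer[of V])

lemma linear_space_with_pl_norm [simp]: "linear_space (with_pl_norm V N) \<longleftrightarrow> linear_space V"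
  by (auto elim: linear_space_transfer[of "with_pl_norm V N"] linear_space_transfer[of V])

lemma finsum_transfer:
  assumes "carrier W = carrier V" "zero W = zero V" "add W = add V"
  shows "finsum W = finsum V"
  using assms by (intro ext) (simp add: finsum_def finprod_def)

lemma a_minus_transfer:
  assumes "carrier W = carrier V" "zero W = zero V" "add W = add V"
  shows "a_minus W = a_minus V"
  using assms by (intro ext) (simp add: a_minus_def a_inv_def m_inv_def)

subsection \<open>Linear operators\<close>

lemma linear_opI:
  assumes "\<And>x. x \<in> carrier V \<Longrightarrow> \<phi> x \<in> carrier W"
    "\<And>x y. x \<in> carrier V \<Longrightarrow> y \<in> carrier V \<Longrightarrow> \<phi> (x \<oplus>\<^bsub>V\<^esub> y) = \<phi> x \<oplus>\<^bsub>W\<^esub> \<phi> y"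
    "\<And>c x. x \<in> carrier V \<Longrightarrow> \<phi> (c \<odot>\<^bsub>V\<^esub> x) = c \<odot>\<^bsub>W\<^esub> \<phi> x"
  shows "linear_op V W \<phi>"
  using assms by (auto simp: linear_op_def)

lemma linear_opD:
  assumes "linear_op V W \<phi>"
  shows "x \<in> carrier V \<Longrightarrow> \<phi> x \<in> carrier W"
    "x \<in> carrier V \<Longrightarrow> y \<in> carrier V \<Longrightarrow> \<phi> (x \<oplus>\<^bsub>V\<^esub> y) = \<phi> x \<oplus>\<^bsub>W\<^esub> \<phi> y"
    "x \<in> carrier V \<Longrightarrow> \<phi> (c \<odot>\<^bsub>V\<^esub> x) = c \<odot>\<^bsub>W\<^esub> \<phi> x"
  using assms by (auto simp: linear_op_def)

lemma linear_op_zero: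
  assumes "linear_op V W \<phi>" "linear_space V" "linear_space W"
  shows "\<phi> \<zero>\<^bsub>V\<^esub> = \<zero>\<^bsub>W\<^esub>"
proof -
  have "\<phi> \<zero>\<^bsub>V\<^esub> = \<phi> (0 \<odot>\<^bsub>V\<^esub> \<zero>\<^bsub>V\<^esub>)" using assms by simp
  also have "\<dots> = 0 \<odot>\<^bsub>W\<^esub> \<phi> \<zero>\<^bsub>V\<^esub>" using assms linear_opD(3)[OF assms(1)] by blast
  finally show ?thesis using assms linear_opD(1)[OF assms(1)] by simp
qed

lemma linear_op_minus:
  assumes "linear_op V W \<phi>" "linear_space V" "linear_space W" "x \<in> carrier V" "y \<in> carrier V"
  shows "\<phi> (x \<ominus>\<^bsub>V\<^esub> y) = \<phi> x \<ominus>\<^bsub>W\<^esub> \<phi> y"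
  using assms by (simp add: ls_minus linear_opD[OF assms(1)])

lemma linear_op_comp:
  assumes "linear_op V W \<phi>" "linear_op W G \<psi>"
  shows "linear_op V G (\<lambda>x. \<psi> (\<phi> x))"
  using assms by (auto simp: linear_op_def Pi_iff)

lemma linear_op_add:
  assumes "linear_op V W \<phi>" "linear_op V W \<psi>" "linear_space W"
  shows "linear_op V W (\<lambda>x. \<phi> x \<oplus>\<^bsub>W\<^esub> \<psi> x)"
  by (rule linear_opI) (use assms in \<open>auto simp: linear_opD ls_ac ls_distrib_right\<close>)

lemma linear_op_smult:
  assumes "linear_op V W \<phi>" "linear_space W"
  shows "linear_op V W (\<lambda>x. c \<odot>\<^bsub>W\<^esub> \<phi> x)"
  by (rule linear_opI) (use assms in \<open>auto simp: linear_opD ls_smult_assoc ls_distrib_right mult.commute\<close>)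

lemma linear_op_finsum:
  assumes "linear_op V W \<phi>" "linear_space V" "linear_space W" "\<And>i. i \<in> A \<Longrightarrow> f i \<in> carrier V"
  shows "\<phi> (\<Oplus>\<^bsub>V\<^esub>i\<in>A. f i) = (\<Oplus>\<^bsub>W\<^esub>i\<in>A. \<phi> (f i))"
proof -
  interpret V: abelian_monoid V by (rule ls_monoid) fact
  interpret W: abelian_monoid W by (rule ls_monoid) fact
  show ?thesis
  proof (cases "finite A")
    case True
    then show ?thesis using assms(4)
    proof (induction A)
      case empty
      then show ?case using linear_op_zero assms by simp
    next
      case (insert i A)
      then show ?case
        using linear_opD(1)[OF assms(1)]
        by (subst V.finsum_insert)
          (auto simp: W.finsum_insert linear_opD(2)[OF assms(1)] Pi_iff)
    qed
  next
    case False
    then show ?thesis using linear_op_zero assms by (simp add: V.finsum_infinite W.finsum_infinite)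
  qed
qed

lemma linear_op_transfer:
  assumes "linear_op V W \<phi>" "carrier V' = carrier V" "add V' = add V" "smult V' = smult V"
    "carrier W' = carrier W" "add W' = add W" "smult W' = smult W"
  shows "linear_op V' W' \<phi>"
  using assms by (simp add: linear_op_def)

subsection \<open>Spaces of classes of representatives\<close>

text \<open>Tensor products, completions and Bochner spaces all have this shape.\<close>

locale quotient_lspace =
  fixes S :: "'a set" and cls :: "'a \<Rightarrow> 'a set" and pl :: "'a \<Rightarrow> 'a \<Rightarrow> 'a"
    and sc :: "complex \<Rightarrow> 'a \<Rightarrow> 'a" and z :: 'a and V :: "(complex, 'a set, 'm) module_scheme"
  assumes carrier_eq: "carrier V = cls ` S" and zero_eq: "zero V = cls z"
    and add_eq: "add V = (\<lambda>A B. \<Union>x\<in>A. \<Union>y\<in>B. cls (pl x y))"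
    and smult_eq: "smult V = (\<lambda>c A. \<Union>x\<in>A. cls (sc c x))"
    and refl: "x \<in> S \<Longrightarrow> x \<in> cls x"
    and cls_cong: "x \<in> S \<Longrightarrow> y \<in> cls x \<Longrightarrow> y \<in> S \<and> cls y = cls x"
    and z_closed: "z \<in> S"
    and pl_closed: "x \<in> S \<Longrightarrow> y \<in> S \<Longrightarrow> pl x y \<in> S"
    and sc_closed: "x \<in> S \<Longrightarrow> sc c x \<in> S"
    and pl_cong: "x \<in> S \<Longrightarrow> y \<in> S \<Longrightarrow> x' \<in> cls x \<Longrightarrow> y' \<in> cls y \<Longrightarrow> cls (pl x' y') = cls (pl x y)"
    and sc_cong: "x \<in> S \<Longrightarrow> x' \<in> cls x \<Longrightarrow> cls (sc c x') = cls (sc c x)"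
    and pl_assoc: "x \<in> S \<Longrightarrow> y \<in> S \<Longrightarrow> w \<in> S \<Longrightarrow> cls (pl (pl x y) w) = cls (pl x (pl y w))"
    and pl_comm: "x \<in> S \<Longrightarrow> y \<in> S \<Longrightarrow> cls (pl x y) = cls (pl y x)"
    and pl_z: "x \<in> S \<Longrightarrow> cls (pl z x) = cls x"
    and sc_left: "x \<in> S \<Longrightarrow> cls (sc (c + d) x) = cls (pl (sc c x) (sc d x))"
    and sc_right: "x \<in> S \<Longrightarrow> y \<in> S \<Longrightarrow> cls (sc c (pl x y)) = cls (pl (sc c x) (sc c y))"
    and sc_sc: "x \<in> S \<Longrightarrow> cls (sc (c * d) x) = cls (sc c (sc d x))"
    and sc_one: "x \<in> S \<Longrightarrow> cls (sc 1 x) = cls x"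
    and sc_null: "x \<in> S \<Longrightarrow> cls (sc 0 x) = cls z"
begin

text \<open>Maps on classes are defined in this development by a union over representatives. If all
  representatives give the same set, the union is this set because the class is nonempty.\<close>

lemma UN_cls:
  assumes "x \<in> S" "\<And>y. y \<in> cls x \<Longrightarrow> g y = g x"
  shows "(\<Union>y\<in>cls x. g y) = g x"
  using assms refl by blast

lemma cls_in_carrier [simp, intro]: "x \<in> S \<Longrightarrow> cls x \<in> carrier V"
  by (simp add: carrier_eq)

lemma add_cls:
  assumes "x \<in> S" "y \<in> S" shows "cls x \<oplus>\<^bsub>V\<^esub> cls y = cls (pl x y)"
proof -
  have "(\<Union>y'\<in>cls y. cls (pl x' y')) = cls (pl x y)" if "x' \<in> cls x" for x'
    using that assms refl[OF assms(2)] pl_cong by blast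
  then have "(\<Union>x'\<in>cls x. \<Union>y'\<in>cls y. cls (pl x' y')) = cls (pl x y)"
    using refl[OF assms(1)] by blast
  then show ?thesis by (simp only: add_eq)
qed

lemma smult_cls:
  assumes "x \<in> S" shows "c \<odot>\<^bsub>V\<^esub> cls x = cls (sc c x)"
proof -
  have "(\<Union>x'\<in>cls x. cls (sc c x')) = cls (sc c x)"
    using refl[OF assms] sc_cong[OF assms] by blast
  then show ?thesis by (simp only: smult_eq)
qed

lemma linear_space: "linear_space V"
proof (rule linear_spaceI)
  show "A \<oplus>\<^bsub>V\<^esub> B = B \<oplus>\<^bsub>V\<^esub> A" if AB: "A \<in> carrier V" "B \<in> carrier V" for A B
  proof -
    obtain x y where "x \<in> S" "A = cls x" "y \<in> S" "B = cls y" using AB carrier_eq by auto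
    then show ?thesis using pl_comm[of x y] by (simp add: add_cls)
  qed
qed (auto simp: carrier_eq zero_eq add_cls smult_cls z_closed pl_closed sc_closed
      pl_assoc pl_z sc_left sc_right sc_sc sc_one sc_null)

lemma minus_cls:
  assumes "x \<in> S" "y \<in> S" shows "cls x \<ominus>\<^bsub>V\<^esub> cls y = cls (pl x (sc (-1) y))"
  using assms by (simp add: ls_minus[OF linear_space] smult_cls add_cls sc_closed)

end

section \<open>Algebraic tensor products\<close>

lemma lookup_scale [simp]:
  "Poly_Mapping.lookup (Poly_Mapping.map ((*) c) f) k = (c :: complex) * Poly_Mapping.lookup f k"
  by (simp add: Poly_Mapping.map.rep_eq when_def)

lemma free_module: "Modules.module (\<lambda>c :: complex. Poly_Mapping.map ((*) c))"
  by unfold_locales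
    (auto intro!: poly_mapping_eqI simp: lookup_add algebra_simps)

interpretation free: Modules.module "\<lambda>c :: complex. Poly_Mapping.map ((*) c)"
  by (rule free_module)

lemma keys_scale: "Poly_Mapping.keys (Poly_Mapping.map ((*) (c::complex)) f) \<subseteq> Poly_Mapping.keys f"
  by (auto simp: in_keys_iff)

lemma keys_minus_complex: "Poly_Mapping.keys (f - g :: 'a \<Rightarrow>\<^sub>0 complex) \<subseteq> Poly_Mapping.keys f \<union> Poly_Mapping.keys g"
  by (auto simp: in_keys_iff lookup_minus)

lemma poly_mapping_sum_single:
  "(\<Sum>k\<in>Poly_Mapping.keys f. Poly_Mapping.single k (Poly_Mapping.lookup f k)) = f"
proof (rule poly_mapping_eqI)
  fix k
  have "(\<Sum>l\<in>Poly_Mapping.keys f. Poly_Mapping.lookup f l when l = k) = Poly_Mapping.lookup f k"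
    by (simp add: when_def in_keys_iff if_distrib cong: if_cong)
  then show "Poly_Mapping.lookup (\<Sum>k\<in>Poly_Mapping.keys f. Poly_Mapping.single k (Poly_Mapping.lookup f k)) k =
      Poly_Mapping.lookup f k"
    by (simp add: lookup_sum lookup_single)
qed

text \<open>The relations involve only pairs from the carriers. Hence a class that has one
  representative supported on the carriers has only such representatives, and evaluation of a
  bilinear map makes sense on each of them.\<close>

lemma tensor_relations_keys:
  assumes "linear_space V" "linear_space W"
    "r \<in> free.span (tensor_relations V W)"
  shows "Poly_Mapping.keys r \<subseteq> carrier V \<times> carrier W"
  using assms(3)
proof (induction r rule: free.span_induct_alt)
  case base
  then show ?case by simp
next
  case (step c x y)
  have "Poly_Mapping.keys x \<subseteq> carrier V \<times> carrier W"
    using step(1) assms(1,2) unfolding tensor_relations_def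
    by (elim UnE CollectE exE conjE; hypsubst)
      (auto simp: in_keys_iff lookup_minus lookup_single when_def split: if_splits)
  then show ?case using step(2) Poly_Mapping.keys_add[of "Poly_Mapping.map ((*) c) x" y] keys_scale[of c x] by blast
qed

lemma tensor_class_eq:
  "g - f \<in> free.span (tensor_relations V W) \<Longrightarrow> tensor_class V W g = tensor_class V W f"
proof (unfold tensor_class_def, intro Collect_cong iffI)
  let ?S = "free.span (tensor_relations V W)"
  fix h assume gf: "g - f \<in> ?S"
  { assume "h - g \<in> ?S"
    from free.span_add[OF this gf] show "h - f \<in> ?S" by simp }
  { assume "h - f \<in> ?S"
    from free.span_diff[OF this gf] show "h - g \<in> ?S" by simp }
qed

lemma tensor_class_refl: "f \<in> tensor_class V W f"
  by (simp add: tensor_class_def free.span_zero)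

lemma quotient_tensor:
  assumes V: "linear_space V" and W: "linear_space W"
  shows "quotient_lspace {f. Poly_Mapping.keys f \<subseteq> carrier V \<times> carrier W} (tensor_class V W)
    (+) (\<lambda>c. Poly_Mapping.map ((*) c)) 0 (tensor_product V W)"
proof
  let ?S = "{f. Poly_Mapping.keys f \<subseteq> carrier V \<times> carrier W}"
  let ?R = "free.span (tensor_relations V W)"
  have inR: "x' - x \<in> ?R" if "x' \<in> tensor_class V W x" for x x'
    using that by (simp add: tensor_class_def)
  show "y \<in> ?S \<and> tensor_class V W y = tensor_class V W x" if "x \<in> ?S" "y \<in> tensor_class V W x" for x y
  proof -
    have "Poly_Mapping.keys (y - x) \<subseteq> carrier V \<times> carrier W"
      using tensor_relations_keys[OF V W] inR that by blast
    then have "y \<in> ?S" using Poly_Mapping.keys_add[of "y - x" x] that(1) by auto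
    then show ?thesis using tensor_class_eq inR that by blast
  qed
  show "tensor_class V W (x' + y') = tensor_class V W (x + y)"
    if "x' \<in> tensor_class V W x" "y' \<in> tensor_class V W y" for x x' y y'
    using free.span_add[OF inR[OF that(1)] inR[OF that(2)]]
    by (intro tensor_class_eq) (simp add: algebra_simps)
  show "tensor_class V W (Poly_Mapping.map ((*) c) x') = tensor_class V W (Poly_Mapping.map ((*) c) x)"
    if "x' \<in> tensor_class V W x" for c x x'
    using free.span_scale[OF inR[OF that], of c]
    by (intro tensor_class_eq) (simp add: free.scale_right_diff_distrib)
  show "x + y \<in> ?S" if "x \<in> ?S" "y \<in> ?S" for x y :: "'a \<times> 'c \<Rightarrow>\<^sub>0 complex"
    using that Poly_Mapping.keys_add[of x y] by auto
  show "Poly_Mapping.map ((*) c) x \<in> ?S" if "x \<in> ?S" for c and x :: "'a \<times> 'c \<Rightarrow>\<^sub>0 complex"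
    using that keys_scale[of c x] by auto
qed (auto simp: tensor_product_def tensor_class_refl free.scale_left_distrib
    free.scale_right_distrib add_ac)

lemma linear_space_tensor [simp, intro]:
  "linear_space V \<Longrightarrow> linear_space W \<Longrightarrow> linear_space (tensor_product V W)"
  by (rule quotient_lspace.linear_space[OF quotient_tensor])

context
  fixes V :: "(complex, 'a, 'm) module_scheme" and W :: "(complex, 'b, 'n) module_scheme"
  assumes V: "linear_space V" and W: "linear_space W"
begin

interpretation quotient_lspace "{f. Poly_Mapping.keys f \<subseteq> carrier V \<times> carrier W}" "tensor_class V W"
    "(+)" "\<lambda>c. Poly_Mapping.map ((*) c)" 0 "tensor_product V W"
  by (rule quotient_tensor) (use V W in auto)

lemma elem_tensor_closed [simp, intro]:
  "x \<in> carrier V \<Longrightarrow> y \<in> carrier W \<Longrightarrow> elem_tensor V W x y \<in> carrier (tensor_product V W)"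
  unfolding elem_tensor_def by (rule cls_in_carrier) auto

lemma elem_tensor_linear_left: "y \<in> carrier W \<Longrightarrow> linear_op V (tensor_product V W) (\<lambda>x. elem_tensor V W x y)"
proof (rule linear_opI)
  fix x x' assume *: "x \<in> carrier V" "x' \<in> carrier V" "y \<in> carrier W"
  then have "Poly_Mapping.single (x \<oplus>\<^bsub>V\<^esub> x', y) 1 - Poly_Mapping.single (x, y) 1 - Poly_Mapping.single (x', y) 1
      \<in> tensor_relations V W" unfolding tensor_relations_def by blast
  from free.span_base[OF this] show
    "elem_tensor V W (x \<oplus>\<^bsub>V\<^esub> x') y = elem_tensor V W x y \<oplus>\<^bsub>tensor_product V W\<^esub> elem_tensor V W x' y"
    unfolding elem_tensor_def using * by (subst add_cls) (auto intro!: tensor_class_eq simp: algebra_simps)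
next
  fix c x assume *: "x \<in> carrier V" "y \<in> carrier W"
  then have "Poly_Mapping.single (c \<odot>\<^bsub>V\<^esub> x, y) 1 - Poly_Mapping.single (x, y) c
      \<in> tensor_relations V W" unfolding tensor_relations_def by blast
  from free.span_base[OF this] show
    "elem_tensor V W (c \<odot>\<^bsub>V\<^esub> x) y = c \<odot>\<^bsub>tensor_product V W\<^esub> elem_tensor V W x y"
    unfolding elem_tensor_def using * by (subst smult_cls) (auto intro!: tensor_class_eq simp: algebra_simps)
qed auto

lemma elem_tensor_linear_right: "x \<in> carrier V \<Longrightarrow> linear_op W (tensor_product V W) (elem_tensor V W x)"
proof (rule linear_opI)
  fix y y' assume *: "x \<in> carrier V" "y' \<in> carrier W" "y \<in> carrier W"
  then have "Poly_Mapping.single (x, y \<oplus>\<^bsub>W\<^esub> y') 1 - Poly_Mapping.single (x, y) 1 - Poly_Mapping.single (x, y') 1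
      \<in> tensor_relations V W" unfolding tensor_relations_def by blast
  from free.span_base[OF this] show
    "elem_tensor V W x (y \<oplus>\<^bsub>W\<^esub> y') = elem_tensor V W x y \<oplus>\<^bsub>tensor_product V W\<^esub> elem_tensor V W x y'"
    unfolding elem_tensor_def using * by (subst add_cls) (auto intro!: tensor_class_eq simp: algebra_simps)
next
  fix c y assume *: "x \<in> carrier V" "y \<in> carrier W"
  then have "Poly_Mapping.single (x, c \<odot>\<^bsub>W\<^esub> y) 1 - Poly_Mapping.single (x, y) c
      \<in> tensor_relations V W" unfolding tensor_relations_def by blast
  from free.span_base[OF this] show
    "elem_tensor V W x (c \<odot>\<^bsub>W\<^esub> y) = c \<odot>\<^bsub>tensor_product V W\<^esub> elem_tensor V W x y"
    unfolding elem_tensor_def using * by (subst smult_cls) (auto intro!: tensor_class_eq simp: algebra_simps)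
qed auto

text \<open>A coefficient can be absorbed into the left factor of an elementary tensor, so every
  element is a sum of elementary tensors and neither a scalar case nor a zero case is
  needed.\<close>

lemma tensor_induct [consumes 3, case_names elem add]:
  assumes U: "U \<in> carrier (tensor_product V W)"
    and elem: "\<And>x y. x \<in> carrier V \<Longrightarrow> y \<in> carrier W \<Longrightarrow> P (elem_tensor V W x y)"
    and add: "\<And>A B. A \<in> carrier (tensor_product V W) \<Longrightarrow> B \<in> carrier (tensor_product V W) \<Longrightarrow>
      P A \<Longrightarrow> P B \<Longrightarrow> P (A \<oplus>\<^bsub>tensor_product V W\<^esub> B)"
  shows "P U"
proof -
  obtain f where f: "U = tensor_class V W f" "Poly_Mapping.keys f \<subseteq> carrier V \<times> carrier W"
    using U carrier_eq by auto
  have single: "tensor_class V W (Poly_Mapping.single (x, y) c) = elem_tensor V W (c \<odot>\<^bsub>V\<^esub> x) y"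
    if "x \<in> carrier V" "y \<in> carrier W" for c x y
    using that linear_opD(3)[OF elem_tensor_linear_left, of y x c]
    by (simp add: elem_tensor_def smult_cls)
  have "P (tensor_class V W (\<Sum>k\<in>A. Poly_Mapping.single k (Poly_Mapping.lookup f k)))"
    if "finite A" "A \<subseteq> carrier V \<times> carrier W" for A
    using that
  proof (induction A)
    case empty
    \<comment> \<open>The empty sum is an instance of the elementary case, as the tensor of the two
      zero vectors.\<close>
    have "tensor_class V W 0 = elem_tensor V W \<zero>\<^bsub>V\<^esub> \<zero>\<^bsub>W\<^esub>"
      using single[of "\<zero>\<^bsub>V\<^esub>" "\<zero>\<^bsub>W\<^esub>" 0] V W by simp
    then show ?case using elem[of "\<zero>\<^bsub>V\<^esub>" "\<zero>\<^bsub>W\<^esub>"] V W by simp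
  next
    case (insert k A)
    let ?g = "\<Sum>k\<in>A. Poly_Mapping.single k (Poly_Mapping.lookup f k)"
    have keys: "Poly_Mapping.keys ?g \<subseteq> carrier V \<times> carrier W"
    proof -
      have "Poly_Mapping.keys ?g \<subseteq> (\<Union>k\<in>A. {k})"
        by (rule order_trans[OF Poly_Mapping.keys_sum UN_mono]) auto
      then show ?thesis using insert by blast
    qed
    have k: "fst k \<in> carrier V" "snd k \<in> carrier W" using insert by auto
    have "P (elem_tensor V W (Poly_Mapping.lookup f k \<odot>\<^bsub>V\<^esub> fst k) (snd k) \<oplus>\<^bsub>tensor_product V W\<^esub> tensor_class V W ?g)"
      using k insert keys V W by (intro add elem) auto
    then show ?case
      using insert k keys by (auto simp: single[symmetric] add_cls)
  qed
  from this[of "Poly_Mapping.keys f"] show ?thesis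
    using f poly_mapping_sum_single[of f] by auto
qed

end

section \<open>Universal property of the algebraic tensor product\<close>

definition bilinear_op where
  "bilinear_op V W G \<beta> \<longleftrightarrow> (\<forall>y\<in>carrier W. linear_op V G (\<lambda>x. \<beta> x y)) \<and> (\<forall>x\<in>carrier V. linear_op W G (\<beta> x))"

text \<open>The linear extension of \<beta> to the free space on pairs; \<open>tensor_lift\<close>
  is this map evaluated on representatives.\<close>

definition free_eval where
  "free_eval G \<beta> f = (\<Oplus>\<^bsub>G\<^esub>p\<in>Poly_Mapping.keys f. Poly_Mapping.lookup f p \<odot>\<^bsub>G\<^esub> \<beta> (fst p) (snd p))"

context
  fixes V :: "(complex, 'a, 'm) module_scheme" and W :: "(complex, 'b, 'n) module_scheme"
    and G :: "(complex, 'c, 'k) module_scheme" and \<beta> :: "'a \<Rightarrow> 'b \<Rightarrow> 'c"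
  assumes V: "linear_space V" and W: "linear_space W" and G: "linear_space G"
    and bil: "bilinear_op V W G \<beta>"
begin

interpretation T: quotient_lspace "{f. Poly_Mapping.keys f \<subseteq> carrier V \<times> carrier W}" "tensor_class V W"
    "(+)" "\<lambda>c. Poly_Mapping.map ((*) c)" 0 "tensor_product V W"
  by (rule quotient_tensor) (use V W in auto)
interpretation G: abelian_monoid G by (rule ls_monoid[OF G])
interpretation GM: Module.module complex_ring G by (rule G)

lemma bil_closed: "x \<in> carrier V \<Longrightarrow> y \<in> carrier W \<Longrightarrow> \<beta> x y \<in> carrier G"
  using bil by (auto simp: bilinear_op_def dest: linear_opD)

text \<open>Cancellation can make the support of a sum smaller than the union of the supports.
  Allowing any finite superset as index set lets the evaluations of both summands and of the sum run
  over the same indices.\<close>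

lemma free_eval_superset:
  assumes "finite A" "Poly_Mapping.keys f \<subseteq> A" "A \<subseteq> carrier V \<times> carrier W"
  shows "free_eval G \<beta> f = (\<Oplus>\<^bsub>G\<^esub>p\<in>A. Poly_Mapping.lookup f p \<odot>\<^bsub>G\<^esub> \<beta> (fst p) (snd p))"
  unfolding free_eval_def
  using assms bil_closed G
  by (intro G.add.finprod_mono_neutral_cong_left) (auto simp: in_keys_iff subset_iff)

lemma free_eval_closed: "Poly_Mapping.keys f \<subseteq> carrier V \<times> carrier W \<Longrightarrow> free_eval G \<beta> f \<in> carrier G"
  unfolding free_eval_def by (intro G.finsum_closed) (auto intro!: ls_closed bil_closed G)

lemma free_eval_add:
  assumes "Poly_Mapping.keys f \<subseteq> carrier V \<times> carrier W" "Poly_Mapping.keys g \<subseteq> carrier V \<times> carrier W"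
  shows "free_eval G \<beta> (f + g) = free_eval G \<beta> f \<oplus>\<^bsub>G\<^esub> free_eval G \<beta> g"
proof -
  let ?A = "Poly_Mapping.keys f \<union> Poly_Mapping.keys g"
  have "\<And>p. p \<in> ?A \<Longrightarrow> \<beta> (fst p) (snd p) \<in> carrier G" using assms bil_closed by fastforce
  then have b: "\<And>p c. p \<in> ?A \<Longrightarrow> c \<odot>\<^bsub>G\<^esub> \<beta> (fst p) (snd p) \<in> carrier G" using G by simp
  have A: "finite ?A" "?A \<subseteq> carrier V \<times> carrier W" using assms by auto
  have "free_eval G \<beta> (f + g) = (\<Oplus>\<^bsub>G\<^esub>p\<in>?A. Poly_Mapping.lookup (f + g) p \<odot>\<^bsub>G\<^esub> \<beta> (fst p) (snd p))"
    using A Poly_Mapping.keys_add[of f g] by (intro free_eval_superset)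
  also have "\<dots> = (\<Oplus>\<^bsub>G\<^esub>p\<in>?A. Poly_Mapping.lookup f p \<odot>\<^bsub>G\<^esub> \<beta> (fst p) (snd p) \<oplus>\<^bsub>G\<^esub>
      Poly_Mapping.lookup g p \<odot>\<^bsub>G\<^esub> \<beta> (fst p) (snd p))"
    using b G \<open>\<And>p. p \<in> ?A \<Longrightarrow> \<beta> (fst p) (snd p) \<in> carrier G\<close>
    by (intro G.finsum_cong' refl) (auto simp only: lookup_add ls_distrib_left[OF G] Pi_iff intro!: ls_closed(3)[OF G])
  also have "\<dots> = (\<Oplus>\<^bsub>G\<^esub>p\<in>?A. Poly_Mapping.lookup f p \<odot>\<^bsub>G\<^esub> \<beta> (fst p) (snd p)) \<oplus>\<^bsub>G\<^esub>
      (\<Oplus>\<^bsub>G\<^esub>p\<in>?A. Poly_Mapping.lookup g p \<odot>\<^bsub>G\<^esub> \<beta> (fst p) (snd p))"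
    using b by (intro G.finsum_addf) auto
  finally show ?thesis using A by (simp only: free_eval_superset[of ?A f] free_eval_superset[of ?A g] Un_upper1 Un_upper2)
qed

lemma free_eval_scale:
  assumes "Poly_Mapping.keys f \<subseteq> carrier V \<times> carrier W"
  shows "free_eval G \<beta> (Poly_Mapping.map ((*) c) f) = c \<odot>\<^bsub>G\<^esub> free_eval G \<beta> f"
proof -
  let ?A = "Poly_Mapping.keys f"
  have b: "\<And>p. p \<in> ?A \<Longrightarrow> \<beta> (fst p) (snd p) \<in> carrier G" using assms bil_closed by fastforce
  have "linear_op G G (\<lambda>x. c \<odot>\<^bsub>G\<^esub> x)"
    by (rule linear_op_smult) (use G in \<open>auto simp: linear_op_def\<close>)
  from linear_op_finsum[OF this G G, of ?A "\<lambda>p. Poly_Mapping.lookup f p \<odot>\<^bsub>G\<^esub> \<beta> (fst p) (snd p)"]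
  have "c \<odot>\<^bsub>G\<^esub> free_eval G \<beta> f = (\<Oplus>\<^bsub>G\<^esub>p\<in>?A. c \<odot>\<^bsub>G\<^esub> (Poly_Mapping.lookup f p \<odot>\<^bsub>G\<^esub> \<beta> (fst p) (snd p)))"
    using b G unfolding free_eval_def by simp
  also have "\<dots> = (\<Oplus>\<^bsub>G\<^esub>p\<in>?A. Poly_Mapping.lookup (Poly_Mapping.map ((*) c) f) p \<odot>\<^bsub>G\<^esub> \<beta> (fst p) (snd p))"
    using b G by (intro G.finsum_cong') (auto simp: ls_smult_assoc)
  also have "\<dots> = free_eval G \<beta> (Poly_Mapping.map ((*) c) f)"
    using assms by (intro free_eval_superset[symmetric] keys_scale) auto
  finally show ?thesis by simp
qed

lemma free_eval_single:
  assumes "x \<in> carrier V" "y \<in> carrier W"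
  shows "free_eval G \<beta> (Poly_Mapping.single (x, y) c) = c \<odot>\<^bsub>G\<^esub> \<beta> x y"
  using assms bil_closed G by (subst free_eval_superset[of "{(x, y)}"]) auto

lemma free_eval_diff:
  assumes "Poly_Mapping.keys f \<subseteq> carrier V \<times> carrier W" "Poly_Mapping.keys g \<subseteq> carrier V \<times> carrier W"
  shows "free_eval G \<beta> (f - g) = free_eval G \<beta> f \<ominus>\<^bsub>G\<^esub> free_eval G \<beta> g"
proof -
  have "f - g = f + Poly_Mapping.map ((*) (-1)) g"
    by (rule poly_mapping_eqI) (simp add: lookup_minus lookup_add)
  moreover have "Poly_Mapping.keys (Poly_Mapping.map ((*) (-1)) g) \<subseteq> carrier V \<times> carrier W"
    using assms(2) keys_scale[of "-1" g] by blast
  ultimately show ?thesis using assms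
    by (simp only: free_eval_add free_eval_scale ls_minus[OF G free_eval_closed])
qed

lemma free_eval_relation:
  assumes "r \<in> tensor_relations V W"
  shows "free_eval G \<beta> r = \<zero>\<^bsub>G\<^esub>"
proof -
  have left: "\<And>y. y \<in> carrier W \<Longrightarrow> linear_op V G (\<lambda>x. \<beta> x y)"
    and right: "\<And>x. x \<in> carrier V \<Longrightarrow> linear_op W G (\<beta> x)"
    using bil by (auto simp: bilinear_op_def)
  have *: "(a \<oplus>\<^bsub>G\<^esub> b) \<ominus>\<^bsub>G\<^esub> a \<ominus>\<^bsub>G\<^esub> b = \<zero>\<^bsub>G\<^esub>" if "a \<in> carrier G" "b \<in> carrier G" for a b
    using that G by (simp add: ls_add_minus_cancel)
  have e: "free_eval G \<beta> (Poly_Mapping.single p c - Poly_Mapping.single q d) =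
      c \<odot>\<^bsub>G\<^esub> \<beta> (fst p) (snd p) \<ominus>\<^bsub>G\<^esub> d \<odot>\<^bsub>G\<^esub> \<beta> (fst q) (snd q)"
    if "p \<in> carrier V \<times> carrier W" "q \<in> carrier V \<times> carrier W" for p q c d
    using that free_eval_single[of "fst p" "snd p" c] free_eval_single[of "fst q" "snd q" d]
    by (subst free_eval_diff) auto
  have e3: "free_eval G \<beta> (Poly_Mapping.single p 1 - Poly_Mapping.single q 1 - Poly_Mapping.single r 1) =
      \<beta> (fst p) (snd p) \<ominus>\<^bsub>G\<^esub> \<beta> (fst q) (snd q) \<ominus>\<^bsub>G\<^esub> \<beta> (fst r) (snd r)"
    if "p \<in> carrier V \<times> carrier W" "q \<in> carrier V \<times> carrier W" "r \<in> carrier V \<times> carrier W" for p q r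
  proof -
    have "Poly_Mapping.keys (Poly_Mapping.single p 1 - Poly_Mapping.single q (1::complex)) \<subseteq> carrier V \<times> carrier W"
      using keys_minus_complex[of "Poly_Mapping.single p 1" "Poly_Mapping.single q 1"] that by auto
    then show ?thesis using that free_eval_single[of "fst r" "snd r" 1] G
      by (subst free_eval_diff) (auto simp: e bil_closed)
  qed
  from assms consider
    (a) x x' y where "x \<in> carrier V" "x' \<in> carrier V" "y \<in> carrier W"
      "r = Poly_Mapping.single (x \<oplus>\<^bsub>V\<^esub> x', y) 1 - Poly_Mapping.single (x, y) 1 - Poly_Mapping.single (x', y) 1"
  | (b) x y y' where "x \<in> carrier V" "y \<in> carrier W" "y' \<in> carrier W"
      "r = Poly_Mapping.single (x, y \<oplus>\<^bsub>W\<^esub> y') 1 - Poly_Mapping.single (x, y) 1 - Poly_Mapping.single (x, y') 1"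
  | (c) c x y where "x \<in> carrier V" "y \<in> carrier W"
      "r = Poly_Mapping.single (c \<odot>\<^bsub>V\<^esub> x, y) 1 - Poly_Mapping.single (x, y) c"
  | (d) c x y where "x \<in> carrier V" "y \<in> carrier W"
      "r = Poly_Mapping.single (x, c \<odot>\<^bsub>W\<^esub> y) 1 - Poly_Mapping.single (x, y) c"
    unfolding tensor_relations_def by blast
  then show ?thesis
  proof cases
    case a
    then show ?thesis using V W by (simp add: e3 linear_opD[OF left] bil_closed *)
  next
    case b
    then show ?thesis using V W by (simp add: e3 linear_opD[OF right] bil_closed *)
  next
    case c
    then show ?thesis using V W G by (simp add: e linear_opD[OF left] bil_closed)
  next
    case d
    then show ?thesis using V W G by (simp add: e linear_opD[OF right] bil_closed)
  qed
qed

lemma free_eval_span: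
  assumes "r \<in> free.span (tensor_relations V W)"
  shows "free_eval G \<beta> r = \<zero>\<^bsub>G\<^esub>"
proof -
  \<comment> \<open>The support condition travels with the induction, since additivity of
    \<open>free_eval\<close> is available only for elements supported on the carriers.\<close>
  have "Poly_Mapping.keys r \<subseteq> carrier V \<times> carrier W \<and> free_eval G \<beta> r = \<zero>\<^bsub>G\<^esub>"
    using assms
  proof (induction r rule: free.span_induct_alt)
    case base
    then show ?case by (simp add: free_eval_def)
  next
    case (step c x y)
    have "Poly_Mapping.keys x \<subseteq> carrier V \<times> carrier W"
      by (rule tensor_relations_keys[OF V W free.span_base[OF step(1)]])
    moreover from this have "Poly_Mapping.keys (Poly_Mapping.map ((*) c) x) \<subseteq> carrier V \<times> carrier W"
      using keys_scale[of c x] by blast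
    ultimately show ?case
      using step(2) G Poly_Mapping.keys_add[of "Poly_Mapping.map ((*) c) x" y]
      by (auto simp: free_eval_add free_eval_scale free_eval_relation[OF step(1)])
  qed
  then show ?thesis ..
qed

text \<open>Two representatives differ by an element of the span of the relations, on which the
  evaluation vanishes. So the set under \<open>the_elem\<close> is a singleton.\<close>

lemma tensor_lift_class:
  assumes "Poly_Mapping.keys f \<subseteq> carrier V \<times> carrier W"
  shows "tensor_lift G \<beta> (tensor_class V W f) = free_eval G \<beta> f"
proof -
  have "free_eval G \<beta> g = free_eval G \<beta> f" if "g \<in> tensor_class V W f" for g
  proof -
    have g: "Poly_Mapping.keys g \<subseteq> carrier V \<times> carrier W" using T.cls_cong[of f g] that assms by auto
    have r: "g - f \<in> free.span (tensor_relations V W)" using that by (simp add: tensor_class_def)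
    have "free_eval G \<beta> g = free_eval G \<beta> ((g - f) + f)" by simp
    also have "\<dots> = free_eval G \<beta> (g - f) \<oplus>\<^bsub>G\<^esub> free_eval G \<beta> f"
      using assms g keys_minus_complex[of g f] by (intro free_eval_add) auto
    finally show ?thesis using free_eval_span[OF r] free_eval_closed[OF assms] G by simp
  qed
  then have "free_eval G \<beta> ` tensor_class V W f = {free_eval G \<beta> f}"
    using tensor_class_refl[of f V W] by blast
  then show ?thesis by (simp add: tensor_lift_def free_eval_def[abs_def] )
qed

lemma tensor_lift_linear: "linear_op (tensor_product V W) G (tensor_lift G \<beta>)"
proof (rule linear_opI)
  fix A B assume "A \<in> carrier (tensor_product V W)" "B \<in> carrier (tensor_product V W)"
  then obtain f g where f: "A = tensor_class V W f" "Poly_Mapping.keys f \<subseteq> carrier V \<times> carrier W"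
    and g: "B = tensor_class V W g" "Poly_Mapping.keys g \<subseteq> carrier V \<times> carrier W"
    using T.carrier_eq by auto
  moreover from f(2) g(2) have "Poly_Mapping.keys (f + g) \<subseteq> carrier V \<times> carrier W"
    using Poly_Mapping.keys_add[of f g] by blast
  ultimately show "tensor_lift G \<beta> (A \<oplus>\<^bsub>tensor_product V W\<^esub> B) = tensor_lift G \<beta> A \<oplus>\<^bsub>G\<^esub> tensor_lift G \<beta> B"
    by (simp add: T.add_cls tensor_lift_class free_eval_add)
  fix c
  show "tensor_lift G \<beta> (c \<odot>\<^bsub>tensor_product V W\<^esub> A) = c \<odot>\<^bsub>G\<^esub> tensor_lift G \<beta> A"
    using f order_trans[OF keys_scale[of c f] f(2)] by (simp add: T.smult_cls tensor_lift_class free_eval_scale)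
qed (auto simp: T.carrier_eq tensor_lift_class free_eval_closed)

lemma tensor_lift_elem:
  "x \<in> carrier V \<Longrightarrow> y \<in> carrier W \<Longrightarrow> tensor_lift G \<beta> (elem_tensor V W x y) = \<beta> x y"
  unfolding elem_tensor_def using G
  by (subst tensor_lift_class) (auto simp: free_eval_single bil_closed)

end

lemma tensor_linear_eqI:
  assumes V: "linear_space V" and W: "linear_space W"
    and "linear_op (tensor_product V W) G \<phi>" "linear_op (tensor_product V W) G \<psi>"
    and "\<And>x y. x \<in> carrier V \<Longrightarrow> y \<in> carrier W \<Longrightarrow> \<phi> (elem_tensor V W x y) = \<psi> (elem_tensor V W x y)"
    and "U \<in> carrier (tensor_product V W)"
  shows "\<phi> U = \<psi> U"
  using V W assms(6)
  by (induction rule: tensor_induct) (use assms in \<open>auto simp: linear_opD\<close>)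

lemma bilinear_opI:
  assumes "\<And>y. y \<in> carrier W \<Longrightarrow> linear_op V G (\<lambda>x. \<beta> x y)" "\<And>x. x \<in> carrier V \<Longrightarrow> linear_op W G (\<beta> x)"
  shows "bilinear_op V W G \<beta>"
  using assms by (simp add: bilinear_op_def)

lemma tensor_lift_transfer:
  assumes "carrier W = carrier V" "zero W = zero V" "add W = add V" "smult W = smult V"
  shows "tensor_lift W = tensor_lift V"
  using assms by (intro ext) (simp add: tensor_lift_def finsum_transfer[OF assms(1-3)])

section \<open>Seminormed spaces and completions\<close>

text \<open>Covers the algebraic tensor products, where definiteness of the norm is not established:
  H \<otimes> H with its Hilbert norm and the amplification of L1(X) \<otimes> F with the projective
  norm. The quotient by null sequences in the completion restores definiteness.\<close>

definition seminormed :: "'a normed_lspace \<Rightarrow> bool" where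
  "seminormed V \<longleftrightarrow> linear_space V \<and> (\<forall>x\<in>carrier V. 0 \<le> nrm V x) \<and>
     (\<forall>c. \<forall>x\<in>carrier V. nrm V (c \<odot>\<^bsub>V\<^esub> x) = cmod c * nrm V x) \<and>
     (\<forall>x\<in>carrier V. \<forall>y\<in>carrier V. nrm V (x \<oplus>\<^bsub>V\<^esub> y) \<le> nrm V x + nrm V y)"

lemma normed_seminormed: "normed_space V \<Longrightarrow> seminormed V"
  by (simp add: normed_space_def seminormed_def)

definition tends_in :: "'a normed_lspace \<Rightarrow> (nat \<Rightarrow> 'a) \<Rightarrow> 'a \<Rightarrow> bool" where
  "tends_in V x l \<longleftrightarrow> (\<lambda>n. nrm V (x n \<ominus>\<^bsub>V\<^esub> l)) \<longlonglongrightarrow> 0"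

lemma tendsto_squeeze0:
  fixes f g :: "nat \<Rightarrow> real"
  assumes "g \<longlonglongrightarrow> 0" "\<And>n. 0 \<le> f n" "\<And>n. f n \<le> g n"
  shows "f \<longlonglongrightarrow> 0"
  by (rule tendsto_sandwich[of "\<lambda>_. 0" f sequentially g]) (use assms in auto)

lemma sn_linear_space: "seminormed V \<Longrightarrow> linear_space V"
  by (simp add: seminormed_def)

context
  fixes V :: "'a normed_lspace" (structure)
  assumes sn: "seminormed V"
begin

private lemma ls_seminormed: "linear_space V" by (rule sn_linear_space[OF sn])

lemma sn_nonneg [simp]: "x \<in> carrier V \<Longrightarrow> 0 \<le> nrm V x"
  and sn_smult: "x \<in> carrier V \<Longrightarrow> nrm V (c \<odot> x) = cmod c * nrm V x"
  and sn_triangle: "x \<in> carrier V \<Longrightarrow> y \<in> carrier V \<Longrightarrow> nrm V (x \<oplus> y) \<le> nrm V x + nrm V y"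
  using sn by (simp_all add: seminormed_def)

lemma sn_zero [simp]: "nrm V \<zero> = 0"
  using sn_smult[of \<zero> 0] ls_seminormed by simp

lemma sn_minus_self: "x \<in> carrier V \<Longrightarrow> nrm V (x \<ominus> x) = 0"
  using ls_seminormed by simp

lemma sn_dist_le: "x \<in> carrier V \<Longrightarrow> y \<in> carrier V \<Longrightarrow> nrm V (x \<ominus> y) \<le> nrm V x + nrm V y"
  using sn_triangle[of x "(-1) \<odot> y"] sn_smult[of y "-1"] ls_seminormed by (simp add: ls_minus)

lemma sn_dist_smult:
  assumes "x \<in> carrier V" "y \<in> carrier V"
  shows "nrm V (c \<odot> x \<ominus> c \<odot> y) = cmod c * nrm V (x \<ominus> y)"
proof -
  have "c \<odot> x \<ominus> c \<odot> y = c \<odot> (x \<ominus> y)"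
    using assms ls_seminormed by (simp add: ls_minus ls_distrib_right ls_smult_assoc mult.commute)
  then show ?thesis using assms ls_seminormed sn_smult by simp
qed

lemma sn_dist_commute:
  assumes "x \<in> carrier V" "y \<in> carrier V" shows "nrm V (x \<ominus> y) = nrm V (y \<ominus> x)"
proof -
  have "x \<ominus> y = (-1) \<odot> (y \<ominus> x)"
    using assms ls_seminormed by (simp add: ls_minus ls_distrib_right ls_smult_assoc ls_comm)
  then show ?thesis using assms ls_seminormed sn_smult[of "y \<ominus> x" "-1"] by simp
qed

lemma sn_dist_triangle:
  assumes "x \<in> carrier V" "y \<in> carrier V" "z \<in> carrier V"
  shows "nrm V (x \<ominus> z) \<le> nrm V (x \<ominus> y) + nrm V (y \<ominus> z)"
proof -
  have "(x \<ominus> y) \<oplus> (y \<ominus> z) = x \<oplus> (y \<oplus> (-1) \<odot> y) \<oplus> (-1) \<odot> z"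
    using assms ls_seminormed by (simp add: ls_minus ls_ac)
  also have "y \<oplus> (-1) \<odot> y = \<zero>"
    using ls_minus_self[OF ls_seminormed assms(2)] ls_minus[OF ls_seminormed assms(2), of y] by simp
  also have "x \<oplus> \<zero> \<oplus> (-1) \<odot> z = x \<ominus> z"
    using assms ls_seminormed by (simp add: ls_minus)
  finally have "(x \<ominus> y) \<oplus> (y \<ominus> z) = x \<ominus> z" .
  then show ?thesis using sn_triangle[of "x \<ominus> y" "y \<ominus> z"] assms ls_seminormed by simp
qed

lemma sn_dist_add:
  assumes "x \<in> carrier V" "y \<in> carrier V" "x' \<in> carrier V" "y' \<in> carrier V"
  shows "nrm V ((x \<oplus> y) \<ominus> (x' \<oplus> y')) \<le> nrm V (x \<ominus> x') + nrm V (y \<ominus> y')"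
proof -
  have "(x \<oplus> y) \<ominus> (x' \<oplus> y') = (x \<ominus> x') \<oplus> (y \<ominus> y')"
    using assms ls_seminormed by (simp add: ls_minus ls_ac ls_distrib_right)
  then show ?thesis using sn_triangle[of "x \<ominus> x'" "y \<ominus> y'"] assms ls_seminormed by simp
qed

lemma sn_norm_dist:
  assumes "x \<in> carrier V" "y \<in> carrier V"
  shows "\<bar>nrm V x - nrm V y\<bar> \<le> nrm V (x \<ominus> y)"
proof -
  have "nrm V x \<le> nrm V y + nrm V (x \<ominus> y)" if "x \<in> carrier V" "y \<in> carrier V" for x y
    using sn_triangle[of y "x \<ominus> y"] that ls_seminormed by (simp add: ls_add_minus)
  from this[of x y] this[of y x] show ?thesis
    using assms sn_dist_commute[of x y] by auto
qed

lemma tends_in_add: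
  assumes "\<And>n. x n \<in> carrier V" "l \<in> carrier V" "\<And>n. y n \<in> carrier V" "k \<in> carrier V"
    "tends_in V x l" "tends_in V y k"
  shows "tends_in V (\<lambda>n. x n \<oplus> y n) (l \<oplus> k)"
  unfolding tends_in_def
proof (rule tendsto_squeeze0)
  show "(\<lambda>n. nrm V (x n \<ominus> l) + nrm V (y n \<ominus> k)) \<longlonglongrightarrow> 0"
    using tendsto_add[OF assms(5,6)[unfolded tends_in_def]] by simp
qed (use assms ls_seminormed in \<open>auto intro: sn_dist_add\<close>)

lemma tends_in_smult:
  assumes "\<And>n. x n \<in> carrier V" "l \<in> carrier V" "tends_in V x l"
  shows "tends_in V (\<lambda>n. c \<odot> x n) (c \<odot> l)"
  using tendsto_mult_left[OF assms(3)[unfolded tends_in_def], of "cmod c"] assms(1,2)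
  by (simp add: tends_in_def sn_dist_smult)

lemma tends_in_const: "l \<in> carrier V \<Longrightarrow> tends_in V (\<lambda>_. l) l"
  by (simp add: tends_in_def sn_minus_self)

lemma tends_in_norm:
  assumes "\<And>n. x n \<in> carrier V" "l \<in> carrier V" "tends_in V x l"
  shows "(\<lambda>n. nrm V (x n)) \<longlonglongrightarrow> nrm V l"
proof -
  have "(\<lambda>n. \<bar>nrm V (x n) - nrm V l\<bar>) \<longlonglongrightarrow> 0"
    by (rule tendsto_squeeze0[OF assms(3)[unfolded tends_in_def]]) (use assms sn_norm_dist in auto)
  then show ?thesis using LIM_zero_cancel tendsto_rabs_zero_iff by blast
qed

lemma tends_in_unique_norm:
  assumes "\<And>n. x n \<in> carrier V" "l \<in> carrier V" "k \<in> carrier V" "tends_in V x l" "tends_in V x k"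
  shows "nrm V (l \<ominus> k) = 0"
proof -
  have "(\<lambda>n. nrm V (l \<ominus> k)) \<longlonglongrightarrow> 0"
  proof (rule tendsto_squeeze0)
    show "(\<lambda>n. nrm V (x n \<ominus> l) + nrm V (x n \<ominus> k)) \<longlonglongrightarrow> 0"
      using tendsto_add[OF assms(4,5)[unfolded tends_in_def]] by simp
    fix n show "nrm V (l \<ominus> k) \<le> nrm V (x n \<ominus> l) + nrm V (x n \<ominus> k)"
      using sn_dist_triangle[of l "x n" k] sn_dist_commute[of l "x n"] assms by simp
  qed (use assms ls_seminormed in simp)
  then show ?thesis by (simp add: LIMSEQ_const_iff)
qed

lemma tends_in_near:
  assumes "\<And>n. x n \<in> carrier V" "\<And>n. y n \<in> carrier V" "l \<in> carrier V" "tends_in V x l"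
    "(\<lambda>n. nrm V (y n \<ominus> x n)) \<longlonglongrightarrow> 0"
  shows "tends_in V y l"
  unfolding tends_in_def
proof (rule tendsto_squeeze0)
  show "(\<lambda>n. nrm V (y n \<ominus> x n) + nrm V (x n \<ominus> l)) \<longlonglongrightarrow> 0"
    using tendsto_add[OF assms(5) assms(4)[unfolded tends_in_def]] by simp
qed (use assms ls_seminormed in \<open>auto intro: sn_dist_triangle\<close>)

lemma cauchy_seqs_carrier: "x \<in> cauchy_seqs V \<Longrightarrow> x n \<in> carrier V"
  by (simp add: cauchy_seqs_def)

lemma cauchy_seqsD: "x \<in> cauchy_seqs V \<Longrightarrow> e > 0 \<Longrightarrow> \<exists>N. \<forall>m\<ge>N. \<forall>n\<ge>N. nrm V (x m \<ominus> x n) < e"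
  by (simp add: cauchy_seqs_def)

lemma cauchy_seqs_const: "l \<in> carrier V \<Longrightarrow> (\<lambda>_. l) \<in> cauchy_seqs V"
  by (simp add: cauchy_seqs_def sn_minus_self)

lemma cauchy_seqs_add:
  assumes x: "x \<in> cauchy_seqs V" and y: "y \<in> cauchy_seqs V"
  shows "(\<lambda>n. x n \<oplus> y n) \<in> cauchy_seqs V"
  unfolding cauchy_seqs_def
proof (intro CollectI conjI allI impI)
  show "x n \<oplus> y n \<in> carrier V" for n using assms ls_seminormed by (auto simp: cauchy_seqs_def)
  fix e :: real assume "e > 0"
  then have e: "e / 2 > 0" by simp
  from cauchy_seqsD[OF x e] obtain N where N: "\<And>m n. m \<ge> N \<Longrightarrow> n \<ge> N \<Longrightarrow> nrm V (x m \<ominus> x n) < e / 2" by blast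
  from cauchy_seqsD[OF y e] obtain N' where N': "\<And>m n. m \<ge> N' \<Longrightarrow> n \<ge> N' \<Longrightarrow> nrm V (y m \<ominus> y n) < e / 2" by blast
  have "nrm V ((x m \<oplus> y m) \<ominus> (x n \<oplus> y n)) < e" if "m \<ge> max N N'" "n \<ge> max N N'" for m n
    using sn_dist_add[of "x m" "y m" "x n" "y n"] N[of m n] N'[of m n] that
      cauchy_seqs_carrier[OF x] cauchy_seqs_carrier[OF y] by force
  then show "\<exists>N. \<forall>m\<ge>N. \<forall>n\<ge>N. nrm V ((x m \<oplus> y m) \<ominus> (x n \<oplus> y n)) < e" by blast
qed

text \<open>Serves in two directions: a bounded operator sends Cauchy sequences to Cauchy sequences,
  and an isometry reflects them.\<close>

lemma cauchy_seqs_le: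
  assumes x: "x \<in> cauchy_seqs V" and "\<And>n. y n \<in> carrier W"
    and le: "\<And>m n. nrm W (y m \<ominus>\<^bsub>W\<^esub> y n) \<le> K * nrm V (x m \<ominus> x n)"
  shows "y \<in> cauchy_seqs W"
  unfolding cauchy_seqs_def
proof (intro CollectI conjI allI impI)
  fix e :: real assume "e > 0"
  \<comment> \<open>The divisor is positive whatever the sign of \<open>K\<close>, and it dominates
    \<open>K\<close>.\<close>
  then have e: "e / (\<bar>K\<bar> + 1) > 0" by simp
  from cauchy_seqsD[OF x e] obtain N where N: "\<And>m n. m \<ge> N \<Longrightarrow> n \<ge> N \<Longrightarrow> nrm V (x m \<ominus> x n) < e / (\<bar>K\<bar> + 1)" by blast
  have "nrm W (y m \<ominus>\<^bsub>W\<^esub> y n) < e" if "m \<ge> N" "n \<ge> N" for m n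
  proof -
    have 0: "0 \<le> nrm V (x m \<ominus> x n)" using cauchy_seqs_carrier[OF x] ls_seminormed by simp
    have "K * nrm V (x m \<ominus> x n) \<le> (\<bar>K\<bar> + 1) * nrm V (x m \<ominus> x n)"
      using 0 by (intro mult_right_mono) auto
    also have "\<dots> < e" using N[OF that] by (simp add: field_simps add_pos_nonneg)
    finally show ?thesis using le[of m n] by simp
  qed
  then show "\<exists>N. \<forall>m\<ge>N. \<forall>n\<ge>N. nrm W (y m \<ominus>\<^bsub>W\<^esub> y n) < e" by blast
qed (use assms in auto)

lemma cauchy_seqs_smult:
  assumes x: "x \<in> cauchy_seqs V" shows "(\<lambda>n. c \<odot> x n) \<in> cauchy_seqs V"
  by (rule cauchy_seqs_le[OF x, of _ _ "cmod c"])
    (use cauchy_seqs_carrier[OF x] ls_seminormed in \<open>auto simp: sn_dist_smult\<close>)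

lemma cauchy_norm_convergent:
  assumes x: "x \<in> cauchy_seqs V"
  shows "convergent (\<lambda>n. nrm V (x n))"
proof -
  have "Cauchy (\<lambda>n. nrm V (x n))"
  proof (rule CauchyI)
    fix e :: real assume "0 < e"
    from cauchy_seqsD[OF x this] obtain N where N: "\<And>m n. m \<ge> N \<Longrightarrow> n \<ge> N \<Longrightarrow> nrm V (x m \<ominus> x n) < e" by blast
    have "norm (nrm V (x m) - nrm V (x n)) < e" if "m \<ge> N" "n \<ge> N" for m n
      using N[OF that] sn_norm_dist[OF cauchy_seqs_carrier[OF x, of m] cauchy_seqs_carrier[OF x, of n]]
      by simp
    then show "\<exists>M. \<forall>m\<ge>M. \<forall>n\<ge>M. norm (nrm V (x m) - nrm V (x n)) < e" by blast
  qed
  then show ?thesis by (simp add: Cauchy_convergent_iff)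
qed

lemma null_sum:
  assumes "x \<in> cauchy_seqs V" "y \<in> cauchy_seqs V" "w \<in> cauchy_seqs V"
    "(\<lambda>n. nrm V (x n \<ominus> y n)) \<longlonglongrightarrow> 0" "(\<lambda>n. nrm V (y n \<ominus> w n)) \<longlonglongrightarrow> 0"
  shows "(\<lambda>n. nrm V (x n \<ominus> w n)) \<longlonglongrightarrow> 0"
proof (rule tendsto_squeeze0)
  show "(\<lambda>n. nrm V (x n \<ominus> y n) + nrm V (y n \<ominus> w n)) \<longlonglongrightarrow> 0"
    using tendsto_add[OF assms(4,5)] by simp
qed (use assms ls_seminormed cauchy_seqs_carrier in \<open>auto intro!: sn_dist_triangle\<close>)

lemma null_commute:
  assumes "x \<in> cauchy_seqs V" "y \<in> cauchy_seqs V" "(\<lambda>n. nrm V (x n \<ominus> y n)) \<longlonglongrightarrow> 0"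
  shows "(\<lambda>n. nrm V (y n \<ominus> x n)) \<longlonglongrightarrow> 0"
  using assms(3) sn_dist_commute[OF cauchy_seqs_carrier[OF assms(1)] cauchy_seqs_carrier[OF assms(2)]]
  by simp

section \<open>Cauchy sequences modulo null sequences\<close>

lemma completion_class_eqI:
  assumes "x \<in> cauchy_seqs V" "y \<in> cauchy_seqs V" "(\<lambda>n. nrm V (x n \<ominus> y n)) \<longlonglongrightarrow> 0"
  shows "completion_class V x = completion_class V y"
  unfolding completion_class_def using assms null_sum null_commute by blast

lemma completion_class_refl: "x \<in> cauchy_seqs V \<Longrightarrow> x \<in> completion_class V x"
  by (simp add: completion_class_def sn_minus_self cauchy_seqs_carrier)

lemma quotient_completion:
  "quotient_lspace (cauchy_seqs V) (completion_class V) (\<lambda>x y n. x n \<oplus> y n) (\<lambda>c x n. c \<odot> x n)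
     (\<lambda>_. \<zero>) (completion V)"
proof
  show "y \<in> cauchy_seqs V \<and> completion_class V y = completion_class V x"
    if "x \<in> cauchy_seqs V" "y \<in> completion_class V x" for x y
    using that completion_class_eqI[of y x] by (auto simp: completion_class_def)
  show "completion_class V (\<lambda>n. x' n \<oplus> y' n) = completion_class V (\<lambda>n. x n \<oplus> y n)"
    if "x \<in> cauchy_seqs V" "y \<in> cauchy_seqs V" "x' \<in> completion_class V x" "y' \<in> completion_class V y" for x y x' y'
  proof -
    have *: "x' \<in> cauchy_seqs V" "y' \<in> cauchy_seqs V" "(\<lambda>n. nrm V (x' n \<ominus> x n)) \<longlonglongrightarrow> 0" "(\<lambda>n. nrm V (y' n \<ominus> y n)) \<longlonglongrightarrow> 0"
      using that by (auto simp: completion_class_def)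
    have "(\<lambda>n. nrm V ((x' n \<oplus> y' n) \<ominus> (x n \<oplus> y n))) \<longlonglongrightarrow> 0"
    proof (rule tendsto_squeeze0)
      show "(\<lambda>n. nrm V (x' n \<ominus> x n) + nrm V (y' n \<ominus> y n)) \<longlonglongrightarrow> 0"
        using tendsto_add[OF *(3,4)] by simp
    qed (use that * cauchy_seqs_carrier ls_seminormed in \<open>auto intro!: sn_dist_add\<close>)
    then show ?thesis using that * by (intro completion_class_eqI cauchy_seqs_add)
  qed
  show "completion_class V (\<lambda>n. c \<odot> x' n) = completion_class V (\<lambda>n. c \<odot> x n)"
    if "x \<in> cauchy_seqs V" "x' \<in> completion_class V x" for c x x'
  proof -
    have *: "x' \<in> cauchy_seqs V" "(\<lambda>n. nrm V (x' n \<ominus> x n)) \<longlonglongrightarrow> 0"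
      using that by (auto simp: completion_class_def)
    show ?thesis using that * tendsto_mult_left[OF *(2), of "cmod c"]
      by (intro completion_class_eqI cauchy_seqs_smult) (auto simp: sn_dist_smult cauchy_seqs_carrier)
  qed
  fix x y w c d assume x: "x \<in> cauchy_seqs V"
  note xc = cauchy_seqs_carrier[OF x]
  show "completion_class V (\<lambda>n. \<zero> \<oplus> x n) = completion_class V x"
    "completion_class V (\<lambda>n. (c + d) \<odot> x n) = completion_class V (\<lambda>n. c \<odot> x n \<oplus> d \<odot> x n)"
    "completion_class V (\<lambda>n. (c * d) \<odot> x n) = completion_class V (\<lambda>n. c \<odot> (d \<odot> x n))"
    "completion_class V (\<lambda>n. 1 \<odot> x n) = completion_class V x"
    "completion_class V (\<lambda>n. 0 \<odot> x n) = completion_class V (\<lambda>_. \<zero>)"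
    using xc ls_seminormed by (simp_all add: ls_distrib_left ls_smult_assoc)
  assume y: "y \<in> cauchy_seqs V"
  note yc = cauchy_seqs_carrier[OF y]
  show "completion_class V (\<lambda>n. x n \<oplus> y n) = completion_class V (\<lambda>n. y n \<oplus> x n)"
    using xc yc ls_seminormed by (simp add: ls_comm)
  show "completion_class V (\<lambda>n. c \<odot> (x n \<oplus> y n)) = completion_class V (\<lambda>n. c \<odot> x n \<oplus> c \<odot> y n)"
    using xc yc ls_seminormed by (simp add: ls_distrib_right)
  assume "w \<in> cauchy_seqs V"
  note wc = cauchy_seqs_carrier[OF this]
  show "completion_class V (\<lambda>n. x n \<oplus> y n \<oplus> w n) = completion_class V (\<lambda>n. x n \<oplus> (y n \<oplus> w n))"
    using xc yc wc ls_seminormed by (simp add: ls_assoc)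
qed (use ls_seminormed in \<open>auto simp: completion_def completion_class_refl cauchy_seqs_add cauchy_seqs_smult cauchy_seqs_const\<close>)

lemma linear_space_completion: "linear_space (completion V)"
  by (rule quotient_lspace.linear_space[OF quotient_completion])

interpretation C: quotient_lspace "cauchy_seqs V" "completion_class V" "\<lambda>x y n. x n \<oplus> y n" "\<lambda>c x n. c \<odot> x n"
     "\<lambda>_. \<zero>" "completion V"
  by (rule quotient_completion)

lemmas completion_add = C.add_cls and completion_smult = C.smult_cls and completion_minus = C.minus_cls
  and completion_carrier = C.carrier_eq and completion_class_cong = C.cls_cong
  and completion_class_closed = C.cls_in_carrier and completion_UN = C.UN_cls

text \<open>By the reverse triangle inequality the norms along a Cauchy sequence converge, and along
  two representatives their difference tends to 0. Thus all representatives share the limit that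
  \<open>the_elem\<close> extracts.\<close>

lemma nrm_completion_lim:
  assumes x: "x \<in> cauchy_seqs V"
  shows "(\<lambda>n. nrm V (x n)) \<longlonglongrightarrow> nrm (completion V) (completion_class V x)"
proof -
  have x_lim: "(\<lambda>n. nrm V (x n)) \<longlonglongrightarrow> lim (\<lambda>n. nrm V (x n))"
    using cauchy_norm_convergent[OF x] convergent_LIMSEQ_iff by blast
  have "lim (\<lambda>n. nrm V (y n)) = lim (\<lambda>n. nrm V (x n))" if "y \<in> completion_class V x" for y
  proof (rule limI)
    have y: "y \<in> cauchy_seqs V" "(\<lambda>n. nrm V (y n \<ominus> x n)) \<longlonglongrightarrow> 0"
      using that by (auto simp: completion_class_def)
    have "(\<lambda>n. \<bar>nrm V (y n) - nrm V (x n)\<bar>) \<longlonglongrightarrow> 0"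
      by (rule tendsto_squeeze0[OF y(2)]) (use y(1) x cauchy_seqs_carrier sn_norm_dist in auto)
    then have "(\<lambda>n. nrm V (y n) - nrm V (x n)) \<longlonglongrightarrow> 0" using tendsto_rabs_zero_iff by blast
    from tendsto_add[OF this x_lim] show "(\<lambda>n. nrm V (y n)) \<longlonglongrightarrow> lim (\<lambda>n. nrm V (x n))" by simp
  qed
  then have "(\<lambda>x. lim (\<lambda>n. nrm V (x n))) ` completion_class V x = {lim (\<lambda>n. nrm V (x n))}"
    using completion_class_refl[OF x] by blast
  then show ?thesis using x_lim by (simp add: completion_def)
qed

lemma seminormed_completion: "seminormed (completion V)"
  unfolding seminormed_def
proof (intro conjI ballI allI)
  fix A assume "A \<in> carrier (completion V)"
  then obtain x where x: "x \<in> cauchy_seqs V" "A = completion_class V x" using completion_carrier by auto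
  note xc = cauchy_seqs_carrier[OF x(1)] and xl = nrm_completion_lim[OF x(1)]
  show "0 \<le> nrm (completion V) A"
    using xc x(2) by (intro tendsto_lowerbound[OF xl[folded x(2)]]) auto
  show "nrm (completion V) (c \<odot>\<^bsub>completion V\<^esub> A) = cmod c * nrm (completion V) A" for c
    using nrm_completion_lim[OF cauchy_seqs_smult[OF x(1), of c]] tendsto_mult_left[OF xl, of "cmod c"] xc x
    by (simp add: completion_smult sn_smult LIMSEQ_unique)
  fix B assume "B \<in> carrier (completion V)"
  then obtain y where y: "y \<in> cauchy_seqs V" "B = completion_class V y" using completion_carrier by auto
  note yc = cauchy_seqs_carrier[OF y(1)] and yl = nrm_completion_lim[OF y(1)]
  show "nrm (completion V) (A \<oplus>\<^bsub>completion V\<^esub> B) \<le> nrm (completion V) A + nrm (completion V) B"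
    unfolding x(2) y(2) completion_add[OF x(1) y(1)]
    by (rule LIMSEQ_le[OF nrm_completion_lim[OF cauchy_seqs_add[OF x(1) y(1)]] tendsto_add[OF xl yl]])
      (use xc yc sn_triangle in auto)
qed (rule linear_space_completion)

lemma completion_embed_linear: "linear_op V (completion V) (completion_embed V)"
  by (rule linear_opI)
    (use ls_seminormed in \<open>auto simp: completion_embed_def completion_add completion_smult cauchy_seqs_const
      intro!: completion_class_closed\<close>)

lemma nrm_completion_embed: "x \<in> carrier V \<Longrightarrow> nrm (completion V) (completion_embed V x) = nrm V x"
  using nrm_completion_lim[OF cauchy_seqs_const, of x] by (simp add: completion_embed_def LIMSEQ_const_iff)

lemma completion_embed_dense:
  assumes x: "x \<in> cauchy_seqs V"
  shows "tends_in (completion V) (\<lambda>n. completion_embed V (x n)) (completion_class V x)"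
  unfolding tends_in_def
proof (rule LIMSEQ_I)
  fix e :: real assume "e > 0"
  then have "e / 2 > 0" by simp
  from cauchy_seqsD[OF x this] obtain N where N: "\<And>m n. m \<ge> N \<Longrightarrow> n \<ge> N \<Longrightarrow> nrm V (x m \<ominus> x n) < e / 2" by blast
  note xc = cauchy_seqs_carrier[OF x]
  have "norm (nrm (completion V) (completion_embed V (x n) \<ominus>\<^bsub>completion V\<^esub> completion_class V x) - 0) < e"
    if "n \<ge> N" for n
  proof -
    \<comment> \<open>With \<open>n\<close> fixed, this sequence represents the difference between
      the embedded \<open>x n\<close> and the class of \<open>x\<close>, so the distance is a limit
      over \<open>m\<close>. A strict bound becomes a weak one in the limit, which is why the Cauchy
      property is used with half of \<open>e\<close>.\<close>
    let ?y = "\<lambda>m. x n \<oplus> (- 1) \<odot> x m"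
    have y: "?y \<in> cauchy_seqs V"
      using cauchy_seqs_add[OF cauchy_seqs_const cauchy_seqs_smult[OF x]] xc by blast
    have eq: "completion_embed V (x n) \<ominus>\<^bsub>completion V\<^esub> completion_class V x = completion_class V ?y"
      unfolding completion_embed_def using cauchy_seqs_const[OF xc] x by (simp add: completion_minus)
    have le: "nrm (completion V) (completion_class V ?y) \<le> e / 2"
      by (rule LIMSEQ_le_const2[OF nrm_completion_lim[OF y]])
        (use N that xc ls_seminormed in \<open>auto simp: ls_minus[symmetric] intro!: exI[of _ N] less_imp_le\<close>)
    have "0 \<le> nrm (completion V) (completion_class V ?y)"
      by (rule tendsto_lowerbound[OF nrm_completion_lim[OF y]]) (use xc ls_seminormed in auto)
    then show ?thesis using le \<open>e > 0\<close> eq by simp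
  qed
  then show "\<exists>no. \<forall>n\<ge>no. norm (nrm (completion V) (completion_embed V (x n) \<ominus>\<^bsub>completion V\<^esub> completion_class V x) - 0) < e"
    by blast
qed

end

lemma normed_space_eqI:
  assumes "normed_space V" "x \<in> carrier V" "y \<in> carrier V" "nrm V (x \<ominus>\<^bsub>V\<^esub> y) = 0"
  shows "x = y"
  using assms ls_minus_zero_iff[of V x y] ls_closed(4)[of V x y] by (simp add: normed_space_def)

lemma tends_in_unique:
  assumes "normed_space V" "\<And>n. x n \<in> carrier V" "l \<in> carrier V" "k \<in> carrier V"
    "tends_in V x l" "tends_in V x k"
  shows "l = k"
  by (rule normed_space_eqI)
    (use assms tends_in_unique_norm[OF normed_seminormed[OF assms(1)] assms(2-)] in auto)

lemma tends_in_map: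
  assumes "seminormed V" "seminormed W" "linear_op V W \<phi>"
    and le: "\<And>x. x \<in> carrier V \<Longrightarrow> nrm W (\<phi> x) \<le> K * nrm V x"
    and "\<And>n. x n \<in> carrier V" "l \<in> carrier V" "tends_in V x l"
  shows "tends_in W (\<lambda>n. \<phi> (x n)) (\<phi> l)"
  unfolding tends_in_def
proof (rule tendsto_squeeze0)
  show "(\<lambda>n. K * nrm V (x n \<ominus>\<^bsub>V\<^esub> l)) \<longlonglongrightarrow> 0"
    using tendsto_mult_left[OF assms(7)[unfolded tends_in_def], of K] by simp
  fix n
  have eq: "\<phi> (x n) \<ominus>\<^bsub>W\<^esub> \<phi> l = \<phi> (x n \<ominus>\<^bsub>V\<^esub> l)"
    by (rule linear_op_minus[symmetric]) (use assms sn_linear_space in auto)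
  have c: "x n \<ominus>\<^bsub>V\<^esub> l \<in> carrier V" using assms sn_linear_space by blast
  show "nrm W (\<phi> (x n) \<ominus>\<^bsub>W\<^esub> \<phi> l) \<le> K * nrm V (x n \<ominus>\<^bsub>V\<^esub> l)"
    unfolding eq by (rule le[OF c])
  show "0 \<le> nrm W (\<phi> (x n) \<ominus>\<^bsub>W\<^esub> \<phi> l)"
    unfolding eq using c linear_opD(1)[OF assms(3)] assms(2) by simp
qed

text \<open>Extension by continuity: the bound makes \<phi> send Cauchy sequences to Cauchy
  sequences and null sequences to null sequences, so \<phi> has one limit along all representatives
  of a class. Linearity and the bound pass to this limit.\<close>

lemma completion_extend:
  assumes V: "seminormed V" and W: "normed_space W" "complete_normed W" and \<phi>: "linear_op V W \<phi>"
    and le: "\<And>x. x \<in> carrier V \<Longrightarrow> nrm W (\<phi> x) \<le> K * nrm V x"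
  obtains I where "linear_op (completion V) W I"
    "\<And>x. x \<in> cauchy_seqs V \<Longrightarrow> tends_in W (\<lambda>n. \<phi> (x n)) (I (completion_class V x))"
    "\<And>x. x \<in> carrier V \<Longrightarrow> I (completion_embed V x) = \<phi> x"
    "\<And>A. A \<in> carrier (completion V) \<Longrightarrow> nrm W (I A) \<le> K * nrm (completion V) A"
proof -
  have Ws: "seminormed W" by (rule normed_seminormed[OF W(1)])
  note lsV = sn_linear_space[OF V] and lsW = sn_linear_space[OF Ws]
  \<comment> \<open>Requiring the limit for every representative makes the value depend on the class
    alone, without a choice of a sequence.\<close>
  define I where "I = (\<lambda>A. THE l. l \<in> carrier W \<and> (\<forall>x\<in>A. tends_in W (\<lambda>n. \<phi> (x n)) l))"
  have I: "I (completion_class V x) \<in> carrier W \<and> tends_in W (\<lambda>n. \<phi> (x n)) (I (completion_class V x))"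
    if x: "x \<in> cauchy_seqs V" for x
  proof -
    note xc = cauchy_seqs_carrier[OF V x]
    note \<phi>c = linear_opD(1)[OF \<phi>]
    have le': "nrm W (\<phi> u \<ominus>\<^bsub>W\<^esub> \<phi> v) \<le> K * nrm V (u \<ominus>\<^bsub>V\<^esub> v)" if "u \<in> carrier V" "v \<in> carrier V" for u v
      using le[of "u \<ominus>\<^bsub>V\<^esub> v"] that lsV lsW by (simp add: linear_op_minus[OF \<phi>])
    have \<phi>x: "(\<lambda>n. \<phi> (x n)) \<in> cauchy_seqs W"
      by (rule cauchy_seqs_le[OF V x, of _ _ K]) (use xc \<phi>c le' in auto)
    obtain l where l: "l \<in> carrier W" "tends_in W (\<lambda>n. \<phi> (x n)) l"
      using W(2)[unfolded complete_normed_def, THEN bspec, OF \<phi>x] by (auto simp: tends_in_def)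
    have all: "tends_in W (\<lambda>n. \<phi> (y n)) l" if "y \<in> completion_class V x" for y
    proof (rule tends_in_near[OF Ws _ _ l(1) l(2)])
      have y: "y \<in> cauchy_seqs V" "(\<lambda>n. nrm V (y n \<ominus>\<^bsub>V\<^esub> x n)) \<longlonglongrightarrow> 0" using that by (auto simp: completion_class_def)
      note yc = cauchy_seqs_carrier[OF V y(1)]
      show "(\<lambda>n. nrm W (\<phi> (y n) \<ominus>\<^bsub>W\<^esub> \<phi> (x n))) \<longlonglongrightarrow> 0"
      proof (rule tendsto_squeeze0)
        show "(\<lambda>n. K * nrm V (y n \<ominus>\<^bsub>V\<^esub> x n)) \<longlonglongrightarrow> 0" using tendsto_mult_left[OF y(2), of K] by simp
      qed (use xc yc \<phi>c le' Ws lsW in auto)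
      show "\<phi> (y n) \<in> carrier W" "\<phi> (x n) \<in> carrier W" for n using xc yc \<phi>c by auto
    qed
    have "\<exists>!l. l \<in> carrier W \<and> (\<forall>y\<in>completion_class V x. tends_in W (\<lambda>n. \<phi> (y n)) l)"
    proof (rule ex1I[of _ l])
      fix k assume "k \<in> carrier W \<and> (\<forall>y\<in>completion_class V x. tends_in W (\<lambda>n. \<phi> (y n)) k)"
      then show "k = l"
        using completion_class_refl[OF V x] l xc \<phi>c
        by (intro tends_in_unique[OF W(1), of "\<lambda>n. \<phi> (x n)"]) auto
    qed (use l all in auto)
    from theI'[OF this] show ?thesis
      using completion_class_refl[OF V x] unfolding I_def by blast
  qed
  have \<phi>x: "\<phi> (x n) \<in> carrier W" if "x \<in> cauchy_seqs V" for x n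
    using cauchy_seqs_carrier[OF V that] linear_opD(1)[OF \<phi>] by blast
  have uniq: "I (completion_class V x) = l" if "x \<in> cauchy_seqs V" "l \<in> carrier W" "tends_in W (\<lambda>n. \<phi> (x n)) l" for x l
    by (rule tends_in_unique[OF W(1), of "\<lambda>n. \<phi> (x n)"]) (use that I \<phi>x in auto)
  show ?thesis
  proof (rule that)
    show "linear_op (completion V) W I"
    proof (rule linear_opI)
      fix A assume "A \<in> carrier (completion V)"
      then obtain x where x: "x \<in> cauchy_seqs V" "A = completion_class V x" using completion_carrier[OF V] by auto
      show "I A \<in> carrier W" using I x by simp
      show "I (c \<odot>\<^bsub>completion V\<^esub> A) = c \<odot>\<^bsub>W\<^esub> I A" for c
        unfolding x(2) completion_smult[OF V x(1)]
        using tends_in_smult[OF Ws \<phi>x[OF x(1)], where l = "I A" and c = c] I[OF x(1)] x lsW cauchy_seqs_carrier[OF V x(1)]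
        by (intro uniq cauchy_seqs_smult[OF V]) (simp_all add: linear_opD[OF \<phi>])
      fix B assume "B \<in> carrier (completion V)"
      then obtain y where y: "y \<in> cauchy_seqs V" "B = completion_class V y" using completion_carrier[OF V] by auto
      show "I (A \<oplus>\<^bsub>completion V\<^esub> B) = I A \<oplus>\<^bsub>W\<^esub> I B"
        unfolding x(2) y(2) completion_add[OF V x(1) y(1)]
        using tends_in_add[OF Ws \<phi>x[OF x(1)] _ \<phi>x[OF y(1)], where l = "I A" and k = "I B"] I[OF x(1)] I[OF y(1)] x y lsW
          cauchy_seqs_carrier[OF V x(1)] cauchy_seqs_carrier[OF V y(1)]
        by (intro uniq cauchy_seqs_add[OF V]) (simp_all add: linear_opD[OF \<phi>])
    qed
    show "tends_in W (\<lambda>n. \<phi> (x n)) (I (completion_class V x))" if "x \<in> cauchy_seqs V" for x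
      using I that by blast
    show "I (completion_embed V x) = \<phi> x" if "x \<in> carrier V" for x
      unfolding completion_embed_def
      using that linear_opD(1)[OF \<phi>]
      by (intro uniq cauchy_seqs_const[OF V] tends_in_const[OF Ws]) auto
    fix A assume "A \<in> carrier (completion V)"
    then obtain x where x: "x \<in> cauchy_seqs V" "A = completion_class V x" using completion_carrier[OF V] by auto
    have "(\<lambda>n. nrm W (\<phi> (x n))) \<longlonglongrightarrow> nrm W (I A)"
      by (rule tends_in_norm[OF Ws]) (use \<phi>x[OF x(1)] I[OF x(1)] x(2) in auto)
    moreover have "(\<lambda>n. K * nrm V (x n)) \<longlonglongrightarrow> K * nrm (completion V) A"
      using tendsto_mult_left[OF nrm_completion_lim[OF V x(1)]] x(2) by blast
    ultimately show "nrm W (I A) \<le> K * nrm (completion V) A"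
      by (rule LIMSEQ_le) (use le cauchy_seqs_carrier[OF V x(1)] in auto)
  qed
qed

section \<open>Bochner spaces\<close>

lemma simple_function_restrict:
  assumes "simple_function M s" "A \<in> sets M"
  shows "simple_function M (\<lambda>t. if t \<in> A then s t else c)"
proof -
  have "simple_function M (\<lambda>t. (\<lambda>i x. if i = (1::nat) then x else c) (indicator A t) (s t))"
    by (rule simple_function_compose2[OF simple_function_indicator[OF assms(2)] assms(1)])
  moreover have "(\<lambda>t. (\<lambda>i x. if i = (1::nat) then x else c) (indicator A t) (s t)) = (\<lambda>t. if t \<in> A then s t else c)"
    by (auto simp: indicator_def)
  ultimately show ?thesis by simp
qed

lemma L1_functionsD:
  assumes "f \<in> L1_functions M V"
  shows "t \<in> space M \<Longrightarrow> f t \<in> carrier V" "strongly_measurable M V f"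
    "(\<integral>\<^sup>+ t. ennreal (nrm V (f t)) \<partial>M) < \<infinity>"
  using assms by (auto simp: L1_functions_def)

context
  fixes M :: "'x measure" and V :: "'a normed_lspace"
  assumes V: "seminormed V"
begin

private lemma ls_L1: "linear_space V" by (rule sn_linear_space[OF V])

text \<open>Since \<open>f\<close> is a limit of simple functions almost everywhere only, its
  pointwise norm need not be measurable. The limit of the norms of the simple functions is a
  measurable version of it; \<open>max 0\<close> keeps that version nonnegative on the exceptional
  null set.\<close>

lemma strongly_measurable_norm:
  assumes "strongly_measurable M V f" "f \<in> space M \<rightarrow> carrier V"
  obtains h where "h \<in> borel_measurable M" "\<And>t. 0 \<le> (h t :: real)" "AE t in M. nrm V (f t) = h t"
proof -
  obtain s where s: "\<And>n. simple_function M (s n)" "\<And>n. s n \<in> space M \<rightarrow> carrier V"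
    and lim: "AE t in M. (\<lambda>n. nrm V (s n t \<ominus>\<^bsub>V\<^esub> f t)) \<longlonglongrightarrow> 0"
    using assms(1) unfolding strongly_measurable_def by blast
  have m [measurable]: "(\<lambda>t. nrm V (s n t)) \<in> borel_measurable M" for n
    by (intro borel_measurable_simple_function simple_function_compose1[OF s(1)])
  show ?thesis
  proof (rule that)
    show "(\<lambda>t. max 0 (lim (\<lambda>n. nrm V (s n t)))) \<in> borel_measurable M" by measurable
    show "AE t in M. nrm V (f t) = max 0 (lim (\<lambda>n. nrm V (s n t)))"
      using lim AE_space
    proof eventually_elim
      case (elim t)
      have "tends_in V (\<lambda>n. s n t) (f t)" using elim by (simp add: tends_in_def)
      then have "(\<lambda>n. nrm V (s n t)) \<longlonglongrightarrow> nrm V (f t)"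
        using s(2) assms(2) elim(2) by (intro tends_in_norm[OF V]) (auto simp: Pi_iff)
      moreover have "0 \<le> nrm V (f t)" using assms(2) elim(2) V by (auto simp: Pi_iff)
      ultimately show ?case by (simp add: limI)
    qed
  qed auto
qed

lemma L1_norm_measurable:
  assumes "f \<in> L1_functions M V"
  obtains h where "h \<in> borel_measurable M" "\<And>t. 0 \<le> (h t :: real)" "AE t in M. nrm V (f t) = h t"
    "(\<integral>\<^sup>+ t. ennreal (h t) \<partial>M) = (\<integral>\<^sup>+ t. ennreal (nrm V (f t)) \<partial>M)"
proof -
  obtain h where h: "h \<in> borel_measurable M" "\<And>t. 0 \<le> (h t :: real)" "AE t in M. nrm V (f t) = h t"
    using strongly_measurable_norm[of f] assms by (auto simp: L1_functions_def)
  moreover have "(\<integral>\<^sup>+ t. ennreal (h t) \<partial>M) = (\<integral>\<^sup>+ t. ennreal (nrm V (f t)) \<partial>M)"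
    by (rule nn_integral_cong_AE) (use h(3) in auto)
  ultimately show ?thesis using that by blast
qed

text \<open>Additivity of the nonnegative integral requires measurable integrands, so the integrals
  are computed for measurable versions \<open>h\<close> and \<open>k\<close> of the two
  norms.\<close>

lemma nn_integral_norm_add:
  assumes f: "f \<in> L1_functions M V" and g: "g \<in> L1_functions M V"
  shows "(\<integral>\<^sup>+ t. ennreal (nrm V (f t \<oplus>\<^bsub>V\<^esub> g t)) \<partial>M) \<le>
    (\<integral>\<^sup>+ t. ennreal (nrm V (f t)) \<partial>M) + (\<integral>\<^sup>+ t. ennreal (nrm V (g t)) \<partial>M)"
proof -
  obtain h where h [measurable]: "h \<in> borel_measurable M" and h': "\<And>t. 0 \<le> (h t :: real)" "AE t in M. nrm V (f t) = h t"
    "(\<integral>\<^sup>+ t. ennreal (h t) \<partial>M) = (\<integral>\<^sup>+ t. ennreal (nrm V (f t)) \<partial>M)"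
    using L1_norm_measurable[OF f] by blast
  obtain k where k [measurable]: "k \<in> borel_measurable M" and k': "\<And>t. 0 \<le> (k t :: real)" "AE t in M. nrm V (g t) = k t"
    "(\<integral>\<^sup>+ t. ennreal (k t) \<partial>M) = (\<integral>\<^sup>+ t. ennreal (nrm V (g t)) \<partial>M)"
    using L1_norm_measurable[OF g] by blast
  have "(\<integral>\<^sup>+ t. ennreal (nrm V (f t \<oplus>\<^bsub>V\<^esub> g t)) \<partial>M) \<le> (\<integral>\<^sup>+ t. ennreal (h t) + ennreal (k t) \<partial>M)"
  proof (rule nn_integral_mono_AE)
    show "AE t in M. ennreal (nrm V (f t \<oplus>\<^bsub>V\<^esub> g t)) \<le> ennreal (h t) + ennreal (k t)"
      using h'(2) k'(2) AE_space
    proof eventually_elim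
      case (elim t)
      have "nrm V (f t \<oplus>\<^bsub>V\<^esub> g t) \<le> h t + k t"
        using sn_triangle[OF V] L1_functionsD(1)[OF f] L1_functionsD(1)[OF g] elim by metis
      then show ?case using h'(1) k'(1) by (simp add: ennreal_plus[symmetric] ennreal_leI del: ennreal_plus)
    qed
  qed
  also have "\<dots> = (\<integral>\<^sup>+ t. ennreal (h t) \<partial>M) + (\<integral>\<^sup>+ t. ennreal (k t) \<partial>M)"
    by (rule nn_integral_add) auto
  finally show ?thesis using h'(3) k'(3) by simp
qed

lemma L1_functions_add:
  assumes f: "f \<in> L1_functions M V" and g: "g \<in> L1_functions M V"
  shows "(\<lambda>t. f t \<oplus>\<^bsub>V\<^esub> g t) \<in> L1_functions M V"
proof -
  obtain s where s: "\<And>n. simple_function M (s n)" "\<And>n. s n \<in> space M \<rightarrow> carrier V"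
    and lims: "AE t in M. (\<lambda>n. nrm V (s n t \<ominus>\<^bsub>V\<^esub> f t)) \<longlonglongrightarrow> 0"
    using L1_functionsD(2)[OF f] unfolding strongly_measurable_def by blast
  obtain r where r: "\<And>n. simple_function M (r n)" "\<And>n. r n \<in> space M \<rightarrow> carrier V"
    and limr: "AE t in M. (\<lambda>n. nrm V (r n t \<ominus>\<^bsub>V\<^esub> g t)) \<longlonglongrightarrow> 0"
    using L1_functionsD(2)[OF g] unfolding strongly_measurable_def by blast
  note fc = L1_functionsD(1)[OF f] and gc = L1_functionsD(1)[OF g]
  have "AE t in M. (\<lambda>n. nrm V (s n t \<oplus>\<^bsub>V\<^esub> r n t \<ominus>\<^bsub>V\<^esub> (f t \<oplus>\<^bsub>V\<^esub> g t))) \<longlonglongrightarrow> 0"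
    using lims limr AE_space
  proof eventually_elim
    case (elim t)
    then show ?case
      using tends_in_add[OF V, of "\<lambda>n. s n t" "f t" "\<lambda>n. r n t" "g t"] s(2) r(2) fc gc
      by (auto simp: tends_in_def Pi_iff)
  qed
  moreover have "simple_function M (\<lambda>t. s n t \<oplus>\<^bsub>V\<^esub> r n t)" for n
    by (rule simple_function_compose2[OF s(1) r(1)])
  moreover have "(\<lambda>t. s n t \<oplus>\<^bsub>V\<^esub> r n t) \<in> space M \<rightarrow> carrier V" for n
    using s(2) r(2) ls_L1 by (auto simp: Pi_iff)
  ultimately have "strongly_measurable M V (\<lambda>t. f t \<oplus>\<^bsub>V\<^esub> g t)"
    unfolding strongly_measurable_def by (intro exI[of _ "\<lambda>n t. s n t \<oplus>\<^bsub>V\<^esub> r n t"]) auto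
  moreover have "(\<integral>\<^sup>+ t. ennreal (nrm V (f t \<oplus>\<^bsub>V\<^esub> g t)) \<partial>M) < \<infinity>"
    using nn_integral_norm_add[OF f g] L1_functionsD(3)[OF f] L1_functionsD(3)[OF g]
    by (auto simp: less_top[symmetric] top_unique)
  ultimately show ?thesis using fc gc ls_L1 by (auto simp: L1_functions_def)
qed

lemma nn_integral_norm_map:
  assumes f: "f \<in> L1_functions M V" and K: "0 \<le> K"
    and le: "\<And>x. x \<in> carrier V \<Longrightarrow> nrm W (b x) \<le> K * nrm V x"
  shows "(\<integral>\<^sup>+ t. ennreal (nrm W (b (f t))) \<partial>M) \<le> ennreal K * (\<integral>\<^sup>+ t. ennreal (nrm V (f t)) \<partial>M)"
proof -
  obtain h where h [measurable]: "h \<in> borel_measurable M" and h': "\<And>t. 0 \<le> (h t :: real)" "AE t in M. nrm V (f t) = h t"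
    "(\<integral>\<^sup>+ t. ennreal (h t) \<partial>M) = (\<integral>\<^sup>+ t. ennreal (nrm V (f t)) \<partial>M)"
    using L1_norm_measurable[OF f] by blast
  have "(\<integral>\<^sup>+ t. ennreal (nrm W (b (f t))) \<partial>M) \<le> (\<integral>\<^sup>+ t. ennreal K * ennreal (h t) \<partial>M)"
  proof (rule nn_integral_mono_AE)
    show "AE t in M. ennreal (nrm W (b (f t))) \<le> ennreal K * ennreal (h t)"
      using h'(2) AE_space
    proof eventually_elim
      case (elim t)
      then have "nrm W (b (f t)) \<le> K * h t" using le[OF L1_functionsD(1)[OF f]] by metis
      then show ?case using K h'(1) by (simp add: ennreal_mult[symmetric] ennreal_leI)
    qed
  qed
  also have "\<dots> = ennreal K * (\<integral>\<^sup>+ t. ennreal (h t) \<partial>M)"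
    by (rule nn_integral_cmult) simp
  finally show ?thesis using h'(3) by simp
qed

text \<open>Composing the approximating simple functions with \<open>b\<close> gives simple
  functions again, and the bound on \<open>b\<close> preserves their convergence almost
  everywhere.\<close>

lemma L1_functions_map:
  assumes f: "f \<in> L1_functions M V" and W: "seminormed W" and b: "linear_op V W b" and K: "0 \<le> K"
    and le: "\<And>x. x \<in> carrier V \<Longrightarrow> nrm W (b x) \<le> K * nrm V x"
  shows "(\<lambda>t. b (f t)) \<in> L1_functions M W"
proof -
  obtain s where s: "\<And>n. simple_function M (s n)" "\<And>n. s n \<in> space M \<rightarrow> carrier V"
    and lims: "AE t in M. (\<lambda>n. nrm V (s n t \<ominus>\<^bsub>V\<^esub> f t)) \<longlonglongrightarrow> 0"
    using L1_functionsD(2)[OF f] unfolding strongly_measurable_def by blast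
  note fc = L1_functionsD(1)[OF f] and bc = linear_opD(1)[OF b]
  have "AE t in M. (\<lambda>n. nrm W (b (s n t) \<ominus>\<^bsub>W\<^esub> b (f t))) \<longlonglongrightarrow> 0"
    using lims AE_space
  proof eventually_elim
    case (elim t)
    then show ?case
      using tends_in_map[OF V W b le, of "\<lambda>n. s n t" "f t"] s(2) fc
      by (auto simp: tends_in_def Pi_iff)
  qed
  moreover have "simple_function M (\<lambda>t. b (s n t))" for n
    by (rule simple_function_compose1[OF s(1)])
  ultimately have "strongly_measurable M W (\<lambda>t. b (f t))"
    unfolding strongly_measurable_def using s(2) bc by (intro exI[of _ "\<lambda>n t. b (s n t)"]) (auto simp: Pi_iff)
  moreover have "(\<integral>\<^sup>+ t. ennreal (nrm W (b (f t))) \<partial>M) < \<infinity>"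
    using nn_integral_norm_map[OF f K le] L1_functionsD(3)[OF f]
    by (auto simp: ennreal_mult_less_top intro: order.strict_trans1)
  ultimately show ?thesis using fc bc by (auto simp: L1_functions_def)
qed

lemma linear_op_scale: "linear_op V V (\<lambda>x. c \<odot>\<^bsub>V\<^esub> x)"
  by (rule linear_op_smult) (use ls_L1 in \<open>auto simp: linear_op_def\<close>)

lemma L1_functions_smult: "f \<in> L1_functions M V \<Longrightarrow> (\<lambda>t. c \<odot>\<^bsub>V\<^esub> f t) \<in> L1_functions M V"
  by (rule L1_functions_map[OF _ V linear_op_scale, of _ "cmod c"]) (simp_all add: sn_smult[OF V])

lemma L1_functions_simple:
  assumes "simple_function M s" "s \<in> space M \<rightarrow> carrier V" "emeasure M {t\<in>space M. s t \<noteq> \<zero>\<^bsub>V\<^esub>} < \<infinity>"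
  shows "s \<in> L1_functions M V"
proof -
  have "strongly_measurable M V s"
    unfolding strongly_measurable_def
    by (rule exI[of _ "\<lambda>_. s"]) (use assms ls_L1 sn_minus_self[OF V] in \<open>auto simp: Pi_iff intro!: AE_I2\<close>)
  moreover have "(\<integral>\<^sup>+ t. ennreal (nrm V (s t)) \<partial>M) < \<infinity>"
  proof -
    let ?A = "{t\<in>space M. s t \<noteq> \<zero>\<^bsub>V\<^esub>}"
    have A: "?A \<in> sets M"
    proof -
      have "?A = s -` (- {\<zero>\<^bsub>V\<^esub>}) \<inter> space M" by auto
      then show ?thesis using simple_functionD(2)[OF assms(1)] by simp
    qed
    \<comment> \<open>A simple function has finitely many norms; the inserted 0 keeps the maximum
      meaningful when the measure space is empty.\<close>
    define B where "B = Max (insert 0 ((\<lambda>t. nrm V (s t)) ` space M))"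
    have fin: "finite (insert 0 ((\<lambda>t. nrm V (s t)) ` space M))"
      using finite_imageI[OF simple_functionD(1)[OF assms(1)], of "nrm V"] by (simp add: image_image)
    have B: "nrm V (s t) \<le> B" if "t \<in> space M" for t
      unfolding B_def using fin that by (intro Max_ge) auto
    have "(\<integral>\<^sup>+ t. ennreal (nrm V (s t)) \<partial>M) \<le> (\<integral>\<^sup>+ t. ennreal B * indicator ?A t \<partial>M)"
      by (rule nn_integral_mono) (use B V in \<open>auto simp: indicator_def sn_zero[OF V] intro!: ennreal_leI\<close>)
    also have "\<dots> = ennreal B * emeasure M ?A" by (rule nn_integral_cmult_indicator[OF A])
    also have "\<dots> < \<infinity>" using assms(3) by (simp add: ennreal_mult_less_top)
    finally show ?thesis .
  qed
  ultimately show ?thesis using assms by (auto simp: L1_functions_def)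
qed

lemma L1_functions_indicator:
  assumes "A \<in> sets M" "emeasure M A < \<infinity>" "v \<in> carrier V"
  shows "(\<lambda>t. if t \<in> A then v else \<zero>\<^bsub>V\<^esub>) \<in> L1_functions M V"
proof (rule L1_functions_simple)
  show "simple_function M (\<lambda>t. if t \<in> A then v else \<zero>\<^bsub>V\<^esub>)"
    using assms by (intro simple_function_restrict) auto
  have "emeasure M {t \<in> space M. (if t \<in> A then v else \<zero>\<^bsub>V\<^esub>) \<noteq> \<zero>\<^bsub>V\<^esub>} \<le> emeasure M A"
    using assms(1) by (intro emeasure_mono) (auto split: if_splits)
  then show "emeasure M {t \<in> space M. (if t \<in> A then v else \<zero>\<^bsub>V\<^esub>) \<noteq> \<zero>\<^bsub>V\<^esub>} < \<infinity>"
    using assms(2) by (rule order.strict_trans1)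
qed (use assms ls_L1 in auto)

lemma L1_functions_zero: "(\<lambda>_. \<zero>\<^bsub>V\<^esub>) \<in> L1_functions M V"
  using ls_L1 by (intro L1_functions_simple) auto

lemma L1_class_eqI:
  assumes "f \<in> L1_functions M V" "g \<in> L1_functions M V" "AE t in M. f t = g t"
  shows "L1_class M V f = L1_class M V g"
proof -
  have "(AE t in M. k t = f t) \<longleftrightarrow> (AE t in M. k t = g t)" for k
    using assms(3) by (auto elim: AE_mp)
  then show ?thesis by (simp add: L1_class_def)
qed

lemma L1_class_refl: "f \<in> L1_functions M V \<Longrightarrow> f \<in> L1_class M V f"
  by (simp add: L1_class_def)

lemma quotient_L1:
  "quotient_lspace (L1_functions M V) (L1_class M V) (\<lambda>f g t. f t \<oplus>\<^bsub>V\<^esub> g t) (\<lambda>c f t. c \<odot>\<^bsub>V\<^esub> f t)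
     (\<lambda>_. \<zero>\<^bsub>V\<^esub>) (L1_normed M V)"
proof
  show "g \<in> L1_functions M V \<and> L1_class M V g = L1_class M V f"
    if "f \<in> L1_functions M V" "g \<in> L1_class M V f" for f g
    using that L1_class_eqI[of g f] by (auto simp: L1_class_def)
  show "L1_class M V (\<lambda>t. f' t \<oplus>\<^bsub>V\<^esub> g' t) = L1_class M V (\<lambda>t. f t \<oplus>\<^bsub>V\<^esub> g t)"
    if "f \<in> L1_functions M V" "g \<in> L1_functions M V" "f' \<in> L1_class M V f" "g' \<in> L1_class M V g" for f g f' g'
  proof (rule L1_class_eqI)
    show "AE t in M. f' t \<oplus>\<^bsub>V\<^esub> g' t = f t \<oplus>\<^bsub>V\<^esub> g t"
      using that(3,4) unfolding L1_class_def by (auto elim: AE_mp)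
  qed (use that in \<open>auto simp: L1_class_def intro!: L1_functions_add\<close>)
  show "L1_class M V (\<lambda>t. c \<odot>\<^bsub>V\<^esub> f' t) = L1_class M V (\<lambda>t. c \<odot>\<^bsub>V\<^esub> f t)"
    if "f \<in> L1_functions M V" "f' \<in> L1_class M V f" for c f f'
    using that by (intro L1_class_eqI L1_functions_smult) (auto simp: L1_class_def)
  fix f g k c d assume f: "f \<in> L1_functions M V"
  note fc = L1_functionsD(1)[OF f]
  note [intro] = L1_functions_add L1_functions_smult L1_functions_zero
  show "L1_class M V (\<lambda>t. \<zero>\<^bsub>V\<^esub> \<oplus>\<^bsub>V\<^esub> f t) = L1_class M V f"
    using f fc ls_L1 by (intro L1_class_eqI) auto
  show "L1_class M V (\<lambda>t. (c + d) \<odot>\<^bsub>V\<^esub> f t) = L1_class M V (\<lambda>t. c \<odot>\<^bsub>V\<^esub> f t \<oplus>\<^bsub>V\<^esub> d \<odot>\<^bsub>V\<^esub> f t)"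
    using f fc ls_L1 by (intro L1_class_eqI) (auto simp: ls_distrib_left)
  show "L1_class M V (\<lambda>t. (c * d) \<odot>\<^bsub>V\<^esub> f t) = L1_class M V (\<lambda>t. c \<odot>\<^bsub>V\<^esub> (d \<odot>\<^bsub>V\<^esub> f t))"
    using f fc ls_L1 by (intro L1_class_eqI) (auto simp: ls_smult_assoc)
  show "L1_class M V (\<lambda>t. 1 \<odot>\<^bsub>V\<^esub> f t) = L1_class M V f"
    using f fc ls_L1 by (intro L1_class_eqI) auto
  show "L1_class M V (\<lambda>t. 0 \<odot>\<^bsub>V\<^esub> f t) = L1_class M V (\<lambda>_. \<zero>\<^bsub>V\<^esub>)"
    using f fc ls_L1 by (intro L1_class_eqI) auto
  assume g: "g \<in> L1_functions M V"
  note gc = L1_functionsD(1)[OF g]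
  show "L1_class M V (\<lambda>t. f t \<oplus>\<^bsub>V\<^esub> g t) = L1_class M V (\<lambda>t. g t \<oplus>\<^bsub>V\<^esub> f t)"
    using f fc g gc ls_L1 by (intro L1_class_eqI) (auto simp: ls_comm)
  show "L1_class M V (\<lambda>t. c \<odot>\<^bsub>V\<^esub> (f t \<oplus>\<^bsub>V\<^esub> g t)) = L1_class M V (\<lambda>t. c \<odot>\<^bsub>V\<^esub> f t \<oplus>\<^bsub>V\<^esub> c \<odot>\<^bsub>V\<^esub> g t)"
    using f fc g gc ls_L1 by (intro L1_class_eqI) (auto simp: ls_distrib_right)
  assume k: "k \<in> L1_functions M V"
  note kc = L1_functionsD(1)[OF k]
  show "L1_class M V (\<lambda>t. f t \<oplus>\<^bsub>V\<^esub> g t \<oplus>\<^bsub>V\<^esub> k t) = L1_class M V (\<lambda>t. f t \<oplus>\<^bsub>V\<^esub> (g t \<oplus>\<^bsub>V\<^esub> k t))"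
    using f fc g gc k kc ls_L1 by (intro L1_class_eqI) (auto simp: ls_assoc)
qed (auto simp: L1_normed_def L1_class_refl L1_functions_add L1_functions_smult L1_functions_zero)

interpretation L: quotient_lspace "L1_functions M V" "L1_class M V" "\<lambda>f g t. f t \<oplus>\<^bsub>V\<^esub> g t" "\<lambda>c f t. c \<odot>\<^bsub>V\<^esub> f t"
     "\<lambda>_. \<zero>\<^bsub>V\<^esub>" "L1_normed M V"
  by (rule quotient_L1)

lemmas linear_space_L1 = L.linear_space and L1_add = L.add_cls and L1_smult = L.smult_cls
  and L1_carrier = L.carrier_eq and L1_zero = L.zero_eq and L1_class_cong = L.cls_cong
  and L1_class_closed = L.cls_in_carrier and L1_UN = L.UN_cls and L1_minus = L.minus_cls

lemma nrm_L1_enn2real: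
  assumes f: "f \<in> L1_functions M V"
  shows "nrm (L1_normed M V) (L1_class M V f) = enn2real (\<integral>\<^sup>+ t. ennreal (nrm V (f t)) \<partial>M)"
proof -
  let ?N = "\<lambda>f. enn2real (\<integral>\<^sup>+ t. ennreal (nrm V (f t)) \<partial>M)"
  have "(\<integral>\<^sup>+ t. ennreal (nrm V (g t)) \<partial>M) = (\<integral>\<^sup>+ t. ennreal (nrm V (f t)) \<partial>M)" if "g \<in> L1_class M V f" for g
    using that unfolding L1_class_def by (intro nn_integral_cong_AE) auto
  then have "?N g = ?N f" if "g \<in> L1_class M V f" for g using that by metis
  then have "?N ` L1_class M V f = {?N f}"
    using L1_class_refl[OF f] by blast
  then show ?thesis by (simp add: L1_normed_def)
qed

lemma nrm_L1:
  assumes f: "f \<in> L1_functions M V"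
  shows "ennreal (nrm (L1_normed M V) (L1_class M V f)) = (\<integral>\<^sup>+ t. ennreal (nrm V (f t)) \<partial>M)"
  using L1_functionsD(3)[OF f] by (simp add: nrm_L1_enn2real[OF f] less_top)

lemma nrm_L1_nonneg: "f \<in> L1_functions M V \<Longrightarrow> 0 \<le> nrm (L1_normed M V) (L1_class M V f)"
  by (simp add: nrm_L1_enn2real)

lemma nrm_L1_le_iff:
  assumes f: "f \<in> L1_functions M V" and "0 \<le> r"
  shows "nrm (L1_normed M V) (L1_class M V f) \<le> r \<longleftrightarrow> (\<integral>\<^sup>+ t. ennreal (nrm V (f t)) \<partial>M) \<le> ennreal r"
  using assms by (simp flip: nrm_L1)

lemma seminormed_L1: "seminormed (L1_normed M V)"
  unfolding seminormed_def
proof (intro conjI ballI allI)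
  fix A assume "A \<in> carrier (L1_normed M V)"
  then obtain f where f: "f \<in> L1_functions M V" "A = L1_class M V f" using L1_carrier by auto
  note fc = L1_functionsD(1)[OF f(1)]
  show A0: "0 \<le> nrm (L1_normed M V) A" using nrm_L1_nonneg f by simp
  show "nrm (L1_normed M V) (c \<odot>\<^bsub>L1_normed M V\<^esub> A) = cmod c * nrm (L1_normed M V) A" for c
  proof -
    obtain h where h [measurable]: "h \<in> borel_measurable M" and h': "\<And>t. 0 \<le> (h t :: real)" "AE t in M. nrm V (f t) = h t"
      "(\<integral>\<^sup>+ t. ennreal (h t) \<partial>M) = (\<integral>\<^sup>+ t. ennreal (nrm V (f t)) \<partial>M)"
      using L1_norm_measurable[OF f(1)] by blast
    have "ennreal (nrm (L1_normed M V) (c \<odot>\<^bsub>L1_normed M V\<^esub> A)) = (\<integral>\<^sup>+ t. ennreal (nrm V (c \<odot>\<^bsub>V\<^esub> f t)) \<partial>M)"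
      using f by (simp add: L1_smult nrm_L1 L1_functions_smult)
    also have "\<dots> = (\<integral>\<^sup>+ t. ennreal (cmod c) * ennreal (h t) \<partial>M)"
    proof (rule nn_integral_cong_AE)
      show "AE t in M. ennreal (nrm V (c \<odot>\<^bsub>V\<^esub> f t)) = ennreal (cmod c) * ennreal (h t)"
        using h'(2) AE_space
        by eventually_elim (use fc h'(1) in \<open>simp add: sn_smult[OF V] ennreal_mult\<close>)
    qed
    also have "\<dots> = ennreal (cmod c) * ennreal (nrm (L1_normed M V) A)"
      using h'(3) f by (simp add: nn_integral_cmult nrm_L1)
    also have "\<dots> = ennreal (cmod c * nrm (L1_normed M V) A)"
      using A0 by (simp add: ennreal_mult)
    finally show ?thesis
      using A0 nrm_L1_nonneg[OF L1_functions_smult[OF f(1)]] f by (simp add: L1_smult)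
  qed
  fix B assume "B \<in> carrier (L1_normed M V)"
  then obtain g where g: "g \<in> L1_functions M V" "B = L1_class M V g" using L1_carrier by auto
  have B0: "0 \<le> nrm (L1_normed M V) B" using nrm_L1_nonneg g by simp
  show "nrm (L1_normed M V) (A \<oplus>\<^bsub>L1_normed M V\<^esub> B) \<le> nrm (L1_normed M V) A + nrm (L1_normed M V) B"
    using nn_integral_norm_add[OF f(1) g(1)] A0 B0 f g
    by (simp add: L1_add nrm_L1_le_iff L1_functions_add ennreal_plus flip: nrm_L1)
qed (rule linear_space_L1)

lemma nrm_L1_indicator:
  assumes "A \<in> sets M" "emeasure M A < \<infinity>" "v \<in> carrier V"
  shows "nrm (L1_normed M V) (L1_class M V (\<lambda>t. if t \<in> A then v else \<zero>\<^bsub>V\<^esub>)) = measure M A * nrm V v"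
proof -
  note f = L1_functions_indicator[OF assms]
  have "ennreal (nrm (L1_normed M V) (L1_class M V (\<lambda>t. if t \<in> A then v else \<zero>\<^bsub>V\<^esub>))) =
      (\<integral>\<^sup>+ t. ennreal (nrm V v) * indicator A t \<partial>M)"
    unfolding nrm_L1[OF f] by (rule nn_integral_cong) (auto simp: sn_zero[OF V])
  also have "\<dots> = ennreal (nrm V v) * emeasure M A"
    by (rule nn_integral_cmult_indicator[OF assms(1)])
  also have "\<dots> = ennreal (measure M A * nrm V v)"
    using assms sn_nonneg[OF V assms(3)] by (simp add: emeasure_eq_ennreal_measure ennreal_mult mult.commute less_top)
  finally show ?thesis
    using nrm_L1_nonneg[OF f] sn_nonneg[OF V assms(3)] by simp
qed

end

text \<open>Composition with \<open>b\<close> on classes of functions. The body has the form of the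
  union that defines the norm of \<open>L1_space\<close>, so that this norm can be rewritten in
  terms of \<open>L1_map\<close>.\<close>

definition L1_map where
  "L1_map M W b A = (\<Union>f\<in>A. L1_class M W (\<lambda>t. b (f t)))"

lemma L1_map_class:
  assumes V: "seminormed V" and W: "seminormed W" and b: "linear_op V W b" and K: "0 \<le> K"
    and le: "\<And>x. x \<in> carrier V \<Longrightarrow> nrm W (b x) \<le> K * nrm V x" and f: "f \<in> L1_functions M V"
  shows "L1_map M W b (L1_class M V f) = L1_class M W (\<lambda>t. b (f t))"
  unfolding L1_map_def
proof (rule L1_UN[OF V f])
  fix g assume "g \<in> L1_class M V f"
  then show "L1_class M W (\<lambda>t. b (g t)) = L1_class M W (\<lambda>t. b (f t))"
    using f by (intro L1_class_eqI[OF W] L1_functions_map[OF V _ W b K le]) (auto simp: L1_class_def)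
qed

lemma L1_map_linear:
  assumes V: "seminormed V" and W: "seminormed W" and b: "linear_op V W b" and K: "0 \<le> K"
    and le: "\<And>x. x \<in> carrier V \<Longrightarrow> nrm W (b x) \<le> K * nrm V x"
  shows "linear_op (L1_normed M V) (L1_normed M W) (L1_map M W b)"
proof (rule linear_opI)
  note [simp] = L1_map_class[OF V W b K le]
  note map = L1_functions_map[OF V _ W b K le]
  fix A assume "A \<in> carrier (L1_normed M V)"
  then obtain f where f: "f \<in> L1_functions M V" "A = L1_class M V f" by (auto simp: L1_carrier[OF V])
  show "L1_map M W b A \<in> carrier (L1_normed M W)"
    using f map[OF f(1)] L1_class_closed[OF W] by simp
  show "L1_map M W b (c \<odot>\<^bsub>L1_normed M V\<^esub> A) = c \<odot>\<^bsub>L1_normed M W\<^esub> L1_map M W b A" for c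
  proof -
    have "L1_class M W (\<lambda>t. b (c \<odot>\<^bsub>V\<^esub> f t)) = L1_class M W (\<lambda>t. c \<odot>\<^bsub>W\<^esub> b (f t))"
      using f(1) L1_functionsD(1)[OF f(1)]
      by (intro L1_class_eqI[OF W] map L1_functions_smult[OF V] L1_functions_smult[OF W])
        (auto simp: linear_opD[OF b])
    then show ?thesis
      using f map[OF f(1)] L1_functions_smult[OF V f(1), of c] by (simp add: L1_smult[OF V] L1_smult[OF W])
  qed
  fix B assume "B \<in> carrier (L1_normed M V)"
  then obtain g where g: "g \<in> L1_functions M V" "B = L1_class M V g" by (auto simp: L1_carrier[OF V])
  have "L1_class M W (\<lambda>t. b (f t \<oplus>\<^bsub>V\<^esub> g t)) = L1_class M W (\<lambda>t. b (f t) \<oplus>\<^bsub>W\<^esub> b (g t))"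
    using f(1) g(1) L1_functionsD(1)[OF f(1)] L1_functionsD(1)[OF g(1)]
    by (intro L1_class_eqI[OF W] map L1_functions_add[OF V] L1_functions_add[OF W])
      (auto simp: linear_opD[OF b])
  then show "L1_map M W b (A \<oplus>\<^bsub>L1_normed M V\<^esub> B) = L1_map M W b A \<oplus>\<^bsub>L1_normed M W\<^esub> L1_map M W b B"
    using f map[OF f(1)] g map[OF g(1)] L1_functions_add[OF V f(1) g(1)]
    by (simp add: L1_add[OF V] L1_add[OF W])
qed

lemma L1_map_norm:
  assumes V: "seminormed V" and W: "seminormed W" and b: "linear_op V W b" and K: "0 \<le> K"
    and le: "\<And>x. x \<in> carrier V \<Longrightarrow> nrm W (b x) \<le> K * nrm V x" and A: "A \<in> carrier (L1_normed M V)"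
  shows "nrm (L1_normed M W) (L1_map M W b A) \<le> K * nrm (L1_normed M V) A"
proof -
  obtain f where f: "f \<in> L1_functions M V" "A = L1_class M V f" using A by (auto simp: L1_carrier[OF V])
  note A0 = nrm_L1_nonneg[OF V f(1)]
  show ?thesis
    using nn_integral_norm_map[OF V f(1) K le] L1_functions_map[OF V f(1) W b K le] K A0 f
    by (simp add: L1_map_class[OF V W b K le] nrm_L1_le_iff[OF W] ennreal_mult flip: nrm_L1[OF V])
qed

section \<open>Density of simple functions\<close>

context
  fixes M :: "'x measure" and V :: "'a normed_lspace"
  assumes V: "seminormed V"
begin

private lemma ls_approx: "linear_space V" by (rule sn_linear_space[OF V])

lemma L1_functions_minus:
  assumes "f \<in> L1_functions M V" "g \<in> L1_functions M V"
  shows "(\<lambda>t. f t \<ominus>\<^bsub>V\<^esub> g t) \<in> L1_functions M V"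
proof -
  have "(\<lambda>t. f t \<oplus>\<^bsub>V\<^esub> (-1) \<odot>\<^bsub>V\<^esub> g t) \<in> L1_functions M V"
    by (rule L1_functions_add[OF V assms(1) L1_functions_smult[OF V assms(2)]])
  \<comment> \<open>The two expressions need to agree only on \<open>space M\<close>, where the
    values of \<open>g\<close> are known to lie in the carrier.\<close>
  moreover have "f t \<oplus>\<^bsub>V\<^esub> (-1) \<odot>\<^bsub>V\<^esub> g t = f t \<ominus>\<^bsub>V\<^esub> g t" if "t \<in> space M" for t
    using L1_functionsD(1)[OF assms(2) that] by (simp add: ls_minus[OF ls_approx])
  ultimately show ?thesis
    unfolding L1_functions_def strongly_measurable_def
    by (auto simp: Pi_iff cong: nn_integral_cong AE_cong_simp)
qed

lemma L1_dist:
  assumes "f \<in> L1_functions M V" "g \<in> L1_functions M V"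
  shows "ennreal (nrm (L1_normed M V) (L1_class M V f \<ominus>\<^bsub>L1_normed M V\<^esub> L1_class M V g)) =
    (\<integral>\<^sup>+ t. ennreal (nrm V (f t \<ominus>\<^bsub>V\<^esub> g t)) \<partial>M)"
  unfolding L1_minus[OF V assms]
  by (subst nrm_L1[OF V L1_functions_add[OF V assms(1) L1_functions_smult[OF V assms(2)]]])
    (use L1_functionsD(1)[OF assms(2)] in \<open>auto simp: ls_minus[OF ls_approx] intro!: nn_integral_cong\<close>)

lemma L1_dist_nonneg:
  assumes "f \<in> L1_functions M V" "g \<in> L1_functions M V"
  shows "0 \<le> nrm (L1_normed M V) (L1_class M V f \<ominus>\<^bsub>L1_normed M V\<^esub> L1_class M V g)"
  by (intro sn_nonneg[OF seminormed_L1[OF V]] ls_closed(4)[OF linear_space_L1[OF V]] L1_class_closed[OF V] assms)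

text \<open>The simple functions given by strong measurability converge almost everywhere, but
  without a dominating function and without supports of finite measure. Truncation provides both:
  \<open>s n\<close> is kept only where its norm is positive and at most twice the norm
  \<open>h\<close> of \<open>f\<close>. Convergence survives. Where \<open>h\<close> is 0, the
  truncated function vanishes and so does the norm of \<open>f\<close>; where \<open>h\<close> is
  positive, the norm of \<open>s n\<close> eventually lies between \<open>h / 2\<close> and
  \<open>2 * h\<close>.\<close>

lemma L1_approx:
  assumes f: "f \<in> L1_functions M V" and e: "(e::real) > 0"
  obtains s where "simple_function M s" "s \<in> space M \<rightarrow> carrier V"
    "emeasure M {t\<in>space M. s t \<noteq> \<zero>\<^bsub>V\<^esub>} < \<infinity>"
    "nrm (L1_normed M V) (L1_class M V f \<ominus>\<^bsub>L1_normed M V\<^esub> L1_class M V s) < e"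
proof -
  obtain s where s: "\<And>n. simple_function M (s n)" "\<And>n. s n \<in> space M \<rightarrow> carrier V"
    and lim: "AE t in M. (\<lambda>n. nrm V (s n t \<ominus>\<^bsub>V\<^esub> f t)) \<longlonglongrightarrow> 0"
    using L1_functionsD(2)[OF f] unfolding strongly_measurable_def by blast
  note fc = L1_functionsD(1)[OF f]
  have sc: "s n t \<in> carrier V" if "t \<in> space M" for n t using s(2) that by auto
  have m [measurable]: "(\<lambda>t. nrm V (s n t)) \<in> borel_measurable M" for n
    by (intro borel_measurable_simple_function simple_function_compose1[OF s(1)])
  obtain h where h [measurable]: "h \<in> borel_measurable M" and h0: "\<And>t. 0 \<le> (h t :: real)"
    and hf: "AE t in M. nrm V (f t) = h t"
    and hN: "(\<integral>\<^sup>+ t. ennreal (h t) \<partial>M) = (\<integral>\<^sup>+ t. ennreal (nrm V (f t)) \<partial>M)"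
    using L1_norm_measurable[OF V f] by blast
  have hfin: "(\<integral>\<^sup>+ t. ennreal (h t) \<partial>M) < \<infinity>" using hN L1_functionsD(3)[OF f] by simp
  define E where "E n = {t\<in>space M. nrm V (s n t) \<le> 2 * h t \<and> nrm V (s n t) > 0}" for n
  have E: "E n \<in> sets M" for n unfolding E_def by measurable
  define r where "r n = (\<lambda>t. if t \<in> E n then s n t else \<zero>\<^bsub>V\<^esub>)" for n
  have r1: "simple_function M (r n)" for n unfolding r_def by (rule simple_function_restrict[OF s(1) E])
  have r2: "r n \<in> space M \<rightarrow> carrier V" for n using sc ls_approx by (auto simp: r_def)
  have r3: "emeasure M {t\<in>space M. r n t \<noteq> \<zero>\<^bsub>V\<^esub>} < \<infinity>" for n
  proof -
    let ?R = "{x \<in> (\<lambda>t. nrm V (s n t)) ` space M. x > 0}"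
    have fin: "finite ?R"
      using finite_imageI[OF simple_functionD(1)[OF s(1)[of n]], of "nrm V"] by (simp add: image_image)
    \<comment> \<open>The least positive norm among the finitely many values of \<open>s n\<close>.
      On the support of \<open>r n\<close> it is at most \<open>2 * h\<close>, so Markov's
      inequality bounds the measure of the support. The inserted 1 covers the case that no value has
      positive norm.\<close>
    define c where "c = Min (insert 1 ?R)"
    have c0: "c > 0" unfolding c_def using fin by (subst Min_gr_iff) auto
    have "{t\<in>space M. r n t \<noteq> \<zero>\<^bsub>V\<^esub>} \<subseteq> {t\<in>space M. 1 \<le> ennreal (2 / c) * ennreal (h t)}"
    proof safe
      fix t assume t: "t \<in> space M" "r n t \<noteq> \<zero>\<^bsub>V\<^esub>"
      then have "nrm V (s n t) \<le> 2 * h t" "nrm V (s n t) > 0" by (auto simp: r_def E_def split: if_splits)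
      moreover from this have "c \<le> nrm V (s n t)" unfolding c_def using fin t(1) by (intro Min_le) auto
      ultimately have "1 \<le> 2 / c * h t" using c0 by (simp add: field_simps)
      then show "1 \<le> ennreal (2 / c) * ennreal (h t)"
        using c0 h0 by (simp add: ennreal_mult[symmetric])
    qed
    then have "emeasure M {t\<in>space M. r n t \<noteq> \<zero>\<^bsub>V\<^esub>} \<le> emeasure M {t\<in>space M. 1 \<le> ennreal (2 / c) * ennreal (h t)}"
      by (rule emeasure_mono) measurable
    also have "\<dots> \<le> ennreal (2 / c) * (\<integral>\<^sup>+ t. ennreal (h t) * indicator (space M) t \<partial>M)"
      by (rule nn_integral_Markov_inequality) auto
    also have "(\<integral>\<^sup>+ t. ennreal (h t) * indicator (space M) t \<partial>M) = (\<integral>\<^sup>+ t. ennreal (h t) \<partial>M)"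
      by (rule nn_integral_cong) simp
    also have "ennreal (2 / c) * (\<integral>\<^sup>+ t. ennreal (h t) \<partial>M) < \<infinity>"
      using hfin by (simp add: ennreal_mult_less_top)
    finally show ?thesis .
  qed
  note rL = L1_functions_simple[OF V r1 r2 r3]
  have "\<exists>k. \<forall>n. k n \<in> borel_measurable M \<and> (\<forall>t. 0 \<le> (k n t :: real)) \<and> (AE t in M. nrm V (f t \<ominus>\<^bsub>V\<^esub> r n t) = k n t)"
  proof (rule choice, rule allI)
    fix n
    show "\<exists>k. k \<in> borel_measurable M \<and> (\<forall>t. 0 \<le> (k t :: real)) \<and> (AE t in M. nrm V (f t \<ominus>\<^bsub>V\<^esub> r n t) = k t)"
      using L1_norm_measurable[OF V L1_functions_minus[OF f rL[of n]]] by metis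
  qed
  then obtain k where k [measurable]: "\<And>n. k n \<in> borel_measurable M" and k0: "\<And>n t. 0 \<le> (k n t :: real)"
    and kr: "\<And>n. AE t in M. nrm V (f t \<ominus>\<^bsub>V\<^esub> r n t) = k n t" by blast
  have kr_all: "AE t in M. \<forall>n. nrm V (f t \<ominus>\<^bsub>V\<^esub> r n t) = k n t"
    using kr by (simp add: AE_all_countable)
  \<comment> \<open>The factor 3 collects \<open>h\<close> for the norm of \<open>f\<close> and
    \<open>2 * h\<close> for the truncated function.\<close>
  have bound: "AE t in M. ennreal (k n t) \<le> ennreal (3 * h t)" for n
    using kr[of n] hf AE_space
  proof eventually_elim
    case (elim t)
    have "nrm V (r n t) \<le> 2 * h t" using h0[of t] by (auto simp: r_def E_def sn_zero[OF V])
    moreover have "nrm V (f t \<ominus>\<^bsub>V\<^esub> r n t) \<le> nrm V (f t) + nrm V (r n t)"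
      using elim fc r2 by (intro sn_dist_le[OF V]) auto
    ultimately show ?case using elim by (intro ennreal_leI) simp
  qed
  have conv: "AE t in M. (\<lambda>n. ennreal (k n t)) \<longlonglongrightarrow> 0"
    using kr_all hf lim AE_space
  proof eventually_elim
    case (elim t)
    note t = elim(4)
    have "(\<lambda>n. nrm V (f t \<ominus>\<^bsub>V\<^esub> r n t)) \<longlonglongrightarrow> 0"
    proof (cases "h t = 0")
      case True
      then have "r n t = \<zero>\<^bsub>V\<^esub>" for n by (auto simp: r_def E_def)
      then show ?thesis using True elim fc ls_approx by (simp add: ls_minus)
    next
      case False
      then have pos: "h t > 0" using h0[of t] by simp
      have "tends_in V (\<lambda>n. s n t) (f t)" using elim by (simp add: tends_in_def)
      then have "(\<lambda>n. nrm V (s n t)) \<longlonglongrightarrow> h t"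
        using tends_in_norm[OF V, of "\<lambda>n. s n t" "f t"] sc fc t elim(2) by simp
      then have "\<forall>\<^sub>F n in sequentially. h t / 2 < nrm V (s n t)" "\<forall>\<^sub>F n in sequentially. nrm V (s n t) < 2 * h t"
        using pos by (auto intro: order_tendstoD simp del: divide_less_eq_numeral1)
      then have ev: "\<forall>\<^sub>F n in sequentially. nrm V (s n t \<ominus>\<^bsub>V\<^esub> f t) = nrm V (f t \<ominus>\<^bsub>V\<^esub> r n t)"
      proof eventually_elim
        case (elim n)
        then have "t \<in> E n" using t pos by (auto simp: E_def)
        then show ?case using sn_dist_commute[OF V sc[OF t] fc[OF t]] by (simp add: r_def)
      qed
      show ?thesis by (rule Lim_transform_eventually[OF elim(3) ev])
    qed
    then have "(\<lambda>n. k n t) \<longlonglongrightarrow> 0" using elim(1) by simp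
    then show ?case using tendsto_ennrealI by fastforce
  qed
  have "(\<lambda>n. (\<integral>\<^sup>+ t. ennreal (k n t) \<partial>M)) \<longlonglongrightarrow> (\<integral>\<^sup>+ t. 0 \<partial>M)"
  proof (rule nn_integral_dominated_convergence[OF _ _ _ bound])
    have "(\<integral>\<^sup>+ t. ennreal (3 * h t) \<partial>M) = ennreal 3 * (\<integral>\<^sup>+ t. ennreal (h t) \<partial>M)"
      using h0 by (simp add: ennreal_mult nn_integral_cmult)
    then show "(\<integral>\<^sup>+ t. ennreal (3 * h t) \<partial>M) < \<infinity>" using hfin by (simp add: ennreal_mult_less_top)
  qed (use conv in auto)
  then have "\<forall>\<^sub>F n in sequentially. (\<integral>\<^sup>+ t. ennreal (k n t) \<partial>M) < ennreal e"
    by (rule order_tendstoD) (use e in simp)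
  then obtain n where n: "(\<integral>\<^sup>+ t. ennreal (k n t) \<partial>M) < ennreal e" by (auto simp: eventually_sequentially)
  have "(\<integral>\<^sup>+ t. ennreal (nrm V (f t \<ominus>\<^bsub>V\<^esub> r n t)) \<partial>M) = (\<integral>\<^sup>+ t. ennreal (k n t) \<partial>M)"
    by (rule nn_integral_cong_AE) (use kr[of n] in auto)
  then have "nrm (L1_normed M V) (L1_class M V f \<ominus>\<^bsub>L1_normed M V\<^esub> L1_class M V (r n)) < e"
    using n L1_dist[OF f rL[of n]] ennreal_less_iff[OF L1_dist_nonneg[OF f rL[of n]], of e] by simp
  then show ?thesis using that r1 r2 r3 by blast
qed

text \<open>A simple function is the sum, over its finitely many nonzero values, of that value on
  the set where it is attained. Leaving out the value zero ensures that each of these sets has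
  finite measure.\<close>

lemma L1_simple_induct:
  assumes s: "simple_function M s" "s \<in> space M \<rightarrow> carrier V" "emeasure M {t\<in>space M. s t \<noteq> \<zero>\<^bsub>V\<^esub>} < \<infinity>"
    and ind: "\<And>A v. A \<in> sets M \<Longrightarrow> emeasure M A < \<infinity> \<Longrightarrow> v \<in> carrier V \<Longrightarrow>
      P (L1_class M V (\<lambda>t. if t \<in> A then v else \<zero>\<^bsub>V\<^esub>))"
    and add: "\<And>Y Z. Y \<in> carrier (L1_normed M V) \<Longrightarrow> Z \<in> carrier (L1_normed M V) \<Longrightarrow> P Y \<Longrightarrow> P Z \<Longrightarrow>
      P (Y \<oplus>\<^bsub>L1_normed M V\<^esub> Z)"
  shows "P (L1_class M V s)"
proof -
  let ?g = "\<lambda>R t. if t \<in> s -` R \<inter> space M then s t else \<zero>\<^bsub>V\<^esub>"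
  have meas: "s -` R \<inter> space M \<in> sets M" for R by (rule simple_functionD(2)[OF s(1)])
  have gL: "?g R \<in> L1_functions M V" for R
  proof (rule L1_functions_simple[OF V simple_function_restrict[OF s(1) meas]])
    have eq: "{t \<in> space M. s t \<noteq> \<zero>\<^bsub>V\<^esub>} = s -` (- {\<zero>\<^bsub>V\<^esub>}) \<inter> space M" by auto
    have "emeasure M {t \<in> space M. ?g R t \<noteq> \<zero>\<^bsub>V\<^esub>} \<le> emeasure M {t \<in> space M. s t \<noteq> \<zero>\<^bsub>V\<^esub>}"
      unfolding eq by (rule emeasure_mono[OF _ meas]) auto
    then show "emeasure M {t \<in> space M. ?g R t \<noteq> \<zero>\<^bsub>V\<^esub>} < \<infinity>" using s(3) by (rule order.strict_trans1)
  qed (use s(2) ls_approx in auto)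
  have "P (L1_class M V (?g R))" if "finite R" "R \<subseteq> s ` space M - {\<zero>\<^bsub>V\<^esub>}" for R
    using that
  proof (induction R)
    case empty
    \<comment> \<open>The zero function is an instance of the indicator case, with the empty
      set.\<close>
    then show ?case using ind[of "{}" "\<zero>\<^bsub>V\<^esub>"] ls_approx by simp
  next
    case (insert v R)
    let ?A = "s -` {v} \<inter> space M"
    have v: "v \<in> carrier V" "v \<noteq> \<zero>\<^bsub>V\<^esub>" using insert(4) s(2) by auto
    have "emeasure M ?A \<le> emeasure M (s -` (- {\<zero>\<^bsub>V\<^esub>}) \<inter> space M)"
      by (rule emeasure_mono[OF _ meas]) (use v in auto)
    also have "s -` (- {\<zero>\<^bsub>V\<^esub>}) \<inter> space M = {t\<in>space M. s t \<noteq> \<zero>\<^bsub>V\<^esub>}" by auto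
    finally have fin: "emeasure M ?A < \<infinity>" using s(3) by (rule order.strict_trans1)
    have "L1_class M V (?g (insert v R)) =
        L1_class M V (\<lambda>t. (if t \<in> ?A then v else \<zero>\<^bsub>V\<^esub>) \<oplus>\<^bsub>V\<^esub> ?g R t)"
      by (rule L1_class_eqI[OF V gL L1_functions_add[OF V L1_functions_indicator[OF V meas fin v(1)] gL]])
        (use insert(2) s(2) v ls_approx in \<open>auto intro!: AE_I2 simp: Pi_iff\<close>)
    also have "\<dots> = L1_class M V (\<lambda>t. if t \<in> ?A then v else \<zero>\<^bsub>V\<^esub>) \<oplus>\<^bsub>L1_normed M V\<^esub> L1_class M V (?g R)"
      by (rule L1_add[OF V L1_functions_indicator[OF V meas fin v(1)] gL, symmetric])
    finally have eq: "L1_class M V (?g (insert v R)) =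
      L1_class M V (\<lambda>t. if t \<in> ?A then v else \<zero>\<^bsub>V\<^esub>) \<oplus>\<^bsub>L1_normed M V\<^esub> L1_class M V (?g R)" .
    show ?case
      unfolding eq using insert.prems
      by (intro add ind insert.IH L1_class_closed[OF V] gL L1_functions_indicator[OF V] meas fin v) auto
  qed
  then have "P (L1_class M V (?g (s ` space M - {\<zero>\<^bsub>V\<^esub>})))"
    using simple_functionD(1)[OF s(1)] by blast
  moreover have "L1_class M V (?g (s ` space M - {\<zero>\<^bsub>V\<^esub>})) = L1_class M V s"
    by (rule L1_class_eqI[OF V gL L1_functions_simple[OF V s]]) (auto intro!: AE_I2)
  ultimately show ?thesis by simp
qed

text \<open>Packages density as an induction principle: sums of indicators reach all simple
  functions, and one use of the limit case reaches every class. It serves for the approximation of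
  tensors and for the density of their image.\<close>

lemma L1_induct [consumes 2, case_names indicator add limit]:
  assumes Z: "Z \<in> carrier (L1_normed M V)"
    and ind: "\<And>A v. A \<in> sets M \<Longrightarrow> emeasure M A < \<infinity> \<Longrightarrow> v \<in> carrier V \<Longrightarrow>
      P (L1_class M V (\<lambda>t. if t \<in> A then v else \<zero>\<^bsub>V\<^esub>))"
    and add: "\<And>Y Z. Y \<in> carrier (L1_normed M V) \<Longrightarrow> Z \<in> carrier (L1_normed M V) \<Longrightarrow> P Y \<Longrightarrow> P Z \<Longrightarrow>
      P (Y \<oplus>\<^bsub>L1_normed M V\<^esub> Z)"
    and limit: "\<And>Z. Z \<in> carrier (L1_normed M V) \<Longrightarrow>
      (\<And>e. e > 0 \<Longrightarrow> \<exists>Y\<in>carrier (L1_normed M V). P Y \<and> nrm (L1_normed M V) (Z \<ominus>\<^bsub>L1_normed M V\<^esub> Y) < e) \<Longrightarrow> P Z"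
  shows "P Z"
proof (rule limit[OF Z])
  fix e :: real assume e: "e > 0"
  obtain f where f: "f \<in> L1_functions M V" "Z = L1_class M V f" using Z by (auto simp: L1_carrier[OF V])
  obtain s where s: "simple_function M s" "s \<in> space M \<rightarrow> carrier V"
    "emeasure M {t\<in>space M. s t \<noteq> \<zero>\<^bsub>V\<^esub>} < \<infinity>"
    "nrm (L1_normed M V) (L1_class M V f \<ominus>\<^bsub>L1_normed M V\<^esub> L1_class M V s) < e"
    by (rule L1_approx[OF f(1) e])
  show "\<exists>Y\<in>carrier (L1_normed M V). P Y \<and> nrm (L1_normed M V) (Z \<ominus>\<^bsub>L1_normed M V\<^esub> Y) < e"
    using L1_simple_induct[OF s(1-3) ind add] s(4) f(2) L1_class_closed[OF V L1_functions_simple[OF V s(1-3)]] by blast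
qed

end

text \<open>A vanishing integral forces the measurable version of the norm to vanish almost
  everywhere, and definiteness in \<open>V\<close> then gives the zero class.\<close>

lemma normed_L1:
  assumes V: "normed_space V"
  shows "normed_space (L1_normed M V)"
proof -
  have Vs: "seminormed V" by (rule normed_seminormed[OF V])
  have "A = \<zero>\<^bsub>L1_normed M V\<^esub>" if A: "A \<in> carrier (L1_normed M V)" and 0: "nrm (L1_normed M V) A = 0" for A
  proof -
    obtain f where f: "f \<in> L1_functions M V" "A = L1_class M V f" using A by (auto simp: L1_carrier[OF Vs])
    obtain h where h: "h \<in> borel_measurable M" "\<And>t. 0 \<le> (h t :: real)" "AE t in M. nrm V (f t) = h t"
      "(\<integral>\<^sup>+ t. ennreal (h t) \<partial>M) = (\<integral>\<^sup>+ t. ennreal (nrm V (f t)) \<partial>M)"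
      using L1_norm_measurable[OF Vs f(1)] by blast
    have "(\<integral>\<^sup>+ t. ennreal (h t) \<partial>M) = 0"
      using nrm_L1[OF Vs f(1)] 0 f(2) h(4) by simp
    then have "AE t in M. ennreal (h t) = 0"
      using h(1) by (subst (asm) nn_integral_0_iff_AE) auto
    then have "AE t in M. f t = \<zero>\<^bsub>V\<^esub>"
      using h(3) AE_space
    proof eventually_elim
      case (elim t)
      then have "nrm V (f t) = 0" using h(2)[of t] by (simp add: ennreal_eq_0_iff)
      then show ?case using L1_functionsD(1)[OF f(1) elim(3)] V by (simp add: normed_space_def)
    qed
    then show ?thesis
      unfolding f(2) L1_zero[OF Vs] by (rule L1_class_eqI[OF Vs f(1) L1_functions_zero[OF Vs]])
  qed
  then show ?thesis
    using seminormed_L1[OF Vs, of M] sn_zero[OF seminormed_L1[OF Vs, of M]]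
    unfolding normed_space_def seminormed_def by blast
qed

subsection \<open>The theorem of Riesz and Fischer\<close>

context
  fixes V :: "'a normed_lspace"
  assumes V: "seminormed V"
begin

private lemma ls_series: "linear_space V" by (rule sn_linear_space[OF V])

lemma telescope_le:
  assumes "\<And>n. x n \<in> carrier V"
  shows "nrm V (x (m + k) \<ominus>\<^bsub>V\<^esub> x k) \<le> (\<Sum>j<m. nrm V (x (Suc (j + k)) \<ominus>\<^bsub>V\<^esub> x (j + k)))"
proof (induction m)
  case 0
  then show ?case using assms by (simp add: sn_minus_self[OF V])
next
  case (Suc m)
  then show ?case
    using sn_dist_triangle[OF V, of "x (Suc (m + k))" "x (m + k)" "x k"] assms by simp
qed

lemma summable_cauchy_seq:
  assumes x: "\<And>n. x n \<in> carrier V" and sum: "summable (\<lambda>n. nrm V (x (Suc n) \<ominus>\<^bsub>V\<^esub> x n))"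
  shows "x \<in> cauchy_seqs V"
  unfolding cauchy_seqs_def
proof (intro CollectI conjI allI impI x)
  fix e :: real assume "e > 0"
  then have e: "e / 2 > 0" by simp
  have nn: "0 \<le> nrm V (x (Suc n) \<ominus>\<^bsub>V\<^esub> x n)" for n using x ls_series V by simp
  obtain N where N: "\<And>n. n \<ge> N \<Longrightarrow> norm (suminf (\<lambda>i. nrm V (x (Suc (i + n)) \<ominus>\<^bsub>V\<^esub> x (i + n)))) < e / 2"
    using suminf_exist_split[OF e sum] by blast
  have *: "nrm V (x m \<ominus>\<^bsub>V\<^esub> x N) < e / 2" if "m \<ge> N" for m
  proof -
    have "nrm V (x ((m - N) + N) \<ominus>\<^bsub>V\<^esub> x N) \<le> (\<Sum>j<m - N. nrm V (x (Suc (j + N)) \<ominus>\<^bsub>V\<^esub> x (j + N)))"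
      by (rule telescope_le[OF x])
    also have "\<dots> \<le> (suminf (\<lambda>i. nrm V (x (Suc (i + N)) \<ominus>\<^bsub>V\<^esub> x (i + N))))"
      using sum nn by (intro sum_le_suminf) (auto simp: summable_iff_shift[of "\<lambda>n. nrm V (x (Suc n) \<ominus>\<^bsub>V\<^esub> x n)" N])
    finally show ?thesis using N[of N] that by simp
  qed
  have "nrm V (x m \<ominus>\<^bsub>V\<^esub> x n) < e" if "m \<ge> N" "n \<ge> N" for m n
    using sn_dist_triangle[OF V x[of m] x[of N] x[of n]] sn_dist_commute[OF V x[of n] x[of N]]
      *[OF that(1)] *[OF that(2)] by simp
  then show "\<exists>N. \<forall>m\<ge>N. \<forall>n\<ge>N. nrm V (x m \<ominus>\<^bsub>V\<^esub> x n) < e" by blast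
qed

text \<open>The telescoping estimate for finite stretches is passed to the limit. The value
  \<open>\<infinity>\<close> of \<open>ennreal\<close> is allowed on the right, so that summability
  of the increments need not be known.\<close>

lemma dist_limit_le_suminf:
  assumes x: "\<And>n. x n \<in> carrier V" and l: "l \<in> carrier V" "tends_in V x l"
  shows "ennreal (nrm V (l \<ominus>\<^bsub>V\<^esub> x k)) \<le> (suminf (\<lambda>j. ennreal (nrm V (x (Suc (j + k)) \<ominus>\<^bsub>V\<^esub> x (j + k)))))"
proof -
  have nn: "0 \<le> nrm V (x (Suc n) \<ominus>\<^bsub>V\<^esub> x n)" for n using x ls_series V by simp
  have "(\<lambda>m. nrm V (x (m + k) \<ominus>\<^bsub>V\<^esub> l)) \<longlonglongrightarrow> 0"
    using l(2) unfolding tends_in_def by (rule LIMSEQ_ignore_initial_segment)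
  then have "tends_in V (\<lambda>m. x (m + k)) l" by (simp add: tends_in_def)
  from tends_in_add[OF V _ _ _ _ this tends_in_const[OF V]]
  have "tends_in V (\<lambda>m. x (m + k) \<oplus>\<^bsub>V\<^esub> (-1) \<odot>\<^bsub>V\<^esub> x k) (l \<oplus>\<^bsub>V\<^esub> (-1) \<odot>\<^bsub>V\<^esub> x k)"
    using x l ls_series by simp
  from tends_in_norm[OF V _ _ this]
  have lim: "(\<lambda>m. nrm V (x (m + k) \<ominus>\<^bsub>V\<^esub> x k)) \<longlonglongrightarrow> nrm V (l \<ominus>\<^bsub>V\<^esub> x k)"
    using x l ls_series by (simp add: ls_minus)
  have "ennreal (nrm V (x (m + k) \<ominus>\<^bsub>V\<^esub> x k)) \<le> (suminf (\<lambda>j. ennreal (nrm V (x (Suc (j + k)) \<ominus>\<^bsub>V\<^esub> x (j + k)))))" for m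
  proof -
    have "ennreal (nrm V (x (m + k) \<ominus>\<^bsub>V\<^esub> x k)) \<le> ennreal (\<Sum>j<m. nrm V (x (Suc (j + k)) \<ominus>\<^bsub>V\<^esub> x (j + k)))"
      by (rule ennreal_leI[OF telescope_le[OF x]])
    also have "\<dots> = (\<Sum>j<m. ennreal (nrm V (x (Suc (j + k)) \<ominus>\<^bsub>V\<^esub> x (j + k))))"
      using nn by (intro sum_ennreal[symmetric]) auto
    also have "\<dots> \<le> (suminf (\<lambda>j. ennreal (nrm V (x (Suc (j + k)) \<ominus>\<^bsub>V\<^esub> x (j + k)))))"
      by (intro sum_le_suminf) auto
    finally show ?thesis .
  qed
  then show ?thesis
    by (intro LIMSEQ_le_const2[OF tendsto_ennrealI[OF lim]]) auto
qed

end

text \<open>The series of pointwise increments has finite integral, hence is finite almost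
  everywhere, and there the values \<open>s k t\<close> form a Cauchy sequence in the complete space
  \<open>V\<close>. As the \<open>s k\<close> are simple, the increments are measurable and the
  sequence itself witnesses strong measurability of the limit. The factor 2 is the sum of the
  geometric series.\<close>

lemma complete_L1_of_summable:
  assumes V: "normed_space V" "complete_normed V"
    and s: "\<And>k. simple_function M (s k)" "\<And>k. s k \<in> L1_functions M V"
    and sum: "\<And>k. nrm (L1_normed M V) (L1_class M V (s (Suc k)) \<ominus>\<^bsub>L1_normed M V\<^esub> L1_class M V (s k)) \<le> C * (1/2)^k"
  obtains f where "f \<in> L1_functions M V"
    "\<And>k. nrm (L1_normed M V) (L1_class M V f \<ominus>\<^bsub>L1_normed M V\<^esub> L1_class M V (s k)) \<le> 2 * C * (1/2)^k"
proof -
  have Vs: "seminormed V" by (rule normed_seminormed[OF V(1)])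
  note ls = sn_linear_space[OF Vs]
  note sc = L1_functionsD(1)[OF s(2)]
  define d where "d k t = nrm V (s (Suc k) t \<ominus>\<^bsub>V\<^esub> s k t)" for k t
  have d [measurable]: "d k \<in> borel_measurable M" for k
    unfolding d_def by (intro borel_measurable_simple_function simple_function_compose2[OF s(1) s(1)])
  have d0: "0 \<le> d k t" if "t \<in> space M" for k t using sc[OF that] ls Vs by (simp add: d_def)
  have C: "0 \<le> C"
    using order_trans[OF L1_dist_nonneg[OF Vs s(2) s(2)] sum[of 0]] by simp
  have dI: "(\<integral>\<^sup>+ t. ennreal (d k t) \<partial>M) \<le> ennreal (C * (1/2)^k)" for k
    using ennreal_leI[OF sum[of k]] by (simp add: L1_dist[OF Vs s(2) s(2)] d_def)
  have tail: "(\<integral>\<^sup>+ t. (suminf (\<lambda>j. ennreal (d (j + k) t))) \<partial>M) \<le> ennreal (2 * C * (1/2)^k)" for k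
  proof -
    have "(\<integral>\<^sup>+ t. (suminf (\<lambda>j. ennreal (d (j + k) t))) \<partial>M) = (suminf (\<lambda>j. \<integral>\<^sup>+ t. ennreal (d (j + k) t) \<partial>M))"
      by (rule nn_integral_suminf) measurable
    also have "\<dots> \<le> (suminf (\<lambda>j. ennreal (C * (1/2)^(j + k))))"
      by (intro suminf_le dI) auto
    also have "\<dots> = ennreal (2 * C * (1/2)^k)"
    proof (rule suminf_ennreal_eq)
      have "(\<lambda>j. (C * (1/2)^k) * (1/2)^j) sums ((C * (1/2)^k) * (1 / (1 - 1/2)))"
        by (intro sums_mult geometric_sums) simp
      then show "(\<lambda>j. C * (1/2)^(j + k)) sums (2 * C * (1/2)^k)"
        by (simp add: power_add mult_ac)
    qed (use C in auto)
    finally show ?thesis .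
  qed
  have "AE t in M. (suminf (\<lambda>j. ennreal (d (j + 0) t))) \<noteq> \<infinity>"
    by (rule nn_integral_PInf_AE) (use tail[of 0] in \<open>auto simp: top_unique\<close>)
  then have lim_ex: "AE t in M. \<exists>l\<in>carrier V. tends_in V (\<lambda>k. s k t) l"
    using AE_space
  proof eventually_elim
    case (elim t)
    have "summable (\<lambda>j. d j t)"
      using elim d0 by (intro summable_suminf_not_top) auto
    then have "(\<lambda>k. s k t) \<in> cauchy_seqs V"
      unfolding d_def by (intro summable_cauchy_seq[OF Vs] sc[OF elim(2)])
    then show ?case using V(2) unfolding complete_normed_def tends_in_def by (rule bspec[rotated])
  qed
  \<comment> \<open>On the null set without a limit the value zero keeps \<open>f\<close> inside the
    carrier.\<close>
  define f where "f t = (if \<exists>l\<in>carrier V. tends_in V (\<lambda>k. s k t) l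
    then (SOME l. l \<in> carrier V \<and> tends_in V (\<lambda>k. s k t) l) else \<zero>\<^bsub>V\<^esub>)" for t
  have f': "f t \<in> carrier V \<and> tends_in V (\<lambda>k. s k t) (f t)" if "\<exists>l\<in>carrier V. tends_in V (\<lambda>k. s k t) l" for t
  proof -
    have "\<exists>l. l \<in> carrier V \<and> tends_in V (\<lambda>k. s k t) l" using that by blast
    from someI_ex[OF this] show ?thesis using that by (simp add: f_def)
  qed
  have fc: "f t \<in> carrier V" for t
    using f'[of t] ls by (cases "\<exists>l\<in>carrier V. tends_in V (\<lambda>k. s k t) l") (auto simp: f_def)
  have flim: "AE t in M. tends_in V (\<lambda>k. s k t) (f t)" using lim_ex by eventually_elim (use f' in blast)
  have sm: "strongly_measurable M V f"
    unfolding strongly_measurable_def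
    using flim s(1) sc by (intro exI[of _ s]) (auto simp: tends_in_def)
  have dist: "(\<integral>\<^sup>+ t. ennreal (nrm V (f t \<ominus>\<^bsub>V\<^esub> s k t)) \<partial>M) \<le> ennreal (2 * C * (1/2)^k)" for k
  proof -
    have "(\<integral>\<^sup>+ t. ennreal (nrm V (f t \<ominus>\<^bsub>V\<^esub> s k t)) \<partial>M) \<le> (\<integral>\<^sup>+ t. (suminf (\<lambda>j. ennreal (d (j + k) t))) \<partial>M)"
    proof (rule nn_integral_mono_AE)
      show "AE t in M. ennreal (nrm V (f t \<ominus>\<^bsub>V\<^esub> s k t)) \<le> (suminf (\<lambda>j. ennreal (d (j + k) t)))"
        using flim AE_space
        by eventually_elim (use dist_limit_le_suminf[OF Vs _ fc, of "\<lambda>k. s k _"] sc in \<open>auto simp: d_def\<close>)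
    qed
    then show ?thesis using tail[of k] by (rule order_trans)
  qed
  have fL: "f \<in> L1_functions M V"
  proof -
    obtain h where h [measurable]: "h \<in> borel_measurable M" and h0: "\<And>t. 0 \<le> (h t :: real)"
      and hf: "AE t in M. nrm V (f t) = h t"
      using strongly_measurable_norm[OF Vs sm] fc by blast
    have m [measurable]: "(\<lambda>t. nrm V (s 0 t)) \<in> borel_measurable M"
      by (intro borel_measurable_simple_function simple_function_compose1[OF s(1)])
    have "(\<integral>\<^sup>+ t. ennreal (nrm V (f t)) \<partial>M) \<le> (\<integral>\<^sup>+ t. ennreal (nrm V (s 0 t)) + (suminf (\<lambda>j. ennreal (d (j + 0) t))) \<partial>M)"
    proof (rule nn_integral_mono_AE)
      show "AE t in M. ennreal (nrm V (f t)) \<le> ennreal (nrm V (s 0 t)) + (suminf (\<lambda>j. ennreal (d (j + 0) t)))"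
        using flim AE_space
      proof eventually_elim
        case (elim t)
        have nn: "0 \<le> nrm V (f t \<ominus>\<^bsub>V\<^esub> s 0 t)" "0 \<le> nrm V (s 0 t)" using fc sc elim ls Vs by auto
        have "nrm V (f t) \<le> nrm V (s 0 t) + nrm V (f t \<ominus>\<^bsub>V\<^esub> s 0 t)"
          using sn_triangle[OF Vs sc[OF elim(2)], of "f t \<ominus>\<^bsub>V\<^esub> s 0 t" 0] fc sc elim ls
          by (simp add: ls_add_minus)
        then have "ennreal (nrm V (f t)) \<le> ennreal (nrm V (s 0 t)) + ennreal (nrm V (f t \<ominus>\<^bsub>V\<^esub> s 0 t))"
          using nn by (simp add: ennreal_plus[symmetric] ennreal_leI del: ennreal_plus)
        also have "ennreal (nrm V (f t \<ominus>\<^bsub>V\<^esub> s 0 t)) \<le> (suminf (\<lambda>j. ennreal (d (j + 0) t)))"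
          unfolding d_def using elim sc by (intro dist_limit_le_suminf[OF Vs _ fc, of "\<lambda>k. s k t"]) auto
        finally show ?case by (simp add: add_left_mono)
      qed
    qed
    also have "\<dots> = (\<integral>\<^sup>+ t. ennreal (nrm V (s 0 t)) \<partial>M) + (\<integral>\<^sup>+ t. (suminf (\<lambda>j. ennreal (d (j + 0) t))) \<partial>M)"
      by (rule nn_integral_add) measurable
    also have "\<dots> < \<infinity>"
      using L1_functionsD(3)[OF s(2)[of 0]] le_less_trans[OF tail[of 0]] by (simp add: less_top)
    finally show ?thesis using fc sm by (simp add: L1_functions_def)
  qed
  show ?thesis
  proof (rule that[OF fL])
    show "nrm (L1_normed M V) (L1_class M V f \<ominus>\<^bsub>L1_normed M V\<^esub> L1_class M V (s k)) \<le> 2 * C * (1/2)^k" for k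
      using dist[of k] C L1_dist_nonneg[OF Vs fL s(2)[of k]] by (simp flip: L1_dist[OF Vs fL s(2)])
  qed
qed

text \<open>Each \<open>s k\<close> is a simple function within \<open>(1/2)^k\<close> of all late
  terms of the given Cauchy sequence. It plays the role of a rapidly converging subsequence and is
  simple at the same time.\<close>

lemma complete_L1:
  assumes V: "normed_space V" "complete_normed V"
  shows "complete_normed (L1_normed M V)"
  unfolding complete_normed_def
proof
  have Vs: "seminormed V" by (rule normed_seminormed[OF V(1)])
  let ?L = "L1_normed M V"
  have L: "seminormed ?L" by (rule seminormed_L1[OF Vs])
  fix Z assume Z: "Z \<in> cauchy_seqs ?L"
  note Zc = cauchy_seqs_carrier[OF L Z]
  have "\<exists>s N. simple_function M s \<and> s \<in> L1_functions M V \<and> (\<forall>m\<ge>N. nrm ?L (Z m \<ominus>\<^bsub>?L\<^esub> L1_class M V s) \<le> (1/2)^k)" for k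
  proof -
    have e: "(1/2)^k / 2 > (0::real)" by simp
    from cauchy_seqsD[OF L Z e] obtain N where N: "\<And>m n. m \<ge> N \<Longrightarrow> n \<ge> N \<Longrightarrow> nrm ?L (Z m \<ominus>\<^bsub>?L\<^esub> Z n) < (1/2)^k / 2" by blast
    obtain f where f: "f \<in> L1_functions M V" "Z N = L1_class M V f" using Zc[of N] by (auto simp: L1_carrier[OF Vs])
    obtain s where s: "simple_function M s" "s \<in> space M \<rightarrow> carrier V"
      "emeasure M {t\<in>space M. s t \<noteq> \<zero>\<^bsub>V\<^esub>} < \<infinity>"
      "nrm ?L (L1_class M V f \<ominus>\<^bsub>?L\<^esub> L1_class M V s) < (1/2)^k / 2"
      by (rule L1_approx[OF Vs f(1) e])
    have sL: "s \<in> L1_functions M V" by (rule L1_functions_simple[OF Vs s(1-3)])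
    have "nrm ?L (Z m \<ominus>\<^bsub>?L\<^esub> L1_class M V s) \<le> (1/2)^k" if "m \<ge> N" for m
      using sn_dist_triangle[OF L Zc[of m] Zc[of N] L1_class_closed[OF Vs sL]] N[of m N] s(4) f(2) that by simp
    then show ?thesis using s(1) sL by blast
  qed
  then obtain s N where s: "\<And>k. simple_function M (s k)" "\<And>k. s k \<in> L1_functions M V"
    and near: "\<And>k m. m \<ge> N k \<Longrightarrow> nrm ?L (Z m \<ominus>\<^bsub>?L\<^esub> L1_class M V (s k)) \<le> (1/2)^k"
    by metis
  note sc = L1_class_closed[OF Vs s(2)]
  \<comment> \<open>A common late term \<open>Z ?m\<close> is within \<open>(1/2)^(Suc k)\<close> of
    the one simple function and within \<open>(1/2)^k\<close> of the other, whence the constant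
    2.\<close>
  have step: "nrm ?L (L1_class M V (s (Suc k)) \<ominus>\<^bsub>?L\<^esub> L1_class M V (s k)) \<le> 2 * (1/2)^k" for k
  proof -
    let ?m = "max (N k) (N (Suc k))"
    have "nrm ?L (L1_class M V (s (Suc k)) \<ominus>\<^bsub>?L\<^esub> Z ?m) \<le> (1/2)^(Suc k)"
      using near[of "Suc k" ?m] by (simp add: sn_dist_commute[OF L sc Zc])
    moreover have "(1/2)^(Suc k) \<le> (1/2 :: real)^k" by simp
    ultimately show ?thesis
      using sn_dist_triangle[OF L sc[of "Suc k"] Zc[of ?m] sc[of k]] near[of k ?m] by linarith
  qed
  obtain f where f: "f \<in> L1_functions M V"
    "\<And>k. nrm ?L (L1_class M V f \<ominus>\<^bsub>?L\<^esub> L1_class M V (s k)) \<le> 2 * 2 * (1/2)^k"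
    by (rule complete_L1_of_summable[OF V, where M = M and s = s and C = 2]) (use s step in auto)
  have fc: "L1_class M V f \<in> carrier ?L" by (rule L1_class_closed[OF Vs f(1)])
  have "(\<lambda>n. nrm ?L (Z n \<ominus>\<^bsub>?L\<^esub> L1_class M V f)) \<longlonglongrightarrow> 0"
  proof (rule LIMSEQ_I)
    fix e :: real assume "e > 0"
    \<comment> \<open>Five parts: one from the distance of \<open>Z n\<close> to \<open>s k\<close>,
      four from the distance of \<open>s k\<close> to the limit.\<close>
    then obtain k where k: "(1/2)^k < e / 5"
      using real_arch_pow_inv[of "e / 5" "1/2"] by auto
    have "norm (nrm ?L (Z n \<ominus>\<^bsub>?L\<^esub> L1_class M V f) - 0) < e" if "n \<ge> N k" for n
      using sn_dist_triangle[OF L Zc[of n] sc[of k] fc] near[OF that] f(2)[of k] k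
        sn_nonneg[OF L ls_closed(4)[OF sn_linear_space[OF L] Zc[of n] fc]]
      by (simp add: sn_dist_commute[OF L sc fc])
    then show "\<exists>no. \<forall>n\<ge>no. norm (nrm ?L (Z n \<ominus>\<^bsub>?L\<^esub> L1_class M V f) - 0) < e" by blast
  qed
  then show "\<exists>l\<in>carrier ?L. (\<lambda>n. nrm ?L (Z n \<ominus>\<^bsub>?L\<^esub> l)) \<longlonglongrightarrow> 0" using fc by blast
qed

section \<open>Hilbert spaces\<close>

lemma scaleC_zero_left [simp]: "0 *\<^sub>C (x :: 'h::complex_hilbert_space) = 0"
  using scaleC_of_real[of 0 x] by simp

lemma scaleC_one [simp]: "1 *\<^sub>C (x :: 'h::complex_hilbert_space) = x"
  using scaleC_of_real[of 1 x] by simp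

lemma scaleC_minus_one [simp]: "(-1) *\<^sub>C (x :: 'h::complex_hilbert_space) = - x"
  using scaleC_of_real[of "-1" x] by simp

lemma cinner_add_right: "cinner (x :: 'h::complex_hilbert_space) (y + z) = cinner x y + cinner x z"
  by (metis cinner_add_left cinner_commute complex_cnj_add)

lemma cinner_scaleC_right: "cinner (x :: 'h::complex_hilbert_space) (c *\<^sub>C y) = cnj c * cinner x y"
  by (metis cinner_scaleC_left cinner_commute complex_cnj_mult)

lemma cinner_zero_left [simp]: "cinner (0 :: 'h::complex_hilbert_space) y = 0"
  using cinner_add_left[of 0 0 y] by simp

lemma cinner_minus_left: "cinner (x - y :: 'h::complex_hilbert_space) z = cinner x z - cinner y z"
  using cinner_add_left[of "x - y" y z] by simp

lemma cinner_sum_left: "cinner (\<Sum>i\<in>A. f i :: 'h::complex_hilbert_space) y = (\<Sum>i\<in>A. cinner (f i) y)"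
  by (induction A rule: infinite_finite_induct) (auto simp: cinner_add_left)

text \<open>The class provides homogeneity for real scalars; for complex ones it follows from
  \<open>cinner_self\<close>, because \<open>c * cnj c\<close> is the square of the modulus.\<close>

lemma norm_scaleC: "norm (c *\<^sub>C (x :: 'h::complex_hilbert_space)) = cmod c * norm x"
proof -
  have "complex_of_real ((norm (c *\<^sub>C x))\<^sup>2) = (c * cnj c) * complex_of_real ((norm x)\<^sup>2)"
    by (simp only: cinner_self[symmetric] cinner_scaleC_left cinner_scaleC_right mult_ac)
  also have "\<dots> = complex_of_real ((cmod c * norm x)\<^sup>2)"
    by (simp add: complex_mult_cnj cmod_power2[symmetric] power_mult_distrib flip: of_real_power)
  finally have "(norm (c *\<^sub>C x))\<^sup>2 = (cmod c * norm x)\<^sup>2" by (simp only: of_real_eq_iff)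
  then show ?thesis by simp
qed

text \<open>The Cauchy-Schwarz inequality. Here \<open>c *\<^sub>C y\<close> is the orthogonal
  projection of \<open>x\<close> to the line of \<open>y\<close>, and by Pythagoras it is no longer
  than \<open>x\<close>.\<close>

lemma cinner_norm_le: "cmod (cinner x y) \<le> norm x * norm (y :: 'h::complex_hilbert_space)"
proof (cases "y = 0")
  case True
  then show ?thesis using cinner_commute[of x y] by simp
next
  case False
  define c where "c = cinner x y / complex_of_real ((norm y)\<^sup>2)"
  define r where "r = x - c *\<^sub>C y"
  have ry: "cinner r y = 0"
    using False by (simp add: r_def cinner_minus_left cinner_scaleC_left cinner_self c_def)
  have yr: "cinner y r = 0" using ry cinner_commute[of y r] by simp
  have "x = r + c *\<^sub>C y" by (simp add: r_def)
  then have "cinner x x = cinner r r + cinner (c *\<^sub>C y) (c *\<^sub>C y)"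
    using ry yr by (simp add: cinner_add_left cinner_add_right cinner_scaleC_left cinner_scaleC_right)
  then have "complex_of_real ((norm x)\<^sup>2) = complex_of_real ((norm r)\<^sup>2 + (norm (c *\<^sub>C y))\<^sup>2)"
    by (simp add: cinner_self)
  then have "(norm x)\<^sup>2 = (norm r)\<^sup>2 + (norm (c *\<^sub>C y))\<^sup>2" by (simp only: of_real_eq_iff)
  then have "(norm (c *\<^sub>C y))\<^sup>2 \<le> (norm x)\<^sup>2" by simp
  then have "norm (c *\<^sub>C y) \<le> norm x" by (rule power2_le_imp_le) simp
  then have "cmod (cinner x y) / norm y \<le> norm x"
    using False by (simp add: norm_scaleC c_def norm_divide norm_mult power2_eq_square)
  then show ?thesis using False by (simp add: field_simps)
qed

lemma hilbert_lspace_simps [simp]: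
  "carrier hilbert_lspace = UNIV" "zero hilbert_lspace = 0" "add hilbert_lspace = (+)"
  "smult hilbert_lspace = scaleC" "nrm hilbert_lspace = norm"
  by (simp_all add: hilbert_lspace_def)

lemma linear_space_hilbert [simp, intro]: "linear_space (hilbert_lspace :: 'h::complex_hilbert_space normed_lspace)"
  by (rule linear_spaceI) (auto simp: algebra_simps scaleC_add_left scaleC_add_right scaleC_scaleC)

lemma minus_hilbert [simp]: "x \<ominus>\<^bsub>hilbert_lspace\<^esub> y = (x :: 'h::complex_hilbert_space) - y"
  by (simp add: ls_minus)

lemma normed_space_hilbert: "normed_space (hilbert_lspace :: 'h::complex_hilbert_space normed_lspace)"
  by (auto simp: normed_space_def norm_scaleC norm_triangle_ineq)

lemma complete_hilbert: "complete_normed (hilbert_lspace :: 'h::complex_hilbert_space normed_lspace)"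
  unfolding complete_normed_def
proof
  fix x :: "nat \<Rightarrow> 'h" assume "x \<in> cauchy_seqs hilbert_lspace"
  then have "Cauchy x" by (simp add: cauchy_seqs_def Cauchy_def dist_norm)
  then obtain l where "x \<longlonglongrightarrow> l" using Cauchy_convergent_iff convergent_def by blast
  then have "(\<lambda>n. norm (x n - l)) \<longlonglongrightarrow> 0" by (simp add: LIM_zero tendsto_norm_zero)
  then show "\<exists>l\<in>carrier hilbert_lspace. (\<lambda>n. nrm hilbert_lspace (x n \<ominus>\<^bsub>hilbert_lspace\<^esub> l)) \<longlonglongrightarrow> 0"
    by auto
qed

lemma complex_lspace_simps [simp]:
  "carrier complex_lspace = UNIV" "zero complex_lspace = 0" "add complex_lspace = (+)"
  "smult complex_lspace = (*)"
  by (simp_all add: complex_lspace_def)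

lemma linear_space_complex [simp, intro]: "linear_space complex_lspace"
  by (rule linear_spaceI) (auto simp: algebra_simps)

lemma finsum_eq_sum:
  assumes "linear_space G" "carrier G = UNIV" "add G = (+)" "zero G = (0 :: 'a::comm_monoid_add)"
  shows "finsum G f A = sum f A"
proof -
  interpret abelian_monoid G by (rule ls_monoid[OF assms(1)])
  show ?thesis
    by (induction A rule: infinite_finite_induct) (use assms in \<open>auto simp: finsum_infinite\<close>)
qed

lemma linear_op_hilbertI:
  assumes "\<And>x y. a (x + y) = a x + a y" "\<And>c x. a (c *\<^sub>C x) = c *\<^sub>C a x"
  shows "linear_op hilbert_lspace (hilbert_lspace :: 'h::complex_hilbert_space normed_lspace) (a :: 'g::complex_hilbert_space \<Rightarrow> 'h)"
  using assms by (auto intro: linear_opI)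

lemma bounded_operatorsI:
  assumes "\<And>x y. a (x + y) = a x + a y" "\<And>c x. a (c *\<^sub>C x) = c *\<^sub>C a x" "\<And>x. norm (a x) \<le> K * norm x"
    "0 \<le> K"
  shows "a \<in> bounded_operators" "onorm a \<le> K"
proof -
  have "bounded_linear a"
    by (rule bounded_linear_intro[where K = K])
      (use assms assms(2)[of "complex_of_real _"] in \<open>auto simp: scaleC_of_real mult.commute\<close>)
  then show "a \<in> bounded_operators" using assms(2) by (simp add: bounded_operators_def)
  show "onorm a \<le> K" by (rule onorm_bound[OF assms(4,3)])
qed

lemma bounded_operators_linear:
  "a \<in> bounded_operators \<Longrightarrow> linear_op hilbert_lspace hilbert_lspace a"
  by (rule linear_op_hilbertI) (auto simp: bounded_operators_def linear_add bounded_linear.linear)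

text \<open>With suitable scaling these operators carry any nonzero vector to any prescribed one.
  Through the module inequality they determine how the norm of an elementary element
  \<open>\<xi>x\<close> depends on \<xi>.\<close>

lemma rank_one_operator:
  fixes x y :: "'h::complex_hilbert_space"
  shows "(\<lambda>\<zeta>. cinner \<zeta> x *\<^sub>C y) \<in> bounded_operators" "onorm (\<lambda>\<zeta>. cinner \<zeta> x *\<^sub>C y) \<le> norm x * norm y"
proof -
  have "norm (cinner \<zeta> x *\<^sub>C y) \<le> norm x * norm y * norm \<zeta>" for \<zeta>
    using mult_right_mono[OF cinner_norm_le[of \<zeta> x], of "norm y"] by (simp add: norm_scaleC mult_ac)
  then show "(\<lambda>\<zeta>. cinner \<zeta> x *\<^sub>C y) \<in> bounded_operators" "onorm (\<lambda>\<zeta>. cinner \<zeta> x *\<^sub>C y) \<le> norm x * norm y"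
    by (auto intro!: bounded_operatorsI
        simp: cinner_add_left cinner_scaleC_left scaleC_add_left scaleC_scaleC)
qed

subsection \<open>The Hilbert tensor product\<close>

definition orthonormal :: "'h::complex_hilbert_space set \<Rightarrow> bool" where
  "orthonormal S \<longleftrightarrow> finite S \<and> (\<forall>e\<in>S. norm e = 1) \<and> (\<forall>e\<in>S. \<forall>e'\<in>S. e \<noteq> e' \<longrightarrow> cinner e e' = 0)"

lemma orthonormal_cinner:
  "orthonormal S \<Longrightarrow> e \<in> S \<Longrightarrow> e' \<in> S \<Longrightarrow> cinner e e' = (if e = e' then 1 else 0)"
  by (auto simp: orthonormal_def cinner_self)

abbreviation HH :: "(complex, ('h::complex_hilbert_space, 'h) tensor) module" where
  "HH \<equiv> tensor_product (hilbert_lspace :: 'h normed_lspace) (hilbert_lspace :: 'h normed_lspace)"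

abbreviation HHe :: "'h::complex_hilbert_space \<Rightarrow> 'h \<Rightarrow> ('h, 'h) tensor" where
  "HHe \<equiv> elem_tensor hilbert_lspace hilbert_lspace"

lemma HHe_linear_left: "linear_op hilbert_lspace HH (\<lambda>\<xi> :: 'h::complex_hilbert_space. HHe \<xi> \<eta>)"
  and HHe_linear_right: "linear_op hilbert_lspace HH (HHe (\<xi> :: 'h))"
  by (simp_all add: elem_tensor_linear_left elem_tensor_linear_right)

lemma HHe_add: "HHe \<xi> (x + y :: 'h::complex_hilbert_space) = HHe \<xi> x \<oplus>\<^bsub>HH\<^esub> HHe \<xi> y"
  and HHe_scale: "HHe \<xi> (c *\<^sub>C x) = c \<odot>\<^bsub>HH\<^esub> HHe \<xi> x"
  and HHe_scale_left: "HHe (c *\<^sub>C \<xi>) x = HHe \<xi> (c *\<^sub>C x)"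
  and HHe_zero: "HHe \<xi> (0 :: 'h) = \<zero>\<^bsub>HH\<^esub>"
  using linear_opD(2,3)[OF HHe_linear_right[of \<xi>]] linear_opD(3)[OF HHe_linear_left[of x]]
    linear_op_zero[OF HHe_linear_right[of \<xi>]] by auto

text \<open>Reduces the Hilbert norm of \<open>H \<otimes> H\<close>, whose positivity is not yet known, to \<open>L2_set\<close>.  Prescribing
  \<open>S0\<close> serves to represent two tensors with the same orthonormal set.\<close>

lemma orthonormal_representation:
  fixes U :: "('h::complex_hilbert_space, 'h) tensor"
  assumes "U \<in> carrier HH" "orthonormal S0"
  shows "\<exists>S g. S0 \<subseteq> S \<and> orthonormal S \<and> U = (\<Oplus>\<^bsub>HH\<^esub>e\<in>S. HHe e (g e))"
  using linear_space_hilbert linear_space_hilbert assms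
proof (induction arbitrary: S0 rule: tensor_induct)
  case (elem \<xi> \<eta>)
  interpret abelian_monoid "HH :: (complex, ('h, 'h) tensor) module" by (rule ls_monoid) auto
  have S0: "finite S0" using elem by (simp add: orthonormal_def)
  \<comment> \<open>A Gram-Schmidt step: \<open>r\<close> is the part of \<xi> orthogonal to
    \<open>S0\<close>. If it does not vanish, its normalization is added to the orthonormal
    set.\<close>
  define r where "r = \<xi> - (\<Sum>e\<in>S0. cinner \<xi> e *\<^sub>C e)"
  have expand: "HHe (\<Sum>e\<in>S. f e *\<^sub>C e) \<eta> = (\<Oplus>\<^bsub>HH\<^esub>e\<in>S. HHe e (f e *\<^sub>C \<eta>))" if "finite S" for f S
  proof -
    have "HHe (finsum hilbert_lspace (\<lambda>e. f e *\<^sub>C e) S) \<eta> = (\<Oplus>\<^bsub>HH\<^esub>e\<in>S. HHe (f e *\<^sub>C e) \<eta>)"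
      by (rule linear_op_finsum[OF HHe_linear_left]) auto
    also have "\<dots> = (\<Oplus>\<^bsub>HH\<^esub>e\<in>S. HHe e (f e *\<^sub>C \<eta>))"
      by (simp only: HHe_scale_left)
    finally show ?thesis by (simp add: finsum_eq_sum)
  qed
  have orth: "cinner r e = 0" if "e \<in> S0" for e
  proof -
    have "cinner (\<Sum>e'\<in>S0. cinner \<xi> e' *\<^sub>C e') e = (\<Sum>e'\<in>S0. if e' = e then cinner \<xi> e else 0)"
      unfolding cinner_sum_left
      using that elem(3) by (intro sum.cong) (auto simp: cinner_scaleC_left orthonormal_cinner)
    then show ?thesis using that S0 by (simp add: r_def cinner_minus_left)
  qed
  show ?case
  proof (cases "r = 0")
    case True
    then have "(\<Sum>e\<in>S0. cinner \<xi> e *\<^sub>C e) = \<xi>" by (simp add: r_def)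
    then have eq: "HHe \<xi> \<eta> = (\<Oplus>\<^bsub>HH\<^esub>e\<in>S0. HHe e (cinner \<xi> e *\<^sub>C \<eta>))"
      using expand[OF S0, of "cinner \<xi>"] by (simp only:)
    show ?thesis
      by (intro exI[of _ S0] exI[of _ "\<lambda>e. cinner \<xi> e *\<^sub>C \<eta>"] conjI eq elem(3) subset_refl)
  next
    case False
    define n where "n = complex_of_real (inverse (norm r)) *\<^sub>C r"
    have n1: "norm n = 1" using False by (simp add: n_def norm_scaleC norm_inverse)
    have nr: "complex_of_real (norm r) *\<^sub>C n = r" using False by (simp add: n_def scaleC_scaleC)
    have n0: "cinner n e = 0" "cinner e n = 0" if "e \<in> S0" for e
      using orth[OF that] cinner_commute[of e r]
      by (simp_all add: n_def cinner_scaleC_left cinner_scaleC_right)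
    have nS: "n \<notin> S0" using n0(1)[of n] n1 by (auto simp: cinner_self)
    define f where "f e = (if e = n then complex_of_real (norm r) else cinner \<xi> e)" for e
    have "(\<Sum>e\<in>insert n S0. f e *\<^sub>C e) = r + (\<Sum>e\<in>S0. cinner \<xi> e *\<^sub>C e)"
      using nS S0 nr by (subst sum.insert) (auto simp: f_def intro!: sum.cong)
    then have "(\<Sum>e\<in>insert n S0. f e *\<^sub>C e) = \<xi>" by (simp add: r_def)
    moreover have "finite (insert n S0)" using S0 by simp
    ultimately have eq: "HHe \<xi> \<eta> = (\<Oplus>\<^bsub>HH\<^esub>e\<in>insert n S0. HHe e (f e *\<^sub>C \<eta>))"
      using expand[of "insert n S0" f] by (simp only:)
    have on: "orthonormal (insert n S0)"
      using elem(3) n1 n0 by (auto simp: orthonormal_def)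
    show ?thesis
      by (intro exI[of _ "insert n S0"] exI[of _ "\<lambda>e. f e *\<^sub>C \<eta>"] conjI eq on subset_insertI)
  qed
next
  case (add A B)
  interpret abelian_monoid "HH :: (complex, ('h, 'h) tensor) module" by (rule ls_monoid) auto
  obtain S1 g where S1: "S0 \<subseteq> S1" "orthonormal S1" "A = (\<Oplus>\<^bsub>HH\<^esub>e\<in>S1. HHe e (g e))"
    using add(3)[OF add(5)] by blast
  obtain S2 k where S2: "S1 \<subseteq> S2" "orthonormal S2" "B = (\<Oplus>\<^bsub>HH\<^esub>e\<in>S2. HHe e (k e))"
    using add(4)[OF S1(2)] by blast
  have fin: "finite S2" using S2(2) by (simp add: orthonormal_def)
  \<comment> \<open>The set for \<open>B\<close> was built on top of the set for \<open>A\<close>,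
    so the coefficients of \<open>A\<close> only have to be extended by 0.\<close>
  let ?g = "\<lambda>e. if e \<in> S1 then g e else 0"
  have "A = (\<Oplus>\<^bsub>HH\<^esub>e\<in>S2. HHe e (?g e))"
    unfolding S1(3) by (rule add.finprod_mono_neutral_cong_left[OF fin S2(1)]) (auto simp: HHe_zero)
  then have "A \<oplus>\<^bsub>HH\<^esub> B = (\<Oplus>\<^bsub>HH\<^esub>e\<in>S2. HHe e (?g e) \<oplus>\<^bsub>HH\<^esub> HHe e (k e))"
    unfolding S2(3) by (simp add: finsum_addf del: if_split)
  also have "\<dots> = (\<Oplus>\<^bsub>HH\<^esub>e\<in>S2. HHe e (?g e + k e))"
    by (simp only: HHe_add)
  finally have eq: "A \<oplus>\<^bsub>HH\<^esub> B = (\<Oplus>\<^bsub>HH\<^esub>e\<in>S2. HHe e (?g e + k e))" .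
  show ?case
    by (intro exI[of _ S2] exI[of _ "\<lambda>e. ?g e + k e"] conjI eq S2(2) order_trans[OF S1(1) S2(1)])
qed

lemma hilbert_tensor_inner_inner_bilinear:
  "bilinear_op hilbert_lspace hilbert_lspace complex_lspace
    (\<lambda>\<xi>' \<eta>'. cinner \<xi>' \<xi> * cinner \<eta>' (\<eta> :: 'h::complex_hilbert_space))"
  by (intro bilinear_opI linear_opI)
    (auto simp: cinner_add_left cinner_scaleC_left algebra_simps)

text \<open>The inner product is antilinear in its second argument, so the inner lift depends
  antilinearly on \<xi> and \<eta>. The conjugation turns this into the linear dependence that a
  further lift requires.\<close>

lemma hilbert_tensor_inner_bilinear:
  assumes V: "V \<in> carrier HH"
  shows "bilinear_op hilbert_lspace hilbert_lspace complex_lspace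
    (\<lambda>\<xi> \<eta>. cnj (tensor_lift complex_lspace (\<lambda>\<xi>' \<eta>'. cinner \<xi>' \<xi> * cinner \<eta>' (\<eta> :: 'h::complex_hilbert_space)) V))"
proof -
  define L where "L \<xi> \<eta> = tensor_lift complex_lspace (\<lambda>\<xi>' \<eta>'. cinner \<xi>' \<xi> * cinner \<eta>' \<eta>)" for \<xi> \<eta> :: 'h
  have lin: "linear_op HH complex_lspace (L \<xi> \<eta>)" for \<xi> \<eta>
    unfolding L_def by (rule tensor_lift_linear) (auto simp: hilbert_tensor_inner_inner_bilinear)
  have el: "L \<xi> \<eta> (HHe \<xi>' \<eta>') = cinner \<xi>' \<xi> * cinner \<eta>' \<eta>" for \<xi> \<eta> \<xi>' \<eta>'
    unfolding L_def by (subst tensor_lift_elem[OF _ _ _ hilbert_tensor_inner_inner_bilinear]) auto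
  have a1: "L (\<xi> + \<xi>') \<eta> V = L \<xi> \<eta> V + L \<xi>' \<eta> V" for \<xi> \<xi>' \<eta>
    using linear_space_hilbert linear_space_hilbert V
    by (induction rule: tensor_induct)
      (auto simp: el cinner_add_right linear_opD(2)[OF lin] algebra_simps)
  have a2: "L \<xi> (\<eta> + \<eta>') V = L \<xi> \<eta> V + L \<xi> \<eta>' V" for \<xi> \<eta> \<eta>'
    using linear_space_hilbert linear_space_hilbert V
    by (induction rule: tensor_induct)
      (auto simp: el cinner_add_right linear_opD(2)[OF lin] algebra_simps)
  have s1: "L (c *\<^sub>C \<xi>) \<eta> V = cnj c * L \<xi> \<eta> V" for c \<xi> \<eta>
    using linear_space_hilbert linear_space_hilbert V
    by (induction rule: tensor_induct)
      (auto simp: el cinner_scaleC_right linear_opD(2)[OF lin] algebra_simps)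
  have s2: "L \<xi> (c *\<^sub>C \<eta>) V = cnj c * L \<xi> \<eta> V" for c \<xi> \<eta>
    using linear_space_hilbert linear_space_hilbert V
    by (induction rule: tensor_induct)
      (auto simp: el cinner_scaleC_right linear_opD(2)[OF lin] algebra_simps)
  show ?thesis
    unfolding L_def[symmetric] by (intro bilinear_opI linear_opI) (simp_all add: a1 a2 s1 s2)
qed

lemma hilbert_tensor_inner_elem:
  "hilbert_tensor_inner (HHe \<xi> \<eta>) (HHe \<xi>' \<eta>') = cinner \<xi> \<xi>' * cinner \<eta> (\<eta>' :: 'h::complex_hilbert_space)"
proof -
  have "hilbert_tensor_inner (HHe \<xi> \<eta>) (HHe \<xi>' \<eta>') = cnj (cinner \<xi>' \<xi> * cinner \<eta>' \<eta>)"
    unfolding hilbert_tensor_inner_def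
    by (subst tensor_lift_elem[OF _ _ _ hilbert_tensor_inner_bilinear])
      (auto simp: tensor_lift_elem[OF _ _ _ hilbert_tensor_inner_inner_bilinear])
  then show ?thesis using cinner_commute[of \<xi> \<xi>'] cinner_commute[of \<eta> \<eta>'] by simp
qed

text \<open>Each cross term contains the inner product of two distinct members of \<open>S\<close>
  and vanishes; the diagonal terms are the squared norms of the coefficients.\<close>

lemma nrm_hilbert_pre_tensor_sum:
  fixes g :: "'h::complex_hilbert_space \<Rightarrow> 'h"
  assumes S: "orthonormal S"
  shows "nrm hilbert_pre_tensor (\<Oplus>\<^bsub>HH\<^esub>e\<in>S. HHe e (g e)) = L2_set (\<lambda>e. norm (g e)) S"
proof -
  let ?U = "\<Oplus>\<^bsub>HH\<^esub>e\<in>S. HHe e (g e)"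
  interpret abelian_monoid "HH :: (complex, ('h, 'h) tensor) module" by (rule ls_monoid) auto
  have fin: "finite S" using S by (simp add: orthonormal_def)
  have U: "?U \<in> carrier HH" by (intro finsum_closed) auto
  have inner: "tensor_lift complex_lspace (\<lambda>\<xi>' \<eta>'. cinner \<xi>' e * cinner \<eta>' (g e)) ?U = complex_of_real ((norm (g e))\<^sup>2)"
    if e: "e \<in> S" for e
  proof -
    have "tensor_lift complex_lspace (\<lambda>\<xi>' \<eta>'. cinner \<xi>' e * cinner \<eta>' (g e)) ?U =
        (\<Sum>e'\<in>S. cinner e' e * cinner (g e') (g e))"
      by (subst linear_op_finsum[OF tensor_lift_linear[OF _ _ _ hilbert_tensor_inner_inner_bilinear]])
        (auto simp: finsum_eq_sum tensor_lift_elem[OF _ _ _ hilbert_tensor_inner_inner_bilinear])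
    also have "\<dots> = (\<Sum>e'\<in>S. if e' = e then cinner (g e) (g e) else 0)"
      using e S by (intro sum.cong) (auto simp: orthonormal_cinner)
    finally show ?thesis using e fin by (simp add: cinner_self)
  qed
  have "hilbert_tensor_inner ?U ?U =
      (\<Sum>e\<in>S. cnj (tensor_lift complex_lspace (\<lambda>\<xi>' \<eta>'. cinner \<xi>' e * cinner \<eta>' (g e)) ?U))"
    unfolding hilbert_tensor_inner_def
    by (subst linear_op_finsum[OF tensor_lift_linear[OF _ _ _ hilbert_tensor_inner_bilinear[OF U]]])
      (auto simp: finsum_eq_sum tensor_lift_elem[OF _ _ _ hilbert_tensor_inner_bilinear[OF U]])
  also have "\<dots> = complex_of_real (\<Sum>e\<in>S. (norm (g e))\<^sup>2)" by (simp add: inner)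
  finally show ?thesis by (simp add: hilbert_pre_tensor_def L2_set_def)
qed

lemma hilbert_pre_tensor_simps [simp]:
  "carrier hilbert_pre_tensor = carrier HH" "zero hilbert_pre_tensor = zero HH"
  "add hilbert_pre_tensor = add HH" "smult hilbert_pre_tensor = smult HH"
  by (simp_all add: hilbert_pre_tensor_def)

text \<open>After both tensors have been written over one orthonormal set, the triangle inequality
  is that of H for each coefficient followed by that of \<open>L2_set\<close>.\<close>

lemma seminormed_hilbert_pre_tensor:
  "seminormed (hilbert_pre_tensor :: ('h::complex_hilbert_space, 'h) tensor normed_lspace)"
  unfolding seminormed_def
proof (intro conjI ballI allI)
  show "linear_space (hilbert_pre_tensor :: ('h, 'h) tensor normed_lspace)"
    unfolding hilbert_pre_tensor_def linear_space_with_norm by auto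
  interpret abelian_monoid "HH :: (complex, ('h, 'h) tensor) module" by (rule ls_monoid) auto
  fix U :: "('h, 'h) tensor" assume U: "U \<in> carrier hilbert_pre_tensor"
  then obtain S g where S: "orthonormal S" "U = (\<Oplus>\<^bsub>HH\<^esub>e\<in>S. HHe e (g e))"
    using orthonormal_representation[of U "{}"] by (auto simp: orthonormal_def)
  show "0 \<le> nrm hilbert_pre_tensor U" using S by (simp add: nrm_hilbert_pre_tensor_sum L2_set_nonneg)
  show "nrm hilbert_pre_tensor (c \<odot>\<^bsub>hilbert_pre_tensor\<^esub> U) = cmod c * nrm hilbert_pre_tensor U" for c
  proof -
    have lin: "linear_op HH HH (\<lambda>x :: ('h, 'h) tensor. c \<odot>\<^bsub>HH\<^esub> x)"
      by (rule linear_op_smult) (auto simp: linear_op_def)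
    have "c \<odot>\<^bsub>HH\<^esub> U = (\<Oplus>\<^bsub>HH\<^esub>e\<in>S. c \<odot>\<^bsub>HH\<^esub> HHe e (g e))"
      unfolding S(2) by (rule linear_op_finsum[OF lin]) auto
    also have "\<dots> = (\<Oplus>\<^bsub>HH\<^esub>e\<in>S. HHe e (c *\<^sub>C g e))"
      by (simp only: HHe_scale)
    finally show ?thesis
      using S by (simp add: nrm_hilbert_pre_tensor_sum norm_scaleC L2_set_right_distrib)
  qed
  fix V :: "('h, 'h) tensor" assume V: "V \<in> carrier hilbert_pre_tensor"
  then obtain T k where T: "S \<subseteq> T" "orthonormal T" "V = (\<Oplus>\<^bsub>HH\<^esub>e\<in>T. HHe e (k e))"
    using orthonormal_representation[of V S] S(1) by auto
  have fin: "finite T" using T(2) by (simp add: orthonormal_def)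
  let ?g = "\<lambda>e. if e \<in> S then g e else 0"
  have U': "U = (\<Oplus>\<^bsub>HH\<^esub>e\<in>T. HHe e (?g e))"
    unfolding S(2) by (rule add.finprod_mono_neutral_cong_left[OF fin T(1)]) (auto simp: HHe_zero)
  then have "U \<oplus>\<^bsub>HH\<^esub> V = (\<Oplus>\<^bsub>HH\<^esub>e\<in>T. HHe e (?g e) \<oplus>\<^bsub>HH\<^esub> HHe e (k e))"
    unfolding T(3) by (simp add: finsum_addf del: if_split)
  also have "\<dots> = (\<Oplus>\<^bsub>HH\<^esub>e\<in>T. HHe e (?g e + k e))"
    by (simp only: HHe_add)
  finally have "nrm hilbert_pre_tensor (U \<oplus>\<^bsub>hilbert_pre_tensor\<^esub> V) = L2_set (\<lambda>e. norm (?g e + k e)) T"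
    using nrm_hilbert_pre_tensor_sum[OF T(2)] by simp
  also have "\<dots> \<le> L2_set (\<lambda>e. norm (?g e) + norm (k e)) T"
    by (intro L2_set_mono norm_triangle_ineq norm_ge_zero)
  also have "\<dots> \<le> L2_set (\<lambda>e. norm (?g e)) T + L2_set (\<lambda>e. norm (k e)) T"
    by (rule L2_set_triangle_ineq)
  finally show "nrm hilbert_pre_tensor (U \<oplus>\<^bsub>hilbert_pre_tensor\<^esub> V) \<le> nrm hilbert_pre_tensor U + nrm hilbert_pre_tensor V"
    using nrm_hilbert_pre_tensor_sum[OF T(2), of ?g] nrm_hilbert_pre_tensor_sum[OF T(2), of k] U' T(3) by simp
qed

lemma nrm_hilbert_pre_tensor_elem:
  "nrm hilbert_pre_tensor (HHe \<xi> (\<eta> :: 'h::complex_hilbert_space)) = norm \<xi> * norm \<eta>"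
  by (simp add: hilbert_pre_tensor_def hilbert_tensor_inner_elem cinner_self flip: of_real_mult)
    (simp add: real_sqrt_mult)

text \<open>The slice map <., e> \<otimes> id. In a representation over an orthonormal set that
  contains \<open>e\<close>, the slice of \<open>U\<close> is the single coefficient at
  \<open>e\<close>, and one coefficient is at most the l2 norm of all.\<close>

lemma cinner_left_contraction:
  fixes e :: "'h::complex_hilbert_space"
  assumes e: "norm e = 1"
  shows "bilinear_op hilbert_lspace hilbert_lspace hilbert_lspace (\<lambda>\<xi> \<eta>. cinner \<xi> e *\<^sub>C (\<eta>::'h))"
    "U \<in> carrier HH \<Longrightarrow> norm (tensor_lift hilbert_lspace (\<lambda>\<xi> \<eta>. cinner \<xi> e *\<^sub>C \<eta>) U) \<le> nrm hilbert_pre_tensor U"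
proof -
  show b: "bilinear_op hilbert_lspace hilbert_lspace hilbert_lspace (\<lambda>\<xi> \<eta>. cinner \<xi> e *\<^sub>C (\<eta>::'h))"
    by (intro bilinear_opI linear_op_hilbertI)
      (auto simp: cinner_add_left cinner_scaleC_left scaleC_add_left scaleC_add_right scaleC_scaleC mult.commute)
  assume "U \<in> carrier HH"
  then obtain S g where S: "{e} \<subseteq> S" "orthonormal S" "U = (\<Oplus>\<^bsub>HH\<^esub>e\<in>S. HHe e (g e))"
    using orthonormal_representation[of U "{e}"] e by (auto simp: orthonormal_def)
  have fin: "finite S" using S(2) by (simp add: orthonormal_def)
  have "tensor_lift hilbert_lspace (\<lambda>\<xi> \<eta>. cinner \<xi> e *\<^sub>C \<eta>) U = (\<Sum>e'\<in>S. cinner e' e *\<^sub>C g e')"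
    unfolding S(3)
    by (subst linear_op_finsum[OF tensor_lift_linear[OF _ _ _ b]])
      (auto simp: finsum_eq_sum tensor_lift_elem[OF _ _ _ b])
  also have "\<dots> = (\<Sum>e'\<in>S. if e' = e then g e else 0)"
    using S by (intro sum.cong) (auto simp: orthonormal_cinner)
  also have "\<dots> = g e" using S(1) fin by simp
  finally show "norm (tensor_lift hilbert_lspace (\<lambda>\<xi> \<eta>. cinner \<xi> e *\<^sub>C \<eta>) U) \<le> nrm hilbert_pre_tensor U"
    using member_le_L2_set[OF fin, of e "\<lambda>e. norm (g e)"] S nrm_hilbert_pre_tensor_sum[OF S(2), of g] by simp
qed

section \<open>The operation \<diamondsuit> on vectors and a contractive left inverse\<close>

context
  fixes \<iota> :: "'h::complex_hilbert_space hilbert_tensor \<Rightarrow> 'h"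
  assumes unitary: "isometric_isomorphism hilbert_tensor_product hilbert_lspace \<iota>"
begin

private lemma \<iota>_linear: "linear_op hilbert_tensor_product hilbert_lspace \<iota>"
  and \<iota>_bij: "bij_betw \<iota> (carrier hilbert_tensor_product) UNIV"
  and \<iota>_norm: "A \<in> carrier hilbert_tensor_product \<Longrightarrow> norm (\<iota> A) = nrm hilbert_tensor_product A"
  using unitary by (auto simp: isometric_isomorphism_def)

lemma diamond_vec_bilinear: "bilinear_op hilbert_lspace hilbert_lspace hilbert_lspace (diamond_vec \<iota>)"
proof -
  note emb = completion_embed_linear[OF seminormed_hilbert_pre_tensor, folded hilbert_tensor_product_def]
  have emb': "linear_op HH hilbert_tensor_product (completion_embed hilbert_pre_tensor)"
    by (rule linear_op_transfer[OF emb]) simp_all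
  show ?thesis
    unfolding diamond_vec_def
    by (intro bilinear_opI linear_op_comp[OF _ \<iota>_linear] linear_op_comp[OF _ emb']
        elem_tensor_linear_left elem_tensor_linear_right) auto
qed

lemma norm_diamond_vec: "norm (diamond_vec \<iota> \<xi> \<eta>) = norm \<xi> * norm \<eta>"
proof -
  have c: "HHe \<xi> \<eta> \<in> carrier hilbert_pre_tensor" by auto
  then have "completion_embed hilbert_pre_tensor (HHe \<xi> \<eta>) \<in> carrier hilbert_tensor_product"
    unfolding hilbert_tensor_product_def
    by (rule linear_opD(1)[OF completion_embed_linear[OF seminormed_hilbert_pre_tensor]])
  then show ?thesis
    using nrm_completion_embed[OF seminormed_hilbert_pre_tensor c]
    by (simp add: diamond_vec_def \<iota>_norm hilbert_tensor_product_def nrm_hilbert_pre_tensor_elem)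
qed

text \<open>The slice map at \<open>e\<close>, extended to the Hilbert tensor product and composed
  with the inverse of \<iota>. It strips the factor \<open>e\<close> off at no cost in norm, which
  makes projective representations with left factor \<open>e\<close> efficient.\<close>

lemma diamond_vec_left_inverse:
  assumes e: "norm e = 1"
  obtains a where "a \<in> bounded_operators" "onorm a \<le> 1" "\<And>\<eta>. a (diamond_vec \<iota> e \<eta>) = \<eta>"
proof -
  let ?c = "tensor_lift hilbert_lspace (\<lambda>\<xi> \<eta>. cinner \<xi> e *\<^sub>C (\<eta>::'h))"
  note b = cinner_left_contraction(1)[OF e] and le = cinner_left_contraction(2)[OF e]
  have lin: "linear_op hilbert_pre_tensor hilbert_lspace ?c"
    by (rule linear_op_transfer[OF tensor_lift_linear[OF _ _ _ b]]) auto
  obtain I where I: "linear_op (completion hilbert_pre_tensor) hilbert_lspace I"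
    "\<And>U. U \<in> carrier hilbert_pre_tensor \<Longrightarrow> I (completion_embed hilbert_pre_tensor U) = ?c U"
    "\<And>A. A \<in> carrier (completion hilbert_pre_tensor) \<Longrightarrow> norm (I A) \<le> 1 * nrm (completion hilbert_pre_tensor) A"
    using completion_extend[OF seminormed_hilbert_pre_tensor normed_space_hilbert complete_hilbert lin, of 1] le
    by (metis hilbert_lspace_simps(5) hilbert_pre_tensor_simps(1) mult_1)
  let ?HT = "hilbert_tensor_product :: 'h hilbert_tensor normed_lspace"
  note I = I[folded hilbert_tensor_product_def]
  \<comment> \<open>The inverse of \<iota>. It is linear because \<iota> is a linear bijection, and
    it preserves norms because \<iota> does.\<close>
  define j where "j = inv_into (carrier ?HT) \<iota>"
  have j: "j \<zeta> \<in> carrier ?HT" "\<iota> (j \<zeta>) = \<zeta>" for \<zeta>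
    using \<iota>_bij unfolding j_def bij_betw_def by (auto intro: inv_into_into f_inv_into_f)
  have ji: "j (\<iota> A) = A" if "A \<in> carrier ?HT" for A
    using \<iota>_bij that unfolding j_def bij_betw_def by simp
  have lsHT: "linear_space ?HT"
    unfolding hilbert_tensor_product_def by (rule linear_space_completion[OF seminormed_hilbert_pre_tensor])
  have j_add: "j (x + y) = j x \<oplus>\<^bsub>?HT\<^esub> j y" for x y
    using ji[of "j x \<oplus>\<^bsub>?HT\<^esub> j y"] j lsHT linear_opD(2)[OF \<iota>_linear, of "j x" "j y"] by simp
  have j_scale: "j (c *\<^sub>C x) = c \<odot>\<^bsub>?HT\<^esub> j x" for c x
    using ji[of "c \<odot>\<^bsub>?HT\<^esub> j x"] j lsHT linear_opD(3)[OF \<iota>_linear, of "j x" c] by simp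
  show ?thesis
  proof (rule that)
    have *: "norm (I (j x)) \<le> 1 * norm x" for x
      using I(3)[OF j(1)[of x]] \<iota>_norm[OF j(1)[of x]] j(2) by simp
    have add: "I (j (x + y)) = I (j x) + I (j y)" for x y
      using linear_opD(2)[OF I(1) j(1) j(1)] by (simp add: j_add)
    have scale: "I (j (c *\<^sub>C x)) = c *\<^sub>C I (j x)" for c x
      using linear_opD(3)[OF I(1) j(1)] by (simp add: j_scale)
    show "(\<lambda>x. I (j x)) \<in> bounded_operators" "onorm (\<lambda>x. I (j x)) \<le> 1"
      by (rule bounded_operatorsI[OF add scale *]; simp)+
    fix \<eta>
    have c: "HHe e \<eta> \<in> carrier hilbert_pre_tensor" by auto
    then have "completion_embed hilbert_pre_tensor (HHe e \<eta>) \<in> carrier ?HT"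
      unfolding hilbert_tensor_product_def
      by (rule linear_opD(1)[OF completion_embed_linear[OF seminormed_hilbert_pre_tensor]])
    then show "I (j (diamond_vec \<iota> e \<eta>)) = \<eta>"
      using I(2)[OF c] e by (simp add: diamond_vec_def ji tensor_lift_elem[OF _ _ _ b] cinner_self)
  qed
qed

end

section \<open>PL-spaces\<close>

text \<open>Tensors are cosets determined by the carrier and the linear operations alone. Attaching
  another norm to a factor therefore gives literally the same tensor product and the same
  elements.\<close>

lemma tensor_transfer:
  assumes "carrier W' = carrier W" "add W' = add W" "smult W' = smult W"
  shows "tensor_class V W' = tensor_class V W" "tensor_product V W' = tensor_product V W"
    "elem_tensor V W' = elem_tensor V W"
proof -
  have r: "tensor_relations V W' = tensor_relations V W"
    unfolding tensor_relations_def assms by (rule refl)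
  show c: "tensor_class V W' = tensor_class V W"
    by (intro ext) (simp add: tensor_class_def r)
  show "tensor_product V W' = tensor_product V W"
    unfolding tensor_product_def c assms by (rule refl)
  show "elem_tensor V W' = elem_tensor V W"
    by (intro ext) (simp add: elem_tensor_def c)
qed

lemma tensor_with_pl_norm [simp]:
  "tensor_product V (with_pl_norm W N) = tensor_product V W"
  "elem_tensor V (with_pl_norm W N) = elem_tensor V W"
  by (rule tensor_transfer; simp)+

lemma H_space_simps:
  "carrier (H_space E) = carrier (tensor_product hilbert_lspace E)"
  "zero (H_space E) = zero (tensor_product hilbert_lspace E)"
  "add (H_space E) = add (tensor_product hilbert_lspace E)"
  "smult (H_space E) = smult (tensor_product hilbert_lspace E)"
  and nrm_H_space [simp]: "nrm (H_space E) = pl_norm E"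
  by (simp_all add: H_space_def)

lemma linear_op_H_source: "linear_op (H_space E) G \<phi> \<longleftrightarrow> linear_op (tensor_product hilbert_lspace E) G \<phi>"
  and linear_op_H_target: "linear_op G (H_space E) \<psi> \<longleftrightarrow> linear_op G (tensor_product hilbert_lspace E) \<psi>"
  by (simp_all add: linear_op_def H_space_simps)

context
  fixes E :: "('h::complex_hilbert_space, 'a) pl_space"
  assumes E: "linear_space E"
begin

lemma linear_space_H [simp, intro]: "linear_space (H_space E)"
  unfolding H_space_def linear_space_with_norm using E by auto

lemma H_elem_closed [simp, intro]: "x \<in> carrier E \<Longrightarrow> H_elem E \<xi> x \<in> carrier (H_space E)"
  using E by (simp add: H_space_simps)

lemma H_elem_linear_left: "x \<in> carrier E \<Longrightarrow> linear_op hilbert_lspace (H_space E) (\<lambda>\<xi>. H_elem E \<xi> x)"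
  unfolding linear_op_H_target using E by (intro elem_tensor_linear_left) auto

lemma H_elem_linear_right: "linear_op E (H_space E) (H_elem E \<xi>)"
  unfolding linear_op_H_target using E by (intro elem_tensor_linear_right) auto

lemma H_elem_arith:
  "x \<in> carrier E \<Longrightarrow> H_elem E (\<xi> + \<eta>) x = H_elem E \<xi> x \<oplus>\<^bsub>H_space E\<^esub> H_elem E \<eta> x"
  "x \<in> carrier E \<Longrightarrow> H_elem E (c *\<^sub>C \<xi>) x = c \<odot>\<^bsub>H_space E\<^esub> H_elem E \<xi> x"
  "x \<in> carrier E \<Longrightarrow> y \<in> carrier E \<Longrightarrow> H_elem E \<xi> (x \<oplus>\<^bsub>E\<^esub> y) = H_elem E \<xi> x \<oplus>\<^bsub>H_space E\<^esub> H_elem E \<xi> y"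
  "x \<in> carrier E \<Longrightarrow> H_elem E \<xi> (c \<odot>\<^bsub>E\<^esub> x) = c \<odot>\<^bsub>H_space E\<^esub> H_elem E \<xi> x"
  using linear_opD(2,3)[OF H_elem_linear_left[of x]] linear_opD(2,3)[OF H_elem_linear_right[of \<xi>]] by auto

lemma H_elem_scale_swap: "x \<in> carrier E \<Longrightarrow> H_elem E (c *\<^sub>C (\<xi> :: 'h)) x = H_elem E \<xi> (c \<odot>\<^bsub>E\<^esub> x)"
  by (simp add: H_elem_arith)

lemma H_lift_linear:
  "linear_space G \<Longrightarrow> bilinear_op hilbert_lspace E G \<beta> \<Longrightarrow> linear_op (H_space E) G (tensor_lift G \<beta>)"
  unfolding linear_op_H_source using E by (intro tensor_lift_linear) auto

lemma H_lift_elem: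
  "linear_space G \<Longrightarrow> bilinear_op hilbert_lspace E G \<beta> \<Longrightarrow> x \<in> carrier E \<Longrightarrow>
    tensor_lift G \<beta> (H_elem E \<xi> x) = \<beta> \<xi> x"
  using E by (subst tensor_lift_elem) auto

end

lemma H_induct [consumes 2, case_names elem add]:
  fixes E :: "('h::complex_hilbert_space, 'a) pl_space"
  assumes E: "linear_space E" and u: "u \<in> carrier (H_space E)"
    and "\<And>\<xi> x. x \<in> carrier E \<Longrightarrow> P (H_elem E \<xi> x)"
    and "\<And>v w. v \<in> carrier (H_space E) \<Longrightarrow> w \<in> carrier (H_space E) \<Longrightarrow> P v \<Longrightarrow> P w \<Longrightarrow> P (v \<oplus>\<^bsub>H_space E\<^esub> w)"
  shows "P u"
  using linear_space_hilbert E u[unfolded H_space_simps]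
  by (induction rule: tensor_induct) (use assms(3,4) in \<open>auto simp: H_space_simps\<close>)

lemma H_linear_eqI:
  fixes E :: "('h::complex_hilbert_space, 'a) pl_space"
  assumes "linear_space E" "linear_op (H_space E) G \<phi>" "linear_op (H_space E) G \<psi>"
    and "\<And>\<xi> x. x \<in> carrier E \<Longrightarrow> \<phi> (H_elem E \<xi> x) = \<psi> (H_elem E \<xi> x)"
    and "u \<in> carrier (H_space E)"
  shows "\<phi> u = \<psi> u"
  using assms(1,5) by (induction rule: H_induct) (use assms in \<open>auto simp: linear_opD\<close>)

lemma op_action_linear:
  assumes E: "linear_space E" and a: "linear_op hilbert_lspace hilbert_lspace a"
  shows "linear_op (H_space E) (H_space E) (op_action E a)"
    and "x \<in> carrier E \<Longrightarrow> op_action E a (H_elem E \<xi> x) = H_elem E (a \<xi>) x"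
proof -
  have b: "bilinear_op hilbert_lspace E (H_space E) (\<lambda>\<xi> x. H_elem E (a \<xi>) x)"
    by (intro bilinear_opI linear_op_comp[OF a H_elem_linear_left] H_elem_linear_right E)
  show "linear_op (H_space E) (H_space E) (op_action E a)"
    unfolding op_action_def by (rule H_lift_linear[OF E linear_space_H[OF E] b])
  show "op_action E a (H_elem E \<xi> x) = H_elem E (a \<xi>) x" if "x \<in> carrier E"
    unfolding op_action_def using H_lift_elem[OF E linear_space_H[OF E] b that] .
qed

lemma amplification_linear:
  assumes E: "linear_space E" and F: "linear_space F" and \<phi>: "linear_op E F \<phi>"
  shows "linear_op (H_space (E :: ('h::complex_hilbert_space, 'a) pl_space)) (H_space F) (amplification F \<phi>)"
    and "x \<in> carrier E \<Longrightarrow> amplification F \<phi> (H_elem E \<xi> x) = H_elem F \<xi> (\<phi> x)"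
proof -
  have b: "bilinear_op hilbert_lspace E (H_space F) (\<lambda>\<xi> x. H_elem F \<xi> (\<phi> x))"
    by (intro bilinear_opI H_elem_linear_left[OF F] linear_op_comp[OF \<phi> H_elem_linear_right[OF F]] linear_opD(1)[OF \<phi>])
  show "linear_op (H_space E) (H_space F) (amplification F \<phi>)"
    unfolding amplification_def by (rule H_lift_linear[OF E linear_space_H[OF F] b])
  show "amplification F \<phi> (H_elem E \<xi> x) = H_elem F \<xi> (\<phi> x)" if "x \<in> carrier E"
    unfolding amplification_def using H_lift_elem[OF E linear_space_H[OF F] b that] .
qed

lemma op_action_with_pl_norm:
  "op_action (with_pl_norm V N) = op_action (with_pl_norm V N')"
  by (intro ext) (simp add: op_action_def H_space_simps
      tensor_lift_transfer[of "H_space (with_pl_norm V N)" "H_space (with_pl_norm V N')"])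

lemma underlying_simps [simp]:
  "carrier (underlying E) = carrier E" "zero (underlying E) = zero E"
  "add (underlying E) = add E" "smult (underlying E) = smult E"
  "linear_space (underlying E) = linear_space E"
  by (simp_all add: underlying_def)

text \<open>The part of the PL-space axioms that the Bochner spaces need; it does not ask the norm on
  \<open>HE\<close> to be definite.\<close>

definition cross_seminormed :: "('h::complex_hilbert_space, 'a) pl_space \<Rightarrow> bool" where
  "cross_seminormed E \<longleftrightarrow> linear_space E \<and> seminormed (H_space E) \<and> seminormed (underlying E) \<and>
     (\<forall>\<xi>. \<forall>x\<in>carrier E. pl_norm E (H_elem E \<xi> x) = norm \<xi> * nrm (underlying E) x)"

lemma cross_seminormedD:
  assumes "cross_seminormed E"
  shows "linear_space E" "seminormed (H_space E)" "seminormed (underlying E)"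
    "x \<in> carrier E \<Longrightarrow> pl_norm E (H_elem E \<xi> x) = norm \<xi> * nrm (underlying E) x"
  using assms by (auto simp: cross_seminormed_def)

text \<open>The very vector chosen in the definition of \<open>underlying\<close>.\<close>

definition unit_vector :: "'h::complex_hilbert_space" where
  "unit_vector = (SOME \<xi>. norm \<xi> = 1)"

lemma nrm_underlying:
  fixes E :: "('h::complex_hilbert_space, 'a) pl_space"
  shows "nrm (underlying E) x = pl_norm E (H_elem E (unit_vector :: 'h) x)"
  by (simp add: underlying_def unit_vector_def)

text \<open>Infinite dimension guarantees a nonzero vector: if H were zero, the empty set would be a
  finite basis. A nonzero vector can be normalized, so the choice behind \<open>underlying\<close>
  is a genuine unit vector.\<close>

lemma norm_unit_vector:
  assumes "\<nexists>B :: 'h set. finite_dimensional_vector_space scaleC B"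
  shows "norm (unit_vector :: 'h::complex_hilbert_space) = 1"
proof -
  have "\<exists>\<xi> :: 'h. \<xi> \<noteq> 0"
  proof (rule ccontr)
    assume "\<not> (\<exists>\<xi> :: 'h. \<xi> \<noteq> 0)"
    then have U: "UNIV = {0 :: 'h}" by auto
    interpret vector_space "scaleC :: complex \<Rightarrow> 'h \<Rightarrow> 'h"
      by unfold_locales (simp_all add: scaleC_add_left scaleC_add_right scaleC_scaleC)
    have "finite_dimensional_vector_space scaleC ({} :: 'h set)"
      by (intro finite_dimensional_vector_space.intro vector_space_axioms
          finite_dimensional_vector_space_axioms.intro finite.emptyI independent_empty)
        (simp only: span_empty U)
    then show False using assms by blast
  qed
  then obtain \<xi> :: 'h where "\<xi> \<noteq> 0" by blast
  then have "norm (complex_of_real (inverse (norm \<xi>)) *\<^sub>C \<xi>) = 1" by (simp add: norm_scaleC norm_inverse)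
  then show ?thesis unfolding unit_vector_def by (rule someI)
qed

context
  fixes E :: "('h::complex_hilbert_space, 'a) pl_space"
  assumes pl: "is_pl_space E" and unit: "norm (unit_vector :: 'h) = 1"
begin

private lemma E: "linear_space E" and HE: "normed_space (H_space E)"
  and act: "a \<in> bounded_operators \<Longrightarrow> u \<in> carrier (H_space E) \<Longrightarrow> pl_norm E (op_action E a u) \<le> onorm a * pl_norm E u"
  using pl by (auto simp: is_pl_space_def)

text \<open>Two rank-one operators, one taking \<open>unit_vector\<close> to \<xi> and the other
  taking \<xi> back, have norms at most that of \<xi> and its inverse. The module inequality for
  each of them gives one half of the equality.\<close>

lemma pl_norm_elem:
  assumes x: "x \<in> carrier E"
  shows "pl_norm E (H_elem E \<xi> x) = norm \<xi> * nrm (underlying E) x"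
proof -
  have le: "pl_norm E (H_elem E \<eta> x) \<le> norm \<zeta> * norm \<eta> * pl_norm E (H_elem E \<xi> x)" if "cinner \<xi> \<zeta> = 1" for \<eta> \<xi> \<zeta>
  proof -
    let ?a = "\<lambda>\<zeta>'. cinner \<zeta>' \<zeta> *\<^sub>C \<eta>"
    have nn: "0 \<le> pl_norm E (H_elem E \<xi> x)"
      using HE H_elem_closed[OF E x] by (simp add: normed_space_def)
    have "pl_norm E (H_elem E \<eta> x) = pl_norm E (op_action E ?a (H_elem E \<xi> x))"
      using op_action_linear(2)[OF E bounded_operators_linear[OF rank_one_operator(1)] x, of \<zeta> \<eta> \<xi>] that by simp
    also have "\<dots> \<le> onorm ?a * pl_norm E (H_elem E \<xi> x)"
      by (rule act[OF rank_one_operator(1) H_elem_closed[OF E x]])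
    also have "\<dots> \<le> norm \<zeta> * norm \<eta> * pl_norm E (H_elem E \<xi> x)"
      by (rule mult_right_mono[OF rank_one_operator(2) nn])
    finally show ?thesis .
  qed
  show ?thesis
  proof (cases "\<xi> = 0")
    case True
    then show ?thesis
      using linear_op_zero[OF H_elem_linear_left[OF E x]] HE E by (simp add: normed_space_def)
  next
    case False
    have "pl_norm E (H_elem E \<xi> x) \<le> norm \<xi> * nrm (underlying E) x"
      using le[of unit_vector unit_vector \<xi>] unit by (simp add: cinner_self nrm_underlying)
    moreover have "nrm (underlying E) x \<le> inverse (norm \<xi>) * pl_norm E (H_elem E \<xi> x)"
    proof -
      \<comment> \<open>The vector \<xi> divided by its squared norm pairs to 1 with \<xi>; its own
        norm is the inverse of the norm of \<xi>.\<close>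
      have "cinner \<xi> (complex_of_real (inverse ((norm \<xi>)\<^sup>2)) *\<^sub>C \<xi>) = 1"
        using False by (simp add: cinner_scaleC_right cinner_self)
      moreover have "norm (complex_of_real (inverse ((norm \<xi>)\<^sup>2)) *\<^sub>C \<xi>) = inverse (norm \<xi>)"
        using False by (simp add: norm_scaleC norm_inverse norm_power power2_eq_square norm_mult)
      ultimately show ?thesis
        using le[of \<xi> _ unit_vector] unit by (metis mult.right_neutral nrm_underlying)
    qed
    ultimately show ?thesis using False by (simp add: field_simps)
  qed
qed

lemma H_elem_unit_eq_zero:
  assumes x: "x \<in> carrier E" and z: "H_elem E (unit_vector :: 'h) x = \<zero>\<^bsub>H_space E\<^esub>"
  shows "x = \<zero>\<^bsub>E\<^esub>"
proof -
  have b: "bilinear_op hilbert_lspace E E (\<lambda>\<xi> x. cinner \<xi> (unit_vector :: 'h) \<odot>\<^bsub>E\<^esub> x)"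
    using E by (intro bilinear_opI linear_opI)
      (auto simp: cinner_add_left cinner_scaleC_left ls_distrib_left ls_distrib_right ls_smult_assoc mult.commute)
  have "x = tensor_lift E (\<lambda>\<xi> x. cinner \<xi> (unit_vector :: 'h) \<odot>\<^bsub>E\<^esub> x) (H_elem E unit_vector x)"
    using H_lift_elem[OF E E b x, of unit_vector] unit E x by (simp add: cinner_self)
  then show ?thesis
    unfolding z using linear_op_zero[OF H_lift_linear[OF E E b]] E by simp
qed

lemma normed_underlying: "normed_space (underlying E)"
proof -
  note r = linear_opD[OF H_elem_linear_right[OF E, of unit_vector]]
  note c = H_elem_closed[OF E]
  show ?thesis
    unfolding normed_space_def nrm_underlying underlying_simps
  proof (intro conjI ballI allI E)
    fix x assume x: "x \<in> carrier E"
    show "0 \<le> pl_norm E (H_elem E (unit_vector :: 'h) x)"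
      using HE c[OF x] by (simp add: normed_space_def)
    show "pl_norm E (H_elem E (unit_vector :: 'h) x) = 0 \<longleftrightarrow> x = \<zero>\<^bsub>E\<^esub>"
      using HE c[OF x] H_elem_unit_eq_zero[OF x] linear_op_zero[OF H_elem_linear_right[OF E, of unit_vector] E] E
      by (auto simp: normed_space_def)
    show "pl_norm E (H_elem E (unit_vector :: 'h) (c \<odot>\<^bsub>E\<^esub> x)) = cmod c * pl_norm E (H_elem E (unit_vector :: 'h) x)" for c
      using HE c[OF x] r(3)[OF x] by (simp add: normed_space_def)
    show "pl_norm E (H_elem E (unit_vector :: 'h) (x \<oplus>\<^bsub>E\<^esub> y)) \<le>
        pl_norm E (H_elem E (unit_vector :: 'h) x) + pl_norm E (H_elem E (unit_vector :: 'h) y)"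
      if y: "y \<in> carrier E" for y
      using HE c[OF x] c[OF y] r(2)[OF x y] by (simp add: normed_space_def)
  qed
qed

lemma cross_seminormed_pl: "cross_seminormed E"
  using E HE normed_underlying pl_norm_elem by (auto simp: cross_seminormed_def intro: normed_seminormed)

end

subsection \<open>The scalars\<close>

lemma complex_pl_simps [simp]:
  "carrier complex_pl = UNIV" "zero complex_pl = 0" "add complex_pl = (+)" "smult complex_pl = (*)"
  "linear_space (complex_pl :: ('h::complex_hilbert_space, complex) pl_space)"
  by (simp_all add: complex_pl_def linear_space_complex)

text \<open>The identification of HC with H, through which the norm of \<open>complex_pl\<close> is
  the norm of H.\<close>

definition scalar_vector :: "('h::complex_hilbert_space, complex) tensor \<Rightarrow> 'h" where
  "scalar_vector = tensor_lift hilbert_lspace (\<lambda>\<xi> c. c *\<^sub>C \<xi>)"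

lemma scalar_vector_linear:
    "linear_op (H_space complex_pl) hilbert_lspace (scalar_vector :: _ \<Rightarrow> 'h::complex_hilbert_space)"
  and scalar_vector_elem:
    "scalar_vector (H_elem (complex_pl :: ('h, complex) pl_space) \<xi> c) = c *\<^sub>C (\<xi> :: 'h)"
proof -
  have b: "bilinear_op hilbert_lspace (complex_pl :: ('h, complex) pl_space) hilbert_lspace (\<lambda>\<xi> c. c *\<^sub>C (\<xi>::'h))"
    by (intro bilinear_opI linear_opI)
      (auto simp: scaleC_add_left scaleC_add_right scaleC_scaleC mult.commute)
  show "linear_op (H_space complex_pl) hilbert_lspace (scalar_vector :: _ \<Rightarrow> 'h)"
    unfolding scalar_vector_def by (rule H_lift_linear[OF _ _ b]) auto
  show "scalar_vector (H_elem (complex_pl :: ('h, complex) pl_space) \<xi> c) = c *\<^sub>C (\<xi>::'h)"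
    unfolding scalar_vector_def by (subst H_lift_elem[OF _ _ b]) auto
qed

lemma pl_norm_complex_pl: "pl_norm complex_pl u = norm (scalar_vector u)"
  by (simp add: complex_pl_def scalar_vector_def)

lemma cross_seminormed_complex_pl:
  assumes unit: "norm (unit_vector :: 'h::complex_hilbert_space) = 1"
  shows "cross_seminormed (complex_pl :: ('h, complex) pl_space)"
    and "nrm (underlying (complex_pl :: ('h, complex) pl_space)) c = cmod c"
proof -
  have L: "linear_op (H_space complex_pl) hilbert_lspace (scalar_vector :: _ \<Rightarrow> 'h)"
    by (rule scalar_vector_linear)
  have H: "seminormed (H_space (complex_pl :: ('h, complex) pl_space))"
    using linear_opD[OF L] by (auto simp: seminormed_def pl_norm_complex_pl norm_scaleC norm_triangle_ineq)
  show n: "nrm (underlying (complex_pl :: ('h, complex) pl_space)) c = cmod c" for c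
    using unit by (simp add: nrm_underlying pl_norm_complex_pl scalar_vector_elem norm_scaleC)
  have "seminormed (underlying (complex_pl :: ('h, complex) pl_space))"
    by (auto simp: seminormed_def n norm_mult norm_triangle_ineq)
  then show "cross_seminormed (complex_pl :: ('h, complex) pl_space)"
    using H by (auto simp: cross_seminormed_def n pl_norm_complex_pl scalar_vector_elem norm_scaleC mult.commute)
qed

subsection \<open>The Bochner spaces as PL-spaces\<close>

text \<open>The counterpart of \<open>L1_map_linear\<close> with the function fixed and the operator
  varying. The two together show that pointwise applied bilinear maps are bilinear on classes, so
  that they can be lifted to tensor products.\<close>

lemma L1_map_linear_param:
  assumes V: "seminormed V" and W: "seminormed W"
    and b: "\<And>p. p \<in> carrier P \<Longrightarrow> linear_op V W (b p)" and K: "\<And>p. p \<in> carrier P \<Longrightarrow> 0 \<le> K p"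
    and le: "\<And>p x. p \<in> carrier P \<Longrightarrow> x \<in> carrier V \<Longrightarrow> nrm W (b p x) \<le> K p * nrm V x"
    and lin: "\<And>x. x \<in> carrier V \<Longrightarrow> linear_op P W (\<lambda>p. b p x)"
    and P: "linear_space P" and A: "A \<in> carrier (L1_normed M V)"
  shows "linear_op P (L1_normed M W) (\<lambda>p. L1_map M W (b p) A)"
proof -
  obtain f where f: "f \<in> L1_functions M V" "A = L1_class M V f" using A by (auto simp: L1_carrier[OF V])
  have map: "L1_map M W (b p) A = L1_class M W (\<lambda>t. b p (f t))" if "p \<in> carrier P" for p
    unfolding f(2) by (rule L1_map_class[OF V W b[OF that] K[OF that] le[OF that] f(1)])
  have L: "(\<lambda>t. b p (f t)) \<in> L1_functions M W" if "p \<in> carrier P" for p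
    by (rule L1_functions_map[OF V f(1) W b[OF that] K[OF that] le[OF that]])
  note l = linear_opD[OF lin[OF L1_functionsD(1)[OF f(1)]]]
  show ?thesis
  proof (rule linear_opI)
    fix p assume p: "p \<in> carrier P"
    show "L1_map M W (b p) A \<in> carrier (L1_normed M W)"
      unfolding map[OF p] by (rule L1_class_closed[OF W L[OF p]])
    show "L1_map M W (b (c \<odot>\<^bsub>P\<^esub> p)) A = c \<odot>\<^bsub>L1_normed M W\<^esub> L1_map M W (b p) A" for c
      unfolding map[OF p] map[OF ls_closed(2)[OF P p]] L1_smult[OF W L[OF p]]
      by (rule L1_class_eqI[OF W L[OF ls_closed(2)[OF P p]] L1_functions_smult[OF W L[OF p]]])
        (use l p in auto)
    fix q assume q: "q \<in> carrier P"
    show "L1_map M W (b (p \<oplus>\<^bsub>P\<^esub> q)) A = L1_map M W (b p) A \<oplus>\<^bsub>L1_normed M W\<^esub> L1_map M W (b q) A"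
      unfolding map[OF p] map[OF q] map[OF ls_closed(3)[OF P p q]] L1_add[OF W L[OF p] L[OF q]]
      by (rule L1_class_eqI[OF W L[OF ls_closed(3)[OF P p q]] L1_functions_add[OF W L[OF p] L[OF q]]])
        (use l p q in auto)
  qed
qed

lemma L1_space_simps [simp]:
  "carrier (L1_space M F) = carrier (L1_normed M (underlying F))"
  "zero (L1_space M F) = zero (L1_normed M (underlying F))"
  "add (L1_space M F) = add (L1_normed M (underlying F))"
  "smult (L1_space M F) = smult (L1_normed M (underlying F))"
  "linear_space (L1_space M F) = linear_space (L1_normed M (underlying F))"
  by (simp_all add: L1_space_def)

text \<open>\<open>L1_section\<close> takes \<open>\<Sum>\<xi>\<^sub>kx\<^sub>k\<close> to the \<open>HF\<close>-valued function \<open>t \<mapsto> \<Sum>\<xi>\<^sub>k(x\<^sub>k(t))\<close>.\<close>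

definition L1_section where
  "L1_section M F = tensor_lift (L1_normed M (H_space F)) (\<lambda>\<xi>. L1_map M (H_space F) (H_elem F \<xi>))"

lemma pl_norm_L1_space: "pl_norm (L1_space M F) u = nrm (L1_normed M (H_space F)) (L1_section M F u)"
  by (simp add: L1_space_def L1_section_def L1_map_def[abs_def])

context
  fixes F :: "('h::complex_hilbert_space, 'f) pl_space" and M :: "'x measure"
  assumes F: "cross_seminormed F" and unit: "norm (unit_vector :: 'h) = 1"
begin

private lemmas F' = cross_seminormedD[OF F]

lemma linear_space_L1_space: "linear_space (L1_space M F)"
  by (simp add: linear_space_L1[OF F'(3)])

lemma H_elem_linear_underlying: "linear_op (underlying F) (H_space F) (H_elem F \<xi>)"
  by (rule linear_op_transfer[OF H_elem_linear_right[OF F'(1)]]) simp_all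

lemma L1_section_linear: "linear_op (H_space (L1_space M F)) (L1_normed M (H_space F)) (L1_section M F)"
  and L1_section_elem: "A \<in> carrier (L1_normed M (underlying F)) \<Longrightarrow>
    L1_section M F (H_elem (L1_space M F) \<xi> A) = L1_map M (H_space F) (H_elem F \<xi>) A"
proof -
  have b: "bilinear_op hilbert_lspace (L1_space M F) (L1_normed M (H_space F)) (\<lambda>\<xi>. L1_map M (H_space F) (H_elem F \<xi>))"
  proof (rule bilinear_opI)
    fix A assume "A \<in> carrier (L1_space M F)"
    then show "linear_op hilbert_lspace (L1_normed M (H_space F)) (\<lambda>\<xi>. L1_map M (H_space F) (H_elem F \<xi>) A)"
      using F'(1,4) by (intro L1_map_linear_param[OF F'(3,2), where K = norm])
        (auto simp: H_elem_linear_underlying H_elem_linear_left)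
  next
    fix \<xi>
    have "linear_op (L1_normed M (underlying F)) (L1_normed M (H_space F)) (L1_map M (H_space F) (H_elem F \<xi>))"
      using F'(1,4) by (intro L1_map_linear[OF F'(3,2) H_elem_linear_underlying, where K = "norm \<xi>"]) auto
    then show "linear_op (L1_space M F) (L1_normed M (H_space F)) (L1_map M (H_space F) (H_elem F \<xi>))"
      by (rule linear_op_transfer) simp_all
  qed
  show "linear_op (H_space (L1_space M F)) (L1_normed M (H_space F)) (L1_section M F)"
    unfolding L1_section_def by (rule H_lift_linear[OF linear_space_L1_space linear_space_L1[OF F'(2)] b])
  show "L1_section M F (H_elem (L1_space M F) \<xi> A) = L1_map M (H_space F) (H_elem F \<xi>) A"
    if "A \<in> carrier (L1_normed M (underlying F))"
    unfolding L1_section_def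
    by (rule H_lift_elem[OF linear_space_L1_space linear_space_L1[OF F'(2)] b]) (simp add: that)
qed

lemma L1_map_H_elem_class:
  "f \<in> L1_functions M (underlying F) \<Longrightarrow>
    L1_map M (H_space F) (H_elem F \<xi>) (L1_class M (underlying F) f) = L1_class M (H_space F) (\<lambda>t. H_elem F \<xi> (f t))"
  "f \<in> L1_functions M (underlying F) \<Longrightarrow> (\<lambda>t. H_elem F \<xi> (f t)) \<in> L1_functions M (H_space F)"
proof -
  have le: "x \<in> carrier (underlying F) \<Longrightarrow> nrm (H_space F) (H_elem F \<xi> x) \<le> norm \<xi> * nrm (underlying F) x" for x
    using F'(4)[of x \<xi>] by simp
  assume f: "f \<in> L1_functions M (underlying F)"
  show "L1_map M (H_space F) (H_elem F \<xi>) (L1_class M (underlying F) f) = L1_class M (H_space F) (\<lambda>t. H_elem F \<xi> (f t))"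
    by (rule L1_map_class[OF F'(3,2) H_elem_linear_underlying norm_ge_zero le f])
  show "(\<lambda>t. H_elem F \<xi> (f t)) \<in> L1_functions M (H_space F)"
    by (rule L1_functions_map[OF F'(3) f F'(2) H_elem_linear_underlying norm_ge_zero le])
qed

lemma pl_norm_L1_elem:
  assumes A: "A \<in> carrier (L1_normed M (underlying F))"
  shows "pl_norm (L1_space M F) (H_elem (L1_space M F) \<xi> A) = norm \<xi> * nrm (L1_normed M (underlying F)) A"
proof -
  obtain f where f: "f \<in> L1_functions M (underlying F)" "A = L1_class M (underlying F) f"
    using A by (auto simp: L1_carrier[OF F'(3)])
  obtain h where h [measurable]: "h \<in> borel_measurable M" and h': "\<And>t. 0 \<le> (h t :: real)"
    "AE t in M. nrm (underlying F) (f t) = h t"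
    "(\<integral>\<^sup>+ t. ennreal (h t) \<partial>M) = (\<integral>\<^sup>+ t. ennreal (nrm (underlying F) (f t)) \<partial>M)"
    using L1_norm_measurable[OF F'(3) f(1)] by blast
  have e: "L1_section M F (H_elem (L1_space M F) \<xi> A) = L1_class M (H_space F) (\<lambda>t. H_elem F \<xi> (f t))"
    using L1_section_elem[OF A] L1_map_H_elem_class(1)[OF f(1)] f(2) by simp
  have "ennreal (pl_norm (L1_space M F) (H_elem (L1_space M F) \<xi> A)) =
      (\<integral>\<^sup>+ t. ennreal (pl_norm F (H_elem F \<xi> (f t))) \<partial>M)"
    using nrm_L1[OF F'(2) L1_map_H_elem_class(2)[OF f(1), of \<xi>]]
    by (simp add: pl_norm_L1_space e)
  also have "\<dots> = (\<integral>\<^sup>+ t. ennreal (norm \<xi>) * ennreal (h t) \<partial>M)"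
  proof (rule nn_integral_cong_AE)
    show "AE t in M. ennreal (pl_norm F (H_elem F \<xi> (f t))) = ennreal (norm \<xi>) * ennreal (h t)"
      using h'(2) AE_space
      by eventually_elim (use L1_functionsD(1)[OF f(1)] h'(1) in \<open>simp add: F'(4) ennreal_mult\<close>)
  qed
  also have "\<dots> = ennreal (norm \<xi> * nrm (L1_normed M (underlying F)) A)"
    using nrm_L1[OF F'(3) f(1)] nrm_L1_nonneg[OF F'(3) f(1)] h'(3) f(2)
    by (simp add: nn_integral_cmult ennreal_mult)
  finally show ?thesis
    using nrm_L1_nonneg[OF F'(2) L1_map_H_elem_class(2)[OF f(1), of \<xi>]] nrm_L1_nonneg[OF F'(3) f(1)] f(2)
    by (simp add: pl_norm_L1_space e[unfolded f(2)])
qed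

lemma nrm_underlying_L1_space:
  "A \<in> carrier (L1_normed M (underlying F)) \<Longrightarrow>
    nrm (underlying (L1_space M F)) A = nrm (L1_normed M (underlying F)) A"
  using pl_norm_L1_elem[of A unit_vector] unit by (simp add: nrm_underlying)

lemma seminormed_transfer:
  assumes "seminormed V" "carrier W = carrier V" "zero W = zero V" "add W = add V" "smult W = smult V"
    "\<And>x. x \<in> carrier V \<Longrightarrow> nrm W x = nrm V x"
  shows "seminormed W"
  using assms linear_space_transfer[OF sn_linear_space[OF assms(1)] assms(2-5)]
    sn_linear_space[OF assms(1)]
  by (simp add: seminormed_def)

text \<open>The PL-norm is the Bochner norm pulled back along the linear operator
  \<open>L1_section\<close>, and a pullback of a seminorm is a seminorm.\<close>

lemma cross_seminormed_L1_space: "cross_seminormed (L1_space M F)"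
proof -
  note L = seminormed_L1[OF F'(2), of M]
  note lin = linear_opD[OF L1_section_linear]
  have "seminormed (H_space (L1_space M F))"
    unfolding seminormed_def
    using linear_space_H[OF linear_space_L1_space] lin L
    by (auto simp: pl_norm_L1_space sn_smult[OF L] sn_triangle[OF L])
  moreover have "seminormed (underlying (L1_space M F))"
    by (rule seminormed_transfer[OF seminormed_L1[OF F'(3), of M]]) (simp_all add: nrm_underlying_L1_space)
  ultimately show ?thesis
    using linear_space_L1_space by (auto simp: cross_seminormed_def pl_norm_L1_elem nrm_underlying_L1_space)
qed

end

section \<open>The projective PL-tensor product\<close>

lemma pl_tensor_simps [simp]:
  "carrier (pl_tensor \<iota> E F) = carrier (tensor_product E F)"
  "zero (pl_tensor \<iota> E F) = zero (tensor_product E F)"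
  "add (pl_tensor \<iota> E F) = add (tensor_product E F)"
  "smult (pl_tensor \<iota> E F) = smult (tensor_product E F)"
  "pl_norm (pl_tensor \<iota> E F) = pl_tensor_norm \<iota> E F"
  "linear_space (pl_tensor \<iota> E F) = linear_space (tensor_product E F)"
  "elem_tensor V (pl_tensor \<iota> E F) = elem_tensor V (tensor_product E F)"
  "tensor_product V (pl_tensor \<iota> E F) = tensor_product V (tensor_product E F)"
  by (simp_all add: pl_tensor_def)

text \<open>The set under the infimum in the projective norm. Estimates for individual members can
  be added and compared without knowing in advance that the infimum is a seminorm.\<close>

definition pl_sums ::
    "('h::complex_hilbert_space hilbert_tensor \<Rightarrow> 'h) \<Rightarrow> ('h, 'a) pl_space \<Rightarrow> ('h, 'b) pl_space \<Rightarrow>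
     ('h, ('a, 'b) tensor) tensor \<Rightarrow> real set" where
  "pl_sums \<iota> E F U = {(\<Sum>k<n. onorm (a k) * pl_norm E (u k) * pl_norm F (v k)) | (n::nat) a u v.
     (\<forall>k<n. a k \<in> bounded_operators \<and> u k \<in> carrier (H_space E) \<and> v k \<in> carrier (H_space F)) \<and>
     U = (\<Oplus>\<^bsub>H_space (pl_tensor \<iota> E F)\<^esub>k\<in>{..<n}. op_action (pl_tensor \<iota> E F) (a k) (diamond \<iota> E F (u k) (v k)))}"

text \<open>Finite sums and the action of operators ignore the norm field, so the dummy norm in the
  definition can be replaced by the projective norm itself. This brings the general facts on
  \<open>H_space\<close> to bear.\<close>

lemma pl_tensor_norm_eq: "pl_tensor_norm \<iota> E F U = Inf (pl_sums \<iota> E F U)"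
proof -
  have "finsum (H_space (pl_tensor \<iota> E F)) = (finsum (tensor_product hilbert_lspace (tensor_product E F)) ::
      (nat \<Rightarrow> _) \<Rightarrow> _)"
    by (rule finsum_transfer) (simp_all add: H_space_simps)
  then show ?thesis
    unfolding pl_tensor_norm_def pl_sums_def Let_def
    by (simp add: pl_tensor_def op_action_with_pl_norm[of _ undefined "pl_tensor_norm \<iota> E F"])
qed

section \<open>The operation \<diamondsuit> on amplified spaces\<close>

lemma diamond_vec_linear:
  assumes "isometric_isomorphism hilbert_tensor_product hilbert_lspace \<iota>"
  shows diamond_vec_linear_left: "linear_op hilbert_lspace hilbert_lspace (\<lambda>\<xi>. diamond_vec \<iota> \<xi> \<eta>)"
    and diamond_vec_linear_right: "linear_op hilbert_lspace hilbert_lspace (diamond_vec \<iota> \<xi>)"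
  using diamond_vec_bilinear[OF assms] by (auto simp: bilinear_op_def)

context
  fixes \<iota> :: "'h::complex_hilbert_space hilbert_tensor \<Rightarrow> 'h"
    and E :: "('h, 'a) pl_space" and F :: "('h, 'b) pl_space"
  assumes unitary: "isometric_isomorphism hilbert_tensor_product hilbert_lspace \<iota>"
    and E: "linear_space E" and F: "linear_space F"
begin

private lemma T: "linear_space (pl_tensor \<iota> E F)" using E F by simp

lemma diamond_inner_bilinear:
  assumes x: "x \<in> carrier E"
  shows "bilinear_op hilbert_lspace F (H_space (pl_tensor \<iota> E F))
    (\<lambda>\<eta> y. H_elem (pl_tensor \<iota> E F) (diamond_vec \<iota> \<xi> \<eta>) (elem_tensor E F x y))"
proof (rule bilinear_opI)
  fix y assume "y \<in> carrier F"
  then have "elem_tensor E F x y \<in> carrier (pl_tensor \<iota> E F)" using x E F by simp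
  from linear_op_comp[OF diamond_vec_linear_right[OF unitary] H_elem_linear_left[OF T this]]
  show "linear_op hilbert_lspace (H_space (pl_tensor \<iota> E F))
    (\<lambda>\<eta>. H_elem (pl_tensor \<iota> E F) (diamond_vec \<iota> \<xi> \<eta>) (elem_tensor E F x y))" .
next
  fix \<eta>
  have "linear_op F (pl_tensor \<iota> E F) (elem_tensor E F x)"
    by (rule linear_op_transfer[OF elem_tensor_linear_right[OF E F x]]) simp_all
  from linear_op_comp[OF this H_elem_linear_right[OF T]]
  show "linear_op F (H_space (pl_tensor \<iota> E F))
    (\<lambda>y. H_elem (pl_tensor \<iota> E F) (diamond_vec \<iota> \<xi> \<eta>) (elem_tensor E F x y))" .
qed

lemma diamond_eq:
  "diamond \<iota> E F u v = tensor_lift (H_space (pl_tensor \<iota> E F)) (\<lambda>\<xi> x.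
     tensor_lift (H_space (pl_tensor \<iota> E F)) (\<lambda>\<eta> y.
       H_elem (pl_tensor \<iota> E F) (diamond_vec \<iota> \<xi> \<eta>) (elem_tensor E F x y)) v) u"
proof -
  have "tensor_lift (H_space (pl_tensor \<iota> E F)) = (tensor_lift (tensor_product hilbert_lspace (tensor_product E F)) ::
      ('h \<Rightarrow> 'a \<Rightarrow> _) \<Rightarrow> _)"
    by (rule tensor_lift_transfer) (simp_all add: H_space_simps)
  moreover have "tensor_lift (H_space (pl_tensor \<iota> E F)) = (tensor_lift (tensor_product hilbert_lspace (tensor_product E F)) ::
      ('h \<Rightarrow> 'b \<Rightarrow> _) \<Rightarrow> _)"
    by (rule tensor_lift_transfer) (simp_all add: H_space_simps)
  ultimately show ?thesis by (simp add: diamond_def Let_def)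
qed

lemma diamond_inner_linear:
  "x \<in> carrier E \<Longrightarrow> linear_op (H_space F) (H_space (pl_tensor \<iota> E F))
     (tensor_lift (H_space (pl_tensor \<iota> E F)) (\<lambda>\<eta> y. H_elem (pl_tensor \<iota> E F) (diamond_vec \<iota> \<xi> \<eta>) (elem_tensor E F x y)))"
  by (rule H_lift_linear[OF F linear_space_H[OF T] diamond_inner_bilinear])

lemma diamond_inner_elem:
  "x \<in> carrier E \<Longrightarrow> y \<in> carrier F \<Longrightarrow>
     tensor_lift (H_space (pl_tensor \<iota> E F)) (\<lambda>\<eta> y. H_elem (pl_tensor \<iota> E F) (diamond_vec \<iota> \<xi> \<eta>) (elem_tensor E F x y))
       (H_elem F \<eta> y) = H_elem (pl_tensor \<iota> E F) (diamond_vec \<iota> \<xi> \<eta>) (elem_tensor E F x y)"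
  by (rule H_lift_elem[OF F linear_space_H[OF T] diamond_inner_bilinear])

text \<open>The operation is a lift nested in a lift, so the outer bilinearity concerns values of
  the inner lift at an arbitrary \<open>v\<close>. Each required identity equates two linear
  functions of \<open>v\<close> and is therefore checked on elementary elements.\<close>

lemma diamond_outer_bilinear:
  assumes v: "v \<in> carrier (H_space F)"
  shows "bilinear_op hilbert_lspace E (H_space (pl_tensor \<iota> E F)) (\<lambda>\<xi> x.
     tensor_lift (H_space (pl_tensor \<iota> E F)) (\<lambda>\<eta> y.
       H_elem (pl_tensor \<iota> E F) (diamond_vec \<iota> \<xi> \<eta>) (elem_tensor E F x y)) v)"
proof -
  let ?T = "pl_tensor \<iota> E F"
  define D where "D \<xi> x = tensor_lift (H_space ?T) (\<lambda>\<eta> y. H_elem ?T (diamond_vec \<iota> \<xi> \<eta>) (elem_tensor E F x y))" for \<xi> x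
  note lin = diamond_inner_linear[folded D_def] and el = diamond_inner_elem[folded D_def]
  have HT: "linear_space (H_space ?T)" by (rule linear_space_H[OF T])
  note [simp] = linear_opD(1)[OF lin]
  have tens: "elem_tensor E F x y \<in> carrier ?T" if "x \<in> carrier E" "y \<in> carrier F" for x y using that E F by simp
  note elin = elem_tensor_linear_left[OF E F]
  have 1: "D (\<xi> + \<xi>') x v = D \<xi> x v \<oplus>\<^bsub>H_space ?T\<^esub> D \<xi>' x v" if x: "x \<in> carrier E" for \<xi> \<xi>' x
  proof (rule H_linear_eqI[OF F _ _ _ v])
    show "linear_op (H_space F) (H_space ?T) (D (\<xi> + \<xi>') x)" by (rule lin[OF x])
    show "linear_op (H_space F) (H_space ?T) (\<lambda>v. D \<xi> x v \<oplus>\<^bsub>H_space ?T\<^esub> D \<xi>' x v)"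
      by (rule linear_op_add[OF lin[OF x] lin[OF x] HT])
    fix \<eta> y assume y: "y \<in> carrier F"
    show "D (\<xi> + \<xi>') x (H_elem F \<eta> y) = D \<xi> x (H_elem F \<eta> y) \<oplus>\<^bsub>H_space ?T\<^esub> D \<xi>' x (H_elem F \<eta> y)"
      using linear_opD(2)[OF linear_op_comp[OF diamond_vec_linear_left[OF unitary, of \<eta>] H_elem_linear_left[OF T tens[OF x y]]], of \<xi> \<xi>']
      by (simp add: el[OF x y])
  qed
  have 2: "D (c *\<^sub>C \<xi>) x v = c \<odot>\<^bsub>H_space ?T\<^esub> D \<xi> x v" if x: "x \<in> carrier E" for c \<xi> x
  proof (rule H_linear_eqI[OF F _ _ _ v])
    show "linear_op (H_space F) (H_space ?T) (D (c *\<^sub>C \<xi>) x)" by (rule lin[OF x])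
    show "linear_op (H_space F) (H_space ?T) (\<lambda>v. c \<odot>\<^bsub>H_space ?T\<^esub> D \<xi> x v)"
      by (rule linear_op_smult[OF lin[OF x] HT])
    fix \<eta> y assume y: "y \<in> carrier F"
    show "D (c *\<^sub>C \<xi>) x (H_elem F \<eta> y) = c \<odot>\<^bsub>H_space ?T\<^esub> D \<xi> x (H_elem F \<eta> y)"
      using linear_opD(3)[OF linear_op_comp[OF diamond_vec_linear_left[OF unitary, of \<eta>] H_elem_linear_left[OF T tens[OF x y]]], of \<xi> c]
      by (simp add: el[OF x y])
  qed
  have 3: "D \<xi> (x \<oplus>\<^bsub>E\<^esub> x') v = D \<xi> x v \<oplus>\<^bsub>H_space ?T\<^esub> D \<xi> x' v" if x: "x \<in> carrier E" "x' \<in> carrier E" for \<xi> x x'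
  proof (rule H_linear_eqI[OF F _ _ _ v])
    have xx: "x \<oplus>\<^bsub>E\<^esub> x' \<in> carrier E" using x E by simp
    show "linear_op (H_space F) (H_space ?T) (D \<xi> (x \<oplus>\<^bsub>E\<^esub> x'))" by (rule lin[OF xx])
    show "linear_op (H_space F) (H_space ?T) (\<lambda>v. D \<xi> x v \<oplus>\<^bsub>H_space ?T\<^esub> D \<xi> x' v)"
      by (rule linear_op_add[OF lin[OF x(1)] lin[OF x(2)] HT])
    fix \<eta> y assume y: "y \<in> carrier F"
    show "D \<xi> (x \<oplus>\<^bsub>E\<^esub> x') (H_elem F \<eta> y) = D \<xi> x (H_elem F \<eta> y) \<oplus>\<^bsub>H_space ?T\<^esub> D \<xi> x' (H_elem F \<eta> y)"
      using linear_opD(2)[OF H_elem_linear_right[OF T, of "diamond_vec \<iota> \<xi> \<eta>"] tens[OF x(1) y] tens[OF x(2) y]]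
        linear_opD(2)[OF elin[OF y] x]
      by (simp add: el[OF x(1) y] el[OF x(2) y] el[OF xx y])
  qed
  have 4: "D \<xi> (c \<odot>\<^bsub>E\<^esub> x) v = c \<odot>\<^bsub>H_space ?T\<^esub> D \<xi> x v" if x: "x \<in> carrier E" for c \<xi> x
  proof (rule H_linear_eqI[OF F _ _ _ v])
    have xx: "c \<odot>\<^bsub>E\<^esub> x \<in> carrier E" using x E by simp
    show "linear_op (H_space F) (H_space ?T) (D \<xi> (c \<odot>\<^bsub>E\<^esub> x))" by (rule lin[OF xx])
    show "linear_op (H_space F) (H_space ?T) (\<lambda>v. c \<odot>\<^bsub>H_space ?T\<^esub> D \<xi> x v)"
      by (rule linear_op_smult[OF lin[OF x] HT])
    fix \<eta> y assume y: "y \<in> carrier F"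
    show "D \<xi> (c \<odot>\<^bsub>E\<^esub> x) (H_elem F \<eta> y) = c \<odot>\<^bsub>H_space ?T\<^esub> D \<xi> x (H_elem F \<eta> y)"
      using linear_opD(3)[OF H_elem_linear_right[OF T, of "diamond_vec \<iota> \<xi> \<eta>"] tens[OF x y], of c]
        linear_opD(3)[OF elin[OF y] x, of c]
      by (simp add: el[OF x y] el[OF xx y])
  qed
  show ?thesis
    unfolding D_def[symmetric]
    by (intro bilinear_opI linear_opI) (auto simp: 1 2 3 4 v)
qed

lemma diamond_linear_left:
  "v \<in> carrier (H_space F) \<Longrightarrow> linear_op (H_space E) (H_space (pl_tensor \<iota> E F)) (\<lambda>u. diamond \<iota> E F u v)"
  unfolding diamond_eq by (rule H_lift_linear[OF E linear_space_H[OF T] diamond_outer_bilinear])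

lemma diamond_elem_left:
  "v \<in> carrier (H_space F) \<Longrightarrow> x \<in> carrier E \<Longrightarrow> diamond \<iota> E F (H_elem E \<xi> x) v =
    tensor_lift (H_space (pl_tensor \<iota> E F)) (\<lambda>\<eta> y.
       H_elem (pl_tensor \<iota> E F) (diamond_vec \<iota> \<xi> \<eta>) (elem_tensor E F x y)) v"
  unfolding diamond_eq by (rule H_lift_elem[OF E linear_space_H[OF T] diamond_outer_bilinear])

lemma diamond_elem_linear:
  assumes x: "x \<in> carrier E"
  shows "linear_op (H_space F) (H_space (pl_tensor \<iota> E F)) (diamond \<iota> E F (H_elem E \<xi> x))"
  using diamond_inner_linear[OF x, of \<xi>] linear_space_H[OF F]
  by (auto simp: linear_op_def diamond_elem_left[OF _ x] Pi_iff)

lemma diamond_elem_elem: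
  "x \<in> carrier E \<Longrightarrow> y \<in> carrier F \<Longrightarrow> diamond \<iota> E F (H_elem E \<xi> x) (H_elem F \<eta> y) =
    H_elem (pl_tensor \<iota> E F) (diamond_vec \<iota> \<xi> \<eta>) (elem_tensor E F x y)"
  by (simp only: diamond_elem_left[OF H_elem_closed[OF F]] diamond_inner_elem)

lemma diamond_closed:
  "u \<in> carrier (H_space E) \<Longrightarrow> v \<in> carrier (H_space F) \<Longrightarrow>
    diamond \<iota> E F u v \<in> carrier (H_space (pl_tensor \<iota> E F))"
  by (rule linear_opD(1)[OF diamond_linear_left])

lemma op_diamond_closed:
  "a \<in> bounded_operators \<Longrightarrow> u \<in> carrier (H_space E) \<Longrightarrow> v \<in> carrier (H_space F) \<Longrightarrow>
    op_action (pl_tensor \<iota> E F) a (diamond \<iota> E F u v) \<in> carrier (H_space (pl_tensor \<iota> E F))"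
  by (rule linear_opD(1)[OF op_action_linear(1)[OF T bounded_operators_linear] diamond_closed])

section \<open>Calculus of representing sums\<close>

lemma pl_sums_zero: "0 \<in> pl_sums \<iota> E F \<zero>\<^bsub>H_space (pl_tensor \<iota> E F)\<^esub>"
proof -
  interpret abelian_monoid "H_space (pl_tensor \<iota> E F)" by (rule ls_monoid[OF linear_space_H[OF T]])
  show ?thesis unfolding pl_sums_def by (auto intro!: exI[of _ "0::nat"])
qed

lemma pl_sums_single:
  assumes "a \<in> bounded_operators" "u \<in> carrier (H_space E)" "v \<in> carrier (H_space F)"
  shows "onorm a * pl_norm E u * pl_norm F v \<in> pl_sums \<iota> E F (op_action (pl_tensor \<iota> E F) a (diamond \<iota> E F u v))"
proof -
  interpret abelian_monoid "H_space (pl_tensor \<iota> E F)" by (rule ls_monoid[OF linear_space_H[OF T]])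
  show ?thesis
    unfolding pl_sums_def
    using assms op_diamond_closed[OF assms]
    by (intro CollectI exI[of _ "1::nat"] exI[of _ "\<lambda>_. a"] exI[of _ "\<lambda>_. u"] exI[of _ "\<lambda>_. v"])
      (simp add: lessThan_Suc)
qed

text \<open>Two representations are concatenated, the indices of the second being shifted by the
  length of the first.\<close>

lemma pl_sums_add:
  assumes "r \<in> pl_sums \<iota> E F U" "s \<in> pl_sums \<iota> E F V"
  shows "r + s \<in> pl_sums \<iota> E F (U \<oplus>\<^bsub>H_space (pl_tensor \<iota> E F)\<^esub> V)"
proof -
  let ?HT = "H_space (pl_tensor \<iota> E F)"
  interpret abelian_monoid ?HT by (rule ls_monoid[OF linear_space_H[OF T]])
  obtain n a u v where 1: "r = (\<Sum>k<n::nat. onorm (a k) * pl_norm E (u k) * pl_norm F (v k))"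
    "\<And>k. k < n \<Longrightarrow> a k \<in> bounded_operators \<and> u k \<in> carrier (H_space E) \<and> v k \<in> carrier (H_space F)"
    "U = (\<Oplus>\<^bsub>?HT\<^esub>k\<in>{..<n}. op_action (pl_tensor \<iota> E F) (a k) (diamond \<iota> E F (u k) (v k)))"
    using assms(1) unfolding pl_sums_def by blast
  obtain m b x y where 2: "s = (\<Sum>k<m::nat. onorm (b k) * pl_norm E (x k) * pl_norm F (y k))"
    "\<And>k. k < m \<Longrightarrow> b k \<in> bounded_operators \<and> x k \<in> carrier (H_space E) \<and> y k \<in> carrier (H_space F)"
    "V = (\<Oplus>\<^bsub>?HT\<^esub>k\<in>{..<m}. op_action (pl_tensor \<iota> E F) (b k) (diamond \<iota> E F (x k) (y k)))"
    using assms(2) unfolding pl_sums_def by blast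
  let ?j = "\<lambda>f g k. if k < n then f k else g (k - n)"
  have split: "{..<n + m} = {..<n} \<union> (\<lambda>k. k + n) ` {..<m}"
  proof -
    have "x \<in> (\<lambda>k. k + n) ` {..<m}" if "n \<le> x" "x < n + m" for x
      by (rule image_eqI[of _ _ "x - n"]) (use that in auto)
    then show ?thesis by (auto simp: not_less[symmetric])
  qed
  have disj: "{..<n} \<inter> (\<lambda>k. k + n) ` {..<m} = {}" by auto
  have inj: "inj_on (\<lambda>k. k + n) {..<m}" by (auto intro: inj_onI)
  have 3: "r + s = (\<Sum>k<n + m. onorm (?j a b k) * pl_norm E (?j u x k) * pl_norm F (?j v y k))"
    unfolding split using disj inj by (subst sum.union_disjoint) (auto simp: sum.reindex 1(1) 2(1))
  have 4: "U \<oplus>\<^bsub>?HT\<^esub> V = (\<Oplus>\<^bsub>?HT\<^esub>k\<in>{..<n + m}. op_action (pl_tensor \<iota> E F) (?j a b k) (diamond \<iota> E F (?j u x k) (?j v y k)))"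
  proof -
    let ?f = "\<lambda>k. op_action (pl_tensor \<iota> E F) (?j a b k) (diamond \<iota> E F (?j u x k) (?j v y k))"
    have "finsum ?HT ?f {..<n + m} = finsum ?HT ?f {..<n} \<oplus>\<^bsub>?HT\<^esub> finsum ?HT ?f ((\<lambda>k. k + n) ` {..<m})"
      unfolding split using 1(2) 2(2) disj
      by (intro finsum_Un_disjoint) (auto intro!: op_diamond_closed)
    moreover have "finsum ?HT ?f {..<n} = U"
      unfolding 1(3) using 1(2) by (intro finsum_cong') (auto intro!: op_diamond_closed)
    moreover have "finsum ?HT ?f ((\<lambda>k. k + n) ` {..<m}) = (\<Oplus>\<^bsub>?HT\<^esub>k\<in>{..<m}. ?f (k + n))"
      using 2(2) inj by (intro finsum_reindex) (auto intro!: op_diamond_closed)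
    moreover have "(\<Oplus>\<^bsub>?HT\<^esub>k\<in>{..<m}. ?f (k + n)) = V"
      unfolding 2(3) using 2(2) by (intro finsum_cong') (auto intro!: op_diamond_closed)
    ultimately show ?thesis by simp
  qed
  have 5: "\<forall>k<n + m. ?j a b k \<in> bounded_operators \<and> ?j u x k \<in> carrier (H_space E) \<and> ?j v y k \<in> carrier (H_space F)"
    using 1(2) 2(2) by auto
  show ?thesis
    unfolding pl_sums_def
    by (intro CollectI exI[of _ "n + m"] exI[of _ "?j a b"] exI[of _ "?j u x"] exI[of _ "?j v y"] conjI 3 4 5)
qed

text \<open>A subadditive function bounded as required on single terms is bounded by every
  representing sum. With the L1 norm of the associated function in place of \<open>p\<close>, this
  is the easy half of the comparison of norms.\<close>

lemma pl_sums_lower_bound: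
  assumes r: "r \<in> pl_sums \<iota> E F U"
    and zero: "p \<zero>\<^bsub>H_space (pl_tensor \<iota> E F)\<^esub> \<le> (0::real)"
    and add: "\<And>U V. U \<in> carrier (H_space (pl_tensor \<iota> E F)) \<Longrightarrow> V \<in> carrier (H_space (pl_tensor \<iota> E F)) \<Longrightarrow>
      p (U \<oplus>\<^bsub>H_space (pl_tensor \<iota> E F)\<^esub> V) \<le> p U + p V"
    and single: "\<And>a u v. a \<in> bounded_operators \<Longrightarrow> u \<in> carrier (H_space E) \<Longrightarrow> v \<in> carrier (H_space F) \<Longrightarrow>
      p (op_action (pl_tensor \<iota> E F) a (diamond \<iota> E F u v)) \<le> onorm a * pl_norm E u * pl_norm F v"
  shows "p U \<le> r"
proof -
  let ?HT = "H_space (pl_tensor \<iota> E F)"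
  interpret abelian_monoid ?HT by (rule ls_monoid[OF linear_space_H[OF T]])
  obtain n a u v where 1: "r = (\<Sum>k<n::nat. onorm (a k) * pl_norm E (u k) * pl_norm F (v k))"
    "\<And>k. k < n \<Longrightarrow> a k \<in> bounded_operators \<and> u k \<in> carrier (H_space E) \<and> v k \<in> carrier (H_space F)"
    "U = (\<Oplus>\<^bsub>?HT\<^esub>k\<in>{..<n}. op_action (pl_tensor \<iota> E F) (a k) (diamond \<iota> E F (u k) (v k)))"
    using r unfolding pl_sums_def by blast
  let ?f = "\<lambda>k. op_action (pl_tensor \<iota> E F) (a k) (diamond \<iota> E F (u k) (v k))"
  have "p (finsum ?HT ?f {..<m}) \<le> (\<Sum>k<m. onorm (a k) * pl_norm E (u k) * pl_norm F (v k))" if "m \<le> n" for m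
    using that
  proof (induction m)
    case 0
    then show ?case using zero by simp
  next
    case (Suc m)
    have c: "?f k \<in> carrier ?HT" if "k < Suc m" for k
      using 1(2)[of k] that Suc(2) by (auto intro!: op_diamond_closed)
    have "finsum ?HT ?f {..<Suc m} = ?f m \<oplus>\<^bsub>?HT\<^esub> finsum ?HT ?f {..<m}"
      unfolding lessThan_Suc using c by (intro finsum_insert) auto
    then have "p (finsum ?HT ?f {..<Suc m}) \<le> p (?f m) + p (finsum ?HT ?f {..<m})"
      using c by (auto intro!: add)
    also have "p (?f m) \<le> onorm (a m) * pl_norm E (u m) * pl_norm F (v m)"
      using 1(2)[of m] Suc(2) by (intro single) auto
    finally show ?case using Suc by simp
  qed
  from this[of n] show ?thesis using 1 by simp
qed

end

text \<open>Where the exponent 1 is essential: for disjoint supports the norm is additive and not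
  merely subadditive, so the cost of a step function can be summed over disjoint pieces without
  loss.\<close>

lemma nrm_L1_disjoint:
  assumes V: "seminormed V" and f: "f \<in> L1_functions M V" and g: "g \<in> L1_functions M V"
    and disj: "\<And>t. t \<in> space M \<Longrightarrow> f t = \<zero>\<^bsub>V\<^esub> \<or> g t = \<zero>\<^bsub>V\<^esub>"
  shows "nrm (L1_normed M V) (L1_class M V (\<lambda>t. f t \<oplus>\<^bsub>V\<^esub> g t)) =
    nrm (L1_normed M V) (L1_class M V f) + nrm (L1_normed M V) (L1_class M V g)"
proof -
  note ls = sn_linear_space[OF V]
  obtain h where h [measurable]: "h \<in> borel_measurable M" and h': "\<And>t. 0 \<le> (h t :: real)" "AE t in M. nrm V (f t) = h t"
    "(\<integral>\<^sup>+ t. ennreal (h t) \<partial>M) = (\<integral>\<^sup>+ t. ennreal (nrm V (f t)) \<partial>M)"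
    using L1_norm_measurable[OF V f] by blast
  obtain k where k [measurable]: "k \<in> borel_measurable M" and k': "\<And>t. 0 \<le> (k t :: real)" "AE t in M. nrm V (g t) = k t"
    "(\<integral>\<^sup>+ t. ennreal (k t) \<partial>M) = (\<integral>\<^sup>+ t. ennreal (nrm V (g t)) \<partial>M)"
    using L1_norm_measurable[OF V g] by blast
  have "(\<integral>\<^sup>+ t. ennreal (nrm V (f t \<oplus>\<^bsub>V\<^esub> g t)) \<partial>M) = (\<integral>\<^sup>+ t. ennreal (h t) + ennreal (k t) \<partial>M)"
  proof (rule nn_integral_cong_AE)
    show "AE t in M. ennreal (nrm V (f t \<oplus>\<^bsub>V\<^esub> g t)) = ennreal (h t) + ennreal (k t)"
      using h'(2) k'(2) AE_space
    proof eventually_elim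
      case (elim t)
      have "nrm V (f t \<oplus>\<^bsub>V\<^esub> g t) = h t + k t"
        using disj[OF elim(3)] L1_functionsD(1)[OF f elim(3)] L1_functionsD(1)[OF g elim(3)] elim ls sn_zero[OF V] by auto
      then show ?case using h'(1) k'(1) by simp
    qed
  qed
  also have "\<dots> = (\<integral>\<^sup>+ t. ennreal (h t) \<partial>M) + (\<integral>\<^sup>+ t. ennreal (k t) \<partial>M)"
    by (rule nn_integral_add) auto
  finally have "ennreal (nrm (L1_normed M V) (L1_class M V (\<lambda>t. f t \<oplus>\<^bsub>V\<^esub> g t))) =
    ennreal (nrm (L1_normed M V) (L1_class M V f) + nrm (L1_normed M V) (L1_class M V g))"
    using h'(3) k'(3) nrm_L1_nonneg[OF V f] nrm_L1_nonneg[OF V g]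
    by (simp add: nrm_L1[OF V f] nrm_L1[OF V g] nrm_L1[OF V L1_functions_add[OF V f g]])
  then show ?thesis
    using nrm_L1_nonneg[OF V f] nrm_L1_nonneg[OF V g] nrm_L1_nonneg[OF V L1_functions_add[OF V f g]]
    by (simp add: ennreal_plus[symmetric] del: ennreal_plus)
qed

lemma op_action_bounded:
  assumes "is_pl_space F" "a \<in> bounded_operators" "u \<in> carrier (H_space F)"
  shows "pl_norm F (op_action F a u) \<le> onorm a * pl_norm F u"
  using assms by (simp add: is_pl_space_def)

section \<open>The tensor product with \<open>L\<^sub>1(X)\<close>\<close>

locale L1_tensor =
  fixes \<iota> :: "'h::complex_hilbert_space hilbert_tensor \<Rightarrow> 'h"
    and M :: "'x measure"
    and F :: "('h, 'f) pl_space"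
  assumes unitary: "isometric_isomorphism hilbert_tensor_product hilbert_lspace \<iota>"
    and unit: "norm (unit_vector :: 'h) = 1"
    and pl_F: "is_pl_space F"
begin

abbreviation (input) "C \<equiv> complex_pl :: ('h, complex) pl_space"
abbreviation (input) "VF \<equiv> underlying F"
abbreviation (input) "E \<equiv> L1_space M C"
abbreviation (input) "L \<equiv> L1_space M F"
abbreviation (input) "T \<equiv> pl_tensor \<iota> E F"
abbreviation (input) "HF \<equiv> H_space F"

lemma cross_C: "cross_seminormed C" and norm_C: "nrm (underlying C) c = cmod c"
  using cross_seminormed_complex_pl[OF unit] by auto

lemma cross_F: "cross_seminormed F"
  by (rule cross_seminormed_pl[OF pl_F unit])

lemmas C' = cross_seminormedD[OF cross_C] and F' = cross_seminormedD[OF cross_F]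

lemma cross_E: "cross_seminormed E" and cross_L: "cross_seminormed L"
  by (rule cross_seminormed_L1_space[OF cross_C unit], rule cross_seminormed_L1_space[OF cross_F unit])

lemmas lsE = cross_seminormedD(1)[OF cross_E] and lsF = F'(1) and lsL = cross_seminormedD(1)[OF cross_L]

lemma lsT: "linear_space T" using lsE lsF by simp

lemma lsHT: "linear_space (H_space T)" by (rule linear_space_H[OF lsT])

lemma sn_LF: "seminormed (L1_normed M HF)" by (rule seminormed_L1[OF F'(2)])

lemma sn_LC: "seminormed (L1_normed M (underlying C))" by (rule seminormed_L1[OF C'(3)])

lemma scalar_linear:
  assumes "seminormed V" "y \<in> carrier V"
  shows "linear_op (underlying C) V (\<lambda>c. c \<odot>\<^bsub>V\<^esub> y)" "nrm V (c \<odot>\<^bsub>V\<^esub> y) \<le> nrm V y * nrm (underlying C) c"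
  using assms sn_linear_space[OF assms(1)]
  by (auto intro!: linear_opI simp: ls_distrib_left ls_smult_assoc sn_smult[OF assms(1)] norm_C mult.commute)

text \<open>Pointwise application of the operator \<lambda>c. c y. With \<open>V\<close> the
  underlying space of F it is the operator of the theorem for a fixed vector; with \<open>V\<close>
  the space HF it describes the functions of tensors with one value in HF.\<close>

lemma scalar_L1:
  assumes V: "seminormed V" and y: "y \<in> carrier V"
  shows "linear_op (L1_normed M (underlying C)) (L1_normed M V) (L1_map M V (\<lambda>c. c \<odot>\<^bsub>V\<^esub> y))"
    and "z \<in> L1_functions M (underlying C) \<Longrightarrow> L1_map M V (\<lambda>c. c \<odot>\<^bsub>V\<^esub> y) (L1_class M (underlying C) z) = L1_class M V (\<lambda>t. z t \<odot>\<^bsub>V\<^esub> y)"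
    and "z \<in> L1_functions M (underlying C) \<Longrightarrow> (\<lambda>t. z t \<odot>\<^bsub>V\<^esub> y) \<in> L1_functions M V"
  using L1_map_linear[OF C'(3) V scalar_linear(1)[OF assms] sn_nonneg[OF assms] scalar_linear(2)[OF assms]]
    L1_map_class[OF C'(3) V scalar_linear(1)[OF assms] sn_nonneg[OF assms] scalar_linear(2)[OF assms]]
    L1_functions_map[OF C'(3) _ V scalar_linear(1)[OF assms] sn_nonneg[OF assms] scalar_linear(2)[OF assms]]
  by blast+

lemma scalar_L1_param:
  assumes V: "seminormed V" and Z: "Z \<in> carrier (L1_normed M (underlying C))"
  shows "linear_op V (L1_normed M V) (\<lambda>y. L1_map M V (\<lambda>c. c \<odot>\<^bsub>V\<^esub> y) Z)"
proof (rule L1_map_linear_param[OF C'(3) V _ _ _ _ sn_linear_space[OF V] Z, where K = "nrm V"])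
  show "linear_op V V (\<lambda>p. x \<odot>\<^bsub>V\<^esub> p)" for x
    by (rule linear_op_scale[OF V])
qed (use scalar_linear[OF V] sn_nonneg[OF V] in auto)

text \<open>The operator of the theorem on the algebraic tensor product, before extension to the
  completion.\<close>

definition \<phi> :: "(('x \<Rightarrow> complex) set, 'f) tensor \<Rightarrow> ('x \<Rightarrow> 'f) set" where
  "\<phi> = tensor_lift L (\<lambda>Z y. L1_map M VF (\<lambda>c. c \<odot>\<^bsub>VF\<^esub> y) Z)"

lemma \<phi>_linear: "linear_op T L \<phi>"
  and \<phi>_elem: "Z \<in> carrier E \<Longrightarrow> y \<in> carrier F \<Longrightarrow> \<phi> (elem_tensor E F Z y) = L1_map M VF (\<lambda>c. c \<odot>\<^bsub>VF\<^esub> y) Z"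
proof -
  have b: "bilinear_op E F L (\<lambda>Z y. L1_map M VF (\<lambda>c. c \<odot>\<^bsub>VF\<^esub> y) Z)"
  proof (rule bilinear_opI)
    fix y assume "y \<in> carrier F"
    then show "linear_op E L (L1_map M VF (\<lambda>c. c \<odot>\<^bsub>VF\<^esub> y))"
      by (intro linear_op_transfer[OF scalar_L1(1)[OF F'(3)]]) simp_all
  next
    fix Z assume "Z \<in> carrier E"
    then show "linear_op F L (\<lambda>y. L1_map M VF (\<lambda>c. c \<odot>\<^bsub>VF\<^esub> y) Z)"
      by (intro linear_op_transfer[OF scalar_L1_param[OF F'(3)]]) simp_all
  qed
  have "linear_op (tensor_product E F) L \<phi>"
    unfolding \<phi>_def by (rule tensor_lift_linear[OF lsE lsF lsL b])
  then show "linear_op T L \<phi>" by (rule linear_op_transfer) simp_all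
  show "\<phi> (elem_tensor E F Z y) = L1_map M VF (\<lambda>c. c \<odot>\<^bsub>VF\<^esub> y) Z" if "Z \<in> carrier E" "y \<in> carrier F"
    unfolding \<phi>_def by (rule tensor_lift_elem[OF lsE lsF lsL b that])
qed

text \<open>\<open>\<Psi> U\<close> is the \<open>HF\<close>-valued function that corresponds to \<open>U \<in> H(L\<^sub>1(X) \<otimes> F)\<close>.\<close>

definition \<Psi> where "\<Psi> U = L1_section M F (amplification L \<phi> U)"

lemma amp_linear: "linear_op (H_space T) (H_space L) (amplification L \<phi>)"
  by (rule amplification_linear(1)[OF lsT lsL \<phi>_linear])

lemma \<Psi>_linear: "linear_op (H_space T) (L1_normed M HF) \<Psi>"
  unfolding \<Psi>_def by (rule linear_op_comp[OF amp_linear L1_section_linear[OF cross_F unit]])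

lemma \<Psi>_elem:
  assumes z: "z \<in> L1_functions M (underlying C)" and y: "y \<in> carrier F"
  shows "\<Psi> (H_elem T \<xi> (elem_tensor E F (L1_class M (underlying C) z) y)) = L1_class M HF (\<lambda>t. H_elem F \<xi> (z t \<odot>\<^bsub>F\<^esub> y))"
proof -
  have y': "y \<in> carrier VF" using y by simp
  have Z: "L1_class M (underlying C) z \<in> carrier E" using L1_class_closed[OF C'(3) z] by simp
  have t: "elem_tensor E F (L1_class M (underlying C) z) y \<in> carrier T" using Z y lsE lsF by simp
  note zy = scalar_L1(3)[OF F'(3) y' z]
  have e: "\<phi> (elem_tensor E F (L1_class M (underlying C) z) y) = L1_class M VF (\<lambda>t. z t \<odot>\<^bsub>VF\<^esub> y)"
    unfolding \<phi>_elem[OF Z y] by (rule scalar_L1(2)[OF F'(3) y' z])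
  have "\<Psi> (H_elem T \<xi> (elem_tensor E F (L1_class M (underlying C) z) y)) =
      L1_section M F (H_elem L \<xi> (L1_class M VF (\<lambda>t. z t \<odot>\<^bsub>VF\<^esub> y)))"
    unfolding \<Psi>_def amplification_linear(2)[OF lsT lsL \<phi>_linear t] e by (rule refl)
  also have "\<dots> = L1_map M HF (H_elem F \<xi>) (L1_class M VF (\<lambda>t. z t \<odot>\<^bsub>VF\<^esub> y))"
    by (rule L1_section_elem[OF cross_F unit L1_class_closed[OF F'(3) zy]])
  also have "\<dots> = L1_class M HF (\<lambda>t. H_elem F \<xi> (z t \<odot>\<^bsub>VF\<^esub> y))"
    by (rule L1_map_H_elem_class(1)[OF cross_F unit zy])
  finally show ?thesis by simp
qed

text \<open>The norm that an L-isometry has to reproduce. It is the Bochner norm of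
  \<open>\<Psi> U\<close> and so subadditive on its own account; the goal is its equality with the
  projective norm.\<close>

definition section_norm where "section_norm U = pl_norm L (amplification L \<phi> U)"

lemma section_norm_eq: "section_norm U = nrm (L1_normed M HF) (\<Psi> U)"
  by (simp add: section_norm_def \<Psi>_def pl_norm_L1_space)

lemma section_norm_add: "U \<in> carrier (H_space T) \<Longrightarrow> V \<in> carrier (H_space T) \<Longrightarrow> section_norm (U \<oplus>\<^bsub>H_space T\<^esub> V) \<le> section_norm U + section_norm V"
  and section_norm_minus: "U \<in> carrier (H_space T) \<Longrightarrow> V \<in> carrier (H_space T) \<Longrightarrow> section_norm (U \<ominus>\<^bsub>H_space T\<^esub> V) \<le> section_norm U + section_norm V"
  using linear_opD[OF \<Psi>_linear] sn_triangle[OF sn_LF] sn_dist_le[OF sn_LF]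
    linear_op_minus[OF \<Psi>_linear lsHT sn_linear_space[OF sn_LF]]
  unfolding section_norm_eq by simp_all

lemma section_norm_zero: "section_norm \<zero>\<^bsub>H_space T\<^esub> = 0"
  using linear_op_zero[OF \<Psi>_linear lsHT sn_linear_space[OF sn_LF]] sn_zero[OF sn_LF] by (simp add: section_norm_eq)

subsection \<open>The norm on the tensor product dominates\<close>

lemma op_diamond_vec_linear:
  assumes v: "v \<in> carrier HF"
  shows "linear_op hilbert_lspace HF (\<lambda>\<xi>. op_action F (diamond_vec \<iota> \<xi>) v)"
proof -
  note lin = op_action_linear(1)[OF lsF diamond_vec_linear_right[OF unitary]]
    and el = op_action_linear(2)[OF lsF diamond_vec_linear_right[OF unitary]]
  note lsHF = linear_space_H[OF lsF]
  show ?thesis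
  proof (rule linear_opI)
    show "op_action F (diamond_vec \<iota> \<xi>) v \<in> carrier HF" for \<xi> by (rule linear_opD(1)[OF lin v])
    show "op_action F (diamond_vec \<iota> (\<xi> \<oplus>\<^bsub>hilbert_lspace\<^esub> \<eta>)) v =
        op_action F (diamond_vec \<iota> \<xi>) v \<oplus>\<^bsub>HF\<^esub> op_action F (diamond_vec \<iota> \<eta>) v" for \<xi> \<eta>
    proof (rule H_linear_eqI[OF lsF lin linear_op_add[OF lin lin lsHF] _ v])
      fix \<zeta> y assume y: "y \<in> carrier F"
      show "op_action F (diamond_vec \<iota> (\<xi> \<oplus>\<^bsub>hilbert_lspace\<^esub> \<eta>)) (H_elem F \<zeta> y) =
        op_action F (diamond_vec \<iota> \<xi>) (H_elem F \<zeta> y) \<oplus>\<^bsub>HF\<^esub> op_action F (diamond_vec \<iota> \<eta>) (H_elem F \<zeta> y)"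
        unfolding el[OF y]
        using linear_opD(2)[OF linear_op_comp[OF diamond_vec_linear_left[OF unitary, of \<zeta>] H_elem_linear_left[OF lsF y]], of \<xi> \<eta>]
        by simp
    qed
    show "op_action F (diamond_vec \<iota> (c \<odot>\<^bsub>hilbert_lspace\<^esub> \<xi>)) v = c \<odot>\<^bsub>HF\<^esub> op_action F (diamond_vec \<iota> \<xi>) v" for c \<xi>
    proof (rule H_linear_eqI[OF lsF lin linear_op_smult[OF lin lsHF] _ v])
      fix \<zeta> y assume y: "y \<in> carrier F"
      show "op_action F (diamond_vec \<iota> (c \<odot>\<^bsub>hilbert_lspace\<^esub> \<xi>)) (H_elem F \<zeta> y) =
        c \<odot>\<^bsub>HF\<^esub> op_action F (diamond_vec \<iota> \<xi>) (H_elem F \<zeta> y)"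
        unfolding el[OF y]
        using linear_opD(3)[OF linear_op_comp[OF diamond_vec_linear_left[OF unitary, of \<zeta>] H_elem_linear_left[OF lsF y]], of \<xi> c]
        by simp
    qed
  qed
qed

lemma diamond_vec_bounded: "diamond_vec \<iota> \<xi> \<in> bounded_operators" "onorm (diamond_vec \<iota> \<xi>) \<le> norm \<xi>"
proof -
  note l = linear_opD[OF diamond_vec_linear_right[OF unitary, of \<xi>]]
  have "norm (diamond_vec \<iota> \<xi> \<eta>) \<le> norm \<xi> * norm \<eta>" for \<eta> by (simp add: norm_diamond_vec[OF unitary])
  then show "diamond_vec \<iota> \<xi> \<in> bounded_operators" "onorm (diamond_vec \<iota> \<xi>) \<le> norm \<xi>"
    using l(2,3) by (auto intro!: bounded_operatorsI)
qed

text \<open>This is \<open>a \<sqdot> (w \<diamondsuit> v)\<close> for \<open>w\<close> in HC, read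
  as a vector of H. Writing \<diamondsuit> with a fixed left vector as the action of a bounded
  operator on \<open>v\<close> makes the module inequality of \<open>F\<close> applicable.\<close>

definition \<beta> where
  "\<beta> a v w = op_action F a (op_action F (diamond_vec \<iota> (scalar_vector w)) v)"

lemma \<beta>_linear:
  assumes a: "a \<in> bounded_operators"
  shows "v \<in> carrier HF \<Longrightarrow> linear_op (H_space C) HF (\<beta> a v)"
    and "w \<in> carrier (H_space C) \<Longrightarrow> linear_op HF HF (\<lambda>v. \<beta> a v w)"
    and "v \<in> carrier HF \<Longrightarrow> w \<in> carrier (H_space C) \<Longrightarrow> nrm HF (\<beta> a v w) \<le> (onorm a * pl_norm F v) * nrm (H_space C) w"
proof -
  note la = op_action_linear(1)[OF lsF bounded_operators_linear[OF a]]
    and lin = op_action_linear(1)[OF lsF diamond_vec_linear_right[OF unitary]]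
  show "linear_op (H_space C) HF (\<beta> a v)" if v: "v \<in> carrier HF"
    unfolding \<beta>_def
    by (rule linear_op_comp[OF linear_op_comp[OF scalar_vector_linear op_diamond_vec_linear[OF v]] la])
  show "linear_op HF HF (\<lambda>v. \<beta> a v w)"
    unfolding \<beta>_def by (rule linear_op_comp[OF lin la])
  assume v: "v \<in> carrier HF" and w: "w \<in> carrier (H_space C)"
  have a0: "0 \<le> onorm a" using a by (simp add: bounded_operators_def onorm_pos_le)
  have v0: "0 \<le> pl_norm F v" using sn_nonneg[OF F'(2) v] by simp
  have "pl_norm F (\<beta> a v w) \<le> onorm a * pl_norm F (op_action F (diamond_vec \<iota> (scalar_vector w)) v)"
    unfolding \<beta>_def by (rule op_action_bounded[OF pl_F a linear_opD(1)[OF lin v]])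
  also have "\<dots> \<le> onorm a * (onorm (diamond_vec \<iota> (scalar_vector w)) * pl_norm F v)"
    by (rule mult_left_mono[OF op_action_bounded[OF pl_F diamond_vec_bounded(1) v] a0])
  also have "\<dots> \<le> onorm a * (norm (scalar_vector w) * pl_norm F v)"
    by (intro mult_left_mono mult_right_mono diamond_vec_bounded a0 v0)
  finally show "nrm HF (\<beta> a v w) \<le> (onorm a * pl_norm F v) * nrm (H_space C) w"
    by (simp add: pl_norm_complex_pl mult_ac)
qed

text \<open>The pointwise formula t \<mapsto> \<open>a \<sqdot> (u(t) \<diamondsuit> v)\<close> for
  the function of \<open>a \<sqdot> (u \<diamondsuit> v)\<close>. Both sides are linear in
  \<open>u\<close> and, once \<open>u\<close> is elementary, in \<open>v\<close>, so elementary
  elements decide.\<close>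

lemma \<Psi>_op_diamond:
  assumes a: "a \<in> bounded_operators" and u: "u \<in> carrier (H_space E)" and v: "v \<in> carrier HF"
  shows "\<Psi> (op_action T a (diamond \<iota> E F u v)) = L1_map M HF (\<beta> a v) (L1_section M C u)"
proof -
  note \<beta>l = \<beta>_linear[OF a]
  have a0: "0 \<le> onorm a" using a by (simp add: bounded_operators_def onorm_pos_le)
  have K: "0 \<le> onorm a * pl_norm F v" if "v \<in> carrier HF" for v using sn_nonneg[OF F'(2) that] a0 by simp
  note opT = op_action_linear[OF lsT bounded_operators_linear[OF a]]
  note \<Psi>op = linear_op_comp[OF opT(1) \<Psi>_linear]
  note secC = L1_section_linear[OF cross_C unit, of M]
  have elem: "\<Psi> (op_action T a (diamond \<iota> E F (H_elem E \<xi> Z) v)) = L1_map M HF (\<beta> a v) (L1_section M C (H_elem E \<xi> Z))"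
    if Z: "Z \<in> carrier E" for \<xi> Z
  proof (rule H_linear_eqI[OF lsF _ _ _ v])
    have A: "L1_section M C (H_elem E \<xi> Z) \<in> carrier (L1_normed M (H_space C))"
      by (rule linear_opD(1)[OF secC H_elem_closed[OF lsE Z]])
    show "linear_op HF (L1_normed M HF) (\<lambda>v. \<Psi> (op_action T a (diamond \<iota> E F (H_elem E \<xi> Z) v)))"
      by (rule linear_op_comp[OF diamond_elem_linear[OF unitary lsE lsF Z] \<Psi>op])
    show "linear_op HF (L1_normed M HF) (\<lambda>v. L1_map M HF (\<beta> a v) (L1_section M C (H_elem E \<xi> Z)))"
      by (rule L1_map_linear_param[OF C'(2) F'(2) \<beta>l(1) K \<beta>l(3) \<beta>l(2) linear_space_H[OF lsF] A])
    fix \<eta> y assume y: "y \<in> carrier F"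
    obtain z where z: "z \<in> L1_functions M (underlying C)" "Z = L1_class M (underlying C) z" using Z by (auto simp: L1_carrier[OF C'(3)])
    have t: "elem_tensor E F Z y \<in> carrier T" using Z y lsE lsF by simp
    note v' = H_elem_closed[OF lsF y, of \<eta>]
    note sec = L1_map_H_elem_class[OF cross_C unit z(1), of \<xi>]
    have "\<Psi> (op_action T a (diamond \<iota> E F (H_elem E \<xi> Z) (H_elem F \<eta> y))) =
        \<Psi> (H_elem T (a (diamond_vec \<iota> \<xi> \<eta>)) (elem_tensor E F Z y))"
      unfolding diamond_elem_elem[OF unitary lsE lsF Z y] opT(2)[OF t] by (rule refl)
    also have "\<dots> = L1_class M HF (\<lambda>t. H_elem F (a (diamond_vec \<iota> \<xi> \<eta>)) (z t \<odot>\<^bsub>F\<^esub> y))"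
      unfolding z(2) by (rule \<Psi>_elem[OF z(1) y])
    \<comment> \<open>The scalar \<open>z t\<close> moves from \<open>y\<close> to the vector of H,
      passes through \<open>a\<close> and \<diamondsuit> by linearity, and ends at \<xi>, where it
      belongs to the value of the function of \<open>H_elem E \<xi> Z\<close> at
      \<open>t\<close>.\<close>
    also have "(\<lambda>t. H_elem F (a (diamond_vec \<iota> \<xi> \<eta>)) (z t \<odot>\<^bsub>F\<^esub> y)) = (\<lambda>t. \<beta> a (H_elem F \<eta> y) (H_elem C \<xi> (z t)))"
    proof
      fix t
      have "\<beta> a (H_elem F \<eta> y) (H_elem C \<xi> (z t)) = H_elem F (a (diamond_vec \<iota> (z t *\<^sub>C \<xi>) \<eta>)) y"
        unfolding \<beta>_def scalar_vector_elem op_action_linear(2)[OF lsF diamond_vec_linear_right[OF unitary] y]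
          op_action_linear(2)[OF lsF bounded_operators_linear[OF a] y] by (rule refl)
      also have "a (diamond_vec \<iota> (z t *\<^sub>C \<xi>) \<eta>) = z t *\<^sub>C a (diamond_vec \<iota> \<xi> \<eta>)"
        using linear_opD(3)[OF linear_op_comp[OF diamond_vec_linear_left[OF unitary, of \<eta>] bounded_operators_linear[OF a]], of \<xi> "z t"]
        by simp
      also have "H_elem F (z t *\<^sub>C a (diamond_vec \<iota> \<xi> \<eta>)) y = H_elem F (a (diamond_vec \<iota> \<xi> \<eta>)) (z t \<odot>\<^bsub>F\<^esub> y)"
        by (rule H_elem_scale_swap[OF lsF y])
      finally show "H_elem F (a (diamond_vec \<iota> \<xi> \<eta>)) (z t \<odot>\<^bsub>F\<^esub> y) = \<beta> a (H_elem F \<eta> y) (H_elem C \<xi> (z t))" by simp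
    qed
    also have "L1_class M HF (\<lambda>t. \<beta> a (H_elem F \<eta> y) (H_elem C \<xi> (z t))) =
        L1_map M HF (\<beta> a (H_elem F \<eta> y)) (L1_class M (H_space C) (\<lambda>t. H_elem C \<xi> (z t)))"
      by (rule L1_map_class[OF C'(2) F'(2) \<beta>l(1)[OF v'] K[OF v'] \<beta>l(3)[OF v'] sec(2), symmetric])
    also have "L1_class M (H_space C) (\<lambda>t. H_elem C \<xi> (z t)) = L1_section M C (H_elem E \<xi> Z)"
      using L1_section_elem[OF cross_C unit, of Z M \<xi>] Z sec(1) z(2) by simp
    finally show "\<Psi> (op_action T a (diamond \<iota> E F (H_elem E \<xi> Z) (H_elem F \<eta> y))) =
        L1_map M HF (\<beta> a (H_elem F \<eta> y)) (L1_section M C (H_elem E \<xi> Z))" .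
  qed
  show ?thesis
    by (rule H_linear_eqI[OF lsE linear_op_comp[OF diamond_linear_left[OF unitary lsE lsF v] \<Psi>op]
          linear_op_comp[OF secC L1_map_linear[OF C'(2) F'(2) \<beta>l(1)[OF v] K[OF v] \<beta>l(3)[OF v]]] elem u])
qed

lemma section_norm_op_diamond:
  assumes a: "a \<in> bounded_operators" and u: "u \<in> carrier (H_space E)" and v: "v \<in> carrier HF"
  shows "section_norm (op_action T a (diamond \<iota> E F u v)) \<le> onorm a * pl_norm E u * pl_norm F v"
proof -
  have a0: "0 \<le> onorm a" using a by (simp add: bounded_operators_def onorm_pos_le)
  have K: "0 \<le> onorm a * pl_norm F v" using sn_nonneg[OF F'(2) v] a0 by simp
  have "section_norm (op_action T a (diamond \<iota> E F u v)) \<le> (onorm a * pl_norm F v) * nrm (L1_normed M (H_space C)) (L1_section M C u)"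
    unfolding section_norm_eq \<Psi>_op_diamond[OF assms]
    by (rule L1_map_norm[OF C'(2) F'(2) \<beta>_linear(1)[OF a v] K \<beta>_linear(3)[OF a v]
          linear_opD(1)[OF L1_section_linear[OF cross_C unit] u]])
  then show ?thesis by (simp add: pl_norm_L1_space mult_ac)
qed

lemma section_norm_le_pl_sums:
  assumes "r \<in> pl_sums \<iota> E F U" shows "section_norm U \<le> r"
  by (rule pl_sums_lower_bound[OF unitary lsE lsF assms]) (use section_norm_zero section_norm_add section_norm_op_diamond in auto)

end

context L1_tensor
begin

subsection \<open>The norm of step functions\<close>

definition indicator_class where "indicator_class B = L1_class M (underlying C) (\<lambda>t. if t \<in> B then 1 else 0)"

abbreviation (input) "fin B \<equiv> B \<in> sets M \<and> emeasure M B < \<infinity>"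

lemma fin_Int: "fin B \<Longrightarrow> D \<in> sets M \<Longrightarrow> fin (B \<inter> D)"
  and fin_Diff: "fin B \<Longrightarrow> D \<in> sets M \<Longrightarrow> fin (B - D)"
  by (auto intro: order.strict_trans1[OF emeasure_mono[of _ B M]])

lemma indicator_L1: "fin B \<Longrightarrow> (\<lambda>t. if t \<in> B then c else 0) \<in> L1_functions M (underlying C)"
  using L1_functions_indicator[OF C'(3), of B M c] by (simp cong: if_cong)

lemma indicator_class_closed: "fin B \<Longrightarrow> indicator_class B \<in> carrier (L1_normed M (underlying C))"
  unfolding indicator_class_def by (rule L1_class_closed[OF C'(3) indicator_L1])

lemma indicator_class_union:
  assumes "fin A" "fin B" "A \<inter> B = {}"
  shows "indicator_class (A \<union> B) = indicator_class A \<oplus>\<^bsub>L1_normed M (underlying C)\<^esub> indicator_class B"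
proof -
  have "(\<lambda>t. if t \<in> A \<union> B then 1 else 0) = (\<lambda>t. (if t \<in> A then 1 else 0) \<oplus>\<^bsub>underlying C\<^esub> (if t \<in> B then 1 else 0))"
    using assms(3) by (intro ext) auto
  then show ?thesis
    unfolding indicator_class_def L1_add[OF C'(3) indicator_L1[OF assms(1)] indicator_L1[OF assms(2)]] by (simp only:)
qed

lemma nrm_indicator_class: "fin B \<Longrightarrow> nrm (L1_normed M (underlying C)) (indicator_class B) = measure M B"
  using nrm_L1_indicator[OF C'(3), of B M 1] by (simp add: indicator_class_def norm_C cong: if_cong)

text \<open>The bilinear operation that takes \<open>Z\<close> and an elementary
  \<open>\<eta>y\<close> in HF to \<eta> tensored with Z \<otimes> y. It corresponds to the
  HF-valued function t \<mapsto> \<open>z t\<close> times \<open>w\<close>, for any representative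
  \<open>z\<close> of \<open>Z\<close>.\<close>

definition H_tensor where "H_tensor Z w = amplification T (elem_tensor E F Z) w"

lemma elem_E_linear: "Z \<in> carrier E \<Longrightarrow> linear_op F T (elem_tensor E F Z)"
  by (rule linear_op_transfer[OF elem_tensor_linear_right[OF lsE lsF]]) simp_all

lemma H_tensor_linear_right: "Z \<in> carrier E \<Longrightarrow> linear_op HF (H_space T) (H_tensor Z)"
  unfolding H_tensor_def by (rule amplification_linear(1)[OF lsF lsT elem_E_linear])

lemma H_tensor_elem: "Z \<in> carrier E \<Longrightarrow> y \<in> carrier F \<Longrightarrow> H_tensor Z (H_elem F \<eta> y) = H_elem T \<eta> (elem_tensor E F Z y)"
  unfolding H_tensor_def by (rule amplification_linear(2)[OF lsF lsT elem_E_linear])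

lemma H_tensor_closed: "Z \<in> carrier E \<Longrightarrow> w \<in> carrier HF \<Longrightarrow> H_tensor Z w \<in> carrier (H_space T)"
  by (rule linear_opD(1)[OF H_tensor_linear_right])

lemma H_tensor_linear_left:
  assumes w: "w \<in> carrier HF"
  shows "linear_op E (H_space T) (\<lambda>Z. H_tensor Z w)"
proof (rule linear_opI)
  fix Z assume Z: "Z \<in> carrier E"
  show "H_tensor Z w \<in> carrier (H_space T)" by (rule H_tensor_closed[OF Z w])
  have t: "elem_tensor E F Z y \<in> carrier T" if "Z \<in> carrier E" "y \<in> carrier F" for Z y
    using that lsE lsF by simp
  show "H_tensor (c \<odot>\<^bsub>E\<^esub> Z) w = c \<odot>\<^bsub>H_space T\<^esub> H_tensor Z w" for c
  proof (rule H_linear_eqI[OF lsF H_tensor_linear_right linear_op_smult[OF H_tensor_linear_right lsHT] _ w])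
    show cZ: "c \<odot>\<^bsub>E\<^esub> Z \<in> carrier E" by (rule ls_closed(2)[OF lsE Z])
    fix \<eta> y assume y: "y \<in> carrier F"
    show "H_tensor (c \<odot>\<^bsub>E\<^esub> Z) (H_elem F \<eta> y) = c \<odot>\<^bsub>H_space T\<^esub> H_tensor Z (H_elem F \<eta> y)"
      unfolding H_tensor_elem[OF cZ y] H_tensor_elem[OF Z y] linear_opD(3)[OF elem_tensor_linear_left[OF lsE lsF y] Z]
      using linear_opD(3)[OF H_elem_linear_right[OF lsT, of \<eta>] t[OF Z y], of c] by simp
  qed (rule Z)
  fix Y assume Y: "Y \<in> carrier E"
  show "H_tensor (Z \<oplus>\<^bsub>E\<^esub> Y) w = H_tensor Z w \<oplus>\<^bsub>H_space T\<^esub> H_tensor Y w"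
  proof (rule H_linear_eqI[OF lsF H_tensor_linear_right linear_op_add[OF H_tensor_linear_right H_tensor_linear_right lsHT] _ w])
    show ZY: "Z \<oplus>\<^bsub>E\<^esub> Y \<in> carrier E" by (rule ls_closed(3)[OF lsE Z Y])
    fix \<eta> y assume y: "y \<in> carrier F"
    show "H_tensor (Z \<oplus>\<^bsub>E\<^esub> Y) (H_elem F \<eta> y) = H_tensor Z (H_elem F \<eta> y) \<oplus>\<^bsub>H_space T\<^esub> H_tensor Y (H_elem F \<eta> y)"
      unfolding H_tensor_elem[OF ZY y] H_tensor_elem[OF Z y] H_tensor_elem[OF Y y] linear_opD(2)[OF elem_tensor_linear_left[OF lsE lsF y] Z Y]
      using linear_opD(2)[OF H_elem_linear_right[OF lsT, of \<eta>] t[OF Z y] t[OF Y y]] by simp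
  qed (rule Z Y)+
qed

text \<open>A single term suffices: \<open>H_tensor Z w\<close> is
  \<open>a \<sqdot> (eZ \<diamondsuit> w)\<close> for the unit vector \<open>e\<close> and the
  contraction \<open>a\<close> that removes \<open>e\<close>. The estimate is used for the pieces of
  step functions and also for the errors of approximation.\<close>

lemma H_tensor_pl_sums:
  assumes Z: "Z \<in> carrier E" and w: "w \<in> carrier HF"
  shows "\<exists>r\<in>pl_sums \<iota> E F (H_tensor Z w). r \<le> nrm (L1_normed M (underlying C)) Z * pl_norm F w"
proof -
  obtain a where a: "a \<in> bounded_operators" "onorm a \<le> 1" "\<And>\<eta>. a (diamond_vec \<iota> unit_vector \<eta>) = \<eta>"
    using diamond_vec_left_inverse[OF unitary unit] by blast
  note opT = op_action_linear[OF lsT bounded_operators_linear[OF a(1)]]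
  have u: "H_elem E (unit_vector :: 'h) Z \<in> carrier (H_space E)" by (rule H_elem_closed[OF lsE Z])
  have eq: "H_tensor Z w = op_action T a (diamond \<iota> E F (H_elem E unit_vector Z) w)"
  proof (rule H_linear_eqI[OF lsF H_tensor_linear_right[OF Z]
        linear_op_comp[OF diamond_elem_linear[OF unitary lsE lsF Z] opT(1)] _ w])
    fix \<eta> y assume y: "y \<in> carrier F"
    have t: "elem_tensor E F Z y \<in> carrier T" using Z y lsE lsF by simp
    show "H_tensor Z (H_elem F \<eta> y) = op_action T a (diamond \<iota> E F (H_elem E unit_vector Z) (H_elem F \<eta> y))"
      unfolding diamond_elem_elem[OF unitary lsE lsF Z y] opT(2)[OF t] a(3) by (rule H_tensor_elem[OF Z y])
  qed
  have nZ: "pl_norm E (H_elem E (unit_vector :: 'h) Z) = nrm (L1_normed M (underlying C)) Z"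
    using pl_norm_L1_elem[OF cross_C unit, of Z M unit_vector] Z unit by simp
  have Z0: "0 \<le> nrm (L1_normed M (underlying C)) Z" using sn_nonneg[OF sn_LC] Z by simp
  have w0: "0 \<le> pl_norm F w" using sn_nonneg[OF F'(2) w] by simp
  have "onorm a * pl_norm E (H_elem E (unit_vector :: 'h) Z) * pl_norm F w \<le> 1 * nrm (L1_normed M (underlying C)) Z * pl_norm F w"
    unfolding nZ by (intro mult_right_mono a(2) Z0 w0)
  then show ?thesis
    using pl_sums_single[OF unitary lsE lsF a(1) u w] unfolding eq by auto
qed

lemma \<Psi>_H_tensor:
  assumes z: "z \<in> L1_functions M (underlying C)" and w: "w \<in> carrier HF"
  shows "\<Psi> (H_tensor (L1_class M (underlying C) z) w) = L1_class M HF (\<lambda>t. z t \<odot>\<^bsub>HF\<^esub> w)"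
proof -
  have Z: "L1_class M (underlying C) z \<in> carrier E" using L1_class_closed[OF C'(3) z] by simp
  have Z': "L1_class M (underlying C) z \<in> carrier (L1_normed M (underlying C))" using Z by simp
  have "\<Psi> (H_tensor (L1_class M (underlying C) z) w) = L1_map M HF (\<lambda>c. c \<odot>\<^bsub>HF\<^esub> w) (L1_class M (underlying C) z)"
  proof (rule H_linear_eqI[OF lsF linear_op_comp[OF H_tensor_linear_right[OF Z] \<Psi>_linear] scalar_L1_param[OF F'(2) Z'] _ w])
    fix \<eta> y assume y: "y \<in> carrier F"
    have "\<Psi> (H_tensor (L1_class M (underlying C) z) (H_elem F \<eta> y)) = L1_class M HF (\<lambda>t. H_elem F \<eta> (z t \<odot>\<^bsub>F\<^esub> y))"
      unfolding H_tensor_elem[OF Z y] by (rule \<Psi>_elem[OF z y])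
    also have "\<dots> = L1_class M HF (\<lambda>t. z t \<odot>\<^bsub>HF\<^esub> H_elem F \<eta> y)"
      by (simp only: H_elem_arith(4)[OF lsF y])
    also have "\<dots> = L1_map M HF (\<lambda>c. c \<odot>\<^bsub>HF\<^esub> H_elem F \<eta> y) (L1_class M (underlying C) z)"
      by (rule scalar_L1(2)[OF F'(2) H_elem_closed[OF lsF y] z, symmetric])
    finally show "\<Psi> (H_tensor (L1_class M (underlying C) z) (H_elem F \<eta> y)) =
      L1_map M HF (\<lambda>c. c \<odot>\<^bsub>HF\<^esub> H_elem F \<eta> y) (L1_class M (underlying C) z)" .
  qed
  also have "\<dots> = L1_class M HF (\<lambda>t. z t \<odot>\<^bsub>HF\<^esub> w)"
    by (rule scalar_L1(2)[OF F'(2) w z])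
  finally show ?thesis .
qed

definition indicator_tensor where "indicator_tensor B w = H_tensor (indicator_class B) w"

lemma indicator_tensor_closed: "fin B \<Longrightarrow> w \<in> carrier HF \<Longrightarrow> indicator_tensor B w \<in> carrier (H_space T)"
  unfolding indicator_tensor_def by (rule H_tensor_closed) (use indicator_class_closed in auto)

lemma indicator_tensor_union: "fin A \<Longrightarrow> fin B \<Longrightarrow> A \<inter> B = {} \<Longrightarrow> w \<in> carrier HF \<Longrightarrow> indicator_tensor (A \<union> B) w = indicator_tensor A w \<oplus>\<^bsub>H_space T\<^esub> indicator_tensor B w"
  using linear_opD(2)[OF H_tensor_linear_left, of w "indicator_class A" "indicator_class B"] indicator_class_closed
  by (simp add: indicator_tensor_def indicator_class_union)

lemma indicator_tensor_linear: "fin B \<Longrightarrow> linear_op HF (H_space T) (indicator_tensor B)"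
  unfolding indicator_tensor_def by (rule H_tensor_linear_right) (use indicator_class_closed in auto)

lemma indicator_tensor_add: "fin B \<Longrightarrow> v \<in> carrier HF \<Longrightarrow> w \<in> carrier HF \<Longrightarrow> indicator_tensor B (v \<oplus>\<^bsub>HF\<^esub> w) = indicator_tensor B v \<oplus>\<^bsub>H_space T\<^esub> indicator_tensor B w"
  by (rule linear_opD(2)[OF indicator_tensor_linear])

lemma indicator_tensor_zero: "fin B \<Longrightarrow> indicator_tensor B \<zero>\<^bsub>HF\<^esub> = \<zero>\<^bsub>H_space T\<^esub>"
  by (rule linear_op_zero[OF indicator_tensor_linear linear_space_H[OF lsF] lsHT])

lemma \<Psi>_indicator_tensor:
  assumes "fin B" "w \<in> carrier HF"
  shows "\<Psi> (indicator_tensor B w) = L1_class M HF (\<lambda>t. if t \<in> B then w else \<zero>\<^bsub>HF\<^esub>)"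
proof -
  have "(\<lambda>t. (if t \<in> B then 1 else 0) \<odot>\<^bsub>HF\<^esub> w) = (\<lambda>t. if t \<in> B then w else \<zero>\<^bsub>HF\<^esub>)"
    using linear_space_H[OF lsF] assms(2) by (intro ext) simp
  then show ?thesis
    unfolding indicator_tensor_def indicator_class_def by (simp only: \<Psi>_H_tensor[OF indicator_L1[OF assms(1)] assms(2)])
qed

text \<open>The sets in the list may overlap, as they do when lists are appended. The argument
  \<open>D\<close> restricts the step function to a subset, which is what the induction over the
  list subdivides.\<close>

fun step where
  "step [] D = \<zero>\<^bsub>H_space T\<^esub>"
| "step ((B, w) # bs) D = indicator_tensor (B \<inter> D) w \<oplus>\<^bsub>H_space T\<^esub> step bs D"

definition valid where "valid bs \<longleftrightarrow> (\<forall>(B, w)\<in>set bs. fin B \<and> w \<in> carrier HF)"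

lemma valid_simps [simp]: "valid []" "valid ((B, w) # bs) \<longleftrightarrow> fin B \<and> w \<in> carrier HF \<and> valid bs"
    "valid (bs @ cs) \<longleftrightarrow> valid bs \<and> valid cs"
  by (auto simp: valid_def)

lemma step_closed: "valid bs \<Longrightarrow> D \<in> sets M \<Longrightarrow> step bs D \<in> carrier (H_space T)"
  by (induction bs) (use lsHT indicator_tensor_closed fin_Int in auto)

lemma add_rearrange:
  assumes "linear_space V" "a \<in> carrier V" "b \<in> carrier V" "c \<in> carrier V" "d \<in> carrier V"
  shows "(a \<oplus>\<^bsub>V\<^esub> b) \<oplus>\<^bsub>V\<^esub> (c \<oplus>\<^bsub>V\<^esub> d) = (a \<oplus>\<^bsub>V\<^esub> c) \<oplus>\<^bsub>V\<^esub> (b \<oplus>\<^bsub>V\<^esub> d)"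
  using assms by (simp add: ls_assoc ls_lcomm)

lemma step_append: "valid bs \<Longrightarrow> valid cs \<Longrightarrow> D \<in> sets M \<Longrightarrow> step (bs @ cs) D = step bs D \<oplus>\<^bsub>H_space T\<^esub> step cs D"
proof (induction bs)
  case Nil
  then show ?case using step_closed[of cs D] lsHT by simp
next
  case (Cons b bs)
  obtain B w where b: "b = (B, w)" by (cases b)
  show ?case
    using Cons step_closed[of bs D] step_closed[of cs D] indicator_tensor_closed[OF fin_Int[of B D], of w]
    by (simp add: b ls_assoc[OF lsHT])
qed

lemma step_union:
  assumes "valid bs" "D1 \<in> sets M" "D2 \<in> sets M" "D1 \<inter> D2 = {}"
  shows "step bs (D1 \<union> D2) = step bs D1 \<oplus>\<^bsub>H_space T\<^esub> step bs D2"
  using assms(1)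
proof (induction bs)
  case Nil
  then show ?case using lsHT by simp
next
  case (Cons b bs)
  obtain B w where b: "b = (B, w)" by (cases b)
  have B: "fin B" "w \<in> carrier HF" "valid bs" using Cons(2) b by auto
  have "B \<inter> D1 \<inter> (B \<inter> D2) = {}" using assms(4) by blast
  then have "indicator_tensor (B \<inter> (D1 \<union> D2)) w = indicator_tensor (B \<inter> D1) w \<oplus>\<^bsub>H_space T\<^esub> indicator_tensor (B \<inter> D2) w"
    unfolding Int_Un_distrib by (rule indicator_tensor_union[OF fin_Int[OF B(1) assms(2)] fin_Int[OF B(1) assms(3)] _ B(2)])
  then show ?case
    using Cons.IH[OF B(3)] add_rearrange[OF lsHT, of "indicator_tensor (B \<inter> D1) w" "indicator_tensor (B \<inter> D2) w" "step bs D1" "step bs D2"]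
      indicator_tensor_closed[OF fin_Int[OF B(1) assms(2)] B(2)] indicator_tensor_closed[OF fin_Int[OF B(1) assms(3)] B(2)]
      step_closed[OF B(3) assms(2)] step_closed[OF B(3) assms(3)]
    by (simp add: b)
qed

lemma step_cong: "(\<And>B w. (B, w) \<in> set bs \<Longrightarrow> B \<inter> D = B \<inter> D') \<Longrightarrow> step bs D = step bs D'"
proof (induction bs)
  case (Cons b bs)
  obtain B w where b: "b = (B, w)" by (cases b)
  have "B \<inter> D = B \<inter> D'" "step bs D = step bs D'" using Cons b by auto
  then show ?case by (simp add: b)
qed simp

text \<open>Splitting \<open>D\<close> along the first set of the list replaces a common refinement of all the sets; the
  summand \<open>w\<close> carries the values collected so far.\<close>

lemma step_norm_aux:
  assumes "valid bs" "fin D" "w \<in> carrier HF"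
  shows "\<exists>g r. g \<in> L1_functions M HF \<and> \<Psi> (indicator_tensor D w \<oplus>\<^bsub>H_space T\<^esub> step bs D) = L1_class M HF g \<and>
    (\<forall>t. t \<notin> D \<longrightarrow> g t = \<zero>\<^bsub>HF\<^esub>) \<and> r \<in> pl_sums \<iota> E F (indicator_tensor D w \<oplus>\<^bsub>H_space T\<^esub> step bs D) \<and>
    r \<le> nrm (L1_normed M HF) (L1_class M HF g)"
  using assms
proof (induction bs arbitrary: D w)
  case Nil
  let ?g = "\<lambda>t. if t \<in> D then w else \<zero>\<^bsub>HF\<^esub>"
  have D: "fin D" and w: "w \<in> carrier HF" using Nil by auto
  have eq: "indicator_tensor D w \<oplus>\<^bsub>H_space T\<^esub> step [] D = indicator_tensor D w" using indicator_tensor_closed[OF D w] lsHT by simp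
  have "indicator_class D \<in> carrier E" using indicator_class_closed[OF D] by simp
  from H_tensor_pl_sums[OF this w] obtain r where r: "r \<in> pl_sums \<iota> E F (indicator_tensor D w)" "r \<le> measure M D * pl_norm F w"
    using nrm_indicator_class[OF D] by (auto simp: indicator_tensor_def)
  have "?g \<in> L1_functions M HF" by (rule L1_functions_indicator[OF F'(2)]) (use D w in auto)
  moreover have "nrm (L1_normed M HF) (L1_class M HF ?g) = measure M D * pl_norm F w"
    using nrm_L1_indicator[OF F'(2), of D M w] D w by simp
  ultimately show ?case
    unfolding eq using \<Psi>_indicator_tensor[OF D w] r by (intro exI[of _ ?g] exI[of _ r]) auto
next
  case (Cons b bs)
  obtain B v where b: "b = (B, v)" by (cases b)
  have B: "fin B" and v: "v \<in> carrier HF" and bs: "valid bs" and D: "fin D" and w: "w \<in> carrier HF"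
    using Cons(2-) b by auto
  let ?D1 = "D \<inter> B" and ?D2 = "D - B"
  note lsHF = linear_space_H[OF lsF]
  have D1: "fin ?D1" by (rule fin_Int[OF D]) (use B in simp)
  have D2: "fin ?D2" by (rule fin_Diff[OF D]) (use B in simp)
  have wv: "w \<oplus>\<^bsub>HF\<^esub> v \<in> carrier HF" by (rule ls_closed(3)[OF lsHF w v])
  let ?U1 = "indicator_tensor ?D1 (w \<oplus>\<^bsub>HF\<^esub> v) \<oplus>\<^bsub>H_space T\<^esub> step bs ?D1" and ?U2 = "indicator_tensor ?D2 w \<oplus>\<^bsub>H_space T\<^esub> step bs ?D2"
  have s1: "step bs ?D1 \<in> carrier (H_space T)" and s2: "step bs ?D2 \<in> carrier (H_space T)"
    using step_closed[OF bs] D1 D2 by auto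
  note t = indicator_tensor_closed[OF D1 w] indicator_tensor_closed[OF D1 v] indicator_tensor_closed[OF D2 w] indicator_tensor_closed[OF D1 wv]
  have U1: "?U1 \<in> carrier (H_space T)" and U2: "?U2 \<in> carrier (H_space T)" using s1 s2 t lsHT by auto
  have "indicator_tensor D w \<oplus>\<^bsub>H_space T\<^esub> step (b # bs) D = ?U1 \<oplus>\<^bsub>H_space T\<^esub> ?U2"
  proof -
    have D12: "?D1 \<union> ?D2 = D" "?D1 \<inter> ?D2 = {}" "B \<inter> D = ?D1" by auto
    have e1: "indicator_tensor D w = indicator_tensor ?D1 w \<oplus>\<^bsub>H_space T\<^esub> indicator_tensor ?D2 w"
      using indicator_tensor_union[OF D1 D2 D12(2) w] unfolding D12(1) .
    have e2: "step bs D = step bs ?D1 \<oplus>\<^bsub>H_space T\<^esub> step bs ?D2"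
      using step_union[OF bs conjunct1[OF D1] conjunct1[OF D2] D12(2)] unfolding D12(1) .
    have e3: "step (b # bs) D = indicator_tensor ?D1 v \<oplus>\<^bsub>H_space T\<^esub> step bs D" by (simp add: b D12(3))
    show ?thesis
      unfolding e3 e1 e2 indicator_tensor_add[OF D1 w v] using t s1 s2 by (simp add: ls_assoc[OF lsHT] ls_lcomm[OF lsHT] lsHT)
  qed
  note eq = this
  obtain g1 r1 where g1: "g1 \<in> L1_functions M HF" "\<Psi> ?U1 = L1_class M HF g1" "\<forall>t. t \<notin> ?D1 \<longrightarrow> g1 t = \<zero>\<^bsub>HF\<^esub>"
    "r1 \<in> pl_sums \<iota> E F ?U1" "r1 \<le> nrm (L1_normed M HF) (L1_class M HF g1)"
    using Cons.IH[OF bs D1 wv] by blast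
  obtain g2 r2 where g2: "g2 \<in> L1_functions M HF" "\<Psi> ?U2 = L1_class M HF g2" "\<forall>t. t \<notin> ?D2 \<longrightarrow> g2 t = \<zero>\<^bsub>HF\<^esub>"
    "r2 \<in> pl_sums \<iota> E F ?U2" "r2 \<le> nrm (L1_normed M HF) (L1_class M HF g2)"
    using Cons.IH[OF bs D2 w] by blast
  let ?g = "\<lambda>t. g1 t \<oplus>\<^bsub>HF\<^esub> g2 t"
  \<comment> \<open>The two functions vanish outside the intersection and outside the difference
    respectively, so their norms add. For this reason the induction records that \<open>g\<close>
    vanishes off \<open>D\<close>.\<close>
  have "nrm (L1_normed M HF) (L1_class M HF ?g) = nrm (L1_normed M HF) (L1_class M HF g1) + nrm (L1_normed M HF) (L1_class M HF g2)"
    by (rule nrm_L1_disjoint[OF F'(2) g1(1) g2(1)]) (use g1(3) g2(3) in blast)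
  moreover have "\<Psi> (?U1 \<oplus>\<^bsub>H_space T\<^esub> ?U2) = L1_class M HF ?g"
    unfolding linear_opD(2)[OF \<Psi>_linear U1 U2] g1(2) g2(2) by (rule L1_add[OF F'(2) g1(1) g2(1)])
  moreover have "\<forall>t. t \<notin> D \<longrightarrow> ?g t = \<zero>\<^bsub>HF\<^esub>" using g1(3) g2(3) lsHF by auto
  ultimately show ?case
    unfolding eq
    using L1_functions_add[OF F'(2) g1(1) g2(1)] pl_sums_add[OF unitary lsE lsF g1(4) g2(4)] g1(5) g2(5)
    by (intro exI[of _ ?g] exI[of _ "r1 + r2"]) auto
qed

text \<open>The induction over the list is started with collected value zero on a set that contains
  all sets of the list.\<close>

lemma step_norm:
  assumes bs: "valid bs"
  shows "\<exists>r\<in>pl_sums \<iota> E F (step bs (space M)). r \<le> section_norm (step bs (space M))"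
proof -
  \<comment> \<open>The whole space may have infinite measure, while the induction requires a set of
    finite measure. Restriction to the union of the listed sets leaves the step function
    unchanged.\<close>
  let ?D = "\<Union>(B, w)\<in>set bs. B"
  have D: "fin ?D"
  proof -
    have "?D \<in> sets M" using bs by (intro sets.finite_UN) (auto simp: valid_def)
    moreover have "emeasure M ?D \<le> (\<Sum>b\<in>set bs. emeasure M (fst b))"
      using emeasure_subadditive_finite[of "set bs" fst M] bs by (fastforce simp: valid_def case_prod_unfold)
    moreover have "(\<Sum>b\<in>set bs. emeasure M (fst b)) < \<infinity>"
      using bs by (auto simp: valid_def)
    ultimately show ?thesis by (auto intro: order.strict_trans1)
  qed
  note lsHF = linear_space_H[OF lsF]
  have "B \<inter> ?D = B \<inter> space M" if "(B, w) \<in> set bs" for B w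
  proof -
    have "B \<in> sets M" using bs that by (auto simp: valid_def)
    then have "B \<subseteq> space M" by (rule sets.sets_into_space)
    then show ?thesis using that by blast
  qed
  then have "step bs ?D = step bs (space M)" by (rule step_cong)
  moreover have "indicator_tensor ?D \<zero>\<^bsub>HF\<^esub> \<oplus>\<^bsub>H_space T\<^esub> step bs ?D = step bs ?D"
    using indicator_tensor_zero[OF D] step_closed[OF bs conjunct1[OF D]] lsHT by simp
  ultimately have eq: "indicator_tensor ?D \<zero>\<^bsub>HF\<^esub> \<oplus>\<^bsub>H_space T\<^esub> step bs ?D = step bs (space M)" by simp
  show ?thesis
    using step_norm_aux[OF bs D ls_closed(1)[OF lsHF]] unfolding eq section_norm_eq by auto
qed

subsection \<open>Approximation by step functions\<close>

text \<open>The remainder \<open>V\<close> is measured by a representing sum. Such a bound is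
  additive under concatenation and at the same time bounds the L1 norm of the function of
  \<open>V\<close>.\<close>

definition approx where
  "approx U \<longleftrightarrow> (\<forall>e>0. \<exists>bs V r. valid bs \<and> V \<in> carrier (H_space T) \<and> U = step bs (space M) \<oplus>\<^bsub>H_space T\<^esub> V \<and>
     r \<in> pl_sums \<iota> E F V \<and> r \<le> (e::real))"

lemma approx_add:
  assumes "approx U" "approx U'" shows "approx (U \<oplus>\<^bsub>H_space T\<^esub> U')"
  unfolding approx_def
proof (intro allI impI)
  fix e :: real assume "e > 0"
  then have e: "e / 2 > 0" by simp
  obtain bs V r where 1: "valid bs" "V \<in> carrier (H_space T)" "U = step bs (space M) \<oplus>\<^bsub>H_space T\<^esub> V"
     "r \<in> pl_sums \<iota> E F V" "r \<le> e / 2" using assms(1) e unfolding approx_def by blast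
  obtain cs W s where 2: "valid cs" "W \<in> carrier (H_space T)" "U' = step cs (space M) \<oplus>\<^bsub>H_space T\<^esub> W"
     "s \<in> pl_sums \<iota> E F W" "s \<le> e / 2" using assms(2) e unfolding approx_def by blast
  have "U \<oplus>\<^bsub>H_space T\<^esub> U' = step (bs @ cs) (space M) \<oplus>\<^bsub>H_space T\<^esub> (V \<oplus>\<^bsub>H_space T\<^esub> W)"
    unfolding 1(3) 2(3) step_append[OF 1(1) 2(1) sets.top]
    by (rule add_rearrange[OF lsHT step_closed[OF 1(1) sets.top] 1(2) step_closed[OF 2(1) sets.top] 2(2)])
  moreover have "valid (bs @ cs)" using 1 2 by simp
  moreover have "V \<oplus>\<^bsub>H_space T\<^esub> W \<in> carrier (H_space T)" by (rule ls_closed(3)[OF lsHT 1(2) 2(2)])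
  moreover have "r + s \<in> pl_sums \<iota> E F (V \<oplus>\<^bsub>H_space T\<^esub> W)" by (rule pl_sums_add[OF unitary lsE lsF 1(4) 2(4)])
  moreover have "r + s \<le> e" using 1(5) 2(5) by simp
  ultimately show "\<exists>bs V r. valid bs \<and> V \<in> carrier (H_space T) \<and> U \<oplus>\<^bsub>H_space T\<^esub> U' = step bs (space M) \<oplus>\<^bsub>H_space T\<^esub> V \<and>
     r \<in> pl_sums \<iota> E F V \<and> r \<le> e" by blast
qed

text \<open>Density of simple functions in L1(X) carries over: replacing \<open>Z\<close> by a
  nearby \<open>Y\<close> leaves the remainder \<open>H_tensor (Z - Y) w\<close>, which costs at
  most the distance times the norm of \<open>w\<close>.\<close>

lemma approx_H_tensor:
  assumes Z: "Z \<in> carrier (L1_normed M (underlying C))" and w: "w \<in> carrier HF"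
  shows "approx (H_tensor Z w)"
  using C'(3) Z
proof (induction rule: L1_induct)
  case (indicator A c)
  note lsHF = linear_space_H[OF lsF]
  have A: "fin A" using indicator by simp
  have indA: "indicator_class A \<in> carrier E" using indicator_class_closed[OF A] by simp
  have cw: "c \<odot>\<^bsub>HF\<^esub> w \<in> carrier HF" by (rule ls_closed(2)[OF lsHF w])
  have "L1_class M (underlying C) (\<lambda>t. if t \<in> A then c else \<zero>\<^bsub>underlying C\<^esub>) = c \<odot>\<^bsub>E\<^esub> indicator_class A"
  proof -
    have "(\<lambda>t. if t \<in> A then c else \<zero>\<^bsub>underlying C\<^esub>) = (\<lambda>t. c \<odot>\<^bsub>underlying C\<^esub> (if t \<in> A then 1 else 0))" by auto
    then show ?thesis
      unfolding indicator_class_def L1_space_simps L1_smult[OF C'(3) indicator_L1[OF A]] by (simp only:)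
  qed
  then have "H_tensor (L1_class M (underlying C) (\<lambda>t. if t \<in> A then c else \<zero>\<^bsub>underlying C\<^esub>)) w = indicator_tensor A (c \<odot>\<^bsub>HF\<^esub> w)"
    using linear_opD(3)[OF H_tensor_linear_left[OF w] indA, of c] linear_opD(3)[OF H_tensor_linear_right[OF indA] w, of c]
    by (simp add: indicator_tensor_def)
  also have "\<dots> = step [(A, c \<odot>\<^bsub>HF\<^esub> w)] (space M) \<oplus>\<^bsub>H_space T\<^esub> \<zero>\<^bsub>H_space T\<^esub>"
    using sets.sets_into_space[OF conjunct1[OF A]] indicator_tensor_closed[OF A cw] lsHT by (simp add: Int_absorb2)
  finally show ?case
    unfolding approx_def
    using A cw lsHT pl_sums_zero[OF unitary lsE lsF]
    by (intro allI impI exI[of _ "[(A, c \<odot>\<^bsub>HF\<^esub> w)]"] exI[of _ "\<zero>\<^bsub>H_space T\<^esub>"] exI[of _ 0]) auto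
next
  case (add Y Z)
  then show ?case using approx_add linear_opD(2)[OF H_tensor_linear_left[OF w], of Y Z] by simp
next
  case (limit Z)
  let ?N = "nrm (L1_normed M (underlying C))"
  note lsLC = sn_linear_space[OF sn_LC]
  have w0: "0 \<le> pl_norm F w" using sn_nonneg[OF F'(2) w] by simp
  show ?case
    unfolding approx_def
  proof (intro allI impI)
    fix e :: real assume e: "e > 0"
    \<comment> \<open>Adding 1 avoids a division by zero when \<open>w\<close> has norm 0. The other
      half of \<open>e\<close> is left for the approximation of \<open>H_tensor Y w\<close>.\<close>
    then have "e / 2 / (pl_norm F w + 1) > 0" using w0 by simp
    from limit(2)[OF this] obtain Y where Y: "Y \<in> carrier (L1_normed M (underlying C))" "approx (H_tensor Y w)"
      "?N (Z \<ominus>\<^bsub>L1_normed M (underlying C)\<^esub> Y) < e / 2 / (pl_norm F w + 1)" by blast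
    let ?X = "Z \<ominus>\<^bsub>L1_normed M (underlying C)\<^esub> Y"
    have X: "?X \<in> carrier (L1_normed M (underlying C))" by (rule ls_closed(4)[OF lsLC limit(1) Y(1)])
    obtain bs V r where 1: "valid bs" "V \<in> carrier (H_space T)" "H_tensor Y w = step bs (space M) \<oplus>\<^bsub>H_space T\<^esub> V"
      "r \<in> pl_sums \<iota> E F V" "r \<le> e / 2" using Y(2) e unfolding approx_def by (meson half_gt_zero)
    have X': "?X \<in> carrier E" using X by simp
    from H_tensor_pl_sums[OF X' w] obtain s where s: "s \<in> pl_sums \<iota> E F (H_tensor ?X w)" "s \<le> ?N ?X * pl_norm F w" by blast
    have "?N ?X * pl_norm F w \<le> e / 2 / (pl_norm F w + 1) * (pl_norm F w + 1)"
      using Y(3) w0 sn_nonneg[OF sn_LC X] by (intro mult_mono) auto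
    also have "\<dots> = e / 2"
    proof -
      have "pl_norm F w + 1 \<noteq> 0" using w0 by simp
      from nonzero_divide_eq_eq[OF this, THEN iffD1, OF refl] show ?thesis by (rule sym)
    qed
    finally have s2: "s \<le> e / 2" using s(2) by simp
    have "H_tensor Z w = H_tensor Y w \<oplus>\<^bsub>H_space T\<^esub> H_tensor ?X w"
      using linear_opD(2)[OF H_tensor_linear_left[OF w], of Y ?X] Y(1) X ls_add_minus[OF lsLC limit(1) Y(1)] by simp
    then have "H_tensor Z w = step bs (space M) \<oplus>\<^bsub>H_space T\<^esub> (V \<oplus>\<^bsub>H_space T\<^esub> H_tensor ?X w)"
      unfolding 1(3) using ls_assoc[OF lsHT step_closed[OF 1(1) sets.top] 1(2) H_tensor_closed[OF X' w]] by simp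
    moreover have "V \<oplus>\<^bsub>H_space T\<^esub> H_tensor ?X w \<in> carrier (H_space T)" by (rule ls_closed(3)[OF lsHT 1(2) H_tensor_closed[OF X' w]])
    moreover have "r + s \<in> pl_sums \<iota> E F (V \<oplus>\<^bsub>H_space T\<^esub> H_tensor ?X w)" by (rule pl_sums_add[OF unitary lsE lsF 1(4) s(1)])
    moreover have "r + s \<le> e" using 1(5) s2 by simp
    ultimately show "\<exists>bs V r. valid bs \<and> V \<in> carrier (H_space T) \<and> H_tensor Z w = step bs (space M) \<oplus>\<^bsub>H_space T\<^esub> V \<and>
      r \<in> pl_sums \<iota> E F V \<and> r \<le> e" using 1(1) by blast
  qed
qed

lemma approx_all:
  assumes U: "U \<in> carrier (H_space T)"
  shows "approx U"
  using lsT U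
proof (induction rule: H_induct)
  case (elem \<xi> W)
  have W: "W \<in> carrier (tensor_product E F)" using elem by simp
  show ?case
    using lsE lsF W
  proof (induction rule: tensor_induct)
    case (elem Z y)
    then show ?case
      using approx_H_tensor[of Z "H_elem F \<xi> y"] H_tensor_elem[of Z y \<xi>] H_elem_closed[OF lsF, of y \<xi>] by simp
  next
    case (add A B)
    then show ?case
      using approx_add linear_opD(2)[OF H_elem_linear_right[OF lsT, of \<xi>], of A B] by simp
  qed
next
  case (add v w)
  then show ?case using approx_add by simp
qed

text \<open>For a step function with remainder \<open>V\<close>, the projective cost of the step
  part is at most its L1 norm, and the step part is \<open>U - V\<close>. So the cost of
  \<open>U\<close> exceeds the L1 norm of \<open>U\<close> by no more than what \<open>V\<close>
  contributes, which is arbitrarily small.\<close>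

theorem pl_tensor_norm_eq_section_norm:
  assumes U: "U \<in> carrier (H_space T)"
  shows "pl_tensor_norm \<iota> E F U = section_norm U"
  unfolding pl_tensor_norm_eq
proof (rule antisym)
  \<comment> \<open>The remainder is paid for twice, once in its own representing sum and once in
    passing from the L1 norm of the step part to that of \<open>U\<close>; hence half of
    \<open>e\<close>.\<close>
  have near: "\<exists>r\<in>pl_sums \<iota> E F U. r \<le> section_norm U + e" if e: "e > 0" for e
  proof -
    have "e / 2 > 0" using e by simp
    then obtain bs V s where 1: "valid bs" "V \<in> carrier (H_space T)" "U = step bs (space M) \<oplus>\<^bsub>H_space T\<^esub> V"
      "s \<in> pl_sums \<iota> E F V" "s \<le> e / 2" using approx_all[OF U] unfolding approx_def by blast
    obtain r where r: "r \<in> pl_sums \<iota> E F (step bs (space M))" "r \<le> section_norm (step bs (space M))"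
      using step_norm[OF 1(1)] by blast
    note c = step_closed[OF 1(1) sets.top]
    have "step bs (space M) = U \<ominus>\<^bsub>H_space T\<^esub> V"
      unfolding 1(3) ls_comm[OF lsHT c 1(2)] by (rule ls_add_minus_cancel[OF lsHT 1(2) c, symmetric])
    then have "section_norm (step bs (space M)) \<le> section_norm U + section_norm V" using section_norm_minus[OF U 1(2)] by simp
    also have "section_norm V \<le> s" by (rule section_norm_le_pl_sums[OF 1(4)])
    finally have "r + s \<le> section_norm U + e" using r(2) 1(5) by simp
    then show ?thesis using pl_sums_add[OF unitary lsE lsF r(1) 1(4)] unfolding 1(3) by blast
  qed
  have bdd: "bdd_below (pl_sums \<iota> E F U)" by (intro bdd_belowI[of _ "section_norm U"] section_norm_le_pl_sums)
  show "Inf (pl_sums \<iota> E F U) \<le> section_norm U"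
  proof (rule field_le_epsilon)
    fix e :: real assume "e > 0"
    from near[OF this] obtain r where "r \<in> pl_sums \<iota> E F U" "r \<le> section_norm U + e" by blast
    then show "Inf (pl_sums \<iota> E F U) \<le> section_norm U + e" using cInf_lower[OF _ bdd] by force
  qed
  \<comment> \<open>The use of \<open>near\<close> with 1 supplies a representing sum, so that the
    infimum is over a nonempty set.\<close>
  show "section_norm U \<le> Inf (pl_sums \<iota> E F U)"
    using near[of 1] section_norm_le_pl_sums by (intro cInf_greatest) auto
qed

end

section \<open>Completions of PL-spaces\<close>

text \<open>A class of norm 0 consists of sequences whose norms tend to 0, and these form the zero
  class.\<close>

lemma normed_completion:
  assumes V: "seminormed V"
  shows "normed_space (completion V)"
proof -
  have "A = \<zero>\<^bsub>completion V\<^esub>" if A: "A \<in> carrier (completion V)" and 0: "nrm (completion V) A = 0" for A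
  proof -
    note ls = sn_linear_space[OF V]
    obtain x where x: "x \<in> cauchy_seqs V" "A = completion_class V x" using A by (auto simp: completion_carrier[OF V])
    note xc = cauchy_seqs_carrier[OF V x(1)]
    have "(\<lambda>n. nrm V (x n \<ominus>\<^bsub>V\<^esub> \<zero>\<^bsub>V\<^esub>)) \<longlonglongrightarrow> 0"
      using nrm_completion_lim[OF V x(1)] 0 x(2) xc ls by (simp add: ls_minus)
    from completion_class_eqI[OF V x(1) cauchy_seqs_const[OF V ls_closed(1)[OF ls]] this]
    show ?thesis by (simp add: x(2) completion_def)
  qed
  then show ?thesis
    using seminormed_completion[OF V] sn_zero[OF seminormed_completion[OF V]]
    unfolding normed_space_def seminormed_def by blast
qed

lemma tends_in_cauchy_seqs:
  assumes V: "seminormed V" and x: "\<And>n. x n \<in> carrier V" and l: "l \<in> carrier V" "tends_in V x l"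
  shows "x \<in> cauchy_seqs V"
  unfolding cauchy_seqs_def
proof (intro CollectI conjI allI impI x)
  fix e :: real assume "e > 0"
  then have "e / 2 > 0" by simp
  then have "\<forall>\<^sub>F n in sequentially. nrm V (x n \<ominus>\<^bsub>V\<^esub> l) < e / 2"
    using l(2) unfolding tends_in_def by (rule order_tendstoD(2)[rotated])
  then obtain N where N: "\<And>n. n \<ge> N \<Longrightarrow> nrm V (x n \<ominus>\<^bsub>V\<^esub> l) < e / 2" by (auto simp: eventually_sequentially)
  have "nrm V (x m \<ominus>\<^bsub>V\<^esub> x n) < e" if "m \<ge> N" "n \<ge> N" for m n
    using sn_dist_triangle[OF V x[of m] l(1) x[of n]] sn_dist_commute[OF V l(1) x[of n]] N[OF that(1)] N[OF that(2)]
    by simp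
  then show "\<exists>N. \<forall>m\<ge>N. \<forall>n\<ge>N. nrm V (x m \<ominus>\<^bsub>V\<^esub> x n) < e" by blast
qed

lemma pl_completion_simps [simp]:
  "carrier (pl_completion T) = carrier (completion (underlying T))"
  "zero (pl_completion T) = zero (completion (underlying T))"
  "add (pl_completion T) = add (completion (underlying T))"
  "smult (pl_completion T) = smult (completion (underlying T))"
  "linear_space (pl_completion T) = linear_space (completion (underlying T))"
  by (simp_all add: pl_completion_def)

text \<open>The natural map of H of the completion into the completion of \<open>H_space T\<close>,
  along which the PL-norm of the completion is pulled back.\<close>

definition H_completion where
  "H_completion T = tensor_lift (completion (H_space T))
     (\<lambda>\<xi> A. \<Union>x\<in>A. completion_class (H_space T) (\<lambda>n. H_elem T \<xi> (x n)))"

lemma pl_norm_pl_completion: "pl_norm (pl_completion T) u = nrm (completion (H_space T)) (H_completion T u)"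
  by (simp add: pl_completion_def H_completion_def)

context
  fixes T :: "('h::complex_hilbert_space, 'a) pl_space"
  assumes T: "cross_seminormed T" and unit: "norm (unit_vector :: 'h) = 1"
begin

private lemmas T' = cross_seminormedD[OF T]

lemma H_elem_linear_bounded:
  "linear_op (underlying T) (H_space T) (H_elem T \<xi>)"
  "x \<in> carrier (underlying T) \<Longrightarrow> nrm (H_space T) (H_elem T \<xi> x) \<le> norm \<xi> * nrm (underlying T) x"
  using linear_op_transfer[OF H_elem_linear_right[OF T'(1)], of "underlying T" "H_space T"] T'(4)[of x \<xi>] by simp_all

lemma H_elem_cauchy:
  assumes x: "x \<in> cauchy_seqs (underlying T)"
  shows "(\<lambda>n. H_elem T \<xi> (x n)) \<in> cauchy_seqs (H_space T)"
proof (rule cauchy_seqs_le[OF T'(3) x])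
  note xc = cauchy_seqs_carrier[OF T'(3) x]
  show "H_elem T \<xi> (x n) \<in> carrier (H_space T)" for n using xc[of n] T'(1) by simp
  fix m n
  note l = linear_op_minus[OF H_elem_linear_bounded(1) sn_linear_space[OF T'(3)] linear_space_H[OF T'(1)] xc xc]
  show "nrm (H_space T) (H_elem T \<xi> (x m) \<ominus>\<^bsub>H_space T\<^esub> H_elem T \<xi> (x n)) \<le> norm \<xi> * nrm (underlying T) (x m \<ominus>\<^bsub>underlying T\<^esub> x n)"
    using H_elem_linear_bounded(2)[OF ls_closed(4)[OF sn_linear_space[OF T'(3)] xc[of m] xc[of n]], of \<xi>]
    unfolding l .
qed

lemma H_elem_class:
  assumes x: "x \<in> cauchy_seqs (underlying T)"
  shows "(\<Union>y\<in>completion_class (underlying T) x. completion_class (H_space T) (\<lambda>n. H_elem T \<xi> (y n))) =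
    completion_class (H_space T) (\<lambda>n. H_elem T \<xi> (x n))"
proof (rule completion_UN[OF T'(3) x])
  fix y assume "y \<in> completion_class (underlying T) x"
  then have y: "y \<in> cauchy_seqs (underlying T)" "(\<lambda>n. nrm (underlying T) (y n \<ominus>\<^bsub>underlying T\<^esub> x n)) \<longlonglongrightarrow> 0"
    by (auto simp: completion_class_def)
  note xc = cauchy_seqs_carrier[OF T'(3) x] and yc = cauchy_seqs_carrier[OF T'(3) y(1)]
  note lsU = sn_linear_space[OF T'(3)] and lsH = linear_space_H[OF T'(1)]
  have l: "H_elem T \<xi> (y n) \<ominus>\<^bsub>H_space T\<^esub> H_elem T \<xi> (x n) = H_elem T \<xi> (y n \<ominus>\<^bsub>underlying T\<^esub> x n)" for n
    by (rule linear_op_minus[OF H_elem_linear_bounded(1) lsU lsH yc xc, symmetric])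
  have c: "y n \<ominus>\<^bsub>underlying T\<^esub> x n \<in> carrier (underlying T)" for n by (rule ls_closed(4)[OF lsU yc xc])
  have "(\<lambda>n. nrm (H_space T) (H_elem T \<xi> (y n) \<ominus>\<^bsub>H_space T\<^esub> H_elem T \<xi> (x n))) \<longlonglongrightarrow> 0"
    unfolding l
  proof (rule tendsto_squeeze0)
    show "(\<lambda>n. norm \<xi> * nrm (underlying T) (y n \<ominus>\<^bsub>underlying T\<^esub> x n)) \<longlonglongrightarrow> 0"
      using tendsto_mult_left[OF y(2), of "norm \<xi>"] by simp
    show "nrm (H_space T) (H_elem T \<xi> (y n \<ominus>\<^bsub>underlying T\<^esub> x n)) \<le> norm \<xi> * nrm (underlying T) (y n \<ominus>\<^bsub>underlying T\<^esub> x n)" for n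
      by (rule H_elem_linear_bounded(2)[OF c])
    show "0 \<le> nrm (H_space T) (H_elem T \<xi> (y n \<ominus>\<^bsub>underlying T\<^esub> x n))" for n
      by (rule sn_nonneg[OF T'(2) linear_opD(1)[OF H_elem_linear_bounded(1) c]])
  qed
  then show "completion_class (H_space T) (\<lambda>n. H_elem T \<xi> (y n)) = completion_class (H_space T) (\<lambda>n. H_elem T \<xi> (x n))"
    by (rule completion_class_eqI[OF T'(2) H_elem_cauchy[OF y(1)] H_elem_cauchy[OF x]])
qed

lemma linear_space_pl_completion: "linear_space (pl_completion T)"
  using linear_space_completion[OF T'(3)] by simp

lemma H_completion_bilinear:
  "bilinear_op hilbert_lspace (pl_completion T) (completion (H_space T))
     (\<lambda>\<xi> A. \<Union>x\<in>A. completion_class (H_space T) (\<lambda>n. H_elem T \<xi> (x n)))"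
proof -
  let ?b = "\<lambda>\<xi> A. \<Union>x\<in>A. completion_class (H_space T) (\<lambda>n. H_elem T \<xi> (x n))"
  note lsU = sn_linear_space[OF T'(3)]
  have rep: "\<exists>x\<in>cauchy_seqs (underlying T). A = completion_class (underlying T) x" if "A \<in> carrier (pl_completion T)" for A
    using that by (auto simp: completion_carrier[OF T'(3)])
  note cl = completion_class_closed[OF T'(2) H_elem_cauchy]
  show ?thesis
  proof (intro bilinear_opI linear_opI)
    fix A \<xi> assume "A \<in> carrier (pl_completion T)"
    then obtain x where x: "x \<in> cauchy_seqs (underlying T)" "A = completion_class (underlying T) x" using rep by blast
    have xc: "x n \<in> carrier T" for n using cauchy_seqs_carrier[OF T'(3) x(1), of n] by simp
    show "?b \<xi> A \<in> carrier (completion (H_space T))" unfolding x(2) H_elem_class[OF x(1)] by (rule cl[OF x(1)])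
    then show "?b \<xi> A \<in> carrier (completion (H_space T))" .
    show "?b (\<xi> \<oplus>\<^bsub>hilbert_lspace\<^esub> \<eta>) A = ?b \<xi> A \<oplus>\<^bsub>completion (H_space T)\<^esub> ?b \<eta> A" for \<eta>
      unfolding x(2) H_elem_class[OF x(1)] completion_add[OF T'(2) H_elem_cauchy[OF x(1)] H_elem_cauchy[OF x(1)]]
      by (simp add: H_elem_arith(1)[OF T'(1) xc])
    show "?b (c \<odot>\<^bsub>hilbert_lspace\<^esub> \<xi>) A = c \<odot>\<^bsub>completion (H_space T)\<^esub> ?b \<xi> A" for c
      unfolding x(2) H_elem_class[OF x(1)] completion_smult[OF T'(2) H_elem_cauchy[OF x(1)]]
      by (simp add: H_elem_arith(2)[OF T'(1) xc])
    show "?b \<xi> (c \<odot>\<^bsub>pl_completion T\<^esub> A) = c \<odot>\<^bsub>completion (H_space T)\<^esub> ?b \<xi> A" for c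
    proof -
      have "?b \<xi> (c \<odot>\<^bsub>pl_completion T\<^esub> A) = completion_class (H_space T) (\<lambda>n. H_elem T \<xi> (c \<odot>\<^bsub>underlying T\<^esub> x n))"
        unfolding x(2) pl_completion_simps completion_smult[OF T'(3) x(1)]
        by (rule H_elem_class[OF cauchy_seqs_smult[OF T'(3) x(1)]])
      then show ?thesis
        unfolding x(2) H_elem_class[OF x(1)] completion_smult[OF T'(2) H_elem_cauchy[OF x(1)]]
        by (simp add: H_elem_arith(4)[OF T'(1) xc])
    qed
    fix B assume "B \<in> carrier (pl_completion T)"
    then obtain y where y: "y \<in> cauchy_seqs (underlying T)" "B = completion_class (underlying T) y" using rep by blast
    have yc: "y n \<in> carrier T" for n using cauchy_seqs_carrier[OF T'(3) y(1), of n] by simp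
    have "?b \<xi> (A \<oplus>\<^bsub>pl_completion T\<^esub> B) = completion_class (H_space T) (\<lambda>n. H_elem T \<xi> (x n \<oplus>\<^bsub>underlying T\<^esub> y n))"
      unfolding x(2) y(2) pl_completion_simps completion_add[OF T'(3) x(1) y(1)]
      by (rule H_elem_class[OF cauchy_seqs_add[OF T'(3) x(1) y(1)]])
    then show "?b \<xi> (A \<oplus>\<^bsub>pl_completion T\<^esub> B) = ?b \<xi> A \<oplus>\<^bsub>completion (H_space T)\<^esub> ?b \<xi> B"
      unfolding x(2) y(2) H_elem_class[OF x(1)] H_elem_class[OF y(1)]
        completion_add[OF T'(2) H_elem_cauchy[OF x(1)] H_elem_cauchy[OF y(1)]]
      by (simp add: H_elem_arith(3)[OF T'(1) xc yc])
  qed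
qed

lemma H_completion_linear: "linear_op (H_space (pl_completion T)) (completion (H_space T)) (H_completion T)"
  unfolding H_completion_def
  by (rule H_lift_linear[OF linear_space_pl_completion linear_space_completion[OF T'(2)] H_completion_bilinear])

lemma H_completion_elem:
  assumes x: "x \<in> cauchy_seqs (underlying T)"
  shows "H_completion T (H_elem (pl_completion T) \<xi> (completion_class (underlying T) x)) =
    completion_class (H_space T) (\<lambda>n. H_elem T \<xi> (x n))"
proof -
  have "completion_class (underlying T) x \<in> carrier (pl_completion T)"
    using completion_class_closed[OF T'(3) x] by simp
  from H_lift_elem[OF linear_space_pl_completion linear_space_completion[OF T'(2)] H_completion_bilinear this]
  show ?thesis unfolding H_completion_def H_elem_class[OF x] .
qed

text \<open>Completing and passing to the underlying space commute as far as norms are concerned: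
  both sides are the limit of the same real sequence.\<close>

lemma pl_norm_pl_completion_elem:
  assumes A: "A \<in> carrier (completion (underlying T))"
  shows "pl_norm (pl_completion T) (H_elem (pl_completion T) (unit_vector :: 'h) A) = nrm (completion (underlying T)) A"
proof -
  obtain x where x: "x \<in> cauchy_seqs (underlying T)" "A = completion_class (underlying T) x"
    using A by (auto simp: completion_carrier[OF T'(3)])
  have "(\<lambda>n. nrm (H_space T) (H_elem T (unit_vector :: 'h) (x n))) \<longlonglongrightarrow>
      pl_norm (pl_completion T) (H_elem (pl_completion T) (unit_vector :: 'h) A)"
    unfolding pl_norm_pl_completion x(2) H_completion_elem[OF x(1)]
    by (rule nrm_completion_lim[OF T'(2) H_elem_cauchy[OF x(1)]])
  moreover have "(\<lambda>n. nrm (H_space T) (H_elem T (unit_vector :: 'h) (x n))) \<longlonglongrightarrow> nrm (completion (underlying T)) A"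
    using nrm_completion_lim[OF T'(3) x(1)] x(2) by (simp add: nrm_underlying)
  ultimately show ?thesis by (rule LIMSEQ_unique)
qed

end

section \<open>Extension of an L-isometry with dense range to the completion\<close>

lemma normed_space_transfer:
  assumes V: "normed_space V" and c: "carrier W = carrier V" "zero W = zero V" "add W = add V" "smult W = smult V"
    and n: "\<And>x. x \<in> carrier V \<Longrightarrow> nrm W x = nrm V x"
  shows "normed_space W"
proof -
  note ls = sn_linear_space[OF normed_seminormed[OF V]]
  show ?thesis
    unfolding normed_space_def c
    using V linear_space_transfer[OF ls c] ls_closed[OF ls] n by (auto simp: normed_space_def)
qed

lemma complete_normed_transfer:
  assumes V: "complete_normed V" and ls: "linear_space V"
    and c: "carrier W = carrier V" "zero W = zero V" "add W = add V"
    and n: "\<And>x. x \<in> carrier V \<Longrightarrow> nrm W x = nrm V x"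
  shows "complete_normed W"
  unfolding complete_normed_def
proof
  have d: "nrm W (x \<ominus>\<^bsub>W\<^esub> y) = nrm V (x \<ominus>\<^bsub>V\<^esub> y)" if "x \<in> carrier V" "y \<in> carrier V" for x y
    unfolding a_minus_transfer[OF c] by (rule n[OF ls_closed(4)[OF ls that]])
  fix x assume x: "x \<in> cauchy_seqs W"
  then have xc: "x k \<in> carrier V" for k by (simp add: cauchy_seqs_def c)
  have "x \<in> cauchy_seqs V" using x unfolding cauchy_seqs_def by (simp add: d[OF xc xc] xc)
  then obtain l where l: "l \<in> carrier V" "(\<lambda>k. nrm V (x k \<ominus>\<^bsub>V\<^esub> l)) \<longlonglongrightarrow> 0"
    using V unfolding complete_normed_def by (meson bspec)
  then show "\<exists>l\<in>carrier W. (\<lambda>k. nrm W (x k \<ominus>\<^bsub>W\<^esub> l)) \<longlonglongrightarrow> 0"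
    by (intro bexI[of _ l]) (simp_all add: d[OF xc l(1)] c)
qed

text \<open>Separates the passage to the completion from the Bochner spaces. Isometry is required of
  the amplified operator, whereas density and completeness concern the underlying spaces.\<close>

locale dense_L_isometry =
  fixes T :: "('h::complex_hilbert_space, 'a) pl_space" and L :: "('h, 'b) pl_space" and \<phi> :: "'a \<Rightarrow> 'b"
  assumes unit: "norm (unit_vector :: 'h) = 1"
    and T: "cross_seminormed T" and L: "cross_seminormed L"
    and normed_L: "normed_space (underlying L)" and complete_L: "complete_normed (underlying L)"
    and \<phi>: "linear_op T L \<phi>"
    and isometric: "U \<in> carrier (H_space T) \<Longrightarrow> pl_norm L (amplification L \<phi> U) = pl_norm T U"
    and dense: "y \<in> carrier L \<Longrightarrow> e > 0 \<Longrightarrow> \<exists>x\<in>carrier T. nrm (underlying L) (y \<ominus>\<^bsub>underlying L\<^esub> \<phi> x) < (e :: real)"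
begin

lemmas T' = cross_seminormedD[OF T] and L' = cross_seminormedD[OF L]

abbreviation (input) "T_completed \<equiv> pl_completion T"

lemmas ls_completed = linear_space_pl_completion[OF T unit]

lemma \<phi>_underlying: "linear_op (underlying T) (underlying L) \<phi>"
  by (rule linear_op_transfer[OF \<phi>]) simp_all

lemma \<phi>_norm: "x \<in> carrier T \<Longrightarrow> nrm (underlying L) (\<phi> x) = nrm (underlying T) x"
  using isometric[OF H_elem_closed[OF T'(1), of x unit_vector]]
    amplification_linear(2)[OF T'(1) L'(1) \<phi>, of x unit_vector]
  by (simp add: nrm_underlying)

lemma extension_norm:
  assumes I: "linear_op T_completed L I" "isometric_isomorphism (H_space T_completed) (H_space L) (amplification L I)"
    and A: "A \<in> carrier (completion (underlying T))"
  shows "nrm (underlying L) (I A) = nrm (completion (underlying T)) A"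
proof -
  have A': "A \<in> carrier T_completed" using A by simp
  have "nrm (underlying L) (I A) = pl_norm L (amplification L I (H_elem T_completed (unit_vector :: 'h) A))"
    by (simp add: nrm_underlying amplification_linear(2)[OF ls_completed L'(1) I(1) A'])
  also have "\<dots> = pl_norm T_completed (H_elem T_completed (unit_vector :: 'h) A)"
    using I(2) H_elem_closed[OF ls_completed A', of unit_vector] by (simp add: isometric_isomorphism_def)
  finally show ?thesis by (simp add: pl_norm_pl_completion_elem[OF T unit A])
qed

text \<open>An L-isometric extension preserves the underlying norm and is therefore continuous, so
  its values are the limits prescribed by \<phi>. Uniqueness of the extension is uniqueness of these
  limits.\<close>

lemma extension_limit:
  assumes I: "linear_op T_completed L I" "isometric_isomorphism (H_space T_completed) (H_space L) (amplification L I)"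
    and emb: "\<And>x. x \<in> carrier T \<Longrightarrow> I (completion_embed (underlying T) x) = \<phi> x"
    and x: "x \<in> cauchy_seqs (underlying T)"
  shows "tends_in (underlying L) (\<lambda>n. \<phi> (x n)) (I (completion_class (underlying T) x))"
proof -
  note xc = cauchy_seqs_carrier[OF T'(3) x]
  have I': "linear_op (completion (underlying T)) (underlying L) I"
    by (rule linear_op_transfer[OF I(1)]) simp_all
  have "tends_in (underlying L) (\<lambda>n. I (completion_embed (underlying T) (x n))) (I (completion_class (underlying T) x))"
    by (rule tends_in_map[OF seminormed_completion[OF T'(3)] L'(3) I', of 1])
      (use extension_norm[OF I] linear_opD(1)[OF completion_embed_linear[OF T'(3)] xc]
        completion_class_closed[OF T'(3) x] completion_embed_dense[OF T'(3) x] in auto)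
  then show ?thesis using emb xc by simp
qed

lemma extension_unique:
  assumes I: "linear_op T_completed L I" "isometric_isomorphism (H_space T_completed) (H_space L) (amplification L I)"
    "\<And>x. x \<in> carrier T \<Longrightarrow> I (completion_embed (underlying T) x) = \<phi> x"
    and J: "linear_op T_completed L J" "isometric_isomorphism (H_space T_completed) (H_space L) (amplification L J)"
    "\<And>x. x \<in> carrier T \<Longrightarrow> J (completion_embed (underlying T) x) = \<phi> x"
    and A: "A \<in> carrier T_completed"
  shows "I A = J A"
proof -
  obtain x where x: "x \<in> cauchy_seqs (underlying T)" "A = completion_class (underlying T) x"
    using A by (auto simp: completion_carrier[OF T'(3)])
  have "\<phi> (x n) \<in> carrier (underlying L)" for n
    by (rule linear_opD(1)[OF \<phi>_underlying cauchy_seqs_carrier[OF T'(3) x(1)]])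
  moreover have "I A \<in> carrier (underlying L)" "J A \<in> carrier (underlying L)"
    using linear_opD(1)[OF I(1) A] linear_opD(1)[OF J(1) A] by simp_all
  ultimately show ?thesis
    using extension_limit[OF I x(1)] extension_limit[OF J x(1)] unfolding x(2)
    by (intro tends_in_unique[OF normed_L, of "\<lambda>n. \<phi> (x n)"])
qed

text \<open>On underlying spaces the continuous extension is isometric, hence injective, and it is
  onto because the range of \<phi> is dense in a complete domain's image. For the amplification,
  bijectivity comes from the inverse operator and isometry from approximating sequences in
  \<open>H_space T\<close>.\<close>

lemma extension_exists:
  obtains I where "I \<in> extensional (carrier T_completed)" "L_isometric_isomorphism T_completed L I"
    "\<And>x. x \<in> carrier T \<Longrightarrow> I (completion_embed (underlying T) x) = \<phi> x"
proof -
  let ?U = "underlying T" and ?W = "underlying L"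
  have "nrm ?W (\<phi> x) \<le> 1 * nrm ?U x" if "x \<in> carrier ?U" for x using \<phi>_norm that by simp
  from completion_extend[OF T'(3) normed_L complete_L \<phi>_underlying this]
  obtain I0 where I0: "linear_op (completion ?U) ?W I0"
    "\<And>x. x \<in> cauchy_seqs ?U \<Longrightarrow> tends_in ?W (\<lambda>n. \<phi> (x n)) (I0 (completion_class ?U x))"
    "\<And>x. x \<in> carrier ?U \<Longrightarrow> I0 (completion_embed ?U x) = \<phi> x" by metis
  \<comment> \<open>The restriction fixes the value outside the carrier, so that uniqueness can be
    stated as equality of functions.\<close>
  define I where "I = restrict I0 (carrier T_completed)"
  note lsC = linear_space_completion[OF T'(3)]
  have II0: "I A = I0 A" if "A \<in> carrier (completion ?U)" for A using that by (simp add: I_def)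
  have I: "linear_op (completion ?U) ?W I"
    by (rule linear_opI) (use lsC linear_opD[OF I0(1)] in \<open>simp_all add: II0 del: underlying_simps\<close>)
  then have IL: "linear_op T_completed L I" by (rule linear_op_transfer) simp_all
  have lim: "tends_in ?W (\<lambda>n. \<phi> (x n)) (I (completion_class ?U x))" if "x \<in> cauchy_seqs ?U" for x
    unfolding II0[OF completion_class_closed[OF T'(3) that]] by (rule I0(2)[OF that])
  have rep: "\<exists>x\<in>cauchy_seqs ?U. A = completion_class ?U x" if "A \<in> carrier (completion ?U)" for A
    using that by (auto simp: completion_carrier[OF T'(3)])
  have \<phi>c: "\<phi> (x n) \<in> carrier ?W" if "x \<in> cauchy_seqs ?U" for x n
    by (rule linear_opD(1)[OF \<phi>_underlying cauchy_seqs_carrier[OF T'(3) that]])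
  have norm: "nrm ?W (I A) = nrm (completion ?U) A" if A: "A \<in> carrier (completion ?U)" for A
  proof -
    obtain x where x: "x \<in> cauchy_seqs ?U" "A = completion_class ?U x" using rep[OF A] by blast
    have "(\<lambda>n. nrm ?W (\<phi> (x n))) \<longlonglongrightarrow> nrm ?W (I A)"
      unfolding x(2)
      by (rule tends_in_norm[OF L'(3) \<phi>c[OF x(1)] _ lim[OF x(1)]])
        (rule linear_opD(1)[OF I completion_class_closed[OF T'(3) x(1)]])
    moreover have "(\<lambda>n. nrm ?W (\<phi> (x n))) \<longlonglongrightarrow> nrm (completion ?U) A"
      using nrm_completion_lim[OF T'(3) x(1)] cauchy_seqs_carrier[OF T'(3) x(1)] x(2) by (simp add: \<phi>_norm)
    ultimately show ?thesis by (rule LIMSEQ_unique)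
  qed
  have inj: "inj_on I (carrier (completion ?U))"
  proof (rule inj_onI)
    fix A B assume AB: "A \<in> carrier (completion ?U)" "B \<in> carrier (completion ?U)" "I A = I B"
    have "I (A \<ominus>\<^bsub>completion ?U\<^esub> B) = \<zero>\<^bsub>?W\<^esub>"
      unfolding linear_op_minus[OF I lsC sn_linear_space[OF L'(3)] AB(1,2)] AB(3)
      by (rule ls_minus_self[OF sn_linear_space[OF L'(3)] linear_opD(1)[OF I AB(2)]])
    then have "nrm (completion ?U) (A \<ominus>\<^bsub>completion ?U\<^esub> B) = 0"
      using norm[OF ls_closed(4)[OF lsC AB(1,2)]] sn_zero[OF L'(3)] by simp
    then show "A = B" by (rule normed_space_eqI[OF normed_completion[OF T'(3)] AB(1,2)])
  qed
  have surj: "\<exists>A\<in>carrier (completion ?U). I A = y" if y: "y \<in> carrier ?W" for y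
  proof -
    have y': "y \<in> carrier L" using y by simp
    have "\<exists>x\<in>carrier T. nrm ?W (y \<ominus>\<^bsub>?W\<^esub> \<phi> x) < inverse (real (Suc n))" for n
      by (rule dense[OF y']) simp
    then obtain x where x: "\<And>n. x n \<in> carrier T" "\<And>n. nrm ?W (y \<ominus>\<^bsub>?W\<^esub> \<phi> (x n)) < inverse (real (Suc n))"
      by metis
    have \<phi>x: "\<phi> (x n) \<in> carrier ?W" for n using linear_opD(1)[OF \<phi>_underlying] x(1) by simp
    have "tends_in ?W (\<lambda>n. \<phi> (x n)) y"
      unfolding tends_in_def
    proof (rule tendsto_squeeze0[OF LIMSEQ_inverse_real_of_nat])
      show "0 \<le> nrm ?W (\<phi> (x n) \<ominus>\<^bsub>?W\<^esub> y)" for n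
        by (rule sn_nonneg[OF L'(3) ls_closed(4)[OF sn_linear_space[OF L'(3)] \<phi>x y]])
      show "nrm ?W (\<phi> (x n) \<ominus>\<^bsub>?W\<^esub> y) \<le> inverse (real (Suc n))" for n
        using x(2)[of n] sn_dist_commute[OF L'(3) y \<phi>x[of n]] by simp
    qed
    note t = this
    \<comment> \<open>The images converge to \<open>y\<close>, so they form a Cauchy sequence, and
      the isometry \<phi> reflects this back to \<open>x\<close>. The class of \<open>x\<close> is
      then a preimage of \<open>y\<close>.\<close>
    have xc: "x \<in> cauchy_seqs ?U"
    proof (rule cauchy_seqs_le[OF L'(3) tends_in_cauchy_seqs[OF L'(3) \<phi>x y t], of _ _ 1])
      show "x n \<in> carrier ?U" for n using x(1) by simp
      fix m n
      have "x m \<ominus>\<^bsub>?U\<^esub> x n \<in> carrier T"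
        using ls_closed(4)[OF sn_linear_space[OF T'(3)], of "x m" "x n"] x(1) by simp
      from \<phi>_norm[OF this]
      show "nrm ?U (x m \<ominus>\<^bsub>?U\<^esub> x n) \<le> 1 * nrm ?W (\<phi> (x m) \<ominus>\<^bsub>?W\<^esub> \<phi> (x n))"
        using linear_op_minus[OF \<phi>_underlying sn_linear_space[OF T'(3)] sn_linear_space[OF L'(3)], of "x m" "x n"] x(1)
        by simp
    qed
    have "I (completion_class ?U x) = y"
      by (rule tends_in_unique[OF normed_L \<phi>x linear_opD(1)[OF I completion_class_closed[OF T'(3) xc]] y lim[OF xc] t])
    then show ?thesis using completion_class_closed[OF T'(3) xc] by blast
  qed
  have bij: "bij_betw I (carrier T_completed) (carrier L)"
    unfolding bij_betw_def
  proof
    show "inj_on I (carrier T_completed)" using inj by simp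
    show "I ` carrier T_completed = carrier L"
    proof
      show "I ` carrier T_completed \<subseteq> carrier L" using linear_opD(1)[OF IL] by blast
      show "carrier L \<subseteq> I ` carrier T_completed" using surj by force
    qed
  qed
  define J where "J = inv_into (carrier T_completed) I"
  have IJ: "I (J y) = y" "J y \<in> carrier T_completed" if "y \<in> carrier L" for y
    using bij that unfolding J_def bij_betw_def by (auto intro: f_inv_into_f inv_into_into)
  have JI: "J (I A) = A" if "A \<in> carrier T_completed" for A
    using bij that unfolding J_def bij_betw_def by simp
  have J: "linear_op L T_completed J"
  proof (rule linear_opI)
    fix y assume y: "y \<in> carrier L"
    show "J y \<in> carrier T_completed" by (rule IJ(2)[OF y])
    show "J (c \<odot>\<^bsub>L\<^esub> y) = c \<odot>\<^bsub>T_completed\<^esub> J y" for c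
      using JI[OF ls_closed(2)[OF ls_completed IJ(2)[OF y]], of c] linear_opD(3)[OF IL IJ(2)[OF y], of c] IJ(1)[OF y] by simp
    fix z assume z: "z \<in> carrier L"
    show "J (y \<oplus>\<^bsub>L\<^esub> z) = J y \<oplus>\<^bsub>T_completed\<^esub> J z"
      using JI[OF ls_closed(3)[OF ls_completed IJ(2)[OF y] IJ(2)[OF z]]]
        linear_opD(2)[OF IL IJ(2)[OF y] IJ(2)[OF z]] IJ(1)[OF y] IJ(1)[OF z] by simp
  qed
  note ampI = amplification_linear[OF ls_completed L'(1) IL] and ampJ = amplification_linear[OF L'(1) ls_completed J]
  have id: "linear_op V V (\<lambda>x. x)" for V :: "'z normed_lspace" by (simp add: linear_op_def)
  \<comment> \<open>Purely algebraic: the amplifications of \<open>I\<close> and of its inverse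
    compose to the identity on elementary elements, hence everywhere.\<close>
  have bijH: "bij_betw (amplification L I) (carrier (H_space T_completed)) (carrier (H_space L))"
  proof (rule bij_betw_byWitness[where f' = "amplification T_completed J"])
    show "\<forall>u\<in>carrier (H_space T_completed). amplification T_completed J (amplification L I u) = u"
    proof
      fix u assume u: "u \<in> carrier (H_space T_completed)"
      show "amplification T_completed J (amplification L I u) = u"
      proof (rule H_linear_eqI[OF ls_completed linear_op_comp[OF ampI(1) ampJ(1)] _ _ u])
        show "linear_op (H_space T_completed) (H_space T_completed) (\<lambda>x. x)" by (simp add: linear_op_def)
        fix \<xi> A assume A: "A \<in> carrier T_completed"
        show "amplification T_completed J (amplification L I (H_elem T_completed \<xi> A)) = H_elem T_completed \<xi> A"
          unfolding ampI(2)[OF A] ampJ(2)[OF linear_opD(1)[OF IL A]] JI[OF A] by (rule refl)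
      qed
    qed
    show "\<forall>u\<in>carrier (H_space L). amplification L I (amplification T_completed J u) = u"
    proof
      fix u assume u: "u \<in> carrier (H_space L)"
      show "amplification L I (amplification T_completed J u) = u"
      proof (rule H_linear_eqI[OF L'(1) linear_op_comp[OF ampJ(1) ampI(1)] _ _ u])
        show "linear_op (H_space L) (H_space L) (\<lambda>x. x)" by (simp add: linear_op_def)
        fix \<xi> y assume y: "y \<in> carrier L"
        show "amplification L I (amplification T_completed J (H_elem L \<xi> y)) = H_elem L \<xi> y"
          unfolding ampJ(2)[OF y] ampI(2)[OF IJ(2)[OF y]] IJ(1)[OF y] by (rule refl)
      qed
    qed
    show "amplification L I ` carrier (H_space T_completed) \<subseteq> carrier (H_space L)"
      using linear_opD(1)[OF ampI(1)] by blast
    show "amplification T_completed J ` carrier (H_space L) \<subseteq> carrier (H_space T_completed)"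
      using linear_opD(1)[OF ampJ(1)] by blast
  qed
  note amp\<phi> = amplification_linear[OF T'(1) L'(1) \<phi>]
  \<comment> \<open>For each \<open>u\<close> there is one sequence in \<open>H_space T\<close> that
    represents \<open>u\<close> in the completion and whose images under the amplified \<phi>
    converge to the image of \<open>u\<close>. Continuity of \<open>H_elem\<close> gives this for
    elementary elements, and sums preserve it; the norm of \<open>u\<close> and that of its image
    are then limits of the same sequence.\<close>
  have approx: "\<exists>U\<in>cauchy_seqs (H_space T). H_completion T u = completion_class (H_space T) U \<and>
      tends_in (H_space L) (\<lambda>n. amplification L \<phi> (U n)) (amplification L I u)"
    if u: "u \<in> carrier (H_space T_completed)" for u
    using ls_completed u
  proof (induction rule: H_induct)
    case (elem \<xi> A)
    then obtain x where x: "x \<in> cauchy_seqs ?U" "A = completion_class ?U x" using rep by auto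
    have xc: "x n \<in> carrier T" for n using cauchy_seqs_carrier[OF T'(3) x(1), of n] by simp
    have IA: "I A \<in> carrier ?W"
      unfolding x(2) by (rule linear_opD(1)[OF I completion_class_closed[OF T'(3) x(1)]])
    have "tends_in (H_space L) (\<lambda>n. H_elem L \<xi> (\<phi> (x n))) (H_elem L \<xi> (I A))"
      by (rule tends_in_map[OF L'(3,2) H_elem_linear_bounded[OF L unit] \<phi>c[OF x(1)] IA lim[OF x(1), folded x(2)]])
    then have "tends_in (H_space L) (\<lambda>n. amplification L \<phi> (H_elem T \<xi> (x n))) (amplification L I (H_elem T_completed \<xi> A))"
      unfolding ampI(2)[OF elem] amp\<phi>(2)[OF xc] .
    then show ?case
      using H_elem_cauchy[OF T unit x(1)] H_completion_elem[OF T unit x(1), of \<xi>] unfolding x(2) by blast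
  next
    case (add v w)
    obtain U where U: "U \<in> cauchy_seqs (H_space T)" "H_completion T v = completion_class (H_space T) U"
      "tends_in (H_space L) (\<lambda>n. amplification L \<phi> (U n)) (amplification L I v)" using add(3) by blast
    obtain W where W: "W \<in> cauchy_seqs (H_space T)" "H_completion T w = completion_class (H_space T) W"
      "tends_in (H_space L) (\<lambda>n. amplification L \<phi> (W n)) (amplification L I w)" using add(4) by blast
    note Uc = cauchy_seqs_carrier[OF T'(2) U(1)] and Wc = cauchy_seqs_carrier[OF T'(2) W(1)]
    have "H_completion T (v \<oplus>\<^bsub>H_space T_completed\<^esub> w) = completion_class (H_space T) (\<lambda>n. U n \<oplus>\<^bsub>H_space T\<^esub> W n)"
      unfolding linear_opD(2)[OF H_completion_linear[OF T unit] add(1,2)] U(2) W(2)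
      by (rule completion_add[OF T'(2) U(1) W(1)])
    moreover have "tends_in (H_space L) (\<lambda>n. amplification L \<phi> (U n \<oplus>\<^bsub>H_space T\<^esub> W n)) (amplification L I (v \<oplus>\<^bsub>H_space T_completed\<^esub> w))"
      unfolding linear_opD(2)[OF ampI(1) add(1,2)] linear_opD(2)[OF amp\<phi>(1) Uc Wc]
      by (rule tends_in_add[OF L'(2) linear_opD(1)[OF amp\<phi>(1) Uc] linear_opD(1)[OF ampI(1) add(1)]
            linear_opD(1)[OF amp\<phi>(1) Wc] linear_opD(1)[OF ampI(1) add(2)] U(3) W(3)])
    ultimately show ?case using cauchy_seqs_add[OF T'(2) U(1) W(1)] by blast
  qed
  have iso: "nrm (H_space L) (amplification L I u) = nrm (H_space T_completed) u"
    if u: "u \<in> carrier (H_space T_completed)" for u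
  proof -
    obtain U where U: "U \<in> cauchy_seqs (H_space T)" "H_completion T u = completion_class (H_space T) U"
      "tends_in (H_space L) (\<lambda>n. amplification L \<phi> (U n)) (amplification L I u)" using approx[OF u] by blast
    note Uc = cauchy_seqs_carrier[OF T'(2) U(1)]
    have "(\<lambda>n. nrm (H_space L) (amplification L \<phi> (U n))) \<longlonglongrightarrow> nrm (H_space L) (amplification L I u)"
      by (rule tends_in_norm[OF L'(2) linear_opD(1)[OF amp\<phi>(1) Uc] linear_opD(1)[OF ampI(1) u] U(3)])
    moreover have "(\<lambda>n. nrm (H_space L) (amplification L \<phi> (U n))) \<longlonglongrightarrow> nrm (H_space T_completed) u"
      using nrm_completion_lim[OF T'(2) U(1)] by (simp add: isometric[OF Uc] pl_norm_pl_completion U(2))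
    ultimately show ?thesis by (rule LIMSEQ_unique)
  qed
  show ?thesis
  proof (rule that)
    show "I \<in> extensional (carrier T_completed)" by (simp add: I_def)
    show "L_isometric_isomorphism T_completed L I"
      using IL ampI(1) bijH iso by (simp add: L_isometric_isomorphism_def isometric_isomorphism_def)
    show "I (completion_embed ?U x) = \<phi> x" if "x \<in> carrier T" for x
      using I0(3)[of x] II0[OF linear_opD(1)[OF completion_embed_linear[OF T'(3)], of x]] that by simp
  qed
qed

end

section \<open>The extension to the completion\<close>

context L1_tensor
begin

lemma tensor_norm_\<phi>: "U \<in> carrier (H_space T) \<Longrightarrow> pl_norm L (amplification L \<phi> U) = pl_norm T U"
  by (simp add: pl_tensor_norm_eq_section_norm section_norm_def)

lemma pl_norm_T_elem: "x \<in> carrier T \<Longrightarrow> pl_norm T (H_elem T \<xi> x) = norm \<xi> * nrm (underlying L) (\<phi> x)"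
  using tensor_norm_\<phi>[OF H_elem_closed[OF lsT, of x \<xi>]] amplification_linear(2)[OF lsT lsL \<phi>_linear, of x \<xi>]
    cross_seminormedD(4)[OF cross_L linear_opD(1)[OF \<phi>_linear], of x \<xi>] by simp

text \<open>By \<open>tensor_norm_\<phi>\<close> the projective norm is the norm of \<open>L\<close>
  pulled back along a linear operator, so the seminorm axioms and the formula for elementary
  elements are inherited from \<open>L\<close>.\<close>

lemma cross_T: "cross_seminormed T"
proof -
  note LH = cross_seminormedD(2)[OF cross_L] and LU = cross_seminormedD(3)[OF cross_L]
  have n: "nrm (underlying T) x = nrm (underlying L) (\<phi> x)" if "x \<in> carrier T" for x
    using pl_norm_T_elem[OF that, of unit_vector] unit by (simp add: nrm_underlying del: pl_tensor_simps)
  have "seminormed (H_space T)"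
    unfolding seminormed_def
  proof (intro conjI ballI allI lsHT)
    fix U assume U: "U \<in> carrier (H_space T)"
    note c = linear_opD(1)[OF amp_linear U]
    show "0 \<le> nrm (H_space T) U"
      using sn_nonneg[OF LH c] tensor_norm_\<phi>[OF U] by simp
    show "nrm (H_space T) (k \<odot>\<^bsub>H_space T\<^esub> U) = cmod k * nrm (H_space T) U" for k
      using sn_smult[OF LH c, of k] tensor_norm_\<phi>[OF U] tensor_norm_\<phi>[OF ls_closed(2)[OF lsHT U], of k]
        linear_opD(3)[OF amp_linear U, of k] by simp
    fix V assume V: "V \<in> carrier (H_space T)"
    show "nrm (H_space T) (U \<oplus>\<^bsub>H_space T\<^esub> V) \<le> nrm (H_space T) U + nrm (H_space T) V"
      using sn_triangle[OF LH c linear_opD(1)[OF amp_linear V]] tensor_norm_\<phi>[OF U] tensor_norm_\<phi>[OF V]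
        tensor_norm_\<phi>[OF ls_closed(3)[OF lsHT U V]] linear_opD(2)[OF amp_linear U V] by simp
  qed
  moreover have "seminormed (underlying T)"
    unfolding seminormed_def
  proof (intro conjI ballI allI)
    show "linear_space (underlying T)" using lsT by (simp del: pl_tensor_simps)
    fix x assume "x \<in> carrier (underlying T)"
    then have x: "x \<in> carrier T" by (simp del: pl_tensor_simps)
    have c: "\<phi> x \<in> carrier (underlying L)" using linear_opD(1)[OF \<phi>_linear x] by simp
    show "0 \<le> nrm (underlying T) x"
      unfolding n[OF x] by (rule sn_nonneg[OF LU c])
    show "nrm (underlying T) (k \<odot>\<^bsub>underlying T\<^esub> x) = cmod k * nrm (underlying T) x" for k
      using sn_smult[OF LU c, of k] n[OF ls_closed(2)[OF lsT x], of k] n[OF x] linear_opD(3)[OF \<phi>_linear x, of k]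
      by (simp del: pl_tensor_simps)
    fix y assume "y \<in> carrier (underlying T)"
    then have y: "y \<in> carrier T" by (simp del: pl_tensor_simps)
    have d: "\<phi> y \<in> carrier (underlying L)" using linear_opD(1)[OF \<phi>_linear y] by simp
    show "nrm (underlying T) (x \<oplus>\<^bsub>underlying T\<^esub> y) \<le> nrm (underlying T) x + nrm (underlying T) y"
      using sn_triangle[OF LU c d] n[OF ls_closed(3)[OF lsT x y]] n[OF x] n[OF y] linear_opD(2)[OF \<phi>_linear x y]
      by (simp del: pl_tensor_simps)
  qed
  moreover have "\<forall>\<xi>. \<forall>x\<in>carrier T. pl_norm T (H_elem T \<xi> x) = norm \<xi> * nrm (underlying T) x"
    using pl_norm_T_elem n by metis
  ultimately show ?thesis using lsT unfolding cross_seminormed_def by blast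
qed

text \<open>An indicator function with value \<open>v\<close> is exactly the image of an elementary
  tensor, and approximability by images is preserved by sums and limits.\<close>

lemma \<phi>_dense:
  assumes y: "y \<in> carrier (L1_normed M (underlying F))" and e: "e > 0"
  shows "\<exists>x\<in>carrier T. nrm (L1_normed M (underlying F)) (y \<ominus>\<^bsub>L1_normed M (underlying F)\<^esub> \<phi> x) < (e :: real)"
proof -
  let ?L = "L1_normed M (underlying F)"
  note snL = seminormed_L1[OF F'(3), of M]
  note lsL' = sn_linear_space[OF snL]
  have \<phi>c: "\<phi> x \<in> carrier ?L" if "x \<in> carrier T" for x using linear_opD(1)[OF \<phi>_linear that] by simp
  have "\<forall>e>0. \<exists>x\<in>carrier T. nrm ?L (y \<ominus>\<^bsub>?L\<^esub> \<phi> x) < e"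
    using F'(3) y
  proof (induction rule: L1_induct)
    case (indicator A v)
    have A: "fin A" and v: "v \<in> carrier F" using indicator by auto
    have iA: "indicator_class A \<in> carrier E" using indicator_class_closed[OF A] by simp
    have x: "elem_tensor E F (indicator_class A) v \<in> carrier T" using iA v lsE lsF by simp
    have "\<phi> (elem_tensor E F (indicator_class A) v) = L1_class M (underlying F) (\<lambda>t. (if t \<in> A then 1 else 0) \<odot>\<^bsub>underlying F\<^esub> v)"
      unfolding \<phi>_elem[OF iA v] unfolding indicator_class_def by (rule scalar_L1(2)[OF F'(3) _ indicator_L1[OF A]]) (use v in simp)
    also have "(\<lambda>t. (if t \<in> A then 1 else 0) \<odot>\<^bsub>underlying F\<^esub> v) = (\<lambda>t. if t \<in> A then v else \<zero>\<^bsub>underlying F\<^esub>)"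
      using v lsF by (intro ext) simp
    finally show ?case
      using x sn_minus_self[OF snL \<phi>c[OF x]] by (intro allI impI bexI[of _ "elem_tensor E F (indicator_class A) v"]) simp_all
  next
    case (add Y Z)
    show ?case
    proof (intro allI impI)
      fix e :: real assume "e > 0"
      then have e: "e / 2 > 0" by simp
      obtain x where x: "x \<in> carrier T" "nrm ?L (Y \<ominus>\<^bsub>?L\<^esub> \<phi> x) < e / 2" using add(3) e by blast
      obtain z where z: "z \<in> carrier T" "nrm ?L (Z \<ominus>\<^bsub>?L\<^esub> \<phi> z) < e / 2" using add(4) e by blast
      have "\<phi> (x \<oplus>\<^bsub>T\<^esub> z) = \<phi> x \<oplus>\<^bsub>?L\<^esub> \<phi> z" using linear_opD(2)[OF \<phi>_linear x(1) z(1)] by simp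
      then have "nrm ?L ((Y \<oplus>\<^bsub>?L\<^esub> Z) \<ominus>\<^bsub>?L\<^esub> \<phi> (x \<oplus>\<^bsub>T\<^esub> z)) < e"
        using sn_dist_add[OF snL add(1,2) \<phi>c[OF x(1)] \<phi>c[OF z(1)]] x(2) z(2) by simp
      then show "\<exists>x\<in>carrier T. nrm ?L ((Y \<oplus>\<^bsub>?L\<^esub> Z) \<ominus>\<^bsub>?L\<^esub> \<phi> x) < e"
        using ls_closed(3)[OF lsT x(1) z(1)] by blast
    qed
  next
    case (limit Z)
    show ?case
    proof (intro allI impI)
      fix e :: real assume "e > 0"
      then have e: "e / 2 > 0" by simp
      obtain Y where Y: "Y \<in> carrier ?L" "\<forall>e>0. \<exists>x\<in>carrier T. nrm ?L (Y \<ominus>\<^bsub>?L\<^esub> \<phi> x) < e"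
        "nrm ?L (Z \<ominus>\<^bsub>?L\<^esub> Y) < e / 2" using limit(2)[OF e] by blast
      obtain x where x: "x \<in> carrier T" "nrm ?L (Y \<ominus>\<^bsub>?L\<^esub> \<phi> x) < e / 2" using Y(2) e by blast
      have "nrm ?L (Z \<ominus>\<^bsub>?L\<^esub> \<phi> x) < e"
        using sn_dist_triangle[OF snL limit(1) Y(1) \<phi>c[OF x(1)]] Y(3) x(2) by simp
      then show "\<exists>x\<in>carrier T. nrm ?L (Z \<ominus>\<^bsub>?L\<^esub> \<phi> x) < e" using x(1) by blast
    qed
  qed
  then show ?thesis using e by blast
qed

lemma underlying_L:
  shows normed_underlying_L: "normed_space (underlying L)"
    and complete_underlying_L: "complete_normed (underlying F) \<Longrightarrow> complete_normed (underlying L)"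
    and minus_underlying_L: "a_minus (underlying L) = a_minus (L1_normed M (underlying F))"
proof -
  note nF = normed_underlying[OF pl_F unit]
  note nL = normed_L1[OF nF, of M]
  have n: "A \<in> carrier (L1_normed M (underlying F)) \<Longrightarrow> nrm (underlying L) A = nrm (L1_normed M (underlying F)) A" for A
    by (rule nrm_underlying_L1_space[OF cross_F unit])
  show m: "a_minus (underlying L) = a_minus (L1_normed M (underlying F))"
    by (rule a_minus_transfer) simp_all
  show "normed_space (underlying L)"
    by (rule normed_space_transfer[OF nL]) (simp_all add: n)
  show "complete_normed (underlying L)" if "complete_normed (underlying F)"
    by (rule complete_normed_transfer[OF complete_L1[OF nF that, of M] sn_linear_space[OF normed_seminormed[OF nL]]])
      (simp_all add: n)
qed

lemma dense_L_isometry_\<phi>: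
  assumes "complete_normed (underlying F)"
  shows "dense_L_isometry T L \<phi>"
proof
  show "\<exists>x\<in>carrier T. nrm (underlying L) (y \<ominus>\<^bsub>underlying L\<^esub> \<phi> x) < e" if "y \<in> carrier L" "e > 0" for y and e :: real
  proof -
    have y: "y \<in> carrier (L1_normed M (underlying F))" and e: "e > 0" using that by simp_all
    obtain x where x: "x \<in> carrier T" "nrm (L1_normed M (underlying F)) (y \<ominus>\<^bsub>L1_normed M (underlying F)\<^esub> \<phi> x) < e"
      using \<phi>_dense[OF y e] by blast
    have "\<phi> x \<in> carrier (L1_normed M (underlying F))" using linear_opD(1)[OF \<phi>_linear x(1)] by simp
    then have "y \<ominus>\<^bsub>L1_normed M (underlying F)\<^esub> \<phi> x \<in> carrier (L1_normed M (underlying F))"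
      by (rule ls_closed(4)[OF linear_space_L1[OF F'(3)] y])
    then show ?thesis
      using x unfolding minus_underlying_L by (metis nrm_underlying_L1_space[OF cross_F unit])
  qed
qed (use unit cross_T cross_L normed_underlying_L complete_underlying_L[OF assms] \<phi>_linear tensor_norm_\<phi> in auto)

end

theorem theorem5p3:
  fixes \<iota> :: "'h::complex_hilbert_space hilbert_tensor \<Rightarrow> 'h"
    and M :: "'x measure"
    and F :: "('h, 'f) pl_space"
  assumes separable_H: "separable_space (euclidean :: 'h topology)"
    and infinite_dim_H: "\<nexists>B :: 'h set. finite_dimensional_vector_space scaleC B"
    and unitary: "isometric_isomorphism hilbert_tensor_product hilbert_lspace \<iota>"
    and complete_F: "complete_pl_space F"
  shows "\<exists>!I. I \<in> extensional (carrier (pl_tensor_completed \<iota> (L1_space M complex_pl) F)) \<and>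
           L_isometric_isomorphism
             (pl_tensor_completed \<iota> (L1_space M complex_pl) F) (L1_space M F) I \<and>
           (\<forall>Z\<in>carrier (L1_space M (complex_pl :: ('h, complex) pl_space)).
            \<forall>z\<in>Z. \<forall>x\<in>carrier F.
              I (completed_elem_tensor \<iota> (L1_space M complex_pl) F Z x) =
              L1_class M (underlying F) (\<lambda>t. z t \<odot>\<^bsub>F\<^esub> x))"
proof -
  interpret L1_tensor \<iota> M F
    by unfold_locales (use unitary norm_unit_vector[OF infinite_dim_H] complete_F in \<open>auto simp: complete_pl_space_def\<close>)
  interpret D: dense_L_isometry "pl_tensor \<iota> (L1_space M complex_pl) F" "L1_space M F" \<phi>
    by (rule dense_L_isometry_\<phi>) (use complete_F in \<open>simp add: complete_pl_space_def\<close>)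
  let ?E = "L1_space M complex_pl :: ('h, ('x \<Rightarrow> complex) set) pl_space"
  let ?T = "pl_tensor \<iota> ?E F"
  have \<phi>_value: "\<phi> (elem_tensor ?E F Z x) = L1_class M (underlying F) (\<lambda>t. z t \<odot>\<^bsub>F\<^esub> x)"
    if Z: "Z \<in> carrier ?E" and z: "z \<in> Z" and x: "x \<in> carrier F" for Z z x
  proof -
    obtain f where f: "f \<in> L1_functions M (underlying C)" "Z = L1_class M (underlying C) f"
      using Z by (auto simp: L1_carrier[OF C'(3)])
    have z': "z \<in> L1_functions M (underlying C)" "L1_class M (underlying C) z = Z"
      using L1_class_cong[OF C'(3) f(1)] z f(2) by auto
    show ?thesis
      using scalar_L1(2)[OF F'(3) _ z'(1), of x] x z'(2) \<phi>_elem[OF Z x] by simp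
  qed
  \<comment> \<open>A competing operator is prescribed on elementary tensors only. Linearity extends
    its agreement with \<phi> to the algebraic tensor product, as the uniqueness of extensions
    requires.\<close>
  have embed_\<phi>: "I (completion_embed (underlying ?T) U) = \<phi> U"
    if I: "linear_op (pl_completion ?T) (L1_space M F) I"
      and val: "\<And>Z z x. Z \<in> carrier ?E \<Longrightarrow> z \<in> Z \<Longrightarrow> x \<in> carrier F \<Longrightarrow>
        I (completed_elem_tensor \<iota> ?E F Z x) = L1_class M (underlying F) (\<lambda>t. z t \<odot>\<^bsub>F\<^esub> x)"
      and U: "U \<in> carrier ?T" for I U
  proof (rule tensor_linear_eqI[OF lsE lsF])
    have emb: "linear_op (underlying ?T) (completion (underlying ?T)) (completion_embed (underlying ?T))"
      by (rule completion_embed_linear[OF D.T'(3)])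
    have emb': "linear_op (tensor_product ?E F) (pl_completion ?T) (completion_embed (underlying ?T))"
      by (rule linear_op_transfer[OF emb]) simp_all
    show "linear_op (tensor_product ?E F) (L1_space M F) (\<lambda>U. I (completion_embed (underlying ?T) U))"
      by (rule linear_op_comp[OF emb' I])
    show "linear_op (tensor_product ?E F) (L1_space M F) \<phi>"
      by (rule linear_op_transfer[OF \<phi>_linear]) simp_all
    show "U \<in> carrier (tensor_product ?E F)" using U by simp
    fix Z x assume Z: "Z \<in> carrier ?E" and x: "x \<in> carrier F"
    obtain f where "f \<in> L1_functions M (underlying C)" "Z = L1_class M (underlying C) f"
      using Z by (auto simp: L1_carrier[OF C'(3)])
    then have z: "f \<in> Z" using L1_class_refl[OF C'(3)] by simp
    show "I (completion_embed (underlying ?T) (elem_tensor ?E F Z x)) = \<phi> (elem_tensor ?E F Z x)"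
      using val[OF Z z x] \<phi>_value[OF Z z x] by (simp add: completed_elem_tensor_def)
  qed
  obtain I where I: "I \<in> extensional (carrier (pl_completion ?T))"
    "L_isometric_isomorphism (pl_completion ?T) (L1_space M F) I"
    "\<And>U. U \<in> carrier ?T \<Longrightarrow> I (completion_embed (underlying ?T) U) = \<phi> U"
    using D.extension_exists by blast
  show ?thesis
    unfolding pl_tensor_completed_def
  proof (rule ex1I[of _ I], intro conjI ballI)
    fix Z z x assume Z: "Z \<in> carrier ?E" and z: "z \<in> Z" and x: "x \<in> carrier F"
    have "elem_tensor ?E F Z x \<in> carrier ?T" using Z x lsE lsF by simp
    from I(3)[OF this] show "I (completed_elem_tensor \<iota> ?E F Z x) = L1_class M (underlying F) (\<lambda>t. z t \<odot>\<^bsub>F\<^esub> x)"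
      unfolding completed_elem_tensor_def \<phi>_value[OF Z z x] .
  next
    fix J
    assume J: "J \<in> extensional (carrier (pl_completion ?T)) \<and>
      L_isometric_isomorphism (pl_completion ?T) (L1_space M F) J \<and>
      (\<forall>Z\<in>carrier ?E. \<forall>z\<in>Z. \<forall>x\<in>carrier F.
        J (completed_elem_tensor \<iota> ?E F Z x) = L1_class M (underlying F) (\<lambda>t. z t \<odot>\<^bsub>F\<^esub> x))"
    then have J': "J \<in> extensional (carrier (pl_completion ?T))"
      "linear_op (pl_completion ?T) (L1_space M F) J"
      "isometric_isomorphism (H_space (pl_completion ?T)) (H_space (L1_space M F)) (amplification (L1_space M F) J)"
      "\<And>Z z x. Z \<in> carrier ?E \<Longrightarrow> z \<in> Z \<Longrightarrow> x \<in> carrier F \<Longrightarrow>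
        J (completed_elem_tensor \<iota> ?E F Z x) = L1_class M (underlying F) (\<lambda>t. z t \<odot>\<^bsub>F\<^esub> x)"
      unfolding L_isometric_isomorphism_def by blast+
    have I': "linear_op (pl_completion ?T) (L1_space M F) I"
      "isometric_isomorphism (H_space (pl_completion ?T)) (H_space (L1_space M F)) (amplification (L1_space M F) I)"
      using I(2) unfolding L_isometric_isomorphism_def by blast+
    show "J = I"
    proof (rule extensionalityI[OF J'(1) I(1)])
      fix A assume A: "A \<in> carrier (pl_completion ?T)"
      show "J A = I A"
        by (rule D.extension_unique[OF J'(2,3) embed_\<phi>[OF J'(2,4)] I' I(3) A])
    qed
  qed (use I in auto)
qed

end
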